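(* Let $(W,S)$ be an arbitrary Coxeter system, $I\subseteq S$ arbitrary, $x\in\mathcal V(C)$, and use the notation of the context. The group $W^{\perp[x]}$ admits a presentation with generators $r_x(w,\gamma)$ indexed by $(w,\gamma)\in\mathcal R_x$ and fundamental relations - $r_x(w,\gamma)^2=1$ for every $(w,\gamma)\in\mathcal R_x$; - $(r_x(w,\gamma)r_x(u,\beta))^k=1$ for every pair $(w,\gamma)\overset{k}{\sim}(u,\beta)$ with $1\le k<\infty$. Moreover, any expression (word in these generators) of an element of $W^{\perp[x]}$ can be converted into an arbitrarily given shortest expression of that element with respect to these generators by using only the following two kinds of transformations of subwords: - $r_x(w,\gamma)^2\leadsto1$ (the empty word), for $(w,\gamma)\in\mathcal R_x$; - $r_x(w,\gamma)r_x(u,\beta)r_x(w,\gamma)\cdots\ \leadsto\ r_x(u,\beta)r_x(w,\gamma)r_x(u,\beta)\cdots$, both sides consisting of $k$ generators, for every pair $(w,\gamma)\overset{k}{\sim}(u,\beta)$ with $1\le k<\infty$.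
   Context: **Coxeter groups.** $(W,S)$ is a Coxeter system, $S$ possibly infinite; $m_{s,t}$ is the order of $st$; $\Gamma$ is the Coxeter graph ($s\ne t$ adjacent iff $m_{s,t}\ge 3$, including $\infty$). $V$ is the real space with basis $\{\alpha_s\mid s\in S\}$ and form $\langle\alpha_s,\alpha_t\rangle=-\cos(\pi/m_{s,t})$ ($=-1$ if $m_{s,t}=\infty$); $W$ acts by $s\cdot v=v-2\langle\alpha_s,v\rangle\alpha_s$. $\Phi=\{w\cdot\alpha_s\}$ is the root system, $\Phi^+$ the positive roots; $s_\gamma=wsw^{-1}$ for $\gamma=w\cdot\alpha_s$. For $J\subseteq S$, $W_J=\langle J\rangle$; $J$ is of finite type if $W_J$ is finite, and then $w_0(J)$ is the longest element of $W_J$. For $J,K\subseteq S$, $J_{\sim K}$ is the union of those connected components of the full subgraph of $\Gamma$ on $J\cup K$ which meet $K$; $J_{\sim s}=J_{\sim\{s\}}$. $\Phi^{\perp J}=\{\gamma\in\Phi\mid\langle\gamma,\alpha_s\rangle=0\ \forall s\in J\}$, $(\Phi^{\perp J})^+=\Phi^{\perp J}\cap\Phi^+$, $W^{\perp J}=\langle s_\gamma\mid\gamma\in\Phi^{\perp J}\rangle$. **Groupoids.** Fix a set $\Lambda$ with $|\Lambda|=|I|$. $S^{(\Lambda)}$ is the set of injections $x:\Lambda\to S$, $x_\lambda=x(\lambda)$, $[x]=x(\Lambda)$. Fix $x_I\in S^{(\Lambda)}$ with $[x_I]=I$. For $x,y\in S^{(\Lambda)}$ put $C_{x,y}=\{w\in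 W\mid\alpha_{x_\lambda}=w\cdot\alpha_{y_\lambda}\ \forall\lambda\}$, $\mathcal V(C)=\{x\mid C_{x,x_I}\ne\emptyset\}$. $C=\{C_{x,y}\}_{x,y\in\mathcal V(C)}$ is a groupoid under multiplication in $W$ (elements of $C_{x,y}$ have source $y$, target $x$; write $x=w\cdot y$). $Y_{x,y}=\{w\in C_{x,y}\mid w\cdot(\Phi^{\perp[y]})^+\subseteq\Phi^+\}$. **Graph and tree.** For $x\in\mathcal V(C)$ and $s\in S\smallsetminus[x]$ with $[x]_{\sim s}$ of finite type, let $w_x^s=w_0([x]_{\sim s})w_0([x]_{\sim s}\smallsetminus\{s\})$; it lies in $C_{y,x}$ for a unique $y\in\mathcal V(C)$. $\mathcal C$ is the graph with vertex set $\mathcal V(C)$ and edges $w_x^s$ from $x$ to $w_x^s\cdot x$, where $w_x^s$ and its inverse $w_y^t$ ($y=w_x^s\cdot x$, $\{t\}=([x]\cup\{s\})\smallsetminus[y]$) are identified as the two orientations of one edge. Paths are written from right to left and represent elements of $C$. A loop generator is a $w_z^s$ with $w_z^s\cdot z=z$ (a loop of $\mathcal C$ at $z$); it is a reflection $s_\gamma$ for a unique positive root $\gamma$. Loop generators are regarded as elements of the groupoid, i.e. the vertex $z$ is remembered. $\mathcal Y^1$ is $\mathcal C$ with all loops deleted; it is connected, and every path in $\mathcal Y^1$ represents an element of $Y$. Fix a maximal tree $\mathcal T$ of $\mathcal Y^1$; $p_{z,y}$ is the non-backtracking path in $\mathcal T$ from $y$ to $z$. For a path $q$ from $y$ to $z$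 (or a loop $q$ at $y=z$), $q_{(x)}=p_{x,z}\,q\,p_{y,x}$. **Shuttling tours.** For $x\in\mathcal V(C)$ and $s\ne t$ in $S\smallsetminus[x]$ with $[x]_{\sim\{s,t\}}$ of finite type, put $J=[x]\cup\{s,t\}$, let $\mathcal C(J)$ be the subgraph of $\mathcal C$ of vertices $y$ with $[y]\subseteq J$ and edges $w_y^{s'}$ with $[y]\cup\{s'\}\subseteq J$, and let $\mathcal G$ be its connected component containing $x$. $\mathcal G$ is either a cycle without loops or a simple path (possibly a single vertex) together with two loops, one at each end (both at the vertex if it is single). In the latter case a shuttling tour is a closed path in $\mathcal G$ visiting each vertex exactly twice (except the start point) and passing each of the two loops exactly once; in particular, if $s_\gamma$ is one of the loops, at $y$, $s_\beta$ the other, at $z$, and $q$ the simple path in $\mathcal G$ from $z$ to $y$, then $s_\gamma q s_\beta q^{-1}$ is a shuttling tour. Its order is its (finite) order as an element of $W$. **Generators and relations.** $\mathcal R_x$ is the set of pairs $(w,u)$ with $w\in Y_{x,x}$ and $u$ a loop generator of $C$ (at any vertex); if $u=s_\gamma$ with $\gamma$ positive, the pair is also written $(w,\gamma)$. $r_x(w,u)=w\,u_{(x)}\,w^{-1}\in W^{\perp[x]}$. For $1\le k<\infty$, $(w,\gamma)\overset{k}{\sim}(wq_{(x)},\beta)$ if there is a shuttling tour of order $k$ of the form $s_\gamma q s_\beta q^{-1}$ (with $s_\gamma,s_\beta$ the given loop generators). *)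

theory Defs
  imports Complex_Main "HOL-Algebra.Generated_Groups" "HOL-Algebra.Multiplicative_Group"
    "HOL-Library.FuncSet"
begin

section \<open>Words, presentations and word transformations\<close>

definition word_val :: "('a, 'm) monoid_scheme \<Rightarrow> ('i \<Rightarrow> 'a) \<Rightarrow> 'i list \<Rightarrow> 'a" where
  "word_val G f u = foldr (\<lambda>i g. f i \<otimes>\<^bsub>G\<^esub> g) u \<one>\<^bsub>G\<^esub>"

text \<open>A letter \<open>(i, True)\<close> stands for the generator indexed by \<open>i\<close> and \<open>(i, False)\<close> for its
  formal inverse.\<close>

definition signed_val :: "('a, 'm) monoid_scheme \<Rightarrow> ('i \<Rightarrow> 'a) \<Rightarrow> ('i \<times> bool) list \<Rightarrow> 'a" where
  "signed_val G f = word_val G (\<lambda>(i, b). if b then f i else inv\<^bsub>G\<^esub> (f i))"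

inductive relator_step :: "'i set \<Rightarrow> ('i \<times> bool) list set \<Rightarrow> ('i \<times> bool) list \<Rightarrow> ('i \<times> bool) list \<Rightarrow> bool"
  for X R where
  cancel: "i \<in> X \<Longrightarrow> relator_step X R (u @ [(i, b), (i, \<not> b)] @ v) (u @ v)"
| relator: "r \<in> R \<Longrightarrow> relator_step X R (u @ r @ v) (u @ v)"

text \<open>\<open>\<langle>X | R\<rangle>\<close> is the group of words in the generators and their inverses modulo the
  congruence generated by free cancellation and deletion of relators. \<open>presents G X f R\<close> says that
  \<open>i \<mapsto> f i\<close> induces an isomorphism of \<open>\<langle>X | R\<rangle>\<close> onto \<open>G\<close>. The generators are indexed
  by \<open>X\<close>; \<open>f\<close> need not be injective.\<close>

definition presents ::
  "('a, 'm) monoid_scheme \<Rightarrow> 'i set \<Rightarrow> ('i \<Rightarrow> 'a) \<Rightarrow> ('i \<times> bool) list set \<Rightarrow> bool" where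
  "presents G X f R \<longleftrightarrow>
     R \<subseteq> lists (X \<times> UNIV) \<and> f ` X \<subseteq> carrier G \<and> generate G (f ` X) = carrier G \<and>
     (\<forall>u \<in> lists (X \<times> UNIV). \<forall>v \<in> lists (X \<times> UNIV).
        signed_val G f u = signed_val G f v \<longleftrightarrow> equivclp (relator_step X R) u v)"

text \<open>The relator \<open>(i j)\<^sup>k\<close>.\<close>

definition pair_power :: "nat \<Rightarrow> 'i \<Rightarrow> 'i \<Rightarrow> ('i \<times> bool) list" where
  "pair_power k i j = concat (replicate k [(i, True), (j, True)])"

primrec alternating :: "nat \<Rightarrow> 'i \<Rightarrow> 'i \<Rightarrow> 'i list" where
  "alternating 0 i j = []"
| "alternating (Suc k) i j = i # alternating k j i"

inductive word_move :: "'i set \<Rightarrow> (nat \<Rightarrow> 'i \<Rightarrow> 'i \<Rightarrow> bool) \<Rightarrow> 'i list \<Rightarrow> 'i list \<Rightarrow> bool"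
  for X sim where
  square: "i \<in> X \<Longrightarrow> word_move X sim (u @ [i, i] @ v) (u @ v)"
| braid: "1 \<le> k \<Longrightarrow> sim k i j \<Longrightarrow>
    word_move X sim (u @ alternating k i j @ v) (u @ alternating k j i @ v)"


section \<open>Coxeter systems\<close>

text \<open>\<open>ord\<close> is \<open>0\<close> for elements of infinite order. For \<open>s = t\<close> the relator below is \<open>s s\<close>.\<close>

locale coxeter_system = group W for W (structure) +
  fixes S :: "'a set"
  assumes S_carrier: "S \<subseteq> carrier W"
    and S_involution: "s \<in> S \<Longrightarrow> s \<noteq> \<one> \<and> s \<otimes> s = \<one>"
    and S_presents: "presents W S (\<lambda>s. s)
      {pair_power (ord (s \<otimes> t)) s t | s t. s \<in> S \<and> t \<in> S \<and> ord (s \<otimes> t) \<noteq> 0}"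
begin

definition m :: "'a \<Rightarrow> 'a \<Rightarrow> nat" where
  "m s t = ord (s \<otimes> t)"

definition len :: "'a \<Rightarrow> nat" where
  "len w = (LEAST n. \<exists>u \<in> lists S. length u = n \<and> word_val W (\<lambda>s. s) u = w)"

definition adjacent :: "'a \<Rightarrow> 'a \<Rightarrow> bool" where
  "adjacent s t \<longleftrightarrow> s \<in> S \<and> t \<in> S \<and> s \<noteq> t \<and> (m s t = 0 \<or> m s t \<ge> 3)"

definition components_meeting :: "'a set \<Rightarrow> 'a set \<Rightarrow> 'a set" where
  "components_meeting J K =
     {t \<in> J \<union> K. \<exists>k \<in> K. (\<lambda>a b. a \<in> J \<union> K \<and> b \<in> J \<union> K \<and> adjacent a b)\<^sup>*\<^sup>* k t}"

definition finite_type :: "'a set \<Rightarrow> bool" where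
  "finite_type J \<longleftrightarrow> finite (generate W J)"

definition w0 :: "'a set \<Rightarrow> 'a" where
  "w0 J = (THE w. w \<in> generate W J \<and> (\<forall>u \<in> generate W J. len u \<le> len w))"

text \<open>Vectors of the geometric representation are coordinate functions with finite support
  contained in \<open>S\<close>.\<close>

definition simple_root :: "'a \<Rightarrow> 'a \<Rightarrow> real" where
  "simple_root s = (\<lambda>t. if t = s then 1 else 0)"

definition form :: "('a \<Rightarrow> real) \<Rightarrow> ('a \<Rightarrow> real) \<Rightarrow> real" where
  "form u v = (\<Sum>s \<in> {s. u s \<noteq> 0}. \<Sum>t \<in> {t. v t \<noteq> 0}.
     u s * v t * (if m s t = 0 then -1 else - cos (pi / real (m s t))))"

definition simple_reflection :: "'a \<Rightarrow> ('a \<Rightarrow> real) \<Rightarrow> ('a \<Rightarrow> real)" where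
  "simple_reflection s v = (\<lambda>t. v t - 2 * form (simple_root s) v * simple_root s t)"

text \<open>The simple reflections satisfy the Coxeter relations, so on vectors the following does not
  depend on the chosen expression of \<open>w\<close>.\<close>

definition act :: "'a \<Rightarrow> ('a \<Rightarrow> real) \<Rightarrow> ('a \<Rightarrow> real)" where
  "act w v = foldr simple_reflection (SOME u. u \<in> lists S \<and> word_val W (\<lambda>s. s) u = w) v"

definition roots :: "('a \<Rightarrow> real) set" where
  "roots = {act w (simple_root s) | w s. w \<in> carrier W \<and> s \<in> S}"

definition positive_roots :: "('a \<Rightarrow> real) set" where
  "positive_roots = {\<gamma> \<in> roots. \<forall>s. \<gamma> s \<ge> 0}"

definition reflection :: "('a \<Rightarrow> real) \<Rightarrow> 'a" where
  "reflection \<gamma> = (THE r. \<exists>w \<in> carrier W. \<exists>s \<in> S.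
     \<gamma> = act w (simple_root s) \<and> r = w \<otimes> s \<otimes> inv w)"

definition perp_roots :: "'a set \<Rightarrow> ('a \<Rightarrow> real) set" where
  "perp_roots J = {\<gamma> \<in> roots. \<forall>s \<in> J. form \<gamma> (simple_root s) = 0}"

definition perp_group :: "'a set \<Rightarrow> 'a set" where
  "perp_group J = generate W (reflection ` perp_roots J)"

end


section \<open>The groupoid, its graph, and shuttling tours\<close>

text \<open>Injections \<open>\<Lambda> \<rightarrow> S\<close> are taken extensional, so that they are determined by their values
  on \<open>\<Lambda>\<close>.\<close>

locale coxeter_groupoid = coxeter_system W S for W (structure) and S :: "'a set" +
  fixes I :: "'a set" and \<Lambda> :: "'l set" and xI :: "'l \<Rightarrow> 'a"
  assumes I_subset: "I \<subseteq> S"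
    and xI_extensional: "xI \<in> extensional \<Lambda>"
    and xI_bij: "bij_betw xI \<Lambda> I"
begin

definition injections :: "('l \<Rightarrow> 'a) set" where
  "injections = {x \<in> \<Lambda> \<rightarrow>\<^sub>E S. inj_on x \<Lambda>}"

definition C :: "('l \<Rightarrow> 'a) \<Rightarrow> ('l \<Rightarrow> 'a) \<Rightarrow> 'a set" where
  "C x y = {w \<in> carrier W. \<forall>l \<in> \<Lambda>. simple_root (x l) = act w (simple_root (y l))}"

definition vertices :: "('l \<Rightarrow> 'a) set" where
  "vertices = {x \<in> injections. C x xI \<noteq> {}}"

definition Y :: "('l \<Rightarrow> 'a) \<Rightarrow> ('l \<Rightarrow> 'a) \<Rightarrow> 'a set" where
  "Y x y = {w \<in> C x y. act w ` (perp_roots (y ` \<Lambda>) \<inter> positive_roots) \<subseteq> positive_roots}"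

text \<open>An oriented edge \<open>w\<^sub>x\<^sup>s\<close> is encoded by \<open>(x, s)\<close>. This loses nothing: \<open>w\<^sub>x\<^sup>s\<close> is the only one
  of the elements \<open>w\<^sub>x\<^sup>t\<close> that makes \<open>\<alpha>\<^sub>s\<close> negative, so \<open>s\<close> is determined by \<open>x\<close> and the
  group element.\<close>

definition edges :: "(('l \<Rightarrow> 'a) \<times> 'a) set" where
  "edges = {(x, s). x \<in> vertices \<and> s \<in> S - x ` \<Lambda> \<and>
                    finite_type (components_meeting (x ` \<Lambda>) {s})}"

fun edge_elt :: "('l \<Rightarrow> 'a) \<times> 'a \<Rightarrow> 'a" where
  "edge_elt (x, s) = w0 (components_meeting (x ` \<Lambda>) {s}) \<otimes>
                     w0 (components_meeting (x ` \<Lambda>) {s} - {s})"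

definition source :: "('l \<Rightarrow> 'a) \<times> 'a \<Rightarrow> ('l \<Rightarrow> 'a)" where
  "source e = fst e"

definition target :: "('l \<Rightarrow> 'a) \<times> 'a \<Rightarrow> ('l \<Rightarrow> 'a)" where
  "target e = (THE y. y \<in> vertices \<and> edge_elt e \<in> C y (source e))"

definition reverse_edge :: "('l \<Rightarrow> 'a) \<times> 'a \<Rightarrow> ('l \<Rightarrow> 'a) \<times> 'a" where
  "reverse_edge e = (target e, THE t. t \<in> (source e ` \<Lambda> \<union> {snd e}) - target e ` \<Lambda>)"

definition loops :: "(('l \<Rightarrow> 'a) \<times> 'a) set" where
  "loops = {e \<in> edges. target e = source e}"

text \<open>Paths are written from right to left: the head of the list is the edge passed last.
  \<open>path E y q z\<close> means that \<open>q\<close> is a path from \<open>y\<close> to \<open>z\<close> with edges in \<open>E\<close>.\<close>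

primrec path :: "(('l \<Rightarrow> 'a) \<times> 'a) set \<Rightarrow> ('l \<Rightarrow> 'a) \<Rightarrow> (('l \<Rightarrow> 'a) \<times> 'a) list \<Rightarrow> ('l \<Rightarrow> 'a) \<Rightarrow> bool" where
  "path E y [] z \<longleftrightarrow> y \<in> vertices \<and> y = z"
| "path E y (e # q) z \<longleftrightarrow> e \<in> E \<and> target e = z \<and> path E y q (source e)"

definition path_elt :: "(('l \<Rightarrow> 'a) \<times> 'a) list \<Rightarrow> 'a" where
  "path_elt = word_val W edge_elt"

definition reverse_path :: "(('l \<Rightarrow> 'a) \<times> 'a) list \<Rightarrow> (('l \<Rightarrow> 'a) \<times> 'a) list" where
  "reverse_path q = map reverse_edge (rev q)"

text \<open>The vertices visited by a path with starting point \<open>y\<close>, in order, again from right to left.\<close>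

definition visited :: "('l \<Rightarrow> 'a) \<Rightarrow> (('l \<Rightarrow> 'a) \<times> 'a) list \<Rightarrow> ('l \<Rightarrow> 'a) list" where
  "visited y q = map target q @ [y]"

definition nonbacktracking :: "(('l \<Rightarrow> 'a) \<times> 'a) list \<Rightarrow> bool" where
  "nonbacktracking q \<longleftrightarrow> (\<forall>i. Suc i < length q \<longrightarrow> q ! i \<noteq> reverse_edge (q ! Suc i))"

text \<open>Trees in \<open>\<Y>\<^sup>1\<close>, the graph with all loops deleted, given by vertex set and set of oriented
  edges.\<close>

definition tree :: "('l \<Rightarrow> 'a) set \<Rightarrow> (('l \<Rightarrow> 'a) \<times> 'a) set \<Rightarrow> bool" where
  "tree U E \<longleftrightarrow>
     U \<noteq> {} \<and> U \<subseteq> vertices \<and> E \<subseteq> edges - loops \<and>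
     (\<forall>e \<in> E. source e \<in> U \<and> target e \<in> U \<and> reverse_edge e \<in> E) \<and>
     (\<forall>y \<in> U. \<forall>z \<in> U. \<exists>q. path E y q z) \<and>
     (\<forall>y q. path E y q y \<and> nonbacktracking q \<longrightarrow> q = [])"

definition maximal_tree :: "('l \<Rightarrow> 'a) set \<Rightarrow> (('l \<Rightarrow> 'a) \<times> 'a) set \<Rightarrow> bool" where
  "maximal_tree U E \<longleftrightarrow>
     tree U E \<and> (\<forall>U' E'. tree U' E' \<and> U \<subseteq> U' \<and> E \<subseteq> E' \<longrightarrow> U' = U \<and> E' = E)"

text \<open>\<open>tree_path T z y\<close> is \<open>p\<^sub>z\<^sub>,\<^sub>y\<close>, the path from \<open>y\<close> to \<open>z\<close> in the tree with edge set \<open>T\<close>.\<close>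

definition tree_path :: "(('l \<Rightarrow> 'a) \<times> 'a) set \<Rightarrow> ('l \<Rightarrow> 'a) \<Rightarrow> ('l \<Rightarrow> 'a) \<Rightarrow> (('l \<Rightarrow> 'a) \<times> 'a) list" where
  "tree_path T z y = (THE q. path T y q z \<and> nonbacktracking q)"

text \<open>The element \<open>q\<^sub>(\<^sub>x\<^sub>)\<close> for a path \<open>q\<close> from \<open>y\<close> to \<open>z\<close>.\<close>

definition based :: "(('l \<Rightarrow> 'a) \<times> 'a) set \<Rightarrow> ('l \<Rightarrow> 'a) \<Rightarrow> ('l \<Rightarrow> 'a) \<Rightarrow> (('l \<Rightarrow> 'a) \<times> 'a) list \<Rightarrow>
    ('l \<Rightarrow> 'a) \<Rightarrow> 'a" where
  "based T x z q y = path_elt (tree_path T x z @ q @ tree_path T y x)"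

definition sub_edges :: "'a set \<Rightarrow> (('l \<Rightarrow> 'a) \<times> 'a) set" where
  "sub_edges J = {e \<in> edges. source e ` \<Lambda> \<union> {snd e} \<subseteq> J}"

definition component_vertices :: "'a set \<Rightarrow> ('l \<Rightarrow> 'a) \<Rightarrow> ('l \<Rightarrow> 'a) set" where
  "component_vertices J x =
     {y \<in> vertices. y ` \<Lambda> \<subseteq> J \<and> (\<exists>q. path (sub_edges J) x q y)}"

definition component_edges :: "'a set \<Rightarrow> ('l \<Rightarrow> 'a) \<Rightarrow> (('l \<Rightarrow> 'a) \<times> 'a) set" where
  "component_edges J x = {e \<in> sub_edges J. source e \<in> component_vertices J x}"

text \<open>A simple path together with two loops, one at each end.\<close>

definition looped_path_graph :: "('l \<Rightarrow> 'a) set \<Rightarrow> (('l \<Rightarrow> 'a) \<times> 'a) set \<Rightarrow> bool" where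
  "looped_path_graph U E \<longleftrightarrow>
     (\<exists>y q z a b. path E y q z \<and> distinct (visited y q) \<and> set (visited y q) = U \<and>
        a \<in> loops \<and> source a = y \<and> b \<in> loops \<and> source b = z \<and> a \<noteq> b \<and>
        E = set q \<union> set (reverse_path q) \<union> {a, b})"

text \<open>\<open>shuttling_tour y c\<close>: the closed path \<open>c\<close>, with starting point \<open>y\<close>, is a shuttling
  tour in the component \<open>\<G>\<close> of some vertex \<open>x\<close> in \<open>\<C>(J)\<close>.\<close>

definition shuttling_tour :: "('l \<Rightarrow> 'a) \<Rightarrow> (('l \<Rightarrow> 'a) \<times> 'a) list \<Rightarrow> bool" where
  "shuttling_tour y c \<longleftrightarrow>
     (\<exists>x s t. x \<in> vertices \<and> s \<in> S - x ` \<Lambda> \<and> t \<in> S - x ` \<Lambda> \<and> s \<noteq> t \<and>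
        finite_type (components_meeting (x ` \<Lambda>) {s, t}) \<and>
        (let J = x ` \<Lambda> \<union> {s, t}; U = component_vertices J x; E = component_edges J x in
           looped_path_graph U E \<and> y \<in> U \<and> path E y c y \<and>
           (\<forall>v \<in> U - {y}. count_list (visited y c) v = 2) \<and>
           (\<forall>e \<in> E \<inter> loops. count_list c e = 1)))"

definition gens :: "('l \<Rightarrow> 'a) \<Rightarrow> ('a \<times> (('l \<Rightarrow> 'a) \<times> 'a)) set" where
  "gens x = Y x x \<times> loops"

definition gen_elt :: "(('l \<Rightarrow> 'a) \<times> 'a) set \<Rightarrow> ('l \<Rightarrow> 'a) \<Rightarrow> 'a \<times> (('l \<Rightarrow> 'a) \<times> 'a) \<Rightarrow> 'a" where
  "gen_elt T x = (\<lambda>(w, e). w \<otimes> based T x (source e) [e] (source e) \<otimes> inv w)"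

text \<open>\<open>gen_sim T x k (w, e) (w', f)\<close> is the relation \<open>(w, \<gamma>) \<sim>\<^sup>k (w q\<^sub>(\<^sub>x\<^sub>), \<beta>)\<close>, where
  \<open>e\<close> and \<open>f\<close> are the loop generators \<open>s\<^sub>\<gamma>\<close> and \<open>s\<^sub>\<beta>\<close>.\<close>

definition gen_sim :: "(('l \<Rightarrow> 'a) \<times> 'a) set \<Rightarrow> ('l \<Rightarrow> 'a) \<Rightarrow> nat \<Rightarrow>
    'a \<times> (('l \<Rightarrow> 'a) \<times> 'a) \<Rightarrow> 'a \<times> (('l \<Rightarrow> 'a) \<times> 'a) \<Rightarrow> bool" where
  "gen_sim T x k = (\<lambda>(w, e) (w', f).
     1 \<le> k \<and> (w, e) \<in> gens x \<and> (w', f) \<in> gens x \<and>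
     (\<exists>q. path edges (source f) q (source e) \<and>
        w' = w \<otimes> based T x (source e) q (source f) \<and>
        shuttling_tour (source e) ([e] @ q @ [f] @ reverse_path q) \<and>
        ord (path_elt ([e] @ q @ [f] @ reverse_path q)) = k))"

end

end

(*
The chambers of the arrangement that W cuts out on the fixed space of W_[x] are the elements of the
groupoid C, and the edges of the graph cross its walls.  A loop is a wall fixed by a reflection of
W^{perp [x]}, while the paths without loops stay inside one chamber of that reflection subgroup.

The reflection subgroup satisfies the exchange condition with respect to the reflections r_x(w, e), hence
Tits' solution of the word problem applies.  What has to be shown is that the relations of the theorem
suffice: indices of the same reflection are linked by relations of order 1, and any two reflections whose
product has finite order k are represented by some related pair.  For the first claim, let u be the
groupoid element that carries the wall of one index to the wall of the other.  It maps the set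
K = [y] together with {s} to simple roots, so Deodhar's argument splits off an elementary move w_K^t whose
length adds up, and this move stays inside the rank two component on K together with {t}; there it is one
shuttling tour.  For the second claim the same walk is applied to the alternating word of length k - 1
in the two reflections; it cannot stay inside the chamber, and the first move that leaves it is a tour
around the corner between the two walls.
*)
theory Submission
  imports Defs
begin

section \<open>Groups generated by involutions with the exchange condition\<close>

text \<open>Lengths are handled through sets of roots. An element of the Coxeter group is determined
  by the positive roots that it makes negative, and a factor splits off with lengths adding up when
  its set of inverted roots lies inside that of the whole. These sets are finite even if
  \<open>S\<close> and \<open>I\<close> are infinite, so every walk ends. The same finiteness
  supplies finite type: an elementary move makes sense only if its component is of finite type, and
  this is read off from the inversions of the element that is being decomposed. Walls and loops are
  matched by roots in both directions. A loop generator is shown to be a reflection, and a root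
  perpendicular to [x] and supported on [x] and one further generator is shown to give a loop. The
  indexing is redundant: many indices name one reflection, and a relation is given only for indices
  joined by an explicit tour. Hence equality of two reflections must itself be turned into word
  moves before representatives can be exchanged in Tits' argument, and that argument has to compare
  letters by value.\<close>

declare in_listsD [rule del] in_listsI [rule del]

lemma rev_in_lists [simp]: "rev a \<in> lists X \<longleftrightarrow> a \<in> lists X"
  by (induction a) auto

context group
begin

lemma word_val_Nil [simp]: "word_val G f [] = \<one>"
  by (simp add: word_val_def)

lemma word_val_Cons [simp]: "word_val G f (i # u) = f i \<otimes> word_val G f u"
  by (simp add: word_val_def)

lemma word_val_closed:
  "f ` X \<subseteq> carrier G \<Longrightarrow> u \<in> lists X \<Longrightarrow> word_val G f u \<in> carrier G"
  by (induction u) auto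

lemma word_val_append:
  assumes "f ` X \<subseteq> carrier G" "u \<in> lists X" "v \<in> lists X"
  shows "word_val G f (u @ v) = word_val G f u \<otimes> word_val G f v"
  using assms(2)
proof (induction u)
  case Nil
  then show ?case using word_val_closed[OF assms(1,3)] by simp
next
  case (Cons a u)
  then have "a \<in> X" "u \<in> lists X" by auto
  then show ?case using Cons assms word_val_closed[OF assms(1)]
    by (auto simp: image_subset_iff m_assoc)
qed

end

lemma word_move_context:
  "word_move X sim a b \<Longrightarrow> word_move X sim (u @ a @ v) (u @ b @ v)"
proof (induction rule: word_move.induct)
  case (square i u' v')
  then show ?case using word_move.square[of i X sim "u @ u'" "v' @ v"] by simp
next
  case (braid k i j u' v')
  then show ?case using word_move.braid[of k sim i j X "u @ u'" "v' @ v"] by simp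
qed

lemma word_moves_context:
  "(word_move X sim)\<^sup>*\<^sup>* a b \<Longrightarrow> (word_move X sim)\<^sup>*\<^sup>* (u @ a @ v) (u @ b @ v)"
proof (induction rule: rtranclp_induct)
  case (step b c)
  then show ?case by (meson rtranclp.rtrancl_into_rtrancl word_move_context)
qed simp

lemma word_moves_Cons:
  "(word_move X sim)\<^sup>*\<^sup>* a b \<Longrightarrow> (word_move X sim)\<^sup>*\<^sup>* (i # a) (i # b)"
  by (rule word_moves_context[of X sim a b "[i]" "[]", unfolded append_Cons append_Nil append_Nil2])

lemma word_moves_head:
  "(word_move X sim)\<^sup>*\<^sup>* [i] [j] \<Longrightarrow> (word_move X sim)\<^sup>*\<^sup>* (i # a) (j # a)"
  by (rule word_moves_context[of X sim "[i]" "[j]" "[]" a, unfolded append_Cons append_Nil])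

lemma relator_step_context:
  "relator_step X R a b \<Longrightarrow> relator_step X R (u @ a @ v) (u @ b @ v)"
proof (induction rule: relator_step.induct)
  case (cancel i u' b v')
  then show ?case using relator_step.cancel[of i X R "u @ u'" b "v' @ v"] by simp
next
  case (relator r u' v')
  then show ?case using relator_step.relator[of r R X "u @ u'" "v' @ v"] by simp
qed

lemma equivclp_relator_context:
  "equivclp (relator_step X R) a b \<Longrightarrow> equivclp (relator_step X R) (u @ a @ v) (u @ b @ v)"
proof (induction rule: equivclp_induct)
  case (step b c)
  from step(2) have "equivclp (relator_step X R) (u @ b @ v) (u @ c @ v)"
    by (elim disjE) (blast intro: r_into_equivclp equivclp_sym relator_step_context)+
  with step(3) show ?case by (rule equivclp_trans)
qed simp

section \<open>Alternating words and powers of a product of two involutions\<close>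

lemma alternating_add:
  "alternating (a + b) i j =
     alternating a i j @ (if even a then alternating b i j else alternating b j i)"
  by (induction a arbitrary: i j) auto

lemma length_alternating [simp]: "length (alternating n i j) = n"
  by (induction n arbitrary: i j) auto

lemma alternating_in_lists: "i \<in> X \<Longrightarrow> j \<in> X \<Longrightarrow> alternating n i j \<in> lists X"
  by (induction n arbitrary: i j) auto

lemma pair_power_Suc: "pair_power (Suc k) i j = (i, True) # (j, True) # pair_power k i j"
  by (simp add: pair_power_def)

lemma pair_power_0 [simp]: "pair_power 0 i j = []"
  by (simp add: pair_power_def)

lemma pair_power_Suc_right: "pair_power (Suc k) i j = pair_power k i j @ [(i, True), (j, True)]"
  by (induction k) (auto simp: pair_power_Suc)

lemma pair_power_shift: "(i, True) # pair_power k j i = pair_power k i j @ [(i, True)]"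
  by (induction k) (auto simp: pair_power_Suc)

lemma pair_power_in_lists: "i \<in> X \<Longrightarrow> j \<in> X \<Longrightarrow> pair_power k i j \<in> lists (X \<times> UNIV)"
  by (induction k) (auto simp: pair_power_Suc)

context group
begin

lemma involution_cancel:
  assumes "a \<in> carrier G" "a \<otimes> a = \<one>" "g \<in> carrier G" shows "a \<otimes> (a \<otimes> g) = g"
  using assms by (simp add: m_assoc[symmetric])

text \<open>Dihedral bookkeeping: the two alternating words differ by a power of the rotation
  \<open>f i \<otimes> f j\<close>, so whether they agree is decided by its order.\<close>

lemma word_val_alternating_swap:
  "\<lbrakk>f i \<in> carrier G; f j \<in> carrier G; f i \<otimes> f i = \<one>; f j \<otimes> f j = \<one>\<rbrakk> \<Longrightarrow>
     word_val G f (alternating n i j) = (f i \<otimes> f j) [^] n \<otimes> word_val G f (alternating n j i)"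
proof (induction n arbitrary: i j)
  case (Suc n)
  note [simp] = Suc.prems(1,2)
  have l: "alternating n i j \<in> lists {i, j}" "alternating n j i \<in> lists {i, j}"
    by (simp_all add: alternating_in_lists)
  have f: "f ` {i, j} \<subseteq> carrier G" by simp
  note [simp] = word_val_closed[OF f l(1)] word_val_closed[OF f l(2)]
  have sh: "f i \<otimes> (f j \<otimes> f i) [^] n = (f i \<otimes> f j) [^] n \<otimes> f i"
  proof (induction n)
    case (Suc n)
    have "f i \<otimes> (f j \<otimes> f i) [^] Suc n = (f i \<otimes> (f j \<otimes> f i) [^] n) \<otimes> (f j \<otimes> f i)"
      by (simp add: m_assoc)
    also have "\<dots> = (f i \<otimes> f j) [^] Suc n \<otimes> f i" by (simp add: Suc m_assoc)
    finally show ?case .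
  qed simp
  have "word_val G f (alternating (Suc n) i j) =
      f i \<otimes> ((f j \<otimes> f i) [^] n \<otimes> word_val G f (alternating n i j))"
    using Suc.IH[of j i] Suc.prems by simp
  also have "\<dots> = (f i \<otimes> (f j \<otimes> f i) [^] n) \<otimes> word_val G f (alternating n i j)"
    by (simp add: m_assoc)
  \<comment> \<open>A square \<open>f j \<otimes> f j\<close> is inserted: its first half completes
    one more rotation, its second half starts the other alternating word.\<close>
  also have "\<dots> = (f i \<otimes> f j) [^] n \<otimes> (f i \<otimes> (f j \<otimes> (f j \<otimes> word_val G f (alternating n i j))))"
    using Suc.prems(4) by (simp add: sh m_assoc involution_cancel)
  also have "\<dots> = (f i \<otimes> f j) [^] Suc n \<otimes> word_val G f (alternating (Suc n) j i)"
    by (simp add: m_assoc)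
  finally show ?case .
qed simp

lemma word_val_rev:
  assumes "f ` X \<subseteq> carrier G" "\<And>i. i \<in> X \<Longrightarrow> f i \<otimes> f i = \<one>" "a \<in> lists X"
  shows "word_val G f (rev a) = inv (word_val G f a)"
  using assms(3)
proof (induction a rule: list.induct)
  case (Cons i a)
  then have i: "i \<in> X" "a \<in> lists X" by auto
  have c: "f i \<in> carrier G" using assms(1) i by auto
  have "inv (f i) = f i" using inv_equality[OF assms(2)[OF i(1)] c c] .
  then show ?case using Cons i c word_val_closed[OF assms(1) i(2)]
    by (simp add: word_val_append[OF assms(1)] inv_mult_group)
qed simp

end

text \<open>Decides on which side of a concatenation the letter deleted by an exchange lies.\<close>

lemma append_eq_append_Cons:
  "a @ v = u @ y # w \<Longrightarrow>
     (\<exists>us. a = u @ y # us \<and> w = us @ v) \<or> (\<exists>us. u = a @ us \<and> v = us @ y # w)"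
proof (induction a arbitrary: u)
  case (Cons x a)
  then show ?case by (cases u) auto
qed simp

section \<open>Reduced words under the exchange condition\<close>

text \<open>The axiom spells out a shortest word \<open>a\<close> and a witness \<open>b\<close>,
  because \<open>reduced\<close> exists only inside the locale. The bound
  \<open>length b \<le> length a\<close> says just that \<open>i # a\<close> is not shortest, so no
  parity of lengths is assumed. Different letters may have the same value under
  \<open>f\<close>.\<close>

locale exchange_system = group G for G (structure) +
  fixes X :: "'i set" and f :: "'i \<Rightarrow> 'a"
  assumes f_closed: "i \<in> X \<Longrightarrow> f i \<in> carrier G"
    and f_ne: "i \<in> X \<Longrightarrow> f i \<noteq> \<one>"
    and f_square: "i \<in> X \<Longrightarrow> f i \<otimes> f i = \<one>"
    and exchange: "\<lbrakk>i \<in> X; a \<in> lists X;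
        \<And>b. b \<in> lists X \<Longrightarrow> word_val G f b = word_val G f a \<Longrightarrow> length a \<le> length b;
        b \<in> lists X; word_val G f b = f i \<otimes> word_val G f a; length b \<le> length a\<rbrakk>
      \<Longrightarrow> \<exists>u j v. a = u @ j # v \<and> f i \<otimes> word_val G f a = word_val G f (u @ v)"
begin

abbreviation val where "val \<equiv> word_val G f"

definition reduced :: "'i list \<Rightarrow> bool" where
  "reduced a \<longleftrightarrow> a \<in> lists X \<and> (\<forall>b \<in> lists X. val b = val a \<longrightarrow> length a \<le> length b)"

lemma f_image: "f ` X \<subseteq> carrier G"
  using f_closed by auto

lemma val_closed [simp]: "a \<in> lists X \<Longrightarrow> val a \<in> carrier G"
  using word_val_closed[OF f_image] .

lemma val_append: "a \<in> lists X \<Longrightarrow> b \<in> lists X \<Longrightarrow> val (a @ b) = val a \<otimes> val b"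
  using word_val_append[OF f_image] .

lemma f_cancel: "i \<in> X \<Longrightarrow> g \<in> carrier G \<Longrightarrow> f i \<otimes> (f i \<otimes> g) = g"
  by (simp add: m_assoc[symmetric] f_closed f_square)

lemma reducedD: "reduced a \<Longrightarrow> a \<in> lists X"
  "reduced a \<Longrightarrow> b \<in> lists X \<Longrightarrow> val b = val a \<Longrightarrow> length a \<le> length b"
  by (auto simp: reduced_def)

lemma reduced_cong:
  assumes "reduced a" "b \<in> lists X" "val b = val a" "length b \<le> length a"
  shows "reduced b"
  unfolding reduced_def
proof (intro conjI ballI impI)
  fix c assume "c \<in> lists X" "val c = val b"
  then have "length a \<le> length c" using reducedD(2)[OF assms(1)] assms(3) by simp
  then show "length b \<le> length c" using assms(4) by simp
qed (rule assms)

lemma reduced_same_length: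
  assumes "reduced a" "reduced b" "val b = val a" shows "length a = length b"
proof (rule le_antisym)
  show "length a \<le> length b" by (rule reducedD(2)[OF assms(1) reducedD(1)[OF assms(2)] assms(3)])
  show "length b \<le> length a"
    by (rule reducedD(2)[OF assms(2) reducedD(1)[OF assms(1)] assms(3)[symmetric]])
qed

lemma reduced_suffix: assumes "reduced (u @ a)" shows "reduced a"
proof -
  have l: "u \<in> lists X" "a \<in> lists X" using reducedD(1)[OF assms] by auto
  show ?thesis unfolding reduced_def
  proof (intro conjI ballI impI)
    fix b assume b: "b \<in> lists X" "val b = val a"
    then have "val (u @ b) = val (u @ a)" using l by (simp add: val_append)
    moreover have "u @ b \<in> lists X" using l b by simp
    ultimately have "length (u @ a) \<le> length (u @ b)" by (rule reducedD(2)[OF assms, rotated])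
    then show "length a \<le> length b" by simp
  qed (use l in auto)
qed

lemma reduced_prefix: assumes "reduced (a @ u)" shows "reduced a"
proof -
  have l: "u \<in> lists X" "a \<in> lists X" using reducedD(1)[OF assms] by auto
  show ?thesis unfolding reduced_def
  proof (intro conjI ballI impI)
    fix b assume b: "b \<in> lists X" "val b = val a"
    then have "val (b @ u) = val (a @ u)" using l by (simp add: val_append)
    moreover have "b @ u \<in> lists X" using l b by simp
    ultimately have "length (a @ u) \<le> length (b @ u)" by (rule reducedD(2)[OF assms, rotated])
    then show "length a \<le> length b" by simp
  qed (use l in auto)
qed

lemma reduced_tail: "reduced (i # a) \<Longrightarrow> reduced a"
  by (rule reduced_suffix[of "[i]" a, unfolded append_Cons append_Nil])

lemma not_reduced_double: "\<not> reduced (i # i # a)"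
proof
  assume r: "reduced (i # i # a)"
  then have l: "i \<in> X" "a \<in> lists X" using reducedD(1)[OF r] by auto
  then have "val (i # i # a) = val a" by (simp add: f_cancel)
  then show False using reducedD(2)[OF r, of a] l by simp
qed

lemma exchange_reduced:
  assumes "reduced a" "i \<in> X" "\<not> reduced (i # a)"
  obtains u j v where "a = u @ j # v" "val (i # a) = val (u @ v)"
proof -
  have a: "a \<in> lists X" using assms reducedD by auto
  have "i # a \<in> lists X" using a assms(2) by simp
  with assms(3) obtain b where b: "b \<in> lists X" "val b = val (i # a)" "length b < length (i # a)"
    unfolding reduced_def[of "i # a"] not_le[symmetric] by blast
  show ?thesis
    using exchange[OF assms(2) a _ b(1)] reducedD(2)[OF assms(1)] b(2,3) that by auto
qed

lemma not_reduced_Cons_cong: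
  assumes "reduced a" "reduced b" "val a = val b" "\<not> reduced (i # a)" "i \<in> X"
  shows "\<not> reduced (i # b)"
proof
  assume r: "reduced (i # b)"
  have "reduced (i # a)"
    by (rule reduced_cong[OF r]) (use assms reducedD reduced_same_length[of a b] in auto)
  then show False using assms by simp
qed

lemma val_alternating_swap:
  "i \<in> X \<Longrightarrow> j \<in> X \<Longrightarrow>
     val (alternating n i j) = (f i \<otimes> f j) [^] n \<otimes> val (alternating n j i)"
  by (rule word_val_alternating_swap) (simp_all add: f_closed f_square)

lemma val_alternating_eq_iff:
  assumes "i \<in> X" "j \<in> X"
  shows "val (alternating n i j) = val (alternating n j i) \<longleftrightarrow> ord (f i \<otimes> f j) dvd n"
proof -
  have l: "alternating n j i \<in> lists X" using assms by (auto intro: alternating_in_lists)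
  have "val (alternating n i j) = val (alternating n j i) \<longleftrightarrow> (f i \<otimes> f j) [^] n = \<one>"
    using val_alternating_swap[OF assms, of n] val_closed[OF l] f_closed assms
    by (metis m_closed nat_pow_closed r_cancel_one l_one)
  then show ?thesis using pow_eq_id f_closed assms by simp
qed

lemma alternating_if_reduced:
  assumes "w \<in> lists {i, j}" "w \<noteq> []" "hd w = i" "i \<noteq> j" "reduced (w @ v)"
  shows "w = alternating (length w) i j"
  using assms
proof (induction w arbitrary: i j rule: list.induct)
  case (Cons x w)
  show ?case
  proof (cases w)
    case Nil
    then show ?thesis using Cons by simp
  next
    case (Cons y w')
    have "y \<noteq> i" using Cons.prems(3,5) not_reduced_double[of i "w' @ v"] Cons by auto
    have "y # w' \<in> lists {i, j}" using Cons.prems(1) unfolding Cons by simp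
    then have "y \<in> {i, j}" unfolding Cons_in_lists_iff by (rule conjunct1)
    with \<open>y \<noteq> i\<close> have y: "y = j" by blast
    have "w = alternating (length w) j i"
      by (rule Cons.IH)
        (use Cons.prems Cons y reduced_tail[of i "w @ v"] in \<open>auto simp: insert_commute\<close>)
    from this[symmetric] show ?thesis using Cons.prems(3) by simp
  qed
qed simp

text \<open>Write \<open>val a = d v\<close> with \<open>d\<close> in the dihedral group generated by \<open>f i\<close>, \<open>f j\<close> and \<open>v\<close> as
  short as possible: both exchanges then take place inside \<open>d\<close>, which is therefore the longest
  element of a finite dihedral group.\<close>

lemma two_descents:
  assumes a: "reduced a" and ij: "i \<in> X" "j \<in> X" "f i \<noteq> f j"
    and na: "\<not> reduced (i # a)" "\<not> reduced (j # a)"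
  shows "ord (f i \<otimes> f j) \<noteq> 0 \<and>
    (\<exists>c. reduced (alternating (ord (f i \<otimes> f j)) i j @ c) \<and>
         val (alternating (ord (f i \<otimes> f j)) i j @ c) = val a)"
proof -
  define P where "P d v \<longleftrightarrow> d \<in> lists {i, j} \<and> v \<in> lists X \<and> val (d @ v) = val a" for d v
  have P0: "P [] a" using a reducedD by (auto simp: P_def)
  \<comment> \<open>Lexicographic minimum with the remainder \<open>v\<close> first: an exchange
    that hits \<open>v\<close> is then impossible, however long the dihedral word becomes.\<close>
  obtain v where v: "\<exists>d. P d v" and vmin: "\<And>d' v'. P d' v' \<Longrightarrow> length v \<le> length v'"
    using ex_has_least_nat[where P = "\<lambda>v. \<exists>d. P d v" and m = length, of a] P0 by metis
  obtain d where d: "P d v" and dmin: "\<And>d'. P d' v \<Longrightarrow> length d \<le> length d'"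
    using ex_has_least_nat[where P = "\<lambda>d. P d v" and m = length] v by metis
  have lX: "e \<in> lists {i, j} \<Longrightarrow> e \<in> lists X" for e
    using ij lists_mono[of "{i, j}" X] by blast
  \<comment> \<open>Induction over the suffixes of \<open>e\<close>, so that exchange is always
    applied to a word already known to be reduced. The letter it deletes lies in \<open>e\<close> or
    in \<open>v\<close> and contradicts one of the two minimalities.\<close>
  have red: "reduced (e @ v)" if e: "P e v" "length e = length d" for e
  proof -
    have "reduced (e2 @ v)" if "e1 @ e2 = e" for e1 e2 using that
    proof (induction e2 arbitrary: e1)
      case Nil
      show ?case unfolding reduced_def append_Nil
      proof (intro conjI ballI impI)
        show "v \<in> lists X" using e by (simp add: P_def)
        fix b assume b: "b \<in> lists X" "val b = val v"
        have "P e b" using e b lX unfolding P_def by (metis val_append)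
        then show "length v \<le> length b" by (rule vmin)
      qed
    next
      case (Cons k e2)
      have r: "reduced (e2 @ v)" using Cons.IH[of "e1 @ [k]"] Cons.prems by simp
      have l: "e1 \<in> lists {i, j}" "e2 \<in> lists {i, j}" "k \<in> {i, j}" "v \<in> lists X"
        using e(1) Cons.prems by (auto simp: P_def)
      have va: "val a = val e1 \<otimes> val (k # e2 @ v)"
      proof -
        have "k \<in> X" using l(3) ij by blast
        then have "val (e1 @ k # e2 @ v) = val e1 \<otimes> val (k # e2 @ v)"
          using val_append[of e1 "k # e2 @ v"] lX[OF l(1)] lX[OF l(2)] l(4) by simp
        moreover have "val (e1 @ k # e2 @ v) = val a"
          using e(1) unfolding P_def Cons.prems[symmetric] by simp
        ultimately show ?thesis by simp
      qed
      show ?case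
      proof (rule ccontr)
        assume "\<not> reduced ((k # e2) @ v)"
        moreover have kX: "k \<in> X" using l(3) ij by blast
        ultimately obtain u y w where w: "e2 @ v = u @ y # w" "val (k # e2 @ v) = val (u @ w)"
          using exchange_reduced[OF r kX] by auto
        have va': "val a = val e1 \<otimes> val (u @ w)" unfolding va w(2) ..
        consider us where "e2 = u @ y # us" "w = us @ v" | us where "u = e2 @ us" "v = us @ y # w"
          using append_eq_append_Cons[OF w(1)] by blast
        then show False
        proof cases
          case (1 us)
          have "val (e1 @ u @ us @ v) = val a"
            using va' 1(2) lX[OF l(1)] lX[OF l(2)] l(4) val_append[of e1 "u @ us @ v"]
            by (simp add: 1)
          then have "P (e1 @ u @ us) v" using l by (simp add: P_def 1)
          from dmin[OF this] e(2) show False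
            unfolding Cons.prems[symmetric] by (simp add: 1)
        next
          case (2 us)
          have "val (e1 @ e2 @ us @ w) = val a"
            using va' lX[OF l(1)] lX[OF l(2)] l(4) val_append[of e1 "e2 @ us @ w"]
            by (simp add: 2)
          then have "P (e1 @ e2) (us @ w)" using l by (simp add: P_def 2)
          from vmin[OF this] 2 show False by simp
        qed
      qed
    qed
    from this[of "[]" e] show ?thesis by simp
  qed
  \<comment> \<open>For a descent \<open>x\<close> the exchange cannot hit \<open>v\<close>, so it
    deletes a letter of \<open>d\<close>. Putting \<open>x\<close> in front restores the length,
    hence the dihedral part can be rewritten to start with \<open>x\<close>.\<close>
  have start: "\<exists>e. P (x # e) v \<and> length (x # e) = length d"
    if x: "x \<in> {i, j}" "\<not> reduced (x # a)" for x
  proof -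
    have xX: "x \<in> X" using x ij by auto
    have r: "reduced (d @ v)" using red[OF d] by simp
    have vd: "val (d @ v) = val a" and l: "d \<in> lists {i, j}" "v \<in> lists X" using d by (auto simp: P_def)
    have "\<not> reduced (x # d @ v)" using not_reduced_Cons_cong[OF a r _ x(2) xX] vd by simp
    then obtain u y w where w: "d @ v = u @ y # w" "val (x # d @ v) = val (u @ w)"
      using exchange_reduced[OF r xX] by auto
    have uw: "u \<in> lists X" "w \<in> lists X"
    proof -
      have "u @ y # w \<in> lists X" unfolding w(1)[symmetric] using l lX[of d] by simp
      then show "u \<in> lists X" "w \<in> lists X" by simp_all
    qed
    have va: "val a = val (x # u @ w)"
    proof -
      have "f x \<otimes> val (u @ w) = f x \<otimes> (f x \<otimes> val a)" using w(2) vd by simp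
      also have "\<dots> = val a" using f_cancel xX a reducedD by simp
      finally show ?thesis by simp
    qed
    consider us where "d = u @ y # us" "w = us @ v" | us where "u = d @ us" "v = us @ y # w"
      using append_eq_append_Cons[OF w(1)] by blast
    then show ?thesis
    proof cases
      case (1 us)
      have "P (x # u @ us) v" using va l x(1) by (simp add: P_def 1)
      then show ?thesis using 1 by auto
    next
      case (2 us)
      have "P (x # d) (us @ w)" using va l x(1) by (simp add: P_def 2)
      from vmin[OF this] 2 show ?thesis by simp
    qed
  qed
  obtain ei where ei: "P (i # ei) v" "length (i # ei) = length d" using start na by blast
  obtain ej where ej: "P (j # ej) v" "length (j # ej) = length d" using start na by blast
  define n where "n = length d"
  have n1: "n \<ge> 1" using ei n_def by auto
  have ij': "i \<noteq> j" using ij by auto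
  have A: "i # ei = alternating n i j"
  proof -
    have "i # ei = alternating (length (i # ei)) i j"
      by (rule alternating_if_reduced[where v = v]) (use ei red[OF ei] ij' in \<open>auto simp: P_def\<close>)
    then show ?thesis unfolding ei(2) n_def .
  qed
  have B: "j # ej = alternating n j i"
  proof -
    have "j # ej = alternating (length (j # ej)) j i"
      by (rule alternating_if_reduced[where v = v])
        (use ej red[OF ej] ij' in \<open>auto simp: P_def insert_commute\<close>)
    then show ?thesis unfolding ej(2) n_def .
  qed
  have l: "v \<in> lists X" using d P_def by auto
  have AB: "alternating n i j \<in> lists X" "alternating n j i \<in> lists X"
    using ij by (auto intro!: alternating_in_lists)
  have "val (alternating n i j @ v) = val (alternating n j i @ v)"
    using ei(1) ej(1) unfolding A B P_def by simp
  then have "val (alternating n i j) = val (alternating n j i)"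
    using l AB by (simp add: val_append)
  then have dv: "ord (f i \<otimes> f j) dvd n" using val_alternating_eq_iff ij by simp
  define k where "k = ord (f i \<otimes> f j)"
  have k0: "k \<noteq> 0" using dv n1 k_def by auto
  \<comment> \<open>If the word were longer than \<open>k\<close>, an alternating block of length
    \<open>k\<close> would follow its first letter; braiding this block would double the first
    letter.\<close>
  have "k = n"
  proof (rule ccontr)
    assume "k \<noteq> n"
    then have kn: "k \<le> n - 1" using dv n1 k_def dvd_imp_le[of k n] by auto
    define rest where "rest = (if even k then alternating (n - 1 - k) j i else alternating (n - 1 - k) i j)"
    have e: "alternating n i j = i # alternating k j i @ rest"
      using alternating_add[of k "n - 1 - k" j i] n1 kn rest_def by (cases n) auto
    have lr: "rest \<in> lists X" "alternating k j i \<in> lists X" "alternating k i j \<in> lists X"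
      using ij by (auto simp: rest_def intro!: alternating_in_lists)
    have r: "reduced (i # alternating k j i @ rest)" using reduced_prefix[OF red[OF ei]] unfolding A e .
    have "val (alternating k j i) = val (alternating k i j)"
      using val_alternating_eq_iff[of i j k] ij k_def by auto
    then have "val (i # alternating k i j @ rest) = val (i # alternating k j i @ rest)"
      using lr by (simp add: val_append)
    then have "reduced (i # alternating k i j @ rest)"
      using reduced_cong[OF r] lr ij by auto
    then show False using not_reduced_double k0 by (cases k) auto
  qed
  then have "i # ei = alternating (ord (f i \<otimes> f j)) i j" using A unfolding k_def by (rule ssubst)
  then show ?thesis using k0 red[OF ei] ei(1) unfolding k_def P_def by metis
qed

text \<open>Were the new word not reduced, the word without its first letter would have both letters
  as descents. By \<open>two_descents\<close> it would then be at least as long as the order of the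
  product.\<close>

lemma reduced_alternating:
  assumes "i \<in> X" "j \<in> X" "f i \<noteq> f j" "ord (f i \<otimes> f j) = 0 \<or> n \<le> ord (f i \<otimes> f j)"
  shows "reduced (alternating n i j)"
  using assms
proof (induction n arbitrary: i j)
  case 0
  then show ?case by (simp add: reduced_def)
next
  case (Suc n)
  have o: "ord (f j \<otimes> f i) = ord (f i \<otimes> f j)"
  proof -
    have "inv (f i \<otimes> f j) = f j \<otimes> f i"
      using Suc.prems f_square f_closed by (metis inv_equality inv_mult_group)
    then show ?thesis using ord_inv[of "f i \<otimes> f j"] Suc.prems f_closed by simp
  qed
  show ?case
  proof (rule ccontr)
    assume n: "\<not> reduced (alternating (Suc n) i j)"
    have r: "reduced (alternating n j i)" using Suc.IH[of j i] Suc.prems o by auto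
    have n0: "n \<noteq> 0"
    proof
      assume "n = 0"
      then obtain b where "b \<in> lists X" "val b = f i" "length b < 1"
        using n Suc.prems f_closed by (auto simp: reduced_def not_le)
      then show False using f_ne[OF Suc.prems(1)] by simp
    qed
    have nj: "\<not> reduced (j # alternating n j i)" using n0 not_reduced_double by (cases n) auto
    have ni: "\<not> reduced (i # alternating n j i)" using n by simp
    from two_descents[OF r Suc.prems(1-3) ni nj]
    obtain c where c: "ord (f i \<otimes> f j) \<noteq> 0"
      "reduced (alternating (ord (f i \<otimes> f j)) i j @ c)"
      "val (alternating (ord (f i \<otimes> f j)) i j @ c) = val (alternating n j i)" by auto
    from reduced_same_length[OF r c(2) c(3)] c(1) Suc.prems(4) show False by simp
  qed
qed

end

section \<open>Word moves and presentations\<close>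

text \<open>\<open>sim_same\<close> and \<open>sim_braid\<close> ask for chains of moves, not for
  \<open>sim\<close> itself: only suitable representatives of two reflections are related, and
  letters of equal value must first be exchanged for them.\<close>

locale braid_system = exchange_system G X f
  for G (structure) and X :: "'i set" and f +
  fixes sim :: "nat \<Rightarrow> 'i \<Rightarrow> 'i \<Rightarrow> bool"
  assumes sim_sound: "1 \<le> k \<Longrightarrow> sim k i j \<Longrightarrow> i \<in> X \<and> j \<in> X \<and> (f i \<otimes> f j) [^] k = \<one>"
    and sim_same: "i \<in> X \<Longrightarrow> j \<in> X \<Longrightarrow> f i = f j \<Longrightarrow> (word_move X sim)\<^sup>*\<^sup>* [i] [j]"
    and sim_braid: "i \<in> X \<Longrightarrow> j \<in> X \<Longrightarrow> f i \<noteq> f j \<Longrightarrow> ord (f i \<otimes> f j) \<noteq> 0 \<Longrightarrow>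
      (word_move X sim)\<^sup>*\<^sup>* (alternating (ord (f i \<otimes> f j)) i j) (alternating (ord (f i \<otimes> f j)) j i)"
begin

abbreviation moves where "moves \<equiv> (word_move X sim)\<^sup>*\<^sup>*"

lemma alternating_lists: "i \<in> X \<Longrightarrow> j \<in> X \<Longrightarrow> alternating n i j \<in> lists X"
  by (rule alternating_in_lists)

lemma val_alternating_ord:
  "i \<in> X \<Longrightarrow> j \<in> X \<Longrightarrow> val (alternating (ord (f i \<otimes> f j)) i j) = val (alternating (ord (f i \<otimes> f j)) j i)"
  by (simp add: val_alternating_eq_iff)

lemma val_tail_eq:
  assumes "i \<in> X" "a \<in> lists X" "b \<in> lists X" "val (i # a) = val (i # b)" shows "val a = val b"
proof -
  have "f i \<otimes> val a = f i \<otimes> val b" using assms(4) by simp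
  then show ?thesis using assms f_closed by simp
qed

text \<open>Tits' argument, by induction on the length. If the first letters differ in value, both
  are descents, so some reduced word of the element begins with the longest alternating word in
  them. It shares a first letter with one given word, and after a braid with the other, so the
  induction hypothesis applies to the tails on both sides.\<close>

theorem matsumoto:
  assumes "reduced a" "reduced b" "val a = val b" shows "moves a b"
  using assms
proof (induction "length a" arbitrary: a b)
  case 0
  then have "length b = 0" using reduced_same_length[OF 0(2,3)] by simp
  then show ?case using 0 by simp
next
  case (Suc n)
  have lb: "length b = Suc n" using reduced_same_length[OF Suc(3,4)] Suc(2,5) by simp
  obtain i a' where a: "a = i # a'" using Suc(2) by (cases a) auto
  obtain j b' where b: "b = j # b'" using lb by (cases b) auto
  have len: "n = length a'" "n = length b'" using Suc(2) lb a b by auto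
  have ra: "reduced (i # a')" and rb: "reduced (j # b')" using Suc a b by auto
  have ra': "reduced a'" and rb': "reduced b'" using reduced_tail[OF ra] reduced_tail[OF rb] by auto
  have X: "i \<in> X" "j \<in> X" "a' \<in> lists X" "b' \<in> lists X"
    using reducedD(1)[OF ra] reducedD(1)[OF rb] by auto
  have v: "val (i # a') = val (j # b')" using Suc(5) a b by simp
  show ?case
  proof (cases "f i = f j")
    case True
    then have "val (i # a') = val (i # b')" using v by simp
    then have "val a' = val b'" by (rule val_tail_eq[OF X(1,3,4)])
    then have "moves a' b'" by (rule Suc(1)[OF len(1) ra' rb'])
    then show ?thesis unfolding a b
      by (rule rtranclp_trans[OF word_moves_Cons word_moves_head[OF sim_same[OF X(1,2) True]]])
  next
    case False
    have nb: "\<not> reduced (j # i # a')"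
      using not_reduced_Cons_cong[OF rb ra v[symmetric] not_reduced_double X(2)] .
    define k where "k = ord (f i \<otimes> f j)"
    obtain c where k0: "k \<noteq> 0" and rc: "reduced (alternating k i j @ c)"
      and vc: "val (alternating k i j @ c) = val (i # a')"
      using two_descents[OF ra X(1,2) False not_reduced_double nb] unfolding k_def by blast
    obtain k' where k': "k = Suc k'" using k0 by (cases k) auto
    have c: "c \<in> lists X" using reducedD(1)[OF rc] by simp
    have l: "alternating m i j \<in> lists X" "alternating m j i \<in> lists X" for m
      using X by (auto intro: alternating_lists)
    have vs: "val (alternating k j i @ c) = val (i # a')"
      using vc val_alternating_ord[OF X(1,2)] c l unfolding k_def by (simp add: val_append)
    have rs: "reduced (alternating k j i @ c)"
      by (rule reduced_cong[OF rc]) (use c l vs vc in simp_all)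
    have la: "length (alternating k i j @ c) = length (i # a')"
      by (rule reduced_same_length[OF rc ra vc[symmetric]])
    have ra1: "reduced (i # alternating k' j i @ c)" using rc k' by simp
    have rb1: "reduced (j # alternating k' i j @ c)" using rs k' by simp
    have v1: "val a' = val (alternating k' j i @ c)"
      by (rule val_tail_eq[OF X(1,3)]) (use c l vc k' in simp_all)
    have v2: "val (alternating k' i j @ c) = val b'"
      by (rule val_tail_eq[OF X(2) _ X(4)]) (use c l vs v k' in simp_all)
    have m1: "moves a' (alternating k' j i @ c)"
      by (rule Suc(1)[OF len(1) ra' reduced_tail[OF ra1] v1])
    have len2: "n = length (alternating k' i j @ c)" using la len k' by simp
    have m2: "moves (alternating k' i j @ c) b'"
      by (rule Suc(1)[OF len2 reduced_tail[OF rb1] rb' v2])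
    have "moves (i # a') (alternating k i j @ c)" using word_moves_Cons[OF m1, of i] k' by simp
    also have "moves (alternating k i j @ c) (alternating k j i @ c)"
      using word_moves_context[OF sim_braid[OF X(1,2) False], of "[]" c] k0 unfolding k_def by simp
    also have "moves (alternating k j i @ c) (j # b')" using word_moves_Cons[OF m2, of j] k' by simp
    finally show ?thesis unfolding a b .
  qed
qed

text \<open>If a letter in front of a reduced word \<open>r\<close> makes it non-reduced, exchange
  yields another reduced word of the same element beginning with that letter. Moving
  \<open>r\<close> to it creates a square, which can be deleted.\<close>

theorem moves_to_reduced:
  assumes "a \<in> lists X" shows "\<exists>b. reduced b \<and> val b = val a \<and> moves a b"
  using assms
proof (induction a rule: list.induct)
  case Nil
  have "reduced []" by (simp add: reduced_def)
  then show ?case by blast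
next
  case (Cons i a)
  then have X: "i \<in> X" "a \<in> lists X" by auto
  obtain r where r: "reduced r" "val r = val a" "moves a r" using Cons.IH[OF X(2)] by blast
  have m: "moves (i # a) (i # r)" by (rule word_moves_Cons[OF r(3)])
  have v: "val (i # r) = val (i # a)" using r(2) by simp
  show ?case
  proof (cases "reduced (i # r)")
    case True
    then show ?thesis using m v by blast
  next
    case False
    have rX: "r \<in> lists X" by (rule reducedD(1)[OF r(1)])
    obtain u j w where w: "r = u @ j # w" "val (i # r) = val (u @ w)"
      using exchange_reduced[OF r(1) X(1) False] by blast
    have uw: "u @ w \<in> lists X" using rX unfolding w(1) by simp
    have vr: "val (i # u @ w) = val r"
      using w(2)[symmetric] f_cancel[OF X(1), of "val r"] rX by simp
    have rr: "reduced (i # u @ w)"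
      by (rule reduced_cong[OF r(1) _ vr]) (use uw X w(1) in simp_all)
    have "moves r (i # u @ w)" by (rule matsumoto[OF r(1) rr vr[symmetric]])
    then have "moves (i # r) (i # i # u @ w)" by (rule word_moves_Cons)
    moreover have "word_move X sim (i # i # u @ w) (u @ w)"
      using word_move.square[OF X(1), of sim "[]" "u @ w"] by simp
    ultimately have "moves (i # a) (u @ w)" using m by (meson rtranclp.rtrancl_into_rtrancl rtranclp_trans)
    moreover have "reduced (u @ w)" by (rule reduced_tail[OF rr])
    ultimately show ?thesis using w(2) v by auto
  qed
qed

theorem moves_to_shortest:
  assumes "a \<in> lists X" "b \<in> lists X" "val a = val b"
    and "\<And>c. c \<in> lists X \<Longrightarrow> val c = val b \<Longrightarrow> length b \<le> length c"
  shows "moves a b"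
proof -
  have rb: "reduced b" unfolding reduced_def using assms(2,4) by blast
  obtain r where r: "reduced r" "val r = val a" "moves a r" using moves_to_reduced[OF assms(1)] by blast
  have "moves r b" by (rule matsumoto[OF r(1) rb]) (use r(2) assms(3) in simp)
  with r(3) show ?thesis by (rule rtranclp_trans)
qed

section \<open>From word moves to the presentation\<close>

definition relators :: "('i \<times> bool) list set" where
  "relators = {[(i, True), (i, True)] | i. i \<in> X} \<union> {pair_power k i j | k i j. 1 \<le> k \<and> sim k i j}"

abbreviation rel_equiv (infix \<open>\<approx>\<close> 50) where "rel_equiv \<equiv> equivclp (relator_step X relators)"

abbreviation lift :: "'i list \<Rightarrow> ('i \<times> bool) list" where "lift \<equiv> map (\<lambda>i. (i, True))"

lemma inv_f: "i \<in> X \<Longrightarrow> inv (f i) = f i"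
  using f_square f_closed by (metis inv_equality)

lemma signed_val_eq: "u \<in> lists (X \<times> UNIV) \<Longrightarrow> signed_val G f u = val (map fst u)"
  unfolding signed_val_def
proof (induction u rule: list.induct)
  case (Cons a u)
  then show ?case using inv_f by (cases a) auto
qed simp

lemma map_fst_lists: "u \<in> lists (X \<times> UNIV) \<Longrightarrow> map fst u \<in> lists X"
  by (induction u rule: list.induct) auto

lemma relators_in_lists: "relators \<subseteq> lists (X \<times> UNIV)"
proof
  fix r assume "r \<in> relators"
  then consider i where "i \<in> X" "r = [(i, True), (i, True)]"
    | k i j where "1 \<le> k" "sim k i j" "r = pair_power k i j" unfolding relators_def by blast
  then show "r \<in> lists (X \<times> UNIV)"
  proof cases
    case 2
    then show ?thesis using sim_sound[OF 2(1,2)] by (simp add: pair_power_in_lists)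
  qed simp
qed

lemma map_fst_pair_power: "map fst (pair_power k i j) = alternating (2 * k) i j"
  by (induction k) (auto simp: pair_power_Suc)

lemma val_pair_power: "i \<in> X \<Longrightarrow> j \<in> X \<Longrightarrow> val (alternating (2 * k) i j) = (f i \<otimes> f j) [^] k"
proof (induction k)
  case (Suc k)
  have "val (alternating (2 * Suc k) i j) = f i \<otimes> (f j \<otimes> (f i \<otimes> f j) [^] k)"
    using Suc by simp
  also have "\<dots> = (f i \<otimes> f j) \<otimes> (f i \<otimes> f j) [^] k"
    using Suc.prems f_closed by (simp add: m_assoc)
  also have "\<dots> = (f i \<otimes> f j) [^] Suc k"
    using Suc.prems f_closed nat_pow_Suc2[of "f i \<otimes> f j" k] by simp
  finally show ?case .
qed simp

lemma relator_val: assumes "r \<in> relators" shows "val (map fst r) = \<one>"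
proof -
  from assms consider i where "i \<in> X" "r = [(i, True), (i, True)]"
    | k i j where "1 \<le> k" "sim k i j" "r = pair_power k i j" unfolding relators_def by blast
  then show ?thesis
  proof cases
    case 1
    then show ?thesis using f_square f_closed by simp
  next
    case 2
    then show ?thesis using sim_sound[OF 2(1,2)] by (simp add: map_fst_pair_power val_pair_power)
  qed
qed

lemma relator_step_sound:
  "relator_step X relators u v \<Longrightarrow>
    (u \<in> lists (X \<times> UNIV) \<longleftrightarrow> v \<in> lists (X \<times> UNIV)) \<and>
    (v \<in> lists (X \<times> UNIV) \<longrightarrow> val (map fst u) = val (map fst v))"
proof (induction rule: relator_step.induct)
  case (cancel i u b v)
  have "val (map fst (u @ [(i, b), (i, \<not> b)] @ v)) = val (map fst (u @ v))"
    if "u \<in> lists (X \<times> UNIV)" "v \<in> lists (X \<times> UNIV)"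
    using map_fst_lists[OF that(1)] map_fst_lists[OF that(2)] cancel
    by (simp add: val_append f_cancel)
  then show ?case using cancel by simp
next
  case (relator r u v)
  have r: "r \<in> lists (X \<times> UNIV)" using relator relators_in_lists by blast
  have "val (map fst (u @ r @ v)) = val (map fst (u @ v))"
    if "u \<in> lists (X \<times> UNIV)" "v \<in> lists (X \<times> UNIV)"
    using map_fst_lists[OF that(1)] map_fst_lists[OF that(2)] map_fst_lists[OF r] relator_val[OF relator]
    by (simp add: val_append)
  then show ?case using r by simp
qed

lemma rel_equiv_sound:
  assumes "u \<approx> v" "u \<in> lists (X \<times> UNIV)"
  shows "v \<in> lists (X \<times> UNIV) \<and> val (map fst u) = val (map fst v)"
  using assms
proof (induction rule: equivclp_induct)
  case (step b c)
  from step(2) step(3)[OF step(4)] show ?case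
    using relator_step_sound[of b c] relator_step_sound[of c b] by auto
qed simp

lemma rel_square: "i \<in> X \<Longrightarrow> [(i, True), (i, True)] \<approx> []"
  using relator_step.relator[of "[(i, True), (i, True)]" relators X "[]" "[]"]
  by (auto simp: relators_def intro!: r_into_equivclp)

lemma rel_context: "u \<approx> v \<Longrightarrow> a @ u @ b \<approx> a @ v @ b"
  by (rule equivclp_relator_context)

text \<open>Since squares are relators, formal inverses can be traded for the letters themselves;
  this reduces signed words to the plain words on which \<open>word_move\<close> acts.\<close>

lemma rel_False: assumes "i \<in> X" shows "[(i, False)] \<approx> [(i, True)]"
proof -
  have "relator_step X relators ([(i, False), (i, \<not> False)] @ [(i, True)]) ([] @ [(i, True)])"
    using relator_step.cancel[OF assms, of relators "[]" False "[(i, True)]"] by simp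
  then have 1: "[(i, False), (i, True), (i, True)] \<approx> [(i, True)]"
    by (auto intro: r_into_equivclp)
  have "[(i, False), (i, True), (i, True)] \<approx> [(i, False)]"
    using rel_context[OF rel_square[OF assms], of "[(i, False)]" "[]"] by simp
  then show ?thesis using 1 by (meson equivclp_sym equivclp_trans)
qed

lemma rel_lift: "u \<in> lists (X \<times> UNIV) \<Longrightarrow> u \<approx> lift (map fst u)"
proof (induction u rule: list.induct)
  case (Cons a u)
  obtain i b where a: "a = (i, b)" by (cases a)
  have i: "i \<in> X" and u: "u \<in> lists (X \<times> UNIV)" using Cons a by auto
  have "[(i, b)] \<approx> [(i, True)]" using rel_False[OF i] by (cases b) auto
  then have "(i, b) # u \<approx> (i, True) # u" using rel_context[of "[(i, b)]" "[(i, True)]" "[]" u] by simp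
  moreover have "(i, True) # u \<approx> (i, True) # lift (map fst u)"
    using rel_context[OF Cons.IH[OF u], of "[(i, True)]" "[]"] by simp
  ultimately show ?case unfolding a list.map fst_conv by (rule equivclp_trans)
qed simp

text \<open>The formal counterpart of \<open>val_alternating_swap\<close>: once
  \<open>pair_power n i j\<close> is a relator, the braid move becomes a consequence of the
  relators.\<close>

lemma rel_alternating:
  "i \<in> X \<Longrightarrow> j \<in> X \<Longrightarrow> lift (alternating n i j) \<approx> pair_power n i j @ lift (alternating n j i)"
proof (induction n arbitrary: i j)
  case (Suc n)
  have "(i, True) # lift (alternating n j i) \<approx> (i, True) # pair_power n j i @ lift (alternating n i j)"
    using rel_context[OF Suc.IH[OF Suc.prems(2,1)], of "[(i, True)]" "[]"] by simp
  also have "(i, True) # pair_power n j i @ lift (alternating n i j) =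
      pair_power n i j @ [(i, True)] @ lift (alternating n i j)"
    using pair_power_shift[of i n j] by (metis append.assoc append_Cons)
  also have "pair_power n i j @ [(i, True)] @ lift (alternating n i j) \<approx>
      pair_power n i j @ [(i, True), (j, True), (j, True)] @ lift (alternating n i j)"
    using equivclp_sym[OF rel_context[OF rel_square[OF Suc.prems(2)],
        of "pair_power n i j @ [(i, True)]" "lift (alternating n i j)"]] by simp
  finally have "(i, True) # lift (alternating n j i) \<approx>
      pair_power n i j @ [(i, True), (j, True), (j, True)] @ lift (alternating n i j)"
    using equivclp_trans by metis
  then show ?case by (simp add: pair_power_Suc_right)
qed simp

lemma moves_rel: "moves a b \<Longrightarrow> lift a \<approx> lift b"
proof (induction rule: rtranclp_induct)
  case (step b c)
  from step(2) have "lift b \<approx> lift c"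
  proof cases
    case (square i u v)
    then show ?thesis using rel_context[OF rel_square, of i "lift u" "lift v"] by simp
  next
    case (braid k i j u v)
    have ij: "i \<in> X" "j \<in> X" using sim_sound[OF braid(3,4)] by auto
    have "pair_power k i j \<in> relators" unfolding relators_def using braid by blast
    then have "relator_step X relators ([] @ pair_power k i j @ lift (alternating k j i))
        ([] @ lift (alternating k j i))" by (rule relator_step.relator)
    then have "pair_power k i j @ lift (alternating k j i) \<approx> lift (alternating k j i)"
      by (auto intro: r_into_equivclp)
    with rel_alternating[OF ij] have "lift (alternating k i j) \<approx> lift (alternating k j i)"
      by (rule equivclp_trans)
    then show ?thesis using rel_context[of _ _ "lift u" "lift v"] braid(1,2) by simp
  qed
  with step(3) show ?case by (rule equivclp_trans)
qed simp

lemma rel_complete: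
  assumes "u \<in> lists (X \<times> UNIV)" "v \<in> lists (X \<times> UNIV)" "val (map fst u) = val (map fst v)"
  shows "u \<approx> v"
proof -
  obtain r where r: "reduced r" "val r = val (map fst u)" "moves (map fst u) r"
    using moves_to_reduced[OF map_fst_lists[OF assms(1)]] by blast
  obtain q where q: "reduced q" "val q = val (map fst v)" "moves (map fst v) q"
    using moves_to_reduced[OF map_fst_lists[OF assms(2)]] by blast
  have "moves r q" by (rule matsumoto[OF r(1) q(1)]) (use r q assms(3) in simp)
  then have "lift (map fst u) \<approx> lift q" using r(3) by (blast intro: moves_rel rtranclp_trans)
  moreover have "lift (map fst v) \<approx> lift q" using moves_rel[OF q(3)] .
  ultimately have "lift (map fst u) \<approx> lift (map fst v)" by (meson equivclp_sym equivclp_trans)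
  then show ?thesis using rel_lift[OF assms(1)] rel_lift[OF assms(2)] by (meson equivclp_sym equivclp_trans)
qed

theorem presents_generate: "presents (G\<lparr>carrier := generate G (f ` X)\<rparr>) X f relators"
proof -
  let ?H = "generate G (f ` X)"
  let ?G = "G\<lparr>carrier := ?H\<rparr>"
  have sub: "subgroup ?H G" by (rule generate_is_subgroup[OF f_image])
  have fH: "f ` X \<subseteq> ?H" by (auto intro: generate.incl)
  have sv: "signed_val ?G f u = val (map fst u)" if "u \<in> lists (X \<times> UNIV)" for u
  proof -
    have "signed_val ?G f u = signed_val G f u" using that unfolding signed_val_def
    proof (induction u rule: list.induct)
      case Nil
      then show ?case by (simp add: word_val_def)
    next
      case (Cons a u)
      obtain i b where a: "a = (i, b)" by (cases a)
      have "i \<in> X" using Cons a by auto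
      then have "inv\<^bsub>?G\<^esub> (f i) = inv (f i)" using m_inv_consistent[OF sub] fH by blast
      then show ?case using Cons a by (auto simp: word_val_def)
    qed
    then show ?thesis using signed_val_eq[OF that] by simp
  qed
  have "generate ?G (f ` X) = ?H" using generate_consistent[OF fH sub] by simp
  moreover have "signed_val ?G f u = signed_val ?G f v \<longleftrightarrow> u \<approx> v"
    if "u \<in> lists (X \<times> UNIV)" "v \<in> lists (X \<times> UNIV)" for u v
    unfolding sv[OF that(1)] sv[OF that(2)]
    using rel_complete[OF that] rel_equiv_sound[OF _ that(1), of v] by blast
  ultimately show ?thesis unfolding presents_def using relators_in_lists fH by simp
qed

end

section \<open>The geometric representation\<close>

context coxeter_system
begin

abbreviation word_elt :: "'a list \<Rightarrow> 'a" where "word_elt \<equiv> word_val W (\<lambda>s. s)"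

definition form_coeff :: "'a \<Rightarrow> 'a \<Rightarrow> real" where
  "form_coeff s t = (if m s t = 0 then -1 else - cos (pi / real (m s t)))"

definition V :: "('a \<Rightarrow> real) set" where
  "V = {v. finite {s. v s \<noteq> 0} \<and> {s. v s \<noteq> 0} \<subseteq> S}"

definition lin :: "real \<Rightarrow> ('a \<Rightarrow> real) \<Rightarrow> real \<Rightarrow> ('a \<Rightarrow> real) \<Rightarrow> ('a \<Rightarrow> real)" where
  "lin a u b v = (\<lambda>t. a * u t + b * v t)"

lemma lin_apply [simp]: "lin a u b v t = a * u t + b * v t"
  by (simp add: lin_def)

lemma S_closed [simp]: "s \<in> S \<Longrightarrow> s \<in> carrier W"
  using S_carrier by auto

lemma S_square: "s \<in> S \<Longrightarrow> s \<otimes> s = \<one>"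
  using S_involution by auto

lemma S_inv: "s \<in> S \<Longrightarrow> inv s = s"
  by (rule inv_equality) (simp_all add: S_square)

lemma id_image: "(\<lambda>s. s) ` S \<subseteq> carrier W"
  using S_carrier by simp

lemma word_elt_closed [simp]: "u \<in> lists S \<Longrightarrow> word_elt u \<in> carrier W"
  by (rule word_val_closed[OF id_image])

lemma word_elt_append: "u \<in> lists S \<Longrightarrow> v \<in> lists S \<Longrightarrow> word_elt (u @ v) = word_elt u \<otimes> word_elt v"
  by (rule word_val_append[OF id_image])

lemma word_elt_rev: "u \<in> lists S \<Longrightarrow> word_elt (rev u) = inv (word_elt u)"
  by (rule word_val_rev[OF id_image]) (simp_all add: S_square)

lemma m_sym: assumes "s \<in> S" "t \<in> S" shows "m s t = m t s"
proof -
  have "inv (s \<otimes> t) = t \<otimes> s" using assms by (simp add: inv_mult_group S_inv)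
  then show ?thesis unfolding m_def using ord_inv[of "s \<otimes> t"] assms by simp
qed

lemma m_self: "s \<in> S \<Longrightarrow> m s s = 1"
  unfolding m_def by (simp add: S_square)

lemma m_ne_1: assumes "s \<in> S" "t \<in> S" "s \<noteq> t" shows "m s t \<noteq> 1"
proof
  assume "m s t = 1"
  then have "s \<otimes> t = \<one>" unfolding m_def using ord_eq_1[of "s \<otimes> t"] assms by simp
  then have "s = t" using inv_equality[of s t] S_inv[of t] assms by simp
  then show False using assms by simp
qed

lemma m_ge_2: "s \<in> S \<Longrightarrow> t \<in> S \<Longrightarrow> s \<noteq> t \<Longrightarrow> m s t \<noteq> 0 \<Longrightarrow> m s t \<ge> 2"
  using m_ne_1[of s t] by linarith

lemma form_coeff_sym: "s \<in> S \<Longrightarrow> t \<in> S \<Longrightarrow> form_coeff s t = form_coeff t s"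
  by (simp add: form_coeff_def m_sym)

lemma form_coeff_self: "s \<in> S \<Longrightarrow> form_coeff s s = 1"
  by (simp add: form_coeff_def m_self)

lemma form_coeff_nonpos: assumes "s \<in> S" "t \<in> S" "s \<noteq> t" shows "form_coeff s t \<le> 0"
proof (cases "m s t = 0")
  case False
  then have "real (m s t) \<ge> 2" using m_ge_2[OF assms] by simp
  then have "pi / real (m s t) \<le> pi / 2" by (intro divide_left_mono) auto
  then have "cos (pi / real (m s t)) \<ge> 0" by (intro cos_ge_zero) (use pi_gt_zero in \<open>auto intro: order_trans[of _ 0]\<close>)
  then show ?thesis by (simp add: form_coeff_def)
qed (simp add: form_coeff_def)

lemma VI: "finite A \<Longrightarrow> A \<subseteq> S \<Longrightarrow> (\<And>s. s \<notin> A \<Longrightarrow> v s = 0) \<Longrightarrow> v \<in> V"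
  unfolding V_def by (auto intro: finite_subset[of _ A])

lemma V_supp: "v \<in> V \<Longrightarrow> finite {s. v s \<noteq> 0}" "v \<in> V \<Longrightarrow> {s. v s \<noteq> 0} \<subseteq> S"
  unfolding V_def by auto

lemma simple_root_V [simp]: "s \<in> S \<Longrightarrow> simple_root s \<in> V"
  by (rule VI[of "{s}"]) (auto simp: simple_root_def)

lemma simple_root_self [simp]: "simple_root s s = 1"
  by (simp add: simple_root_def)

lemma simple_root_other: "s \<noteq> t \<Longrightarrow> simple_root s t = 0"
  by (simp add: simple_root_def)

lemma simple_root_inj: "simple_root s = simple_root t \<longleftrightarrow> s = t"
  by (metis simple_root_self simple_root_other zero_neq_one)

lemma lin_V [simp]: assumes "u \<in> V" "v \<in> V" shows "lin a u b v \<in> V"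
  by (rule VI[of "{s. u s \<noteq> 0} \<union> {s. v s \<noteq> 0}"]) (use V_supp assms in auto)

lemma form_alt:
  assumes "finite A" "finite B" "{s. u s \<noteq> 0} \<subseteq> A" "{t. v t \<noteq> 0} \<subseteq> B"
  shows "form u v = (\<Sum>s\<in>A. \<Sum>t\<in>B. u s * v t * form_coeff s t)"
proof -
  have "form u v = (\<Sum>s\<in>{s. u s \<noteq> 0}. \<Sum>t\<in>{t. v t \<noteq> 0}. u s * v t * form_coeff s t)"
    unfolding form_def form_coeff_def ..
  also have "\<dots> = (\<Sum>s\<in>{s. u s \<noteq> 0}. \<Sum>t\<in>B. u s * v t * form_coeff s t)"
    by (intro sum.cong refl sum.mono_neutral_left) (use assms in auto)
  also have "\<dots> = (\<Sum>s\<in>A. \<Sum>t\<in>B. u s * v t * form_coeff s t)"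
    by (intro sum.mono_neutral_left) (use assms in auto)
  finally show ?thesis .
qed

lemma form_lin_right:
  assumes "u \<in> V" "v \<in> V" "v' \<in> V"
  shows "form u (lin a v b v') = a * form u v + b * form u v'"
proof -
  let ?A = "{s. u s \<noteq> 0}" and ?B = "{s. v s \<noteq> 0} \<union> {s. v' s \<noteq> 0}"
  have fin: "finite ?A" "finite ?B" using V_supp assms by auto
  have "form u (lin a v b v') = (\<Sum>s\<in>?A. \<Sum>t\<in>?B. u s * lin a v b v' t * form_coeff s t)"
    by (rule form_alt[OF fin]) auto
  also have "\<dots> = (\<Sum>s\<in>?A. \<Sum>t\<in>?B. a * (u s * v t * form_coeff s t) + b * (u s * v' t * form_coeff s t))"
    by (intro sum.cong refl) (simp add: algebra_simps)
  also have "\<dots> = a * (\<Sum>s\<in>?A. \<Sum>t\<in>?B. u s * v t * form_coeff s t) + b * (\<Sum>s\<in>?A. \<Sum>t\<in>?B. u s * v' t * form_coeff s t)"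
    by (simp add: sum.distrib sum_distrib_left)
  also have "(\<Sum>s\<in>?A. \<Sum>t\<in>?B. u s * v t * form_coeff s t) = form u v"
    by (rule form_alt[OF fin, symmetric]) auto
  also have "(\<Sum>s\<in>?A. \<Sum>t\<in>?B. u s * v' t * form_coeff s t) = form u v'"
    by (rule form_alt[OF fin, symmetric]) auto
  finally show ?thesis .
qed

lemma form_sym: assumes "u \<in> V" "v \<in> V" shows "form u v = form v u"
proof -
  let ?A = "{s. u s \<noteq> 0}" and ?B = "{s. v s \<noteq> 0}"
  have fin: "finite ?A" "finite ?B" using V_supp assms by auto
  have "form u v = (\<Sum>s\<in>?A. \<Sum>t\<in>?B. u s * v t * form_coeff s t)" by (rule form_alt[OF fin]) auto
  also have "\<dots> = (\<Sum>t\<in>?B. \<Sum>s\<in>?A. u s * v t * form_coeff s t)" by (rule sum.swap)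
  also have "\<dots> = (\<Sum>t\<in>?B. \<Sum>s\<in>?A. v t * u s * form_coeff t s)"
    by (intro sum.cong refl) (use V_supp(2) assms form_coeff_sym in \<open>auto simp: subset_iff\<close>)
  also have "\<dots> = form v u" by (rule form_alt[OF fin(2,1), symmetric]) auto
  finally show ?thesis .
qed

lemma form_lin_left:
  assumes "u \<in> V" "v \<in> V" "v' \<in> V"
  shows "form (lin a v b v') u = a * form v u + b * form v' u"
  using form_lin_right[OF assms] form_sym[of u] assms by simp

lemma form_simple: assumes "s \<in> S" "t \<in> S" shows "form (simple_root s) (simple_root t) = form_coeff s t"
proof -
  have "form (simple_root s) (simple_root t) =
      (\<Sum>p\<in>{s}. \<Sum>q\<in>{t}. simple_root s p * simple_root t q * form_coeff p q)"
    by (rule form_alt) (auto simp: simple_root_def)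
  then show ?thesis by simp
qed

definition linear_functional :: "(('a \<Rightarrow> real) \<Rightarrow> real) \<Rightarrow> bool" where
  "linear_functional F \<longleftrightarrow> (\<forall>u\<in>V. \<forall>v\<in>V. \<forall>a b. F (lin a u b v) = a * F u + b * F v)"

lemma linear_functional_expand:
  assumes F: "linear_functional F" and "finite A" "A \<subseteq> S" "\<And>s. s \<notin> A \<Longrightarrow> v s = 0"
  shows "F v = (\<Sum>s\<in>A. v s * F (simple_root s))"
  using assms(2-)
proof (induction A arbitrary: v rule: finite_induct)
  case empty
  have v: "v = (\<lambda>_. 0)" using empty by auto
  have "(\<lambda>_. 0) \<in> V" by (rule VI[of "{}"]) auto
  moreover have "lin 0 (\<lambda>_. 0) 0 (\<lambda>_. 0) = (\<lambda>_::'a. 0)" by (auto simp: lin_def)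
  ultimately show ?case using F unfolding linear_functional_def v
    by (metis add.right_neutral mult_zero_left sum.empty)
next
  case (insert s A)
  let ?u = "v(s := 0)"
  have s: "s \<in> S" and A: "A \<subseteq> S" using insert by auto
  have "?u \<in> V" by (rule VI[of A]) (use insert in auto)
  moreover have v: "v = lin 1 ?u (v s) (simple_root s)" by (auto simp: lin_def simple_root_def)
  ultimately have "F v = 1 * F ?u + v s * F (simple_root s)"
    using F s unfolding linear_functional_def by (metis simple_root_V)
  moreover have "F ?u = (\<Sum>s\<in>A. ?u s * F (simple_root s))"
    by (rule insert.IH) (use A insert.prems in auto)
  moreover have "(\<Sum>s\<in>A. ?u s * F (simple_root s)) = (\<Sum>s\<in>A. v s * F (simple_root s))"
    using insert.hyps by (intro sum.cong) auto
  ultimately show ?case using insert.hyps by simp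
qed

lemma linear_functional_expand_V:
  assumes "linear_functional F" "v \<in> V"
  shows "F v = (\<Sum>s\<in>{s. v s \<noteq> 0}. v s * F (simple_root s))"
  using V_supp[OF assms(2)] by (intro linear_functional_expand[OF assms(1)]) auto

lemma linear_functional_form: "u \<in> V \<Longrightarrow> linear_functional (form u)"
  unfolding linear_functional_def by (simp add: form_lin_right)

lemma linear_functional_coord: "linear_functional (\<lambda>v. v t)"
  unfolding linear_functional_def by simp

lemma simple_reflection_lin: "simple_reflection s v = lin 1 v (- 2 * form (simple_root s) v) (simple_root s)"
  by (auto simp: simple_reflection_def)

lemma simple_reflection_V [simp]: "s \<in> S \<Longrightarrow> v \<in> V \<Longrightarrow> simple_reflection s v \<in> V"
  by (simp add: simple_reflection_lin)

lemma simple_reflection_linear: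
  assumes "s \<in> S" "u \<in> V" "v \<in> V"
  shows "simple_reflection s (lin a u b v) = lin a (simple_reflection s u) b (simple_reflection s v)"
  by (rule ext) (simp add: simple_reflection_def form_lin_right assms algebra_simps)

lemma simple_reflection_form:
  assumes "s \<in> S" "u \<in> V" "v \<in> V"
  shows "form (simple_reflection s u) (simple_reflection s v) = form u v"
  using assms form_sym[of u "simple_root s"]
  by (simp add: simple_reflection_lin form_lin_left form_lin_right form_simple form_coeff_self algebra_simps)

lemma simple_reflection_sr: assumes "s \<in> S" "v \<in> V" shows "simple_reflection s (simple_reflection s v) = v"
  unfolding simple_reflection_lin using assms
  by (intro ext) (simp add: form_lin_right form_simple form_coeff_self algebra_simps)

lemma simple_reflection_self: "s \<in> S \<Longrightarrow> simple_reflection s (simple_root s) = lin (-1) (simple_root s) 0 (simple_root s)"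
  by (rule ext) (simp add: simple_reflection_def form_simple form_coeff_self)

lemma simple_reflection_fixed: "form (simple_root s) v = 0 \<Longrightarrow> simple_reflection s v = v"
  by (simp add: simple_reflection_def)

abbreviation word_act :: "'a list \<Rightarrow> ('a \<Rightarrow> real) \<Rightarrow> ('a \<Rightarrow> real)" where
  "word_act \<equiv> foldr simple_reflection"

lemma word_act_V [simp]: "u \<in> lists S \<Longrightarrow> v \<in> V \<Longrightarrow> word_act u v \<in> V"
  by (induction u rule: list.induct) auto

lemma word_act_linear:
  "u \<in> lists S \<Longrightarrow> v \<in> V \<Longrightarrow> v' \<in> V \<Longrightarrow> word_act u (lin a v b v') = lin a (word_act u v) b (word_act u v')"
  by (induction u rule: list.induct) (auto simp: simple_reflection_linear)

lemma word_act_form: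
  "u \<in> lists S \<Longrightarrow> v \<in> V \<Longrightarrow> v' \<in> V \<Longrightarrow> form (word_act u v) (word_act u v') = form v v'"
  by (induction u rule: list.induct) (auto simp: simple_reflection_form)

lemma word_act_fixed:
  assumes "u \<in> lists A" "\<And>s. s \<in> A \<Longrightarrow> form (simple_root s) v = 0" shows "word_act u v = v"
  using assms(1) by (induction u rule: list.induct) (auto simp: simple_reflection_fixed assms(2))

section \<open>Dihedral subgroups and the braid relations\<close>

text \<open>Chebyshev polynomials of the second kind, of index \<open>n - 1\<close>, evaluated at
  \<open>- form_coeff s t\<close>. They are the coordinates of the roots of the dihedral group;
  \<open>real n\<close> is the limit for angle 0, which belongs to infinite order.\<close>

definition dihedral_coeff :: "'a \<Rightarrow> 'a \<Rightarrow> nat \<Rightarrow> real" where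
  "dihedral_coeff s t n = (if m s t = 0 then real n
     else sin (real n * (pi / real (m s t))) / sin (pi / real (m s t)))"

lemma sin_pos: assumes "s \<in> S" "t \<in> S" "s \<noteq> t" "m s t \<noteq> 0" shows "sin (pi / real (m s t)) > 0"
proof (rule sin_gt_zero)
  have "real (m s t) \<ge> 2" using m_ge_2[OF assms] by simp
  then have "pi / real (m s t) \<le> pi / 2" by (intro divide_left_mono) auto
  then show "pi / real (m s t) < pi" using pi_gt_zero by linarith
  show "0 < pi / real (m s t)" using assms by simp
qed

lemma dihedral_coeff_0 [simp]: "dihedral_coeff s t 0 = 0"
  by (simp add: dihedral_coeff_def)

lemma dihedral_coeff_1: assumes "s \<in> S" "t \<in> S" "s \<noteq> t" shows "dihedral_coeff s t (Suc 0) = 1"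
proof (cases "m s t = 0")
  case False
  then show ?thesis using sin_pos[OF assms False] by (simp add: dihedral_coeff_def)
qed (simp add: dihedral_coeff_def)

lemma dihedral_coeff_rec: "dihedral_coeff s t (Suc (Suc n)) = - 2 * form_coeff s t * dihedral_coeff s t (Suc n) - dihedral_coeff s t n"
proof (cases "m s t = 0")
  case False
  define x where "x = pi / real (m s t)"
  have "sin (real (Suc (Suc n)) * x) + sin (real n * x) = 2 * sin (real (Suc n) * x) * cos x"
    using sin_add[of "real (Suc n) * x" x] sin_diff[of "real (Suc n) * x" x]
    by (simp add: algebra_simps)
  then have e: "sin (real (Suc (Suc n)) * x) = 2 * sin (real (Suc n) * x) * cos x - sin (real n * x)"
    by simp
  show ?thesis using False unfolding dihedral_coeff_def form_coeff_def x_def[symmetric] e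
    by (simp add: diff_divide_distrib)
qed (simp add: dihedral_coeff_def form_coeff_def)

lemma dihedral_coeff_nonneg:
  assumes "s \<in> S" "t \<in> S" "s \<noteq> t" "m s t = 0 \<or> n \<le> m s t" shows "dihedral_coeff s t n \<ge> 0"
proof (cases "m s t = 0")
  case False
  then have "real n * (pi / real (m s t)) \<le> real (m s t) * (pi / real (m s t))"
    using assms(4) by (intro mult_right_mono) auto
  then have "sin (real n * (pi / real (m s t))) \<ge> 0" using False by (intro sin_ge_zero) auto
  then show ?thesis using sin_pos[OF assms(1-3) False] by (simp add: dihedral_coeff_def)
qed (simp add: dihedral_coeff_def)

lemma rev_alternating_Suc:
  "rev (alternating (Suc n) t s) = (if even n then t else s) # rev (alternating n t s)"
proof -
  have "alternating (n + 1) t s = alternating n t s @ [if even n then t else s]"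
    unfolding alternating_add by simp
  then show ?thesis by simp
qed

lemma simple_reflection_lin_basis:
  assumes "s \<in> S" "t \<in> S" "s \<noteq> t"
  shows "simple_reflection t (lin a (simple_root s) b (simple_root t)) =
    lin a (simple_root s) (- 2 * form_coeff s t * a - b) (simple_root t)"
  using assms form_coeff_sym[of s t]
  by (intro ext) (simp add: simple_reflection_def form_lin_right form_simple form_coeff_self algebra_simps)

lemma lin_swap: "lin a u b v = lin b v a u"
  by (auto simp: lin_def)

text \<open>The word is reversed so that \<open>t\<close> acts first. The reflection
  \<open>s\<close> would only change the sign of its own root, so words ending in \<open>t\<close>
  are the ones that produce new roots.\<close>

lemma word_act_alternating:
  assumes "s \<in> S" "t \<in> S" "s \<noteq> t"
  shows "word_act (rev (alternating n t s)) (simple_root s) =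
    (if even n then lin (dihedral_coeff s t (Suc n)) (simple_root s) (dihedral_coeff s t n) (simple_root t)
     else lin (dihedral_coeff s t n) (simple_root s) (dihedral_coeff s t (Suc n)) (simple_root t))"
proof (induction n)
  case 0
  show ?case using dihedral_coeff_1[OF assms] by (auto simp: lin_def)
next
  case (Suc n)
  show ?case
  proof (cases "even n")
    case True
    have "word_act (rev (alternating (Suc n) t s)) (simple_root s) = simple_reflection t
        (lin (dihedral_coeff s t (Suc n)) (simple_root s) (dihedral_coeff s t n) (simple_root t))"
      by (simp only: rev_alternating_Suc True if_True foldr.simps o_apply Suc.IH)
    also have "\<dots> = lin (dihedral_coeff s t (Suc n)) (simple_root s) (dihedral_coeff s t (Suc (Suc n))) (simple_root t)"
      unfolding simple_reflection_lin_basis[OF assms] dihedral_coeff_rec ..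
    finally show ?thesis using True by (simp only: even_Suc not_True_eq_False if_False)
  next
    case False
    have "word_act (rev (alternating (Suc n) t s)) (simple_root s) = simple_reflection s
        (lin (dihedral_coeff s t n) (simple_root s) (dihedral_coeff s t (Suc n)) (simple_root t))"
      by (simp only: rev_alternating_Suc False if_False foldr.simps o_apply Suc.IH)
    also have "\<dots> = simple_reflection s
        (lin (dihedral_coeff s t (Suc n)) (simple_root t) (dihedral_coeff s t n) (simple_root s))"
      by (simp only: lin_swap[of "dihedral_coeff s t n"])
    also have "\<dots> = lin (dihedral_coeff s t (Suc n)) (simple_root t) (dihedral_coeff s t (Suc (Suc n))) (simple_root s)"
      unfolding simple_reflection_lin_basis[OF assms(2,1) assms(3)[symmetric]] form_coeff_sym[OF assms(2,1)] dihedral_coeff_rec ..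
    also have "\<dots> = lin (dihedral_coeff s t (Suc (Suc n))) (simple_root s) (dihedral_coeff s t (Suc n)) (simple_root t)"
      by (rule lin_swap)
    finally show ?thesis using False by (simp only: even_Suc not_False_eq_True if_True)
  qed
qed

lemma dihedral_coeff_period:
  assumes "s \<in> S" "t \<in> S" "s \<noteq> t" "m s t \<noteq> 0"
  shows "dihedral_coeff s t (2 * m s t) = 0" "dihedral_coeff s t (Suc (2 * m s t)) = 1"
    "dihedral_coeff s t (2 * m s t - 1) = -1"
proof -
  define x where "x = pi / real (m s t)"
  have e: "real (2 * m s t) * x = 2 * pi" using assms(4) by (simp add: x_def)
  have p: "sin x > 0" using sin_pos[OF assms] by (simp add: x_def)
  show "dihedral_coeff s t (2 * m s t) = 0" using assms(4) unfolding dihedral_coeff_def x_def[symmetric] e by simp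
  have "real (Suc (2 * m s t)) * x = 2 * pi + x" using e by (simp add: algebra_simps)
  then show "dihedral_coeff s t (Suc (2 * m s t)) = 1" using assms(4) p unfolding dihedral_coeff_def x_def[symmetric]
    by (simp add: sin_add)
  have "real (2 * m s t - 1) * x = 2 * pi - x" using e assms(4) by (simp add: algebra_simps of_nat_diff)
  then show "dihedral_coeff s t (2 * m s t - 1) = -1" using assms(4) p unfolding dihedral_coeff_def x_def[symmetric]
    by (simp add: sin_diff)
qed

text \<open>The relator fixes both simple roots. For finite order the form is nondegenerate on their
  plane, so every vector is a sum of one in the plane and one orthogonal to it, and both summands
  are fixed.\<close>

lemma word_act_braid_relator:
  assumes "s \<in> S" "t \<in> S" "s \<noteq> t" "m s t \<noteq> 0" "v \<in> V"
  shows "word_act (rev (alternating (2 * m s t) t s)) v = v"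
proof -
  let ?w = "rev (alternating (2 * m s t) t s)"
  let ?a = "simple_root s" and ?b = "simple_root t"
  have l: "alternating n t s \<in> lists {s, t}" for n by (simp add: alternating_in_lists)
  have sub: "lists {s, t} \<subseteq> lists S" using assms by (intro lists_mono) auto
  have w: "?w \<in> lists S" using l[of "2 * m s t"] sub by auto
  have ws: "word_act ?w ?a = ?a"
    using word_act_alternating[OF assms(1-3), of "2 * m s t"] dihedral_coeff_period[OF assms(1-4)]
    by (auto simp: lin_def)
  have wt: "word_act ?w ?b = ?b"
  proof -
    \<comment> \<open>The last letter of the word is \<open>t\<close> and negates its own root. What
      remains is an alternating word of odd length with the roles of \<open>s\<close> and
      \<open>t\<close> exchanged, one short of a full period.\<close>
    define k where "k = 2 * m s t - 1"
    have k: "2 * m s t = Suc k" "odd k" using assms(4) unfolding k_def by auto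
    have ts: "m t s = m s t" using m_sym[OF assms(1,2)] by simp
    have e: "?w = rev (alternating k s t) @ [t]" unfolding k by simp
    have lk: "rev (alternating k s t) \<in> lists S" using l[of "Suc k"] sub by auto
    have "word_act ?w ?b = word_act (rev (alternating k s t)) (lin (-1) ?b 0 ?b)"
      unfolding e using simple_reflection_self[OF assms(2)] by simp
    also have "\<dots> = lin (-1) (word_act (rev (alternating k s t)) ?b) 0 (word_act (rev (alternating k s t)) ?b)"
      using word_act_linear[OF lk] assms by simp
    also have "word_act (rev (alternating k s t)) ?b = lin (-1) ?b 0 ?a"
    proof -
      have "dihedral_coeff t s n = dihedral_coeff s t n" for n by (simp add: dihedral_coeff_def ts)
      moreover have "dihedral_coeff s t k = -1" unfolding k_def by (rule dihedral_coeff_period(3)[OF assms(1-4)])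
      moreover have "dihedral_coeff s t (Suc k) = 0" unfolding k(1)[symmetric] by (rule dihedral_coeff_period(1)[OF assms(1-4)])
      ultimately have "dihedral_coeff t s k = -1" "dihedral_coeff t s (Suc k) = 0" by simp_all
      then show ?thesis
        using word_act_alternating[OF assms(2,1) assms(3)[symmetric], of k] k by simp
    qed
    finally show ?thesis by (auto simp: lin_def)
  qed
  define c where "c = form_coeff s t"
  define p where "p = form ?a v"
  define q where "q = form ?b v"
  define D where "D = 1 - c * c"
  have D: "D \<noteq> 0"
  proof -
    have "D = (sin (pi / real (m s t)))\<^sup>2" using assms(4) sin_cos_squared_add[of "pi / real (m s t)"]
      by (simp add: D_def c_def form_coeff_def power2_eq_square)
    then show ?thesis using sin_pos[OF assms(1-4)] by simp
  qed
  \<comment> \<open>Cramer's rule: \<open>a\<close> and \<open>b\<close> are chosen such that the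
    vector \<open>y\<close> below has the same products with both simple roots as \<open>v\<close>.
    The determinant \<open>D\<close> is the square of a sine.\<close>
  define a where "a = (p - c * q) / D"
  define b where "b = (q - c * p) / D"
  have aD: "a * D = p - c * q" and bD: "b * D = q - c * p" using D by (simp_all add: a_def b_def)
  have ab: "a + c * b = p" "c * a + b = q"
  proof -
    have "(a + c * b) * D = a * D + c * (b * D)" by (simp add: algebra_simps)
    also have "\<dots> = p * D" unfolding aD bD by (simp add: D_def algebra_simps)
    finally show "a + c * b = p" using D by simp
    have "(c * a + b) * D = c * (a * D) + b * D" by (simp add: algebra_simps)
    also have "\<dots> = q * D" unfolding aD bD by (simp add: D_def algebra_simps)
    finally show "c * a + b = q" using D by simp
  qed
  define y where "y = lin a ?a b ?b"
  define z where "z = lin 1 v (-1) y"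
  have y: "y \<in> V" "word_act ?w y = y" using assms word_act_linear[OF w] ws wt by (simp_all add: y_def)
  have z: "z \<in> V" using assms y by (simp add: z_def)
  have "form (simple_root r) z = 0" if "r \<in> {s, t}" for r
  proof -
    have "form ?a z = 0" using assms y ab by (simp add: z_def y_def form_lin_right form_simple form_coeff_self p_def c_def algebra_simps)
    moreover have "form ?b z = 0" using assms y ab form_coeff_sym[OF assms(1,2)]
      by (simp add: z_def y_def form_lin_right form_simple form_coeff_self q_def c_def algebra_simps)
    ultimately show ?thesis using that by auto
  qed
  then have wz: "word_act ?w z = z" by (intro word_act_fixed[where A = "{s, t}"]) (use l[of "2 * m s t"] in simp_all)
  have v: "v = lin 1 z 1 y" by (auto simp: z_def)
  have "word_act ?w v = lin 1 (word_act ?w z) 1 (word_act ?w y)" by (subst v) (rule word_act_linear[OF w z y(1)])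
  then show ?thesis unfolding wz y(2) v[symmetric] .
qed

lemma map_fst_pair_power_alternating: "map fst (pair_power k s t) = rev (alternating (2 * k) t s)"
proof (induction k)
  case (Suc k)
  then show ?case unfolding pair_power_Suc by (simp add: rev_alternating_Suc del: alternating.simps)
qed simp

text \<open>The equivalence closure runs through steps in both directions, hence the disjunction in
  the hypothesis and both memberships in the conclusion.\<close>

lemma relator_step_word_act:
  assumes "relator_step S {pair_power (ord (s \<otimes> t)) s t | s t. s \<in> S \<and> t \<in> S \<and> ord (s \<otimes> t) \<noteq> 0} a b"
    "v \<in> V" "a \<in> lists (S \<times> UNIV) \<or> b \<in> lists (S \<times> UNIV)"
  shows "a \<in> lists (S \<times> UNIV) \<and> b \<in> lists (S \<times> UNIV) \<and> word_act (map fst a) v = word_act (map fst b) v"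
  using assms(1)
proof cases
  case (cancel i u c w)
  have l: "u \<in> lists (S \<times> UNIV)" "w \<in> lists (S \<times> UNIV)" using assms(3) cancel by auto
  have mf: "map fst w \<in> lists S" using l(2) by (induction w rule: list.induct) auto
  show ?thesis using l cancel simple_reflection_sr[of i "word_act (map fst w) v"] mf assms(2) by simp
next
  case (relator r u w)
  then obtain s t where st: "r = pair_power (m s t) s t" "s \<in> S" "t \<in> S" "m s t \<noteq> 0"
    unfolding m_def by blast
  have r: "r \<in> lists (S \<times> UNIV)" unfolding st(1) by (rule pair_power_in_lists) (use st in auto)
  have l: "u \<in> lists (S \<times> UNIV)" "w \<in> lists (S \<times> UNIV)" using assms(3) relator by auto
  have mf: "map fst w \<in> lists S" using l(2) by (induction w rule: list.induct) auto
  have "word_act (map fst r) (word_act (map fst w) v) = word_act (map fst w) v"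
  proof (cases "s = t")
    case True
    have "map fst r = [s, s]" unfolding st(1) True using m_self[OF st(3)] by (simp add: pair_power_def)
    then show ?thesis using simple_reflection_sr[OF st(2), of "word_act (map fst w) v"] mf assms(2) by simp
  next
    case False
    show ?thesis unfolding st(1) map_fst_pair_power_alternating
      by (rule word_act_braid_relator[OF st(2,3) False st(4)]) (use mf assms(2) in simp)
  qed
  then show ?thesis using l r relator by simp
qed

section \<open>The action of group elements on vectors\<close>

text \<open>Here completeness of the Coxeter relations enters: words of equal value are joined by
  relator steps, and each step preserves the action.\<close>

lemma word_act_cong:
  assumes "u \<in> lists S" "u' \<in> lists S" "word_elt u = word_elt u'" "v \<in> V"
  shows "word_act u v = word_act u' v"
proof -
  let ?R = "{pair_power (ord (s \<otimes> t)) s t | s t. s \<in> S \<and> t \<in> S \<and> ord (s \<otimes> t) \<noteq> 0}"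
  let ?l = "map (\<lambda>s. (s, True))"
  have ll: "?l u \<in> lists (S \<times> UNIV)" if "u \<in> lists S" for u
    using that by (induction u rule: list.induct) auto
  have sv: "signed_val W (\<lambda>s. s) (?l u) = word_elt u" for u
    unfolding signed_val_def by (induction u rule: list.induct) auto
  have mf: "map fst (?l u) = u" for u :: "'a list" by (induction u) auto
  have e: "equivclp (relator_step S ?R) (?l u) (?l u')"
    using S_presents ll[OF assms(1)] ll[OF assms(2)] assms(3) unfolding presents_def sv[symmetric] by blast
  have "b \<in> lists (S \<times> UNIV) \<and> word_act (map fst (?l u)) v = word_act (map fst b) v"
    if "equivclp (relator_step S ?R) (?l u) b" for b
    using that
  proof (induction rule: equivclp_induct)
    case base
    then show ?case using ll[OF assms(1)] by simp
  next
    case (step b c)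
    from step(2) show ?case
    proof
      assume "relator_step S ?R b c"
      from relator_step_word_act[OF this assms(4)] step(3) show ?thesis by simp
    next
      assume "relator_step S ?R c b"
      from relator_step_word_act[OF this assms(4)] step(3) show ?thesis by simp
    qed
  qed
  from this[OF e] show ?thesis unfolding mf by simp
qed

lemma word_exists: assumes "w \<in> carrier W" shows "\<exists>u \<in> lists S. word_elt u = w"
proof -
  have "w \<in> generate W ((\<lambda>s. s) ` S)" using assms S_presents unfolding presents_def by simp
  then have "w \<in> generate W S" by simp
  then show ?thesis
  proof (induction rule: generate.induct)
    case one
    show ?case by (rule bexI[of _ "[]"]) auto
  next
    case (incl h)
    then show ?case by (intro bexI[of _ "[h]"]) auto
  next
    case (inv h)
    then show ?case by (intro bexI[of _ "[h]"]) (auto simp: S_inv)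
  next
    case (eng h1 h2)
    then obtain u1 u2 where "u1 \<in> lists S" "word_elt u1 = h1" "u2 \<in> lists S" "word_elt u2 = h2" by blast
    then show ?case by (intro bexI[of _ "u1 @ u2"]) (auto simp: word_elt_append)
  qed
qed

lemma act_word_elt: assumes "u \<in> lists S" "v \<in> V" shows "act (word_elt u) v = word_act u v"
proof -
  let ?u = "SOME u'. u' \<in> lists S \<and> word_elt u' = word_elt u"
  have "?u \<in> lists S \<and> word_elt ?u = word_elt u" by (rule someI[of _ u]) (use assms in simp)
  then have "word_act ?u v = word_act u v" using assms by (intro word_act_cong) auto
  then show ?thesis by (simp add: act_def)
qed

lemma act_V [simp]: assumes "w \<in> carrier W" "v \<in> V" shows "act w v \<in> V"
proof -
  obtain u where "u \<in> lists S" "word_elt u = w" using word_exists[OF assms(1)] by blast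
  then show ?thesis using act_word_elt[of u v] assms by auto
qed

lemma act_linear:
  assumes "w \<in> carrier W" "u \<in> V" "v \<in> V" shows "act w (lin a u b v) = lin a (act w u) b (act w v)"
proof -
  obtain x where x: "x \<in> lists S" "word_elt x = w" using word_exists[OF assms(1)] by blast
  show ?thesis unfolding x(2)[symmetric] using x(1) assms(2,3) by (simp add: act_word_elt word_act_linear)
qed

lemma act_form:
  assumes "w \<in> carrier W" "u \<in> V" "v \<in> V" shows "form (act w u) (act w v) = form u v"
proof -
  obtain x where x: "x \<in> lists S" "word_elt x = w" using word_exists[OF assms(1)] by blast
  show ?thesis unfolding x(2)[symmetric] using x(1) assms(2,3) by (simp add: act_word_elt word_act_form)
qed

lemma act_one [simp]: "v \<in> V \<Longrightarrow> act \<one> v = v"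
  using act_word_elt[of "[]" v] by simp

lemma act_S: "s \<in> S \<Longrightarrow> v \<in> V \<Longrightarrow> act s v = simple_reflection s v"
  using act_word_elt[of "[s]" v] by simp

lemma act_mult:
  assumes "g \<in> carrier W" "h \<in> carrier W" "v \<in> V" shows "act (g \<otimes> h) v = act g (act h v)"
proof -
  obtain x where x: "x \<in> lists S" "word_elt x = g" using word_exists[OF assms(1)] by blast
  obtain y where y: "y \<in> lists S" "word_elt y = h" using word_exists[OF assms(2)] by blast
  have "act (word_elt (x @ y)) v = word_act (x @ y) v" by (rule act_word_elt) (use x y assms in simp_all)
  also have "\<dots> = word_act x (word_act y v)" by simp
  also have "\<dots> = act (word_elt x) (act (word_elt y) v)" using x(1) y(1) assms(3) by (simp add: act_word_elt)
  finally show ?thesis unfolding word_elt_append[OF x(1) y(1)] x(2) y(2) .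
qed

lemma act_inv [simp]:
  assumes "g \<in> carrier W" "v \<in> V" shows "act (inv g) (act g v) = v" "act g (act (inv g) v) = v"
  using assms act_mult[of "inv g" g v] act_mult[of g "inv g" v] by simp_all

lemma act_expand:
  assumes "w \<in> carrier W" "finite A" "A \<subseteq> S" "\<And>s. s \<notin> A \<Longrightarrow> v s = 0"
  shows "act w v t = (\<Sum>s\<in>A. v s * act w (simple_root s) t)"
proof (rule linear_functional_expand[OF _ assms(2-4)])
  show "linear_functional (\<lambda>v. act w v t)"
    unfolding linear_functional_def using assms(1) by (simp add: act_linear)
qed

end

section \<open>Roots and inversion sets\<close>

context coxeter_system
begin

lemma len_word: assumes "w \<in> carrier W" obtains u where "u \<in> lists S" "length u = len w" "word_elt u = w"
proof -
  have "\<exists>n. \<exists>u \<in> lists S. length u = n \<and> word_elt u = w" using word_exists[OF assms] by blast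
  from LeastI_ex[OF this] show ?thesis using that unfolding len_def by blast
qed

lemma len_le: assumes "u \<in> lists S" shows "len (word_elt u) \<le> length u"
  unfolding len_def by (rule Least_le) (use assms in blast)

lemma len_mult_word: assumes "w \<in> carrier W" "u \<in> lists S" shows "len (w \<otimes> word_elt u) \<le> len w + length u"
proof -
  obtain x where x: "x \<in> lists S" "length x = len w" "word_elt x = w" using len_word[OF assms(1)] .
  have "len (word_elt (x @ u)) \<le> length (x @ u)" by (rule len_le) (use x assms in simp)
  then show ?thesis unfolding word_elt_append[OF x(1) assms(2)] x(3) using x(2) by simp
qed

lemma len_mult_S: assumes "w \<in> carrier W" "s \<in> S" shows "len (w \<otimes> s) \<le> Suc (len w)"
  using len_mult_word[OF assms(1), of "[s]"] assms by simp

lemma inv_cancel: assumes "w \<in> carrier W" "x \<in> carrier W"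
  shows "inv w \<otimes> (w \<otimes> x) = x" "w \<otimes> (inv w \<otimes> x) = x"
  using assms by (simp_all add: m_assoc[symmetric])

lemma simple_root_nonneg: "simple_root s r \<ge> 0"
  by (simp add: simple_root_def)

lemma mult_S_S: assumes "w \<in> carrier W" "s \<in> S" shows "w \<otimes> s \<otimes> s = w"
  using assms by (simp add: m_assoc S_square)

lemma alternatingI:
  assumes "e \<in> lists {s, t}" "e = [] \<or> hd e = t" "\<And>a x b. e \<noteq> a @ x # x # b" "s \<noteq> t"
  shows "e = alternating (length e) t s"
  using assms
proof (induction e arbitrary: s t rule: list.induct)
  case (Cons x e)
  have x: "x = t" using Cons.prems(2) by simp
  have e: "e \<in> lists {t, s}" using Cons.prems(1) by (simp add: insert_commute)
  have hd: "e = [] \<or> hd e = s"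
  proof (cases e)
    case (Cons y e')
    have "y \<noteq> t" using Cons.prems(3)[of "[]" t e'] Cons x by simp
    then show ?thesis using e Cons by simp
  qed simp
  have "e \<noteq> a @ y # y # b" for a y b using Cons.prems(3)[of "x # a" y b] by simp
  from Cons.IH[OF e hd this] Cons.prems(4) have "e = alternating (length e) s t" by simp
  from this[symmetric] x show ?case by simp
qed simp

text \<open>Write \<open>w = v d\<close> with \<open>d\<close> a word in \<open>s\<close> and \<open>t\<close>, lengths adding up and \<open>v\<close> as short as possible.
  Then \<open>v\<close> keeps \<open>\<alpha>\<^sub>s\<close> and \<open>\<alpha>\<^sub>t\<close> positive, and \<open>d \<alpha>\<^sub>s\<close> is a nonnegative combination of the two.\<close>

theorem len_nonneg:
  assumes "w \<in> carrier W" "s \<in> S" "len w \<le> len (w \<otimes> s)"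
  shows "act w (simple_root s) r \<ge> 0"
  using assms
proof (induction "len w" arbitrary: w s r rule: less_induct)
  case less
  note w = less.prems(1) and s = less.prems(2)
  obtain u where u: "u \<in> lists S" "length u = len w" "word_elt u = w" using len_word[OF w] .
  show ?case
  proof (cases u rule: rev_cases)
    case Nil
    then have "w = \<one>" using u(3) by simp
    then show ?thesis using s simple_root_nonneg by simp
  next
    case (snoc u' t)
    have t: "t \<in> S" and u': "u' \<in> lists S" using u(1) snoc by auto
    define v0 where "v0 = word_elt u'"
    have v0: "v0 \<in> carrier W" using u' by (simp add: v0_def)
    have wv0: "w = v0 \<otimes> t" using u(3) snoc u' t by (simp add: word_elt_append v0_def)
    have lu': "len w = Suc (length u')" using u(2) snoc by simp
    have lv0: "len w = Suc (len v0)"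
      using len_le[OF u'] len_mult_S[OF v0 t] lu' unfolding wv0 v0_def[symmetric] by simp
    have st: "s \<noteq> t"
    proof
      assume "s = t"
      then have "w \<otimes> s = v0" using mult_S_S[OF v0 t] wv0 by simp
      then show False using lv0 less.prems(3) by simp
    qed
    have sub: "e \<in> lists {s, t} \<Longrightarrow> e \<in> lists S" for e
      using lists_mono[of "{s, t}" S] s t by blast
    define P where "P d v \<longleftrightarrow> d \<in> lists {s, t} \<and> v \<in> carrier W \<and> w = v \<otimes> word_elt d \<and> len w = len v + length d" for d v
    have P0: "P [t] v0" using v0 t wv0 lv0 by (simp add: P_def)
    obtain v where v: "\<exists>d. P d v" and vmin: "\<And>d' v'. P d' v' \<Longrightarrow> len v \<le> len v'"
      using ex_has_least_nat[where P = "\<lambda>v. \<exists>d. P d v" and m = len, of v0] P0 by blast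
    obtain d where d: "P d v" using v by blast
    have dl: "d \<in> lists {s, t}" and vW: "v \<in> carrier W" and wd: "w = v \<otimes> word_elt d"
      and lw: "len w = len v + length d" using d by (auto simp: P_def)
    have lv: "len v < len w" using vmin[OF P0] lv0 by simp
    have shorter': False if "e \<in> lists S" "word_elt e = word_elt d" "length e < length d" for e
      using len_mult_word[OF vW that(1)] lw that wd by simp
    \<comment> \<open>A letter shortening \<open>v\<close> could be moved over to the dihedral part
      without changing the total length, against the minimality of \<open>v\<close>.\<close>
    have up: "len v \<le> len (v \<otimes> x)" if x: "x \<in> {s, t}" for x
    proof (rule ccontr)
      assume n: "\<not> ?thesis"
      have xS: "x \<in> S" using x s t by blast
      have c: "v \<otimes> x \<in> carrier W" using vW xS by simp
      have xd: "x # d \<in> lists {s, t}" using x dl by simp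
      have e: "w = (v \<otimes> x) \<otimes> word_elt (x # d)"
        using vW xS sub[OF dl] wd by (simp add: m_assoc involution_cancel S_square)
      have "len w \<le> len (v \<otimes> x) + length (x # d)"
        using len_mult_word[OF c sub[OF xd]] e by simp
      then have "len w = len (v \<otimes> x) + length (x # d)" using n lw by simp
      then have "P (x # d) (v \<otimes> x)" using xd c e by (simp add: P_def)
      from vmin[OF this] n show False by simp
    qed
    have ps: "act v (simple_root s) r \<ge> 0" by (rule less.hyps[OF lv vW s]) (use up in simp)
    have pt: "act v (simple_root t) r \<ge> 0" by (rule less.hyps[OF lv vW t]) (use up in simp)
    define e where "e = rev d"
    define n where "n = length d"
    have el: "e \<in> lists {s, t}" and le: "length e = n" and de: "d = rev e"
      using dl by (simp_all add: e_def n_def)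
    \<comment> \<open>No word at most as long as \<open>d\<close> for the same element ends in
      \<open>s\<close>: cancelling that \<open>s\<close> would make \<open>w \<otimes> s\<close>
      shorter than \<open>w\<close>.\<close>
    have ends: False if "f \<in> lists S" "word_elt d = word_elt (f @ [s])" "length f < length d" for f
    proof -
      have "w \<otimes> s = v \<otimes> word_elt f" using that(1,2) wd vW s by (simp add: word_elt_append m_assoc S_square)
      then have "len (w \<otimes> s) \<le> len v + length f" using len_mult_word[OF vW that(1)] by simp
      then show False using that(3) less.prems(3) lw by simp
    qed
    have hd: "e = [] \<or> hd e = t"
    proof (cases e)
      case (Cons y e')
      have "y \<noteq> s"
      proof
        assume y: "y = s"
        have "rev e' \<in> lists S" using el Cons sub by simp
        then show False using ends[of "rev e'"] y Cons de by simp
      qed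
      then show ?thesis using Cons el by simp
    qed simp
    have nodup: "e \<noteq> a @ x # x # b" for a x b
    proof
      assume eq: "e = a @ x # x # b"
      have l: "a \<in> lists S" "b \<in> lists S" "x \<in> S" using sub[OF el] unfolding eq by auto
      have "word_elt d = word_elt (rev b @ rev a)"
        using l unfolding de eq by (simp add: word_elt_append m_assoc involution_cancel S_square)
      then show False using shorter'[of "rev b @ rev a"] l de eq by simp
    qed
    have ea: "e = alternating n t s" using alternatingI[OF el hd nodup st] le by simp
    \<comment> \<open>If \<open>d\<close> had at least \<open>m s t\<close> letters, its last
      \<open>m s t\<close> letters could be braided so that the word ends in \<open>s\<close>. The
      bound keeps the coefficients below in the range where they are nonnegative.\<close>
    have nm: "m s t = 0 \<or> n < m s t"
    proof (rule ccontr)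
      assume "\<not> ?thesis"
      then have m0: "m s t \<noteq> 0" and mn: "m s t \<le> n" by auto
      define k where "k = m s t"
      define rest where "rest = (if even k then alternating (n - k) t s else alternating (n - k) s t)"
      have ee: "e = alternating k t s @ rest"
        using alternating_add[of k "n - k" t s] mn unfolding ea rest_def k_def by simp
      have l: "rest \<in> lists S" "alternating i t s \<in> lists S" "alternating i s t \<in> lists S" for i
        using s t by (auto simp: rest_def intro!: alternating_in_lists)
      obtain k' where k': "k = Suc k'" using m0 by (cases k) (auto simp: k_def)
      have p1: "(s \<otimes> t) [^] k = \<one>" using s t by (simp add: k_def m_def pow_ord_eq_1)
      have "word_elt (alternating k s t) = (s \<otimes> t) [^] k \<otimes> word_elt (alternating k t s)"
        by (rule word_val_alternating_swap) (use s t S_square in simp_all)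
      then have eq: "word_elt (alternating k s t) = word_elt (alternating k t s)" unfolding p1 using l by simp
      have "word_elt d = word_elt (rev rest @ rev (alternating k t s))" unfolding de ee by simp
      also have "\<dots> = word_elt (rev rest @ rev (alternating k s t))"
        using l eq by (simp add: word_elt_append word_elt_rev)
      also have "\<dots> = word_elt ((rev rest @ rev (alternating k' t s)) @ [s])" unfolding k' by simp
      finally show False
        by (rule ends[rotated]) (use l in \<open>simp_all add: de ee k'\<close>)
    qed
    obtain a b where ab: "a \<ge> 0" "b \<ge> 0" "act (word_elt d) (simple_root s) = lin a (simple_root s) b (simple_root t)"
    proof -
      have nn: "dihedral_coeff s t n \<ge> 0" "dihedral_coeff s t (Suc n) \<ge> 0"
        using nm by (auto intro!: dihedral_coeff_nonneg s t st)
      have "act (word_elt d) (simple_root s) = word_act (rev (alternating n t s)) (simple_root s)"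
        using act_word_elt[OF sub[OF dl]] s unfolding de ea by simp
      then show ?thesis unfolding word_act_alternating[OF s t st]
        using nn that by (cases "even n") (simp_all only: if_True if_False)
    qed
    have "act w (simple_root s) = act v (act (word_elt d) (simple_root s))"
      unfolding wd by (rule act_mult) (use vW sub[OF dl] s in simp_all)
    also have "\<dots> = lin a (act v (simple_root s)) b (act v (simple_root t))"
      unfolding ab(3) by (rule act_linear) (use vW s t in simp_all)
    finally show ?thesis using ps pt ab(1,2) by simp
  qed
qed

lemma len_nonpos:
  assumes "w \<in> carrier W" "s \<in> S" "len (w \<otimes> s) \<le> len w"
  shows "act w (simple_root s) r \<le> 0"
proof -
  have "act (w \<otimes> s) (simple_root s) r \<ge> 0"
    by (rule len_nonneg) (use assms mult_S_S in simp_all)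
  moreover have "act (w \<otimes> s) (simple_root s) = lin (-1) (act w (simple_root s)) 0 (act w (simple_root s))"
    using assms by (simp add: act_mult act_S simple_reflection_self act_linear)
  ultimately show ?thesis by simp
qed

section \<open>Roots and their signs\<close>

definition neg :: "('a \<Rightarrow> real) \<Rightarrow> ('a \<Rightarrow> real)" where "neg v = (\<lambda>t. - v t)"

lemma neg_apply [simp]: "neg v t = - v t"
  by (simp add: neg_def)

lemma neg_lin: "neg v = lin (-1) v 0 v"
  by (auto simp: neg_def)

lemma neg_neg [simp]: "neg (neg v) = v"
  by auto

lemma neg_V [simp]: "v \<in> V \<Longrightarrow> neg v \<in> V"
  by (simp add: neg_lin)

lemma act_neg: "w \<in> carrier W \<Longrightarrow> v \<in> V \<Longrightarrow> act w (neg v) = neg (act w v)"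
  by (simp add: neg_lin act_linear)

lemma form_neg_left: "u \<in> V \<Longrightarrow> v \<in> V \<Longrightarrow> form (neg v) u = - form v u"
  by (simp add: neg_lin form_lin_left)

lemma form_neg_right: "u \<in> V \<Longrightarrow> v \<in> V \<Longrightarrow> form u (neg v) = - form u v"
  by (simp add: neg_lin form_lin_right)

lemma rootI: "w \<in> carrier W \<Longrightarrow> s \<in> S \<Longrightarrow> act w (simple_root s) \<in> roots"
  unfolding roots_def by blast

lemma rootE: assumes "\<gamma> \<in> roots" obtains w s where "w \<in> carrier W" "s \<in> S" "\<gamma> = act w (simple_root s)"
  using assms unfolding roots_def by blast

lemma root_V [simp]: "\<gamma> \<in> roots \<Longrightarrow> \<gamma> \<in> V"
  by (erule rootE) simp

lemma root_norm: "\<gamma> \<in> roots \<Longrightarrow> form \<gamma> \<gamma> = 1"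
  by (erule rootE) (simp add: act_form form_simple form_coeff_self)

lemma root_act [simp]: "\<gamma> \<in> roots \<Longrightarrow> w \<in> carrier W \<Longrightarrow> act w \<gamma> \<in> roots"
  by (erule rootE) (simp add: act_mult[symmetric] rootI)

lemma simple_root_root [simp]: "s \<in> S \<Longrightarrow> simple_root s \<in> roots"
  using rootI[OF one_closed, of s] by simp

lemma root_neg [simp]: assumes "\<gamma> \<in> roots" shows "neg \<gamma> \<in> roots"
proof -
  obtain w s where w: "w \<in> carrier W" "s \<in> S" "\<gamma> = act w (simple_root s)" using rootE[OF assms] .
  have "neg \<gamma> = act (w \<otimes> s) (simple_root s)"
    using w by (simp add: act_mult act_S simple_reflection_self neg_lin[symmetric] act_neg)
  then show ?thesis using w rootI[of "w \<otimes> s" s] by simp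
qed

lemma root_sign: assumes "\<gamma> \<in> roots" shows "(\<forall>r. \<gamma> r \<ge> 0) \<or> (\<forall>r. \<gamma> r \<le> 0)"
proof -
  obtain w s where w: "w \<in> carrier W" "s \<in> S" "\<gamma> = act w (simple_root s)" using rootE[OF assms] .
  then show ?thesis using len_nonneg[OF w(1,2)] len_nonpos[OF w(1,2)] by (meson nle_le)
qed

lemma root_nonzero: assumes "\<gamma> \<in> roots" obtains r where "\<gamma> r \<noteq> 0" "r \<in> S"
proof -
  have "\<exists>r. \<gamma> r \<noteq> 0"
  proof (rule ccontr)
    assume "\<nexists>r. \<gamma> r \<noteq> 0"
    then have "form \<gamma> \<gamma> = 0" by (simp add: form_def)
    then show False using root_norm[OF assms] by simp
  qed
  then show ?thesis using that V_supp(2)[OF root_V[OF assms]] by blast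
qed

lemma pos_root [simp]: "\<gamma> \<in> positive_roots \<Longrightarrow> \<gamma> \<in> roots"
  unfolding positive_roots_def by blast

lemma pos_nonneg: "\<gamma> \<in> positive_roots \<Longrightarrow> \<gamma> r \<ge> 0"
  unfolding positive_roots_def by blast

lemma pos_if_coord: assumes "\<gamma> \<in> roots" "\<gamma> r > 0" shows "\<gamma> \<in> positive_roots"
proof -
  have "\<not> (\<forall>r. \<gamma> r \<le> 0)" using assms(2) by (meson linorder_not_le)
  then show ?thesis using root_sign[OF assms(1)] assms(1) unfolding positive_roots_def by blast
qed

lemma nonpos_if_coord: assumes "\<gamma> r < 0" shows "\<gamma> \<notin> positive_roots"
proof
  assume "\<gamma> \<in> positive_roots"
  from pos_nonneg[OF this, of r] assms show False by simp
qed

lemma neg_pos_iff: assumes "\<gamma> \<in> roots" shows "neg \<gamma> \<in> positive_roots \<longleftrightarrow> \<gamma> \<notin> positive_roots"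
proof -
  obtain r where r: "\<gamma> r \<noteq> 0" using root_nonzero[OF assms] .
  show ?thesis
  proof (cases "\<gamma> r > 0")
    case True
    then show ?thesis using pos_if_coord[OF assms True] nonpos_if_coord[of "neg \<gamma>" r] by simp
  next
    case False
    then have "\<gamma> r < 0" using r by simp
    then show ?thesis using pos_if_coord[OF root_neg[OF assms], of r] nonpos_if_coord[of \<gamma> r] by simp
  qed
qed

lemma notpos_coord: "\<gamma> \<in> roots \<Longrightarrow> \<gamma> \<notin> positive_roots \<Longrightarrow> \<gamma> r \<le> 0"
  using pos_if_coord[of \<gamma> r] by (meson linorder_not_le)

lemma pos_coord_pos: assumes "\<gamma> \<in> positive_roots" obtains r where "\<gamma> r > 0" "r \<in> S"
proof -
  obtain r where "\<gamma> r \<noteq> 0" "r \<in> S" using root_nonzero[OF pos_root[OF assms(1)]] .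
  then show ?thesis using pos_nonneg[OF assms, of r] that by force
qed

lemma simple_root_pos [simp]: "s \<in> S \<Longrightarrow> simple_root s \<in> positive_roots"
  unfolding positive_roots_def using simple_root_nonneg simple_root_root by blast

lemma root_multiple_simple:
  assumes "\<gamma> \<in> positive_roots" "s \<in> S" "\<And>r. r \<noteq> s \<Longrightarrow> \<gamma> r = 0" shows "\<gamma> = simple_root s"
proof -
  have e: "\<gamma> = lin (\<gamma> s) (simple_root s) 0 (simple_root s)"
    using assms(3) by (auto simp: lin_def simple_root_def)
  have "form \<gamma> \<gamma> = \<gamma> s * \<gamma> s"
    by (subst (1 2) e) (use assms(2) in \<open>simp add: form_lin_left form_lin_right form_simple form_coeff_self\<close>)
  then have "\<gamma> s * \<gamma> s = 1" using root_norm assms(1) by simp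
  then have "\<gamma> s = 1" using pos_nonneg[OF assms(1), of s] by (simp add: square_eq_1_iff)
  then show ?thesis using e by (auto simp: lin_def)
qed

lemma simple_reflection_other_coord: "r \<noteq> s \<Longrightarrow> simple_reflection s v r = v r"
  by (simp add: simple_reflection_def simple_root_other)

text \<open>The reflection \<open>s\<close> changes only the coordinate at \<open>s\<close>, so a
  positive coordinate elsewhere survives and fixes the sign of the root.\<close>

lemma simple_permutes:
  assumes "s \<in> S" "\<gamma> \<in> positive_roots" "\<gamma> \<noteq> simple_root s" shows "act s \<gamma> \<in> positive_roots"
proof -
  obtain r where r: "r \<noteq> s" "\<gamma> r \<noteq> 0" using root_multiple_simple[OF assms(2,1)] assms(3) by blast
  have "act s \<gamma> r = \<gamma> r" using r assms by (simp add: act_S simple_reflection_other_coord)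
  then have "act s \<gamma> r > 0" using r pos_nonneg[OF assms(2), of r] by simp
  then show ?thesis using assms by (intro pos_if_coord[of _ r]) auto
qed

section \<open>Inversion sets\<close>

text \<open>The cardinality of this set is the length of \<open>w\<close>. The set carries more than
  the number: it determines \<open>w\<close> (\<open>inversions_eq_imp\<close>), and inclusion
  expresses that a right factor splits off with lengths adding up
  (\<open>card_inversions_quot\<close>).\<close>

definition inversions :: "'a \<Rightarrow> ('a \<Rightarrow> real) set" where
  "inversions w = {\<gamma> \<in> positive_roots. act w \<gamma> \<notin> positive_roots}"

lemma inversionsI: "\<gamma> \<in> positive_roots \<Longrightarrow> act w \<gamma> \<notin> positive_roots \<Longrightarrow> \<gamma> \<in> inversions w"
  by (simp add: inversions_def)

lemma inversionsD: "\<gamma> \<in> inversions w \<Longrightarrow> \<gamma> \<in> positive_roots" "\<gamma> \<in> inversions w \<Longrightarrow> act w \<gamma> \<notin> positive_roots"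
  by (simp_all add: inversions_def)

text \<open>Each further letter on the left adds at most one inversion, the root that the rest of
  the word carries to the simple root of this letter.\<close>

lemma finite_inversions: assumes "w \<in> carrier W" shows "finite (inversions w)"
proof -
  have "finite (inversions (word_elt u))" if "u \<in> lists S" for u
    using that
  proof (induction u rule: list.induct)
    case Nil
    have "inversions \<one> = {}" by (auto simp: inversions_def)
    then show ?case by simp
  next
    case (Cons s u)
    then have s: "s \<in> S" and u: "u \<in> lists S" by auto
    have "inversions (word_elt (s # u)) \<subseteq> insert (act (inv (word_elt u)) (simple_root s)) (inversions (word_elt u))"
    proof
      fix \<gamma> assume g: "\<gamma> \<in> inversions (word_elt (s # u))"
      have gV: "\<gamma> \<in> V" "\<gamma> \<in> roots" using inversionsD(1)[OF g] by auto
      have a: "act (word_elt (s # u)) \<gamma> = act s (act (word_elt u) \<gamma>)" using s u gV by (simp add: act_mult)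
      show "\<gamma> \<in> insert (act (inv (word_elt u)) (simple_root s)) (inversions (word_elt u))"
      proof (cases "act (word_elt u) \<gamma> \<in> positive_roots")
        case True
        then have "act (word_elt u) \<gamma> = simple_root s"
          using simple_permutes[OF s True] inversionsD(2)[OF g] a by auto
        then have "\<gamma> = act (inv (word_elt u)) (simple_root s)" using u gV act_inv(1)[of "word_elt u" \<gamma>] by simp
        then show ?thesis by simp
      next
        case False
        then show ?thesis using inversionsD(1)[OF g] inversionsI by simp
      qed
    qed
    then show ?case using Cons.IH[OF u] finite_subset by blast
  qed
  then show ?thesis using word_exists[OF assms] by blast
qed

lemma descent_exists:
  assumes "w \<in> carrier W" "w \<noteq> \<one>"
  obtains s where "s \<in> S" "simple_root s \<in> inversions w" "len w = Suc (len (w \<otimes> s))"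
proof -
  obtain u where u: "u \<in> lists S" "length u = len w" "word_elt u = w" using len_word[OF assms(1)] .
  show ?thesis
  proof (cases u rule: rev_cases)
    case Nil
    then show ?thesis using u assms(2) by simp
  next
    case (snoc u' s)
    then have s: "s \<in> S" and u': "u' \<in> lists S" using u by auto
    have w: "w = word_elt u' \<otimes> s" using u(3) snoc s u' by (simp add: word_elt_append)
    then have ws: "w \<otimes> s = word_elt u'" using mult_S_S[of "word_elt u'" s] u' s by simp
    have l: "len (w \<otimes> s) \<le> length u'" unfolding ws by (rule len_le[OF u'])
    have lw: "len w = Suc (length u')" using u(2) snoc by simp
    have "len w \<le> Suc (len (w \<otimes> s))"
      using len_mult_S[of "w \<otimes> s" s] assms(1) s mult_S_S[OF assms(1) s] by simp
    then have e: "len w = Suc (len (w \<otimes> s))" using l lw by simp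
    have "act w (simple_root s) \<notin> positive_roots"
    proof
      assume p: "act w (simple_root s) \<in> positive_roots"
      obtain r where "act w (simple_root s) r > 0" using pos_coord_pos[OF p] .
      moreover have "act w (simple_root s) r \<le> 0" by (rule len_nonpos[OF assms(1) s]) (use e in simp)
      ultimately show False by simp
    qed
    then show ?thesis using that[OF s inversionsI e] s by simp
  qed
qed

lemma inversions_empty: "w \<in> carrier W \<Longrightarrow> inversions w = {} \<Longrightarrow> w = \<one>"
  using descent_exists[of w] by (metis empty_iff)

lemma inversions_one [simp]: "inversions \<one> = {}"
  by (auto simp: inversions_def)

lemma act_faithful:
  assumes "g \<in> carrier W" "h \<in> carrier W" "\<And>s. s \<in> S \<Longrightarrow> act g (simple_root s) = act h (simple_root s)"
  shows "g = h"
proof -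
  have c: "inv h \<otimes> g \<in> carrier W" using assms by simp
  have "inv h \<otimes> g = \<one>"
  proof (rule ccontr)
    assume "inv h \<otimes> g \<noteq> \<one>"
    then obtain s where s: "s \<in> S" "simple_root s \<in> inversions (inv h \<otimes> g)" using descent_exists[OF c] by blast
    have "act (inv h \<otimes> g) (simple_root s) = simple_root s" using assms s(1) by (simp add: act_mult)
    then show False using inversionsD(2)[OF s(2)] s(1) by simp
  qed
  then show ?thesis using assms by (metis inv_comm inv_equality inv_inv inv_closed)
qed

text \<open>A root inverted by \<open>w \<otimes> inv d\<close> is pulled back along
  \<open>d\<close>. If the pullback were negative, its opposite would be inverted by
  \<open>d\<close>, hence by \<open>w\<close>, and the two signs would cancel.\<close>

lemma inversions_quot:
  assumes "w \<in> carrier W" "d \<in> carrier W" "inversions d \<subseteq> inversions w"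
  shows "inversions (w \<otimes> inv d) = act d ` (inversions w - inversions d)"
proof (intro equalityI subsetI)
  fix \<gamma> assume g: "\<gamma> \<in> inversions (w \<otimes> inv d)"
  have gr: "\<gamma> \<in> roots" "\<gamma> \<in> positive_roots" using inversionsD(1)[OF g] by auto
  let ?b = "act (inv d) \<gamma>"
  have br: "?b \<in> roots" using gr assms by simp
  have wb: "act w ?b \<notin> positive_roots" using inversionsD(2)[OF g] gr assms by (simp add: act_mult)
  have db: "act d ?b = \<gamma>" using gr assms by simp
  have bp: "?b \<in> positive_roots"
  proof (rule ccontr)
    assume n: "?b \<notin> positive_roots"
    then have nb: "neg ?b \<in> positive_roots" using neg_pos_iff br by simp
    have "act d (neg ?b) = neg \<gamma>" using act_neg[OF assms(2), of ?b] br db by simp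
    then have "neg ?b \<in> inversions d" using nb gr neg_pos_iff[OF gr(1)] by (intro inversionsI) auto
    then have "act w (neg ?b) \<notin> positive_roots" using assms(3) inversionsD(2) by blast
    then have "neg (act w ?b) \<notin> positive_roots" using act_neg[OF assms(1), of ?b] br by simp
    then show False using wb neg_pos_iff[of "act w ?b"] br assms(1) by simp
  qed
  have "?b \<in> inversions w - inversions d" using bp wb db gr(2) by (auto simp: inversions_def)
  then show "\<gamma> \<in> act d ` (inversions w - inversions d)" using db by (metis imageI)
next
  fix \<gamma> assume "\<gamma> \<in> act d ` (inversions w - inversions d)"
  then obtain b where b: "b \<in> inversions w" "b \<notin> inversions d" "\<gamma> = act d b" by blast
  have br: "b \<in> roots" "b \<in> positive_roots" using inversionsD(1)[OF b(1)] by auto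
  have "\<gamma> \<in> positive_roots" using b br by (auto simp: inversions_def)
  moreover have "act (w \<otimes> inv d) \<gamma> = act w b" using b br assms by (simp add: act_mult)
  ultimately show "\<gamma> \<in> inversions (w \<otimes> inv d)" using inversionsD(2)[OF b(1)] by (simp add: inversions_def)
qed

lemma act_inj: "w \<in> carrier W \<Longrightarrow> u \<in> V \<Longrightarrow> v \<in> V \<Longrightarrow> act w u = act w v \<Longrightarrow> u = v"
  by (metis act_inv(1))

lemma card_inversions_quot:
  assumes "w \<in> carrier W" "d \<in> carrier W" "inversions d \<subseteq> inversions w"
  shows "card (inversions (w \<otimes> inv d)) + card (inversions d) = card (inversions w)"
proof -
  have "inj_on (act d) (inversions w - inversions d)"
    by (rule inj_onI) (use act_inj[OF assms(2)] inversionsD(1) in \<open>meson DiffD1 pos_root root_V\<close>)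
  then have "card (inversions (w \<otimes> inv d)) = card (inversions w - inversions d)" unfolding inversions_quot[OF assms] by (rule card_image)
  then show ?thesis
    using card_Diff_subset[OF finite_inversions[OF assms(2)] assms(3)] card_mono[OF finite_inversions[OF assms(1)] assms(3)] by simp
qed

lemma inversions_eq_imp: assumes "w \<in> carrier W" "d \<in> carrier W" "inversions d = inversions w" shows "w = d"
proof -
  have "inversions (w \<otimes> inv d) = {}" using inversions_quot[OF assms(1,2)] assms(3) by simp
  then have "w \<otimes> inv d = \<one>" using inversions_empty assms by simp
  then show ?thesis using assms by (metis inv_closed inv_equality inv_inv)
qed

lemma inversions_S: assumes "s \<in> S" shows "inversions s = {simple_root s}"
proof (intro equalityI subsetI)
  fix \<gamma> assume "\<gamma> \<in> inversions s"
  then show "\<gamma> \<in> {simple_root s}" using simple_permutes[OF assms, of \<gamma>] inversionsD by blast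
next
  fix \<gamma> assume "\<gamma> \<in> {simple_root s}"
  then show "\<gamma> \<in> inversions s" using assms neg_pos_iff[of "simple_root s"]
    by (auto intro!: inversionsI simp: act_S simple_reflection_self neg_lin[symmetric])
qed

lemma card_inversions_inv: assumes "w \<in> carrier W" shows "card (inversions (inv w)) = card (inversions w)"
proof (rule bij_betw_same_card[symmetric, of "\<lambda>\<gamma>. neg (act w \<gamma>)"], rule bij_betwI[of _ _ _ "\<lambda>\<gamma>. neg (act (inv w) \<gamma>)"])
  show "(\<lambda>\<gamma>. neg (act w \<gamma>)) \<in> inversions w \<rightarrow> inversions (inv w)"
  proof
    fix \<gamma> assume g: "\<gamma> \<in> inversions w"
    have r: "\<gamma> \<in> roots" "act w \<gamma> \<in> roots" using inversionsD(1)[OF g] assms by auto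
    show "neg (act w \<gamma>) \<in> inversions (inv w)"
      using inversionsD[OF g] r assms neg_pos_iff[OF r(2)] neg_pos_iff[OF r(1)]
      by (intro inversionsI) (simp_all add: act_neg)
  qed
  show "(\<lambda>\<gamma>. neg (act (inv w) \<gamma>)) \<in> inversions (inv w) \<rightarrow> inversions w"
  proof
    fix \<gamma> assume g: "\<gamma> \<in> inversions (inv w)"
    have r: "\<gamma> \<in> roots" "act (inv w) \<gamma> \<in> roots" using inversionsD(1)[OF g] assms by auto
    show "neg (act (inv w) \<gamma>) \<in> inversions w"
      using inversionsD[OF g] r assms neg_pos_iff[OF r(2)] neg_pos_iff[OF r(1)]
      by (intro inversionsI) (simp_all add: act_neg)
  qed
  show "neg (act (inv w) (neg (act w \<gamma>))) = \<gamma>" if "\<gamma> \<in> inversions w" for \<gamma>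
    using inversionsD(1)[OF that] assms by (simp add: act_neg)
  show "neg (act w (neg (act (inv w) \<gamma>))) = \<gamma>" if "\<gamma> \<in> inversions (inv w)" for \<gamma>
    using inversionsD(1)[OF that] assms by (simp add: act_neg)
qed

section \<open>Reflections in roots\<close>

text \<open>The conjugate acts by a formula that involves only the root, and the action is faithful;
  this makes the definite description in \<open>reflection\<close> meaningful.\<close>

lemma reflection_unique:
  assumes "w \<in> carrier W" "s \<in> S" "\<gamma> = act w (simple_root s)"
  shows "reflection \<gamma> = w \<otimes> s \<otimes> inv w"
    and "v \<in> V \<Longrightarrow> act (w \<otimes> s \<otimes> inv w) v = lin 1 v (- 2 * form \<gamma> v) \<gamma>"
proof -
  have a: "act (g \<otimes> r \<otimes> inv g) v = lin 1 v (- 2 * form (act g (simple_root r)) v) (act g (simple_root r))"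
    if "g \<in> carrier W" "r \<in> S" "v \<in> V" for g r v
  proof -
    have "act (g \<otimes> r \<otimes> inv g) v = act g (simple_reflection r (act (inv g) v))"
      using that by (simp add: act_mult act_S)
    also have "\<dots> = lin 1 v (- 2 * form (simple_root r) (act (inv g) v)) (act g (simple_root r))"
      unfolding simple_reflection_lin using that by (simp add: act_linear)
    also have "form (simple_root r) (act (inv g) v) = form (act g (simple_root r)) v"
      using act_form[OF that(1), of "simple_root r" "act (inv g) v"] that by simp
    finally show ?thesis .
  qed
  from a[OF assms(1,2)] show "v \<in> V \<Longrightarrow> act (w \<otimes> s \<otimes> inv w) v = lin 1 v (- 2 * form \<gamma> v) \<gamma>"
    using assms(3) by simp
  show "reflection \<gamma> = w \<otimes> s \<otimes> inv w" unfolding reflection_def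
  proof (rule the_equality)
    show "\<exists>g\<in>carrier W. \<exists>r\<in>S. \<gamma> = act g (simple_root r) \<and> w \<otimes> s \<otimes> inv w = g \<otimes> r \<otimes> inv g"
      using assms by blast
    fix x assume "\<exists>g\<in>carrier W. \<exists>r\<in>S. \<gamma> = act g (simple_root r) \<and> x = g \<otimes> r \<otimes> inv g"
    then obtain g r where g: "g \<in> carrier W" "r \<in> S" "\<gamma> = act g (simple_root r)" "x = g \<otimes> r \<otimes> inv g" by blast
    show "x = w \<otimes> s \<otimes> inv w"
    proof (rule act_faithful)
      show "act x (simple_root t) = act (w \<otimes> s \<otimes> inv w) (simple_root t)" if "t \<in> S" for t
        unfolding g(4) using that by (simp add: a[OF g(1,2)] a[OF assms(1,2)] g(3)[symmetric] assms(3)[symmetric])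
    qed (use g assms in simp_all)
  qed
qed

lemma reflection_closed [simp]: "\<gamma> \<in> roots \<Longrightarrow> reflection \<gamma> \<in> carrier W"
  by (erule rootE) (simp add: reflection_unique)

lemma act_reflection: assumes "\<gamma> \<in> roots" "v \<in> V" shows "act (reflection \<gamma>) v = lin 1 v (- 2 * form \<gamma> v) \<gamma>"
proof -
  obtain w s where "w \<in> carrier W" "s \<in> S" "\<gamma> = act w (simple_root s)" using rootE[OF assms(1)] .
  from reflection_unique[OF this] show ?thesis using assms(2) by simp
qed

lemma reflection_square [simp]: assumes "\<gamma> \<in> roots" shows "reflection \<gamma> \<otimes> reflection \<gamma> = \<one>"
proof -
  obtain w s where w: "w \<in> carrier W" "s \<in> S" "\<gamma> = act w (simple_root s)" using rootE[OF assms(1)] .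
  have "(w \<otimes> s \<otimes> inv w) \<otimes> (w \<otimes> s \<otimes> inv w) = \<one>"
    using w(1,2) by (simp add: m_assoc inv_cancel involution_cancel S_square)
  then show ?thesis using reflection_unique(1)[OF w] by simp
qed

lemma reflection_inv: "\<gamma> \<in> roots \<Longrightarrow> inv (reflection \<gamma>) = reflection \<gamma>"
  by (rule inv_equality) simp_all

lemma act_reflection_self: "\<gamma> \<in> roots \<Longrightarrow> act (reflection \<gamma>) \<gamma> = neg \<gamma>"
  by (rule ext) (simp add: act_reflection root_norm)

lemma reflection_fixes: "\<gamma> \<in> roots \<Longrightarrow> v \<in> V \<Longrightarrow> form \<gamma> v = 0 \<Longrightarrow> act (reflection \<gamma>) v = v"
  by (rule ext) (simp add: act_reflection)

lemma reflection_simple: assumes "s \<in> S" shows "reflection (simple_root s) = s"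
  using reflection_unique(1)[of \<one> s "simple_root s"] assms by simp

lemma reflection_act:
  assumes "\<gamma> \<in> roots" "g \<in> carrier W" shows "reflection (act g \<gamma>) = g \<otimes> reflection \<gamma> \<otimes> inv g"
proof -
  obtain w s where w: "w \<in> carrier W" "s \<in> S" "\<gamma> = act w (simple_root s)" using rootE[OF assms(1)] .
  have "act g \<gamma> = act (g \<otimes> w) (simple_root s)" using w assms by (simp add: act_mult)
  then have "reflection (act g \<gamma>) = (g \<otimes> w) \<otimes> s \<otimes> inv (g \<otimes> w)"
    by (intro reflection_unique(1)) (use w assms in simp_all)
  then show ?thesis using w assms reflection_unique(1)[OF w] by (simp add: inv_mult_group m_assoc)
qed

lemma reflection_eqI:
  assumes "g \<in> carrier W" "\<gamma> \<in> roots"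
    "\<And>s. s \<in> S \<Longrightarrow> act g (simple_root s) = lin 1 (simple_root s) (- 2 * form \<gamma> (simple_root s)) \<gamma>"
  shows "g = reflection \<gamma>"
  by (rule act_faithful) (use assms in \<open>simp_all add: act_reflection\<close>)

lemma reflection_neg: assumes "\<gamma> \<in> roots" shows "reflection (neg \<gamma>) = reflection \<gamma>"
  by (rule reflection_eqI[OF reflection_closed])
    (use assms in \<open>auto simp: act_reflection lin_def form_neg_left\<close>)

lemma reflection_inj:
  assumes "\<gamma> \<in> positive_roots" "\<beta> \<in> positive_roots" "reflection \<gamma> = reflection \<beta>" shows "\<gamma> = \<beta>"
proof -
  have e: "neg \<gamma> = lin 1 \<gamma> (- 2 * form \<beta> \<gamma>) \<beta>"
    using act_reflection_self[of \<gamma>] act_reflection[of \<beta> \<gamma>] assms by simp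
  define c where "c = form \<beta> \<gamma>"
  have g: "\<gamma> r = c * \<beta> r" for r using fun_cong[OF e, of r] by (simp add: c_def)
  then have gl: "\<gamma> = lin c \<beta> 0 \<beta>" by auto
  have "1 = form \<gamma> \<gamma>" using root_norm assms by simp
  also have "\<dots> = c * c" by (subst (1 2) gl) (use assms in \<open>simp add: form_lin_left form_lin_right root_norm\<close>)
  finally have "c = 1 \<or> c = -1" by (metis square_eq_1_iff)
  moreover have "c \<noteq> -1"
  proof
    assume "c = -1"
    then have "\<gamma> = neg \<beta>" using g by auto
    then show False using neg_pos_iff[of \<beta>] assms by simp
  qed
  ultimately show ?thesis using g by auto
qed

lemma reflection_ne_one: assumes "\<gamma> \<in> roots" shows "reflection \<gamma> \<noteq> \<one>"
proof
  assume "reflection \<gamma> = \<one>"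
  then have "neg \<gamma> = \<gamma>" using act_reflection_self[OF assms] assms by simp
  then show False using neg_pos_iff[OF assms] by simp
qed

end

section \<open>Standard parabolic subgroups and longest elements\<close>

context coxeter_system
begin

text \<open>The root system of the parabolic subgroup of \<open>J\<close>, encoded by a support
  condition that can be tested on coordinates; \<open>reflection_generate\<close> provides the link
  to the subgroup.\<close>

definition Phi :: "'a set \<Rightarrow> ('a \<Rightarrow> real) set" where
  "Phi J = {\<gamma> \<in> roots. \<forall>s. s \<notin> J \<longrightarrow> \<gamma> s = 0}"

lemma PhiD: "\<gamma> \<in> Phi J \<Longrightarrow> \<gamma> \<in> roots" "\<gamma> \<in> Phi J \<Longrightarrow> s \<notin> J \<Longrightarrow> \<gamma> s = 0"
  unfolding Phi_def by auto

lemma PhiI: "\<gamma> \<in> roots \<Longrightarrow> (\<And>s. s \<notin> J \<Longrightarrow> \<gamma> s = 0) \<Longrightarrow> \<gamma> \<in> Phi J"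
  unfolding Phi_def by auto

lemma Phi_mono: "\<gamma> \<in> Phi J \<Longrightarrow> J \<subseteq> K \<Longrightarrow> \<gamma> \<in> Phi K"
  unfolding Phi_def by auto

lemma simple_root_Phi: "s \<in> S \<Longrightarrow> s \<in> J \<Longrightarrow> simple_root s \<in> Phi J"
  by (rule PhiI) (auto intro: simple_root_other)

lemma posI: "\<gamma> \<in> roots \<Longrightarrow> (\<And>r. \<gamma> r \<ge> 0) \<Longrightarrow> \<gamma> \<in> positive_roots"
  unfolding positive_roots_def by auto

lemma root_supp: assumes "\<gamma> \<in> roots" "\<gamma> r \<noteq> 0" shows "r \<in> S"
  using V_supp(2)[OF root_V[OF assms(1)]] assms(2) by auto

lemma generate_carrier: "J \<subseteq> S \<Longrightarrow> g \<in> generate W J \<Longrightarrow> g \<in> carrier W"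
  using generate_in_carrier[of J g] S_carrier by blast

lemma generate_inv: "J \<subseteq> S \<Longrightarrow> g \<in> generate W J \<Longrightarrow> inv g \<in> generate W J"
  using generate_m_inv_closed[of J g] S_carrier by blast

lemma generate_act_coord:
  assumes "J \<subseteq> S" "g \<in> generate W J" "v \<in> V" "r \<notin> J" shows "act g v r = v r"
  using assms(2,3)
proof (induction arbitrary: v rule: generate.induct)
  case (incl h)
  then have "h \<in> S" "r \<noteq> h" using assms(1,4) by blast+
  then show ?case using incl by (simp add: act_S simple_reflection_other_coord)
next
  case (inv h)
  then have "h \<in> S" "r \<noteq> h" using assms(1,4) by blast+
  then show ?case using inv by (simp add: S_inv act_S simple_reflection_other_coord)
next
  case (eng h1 h2)
  then show ?case using generate_carrier[OF assms(1)] by (simp add: act_mult)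
qed simp

lemma generate_act_Phi:
  assumes "J \<subseteq> S" "g \<in> generate W J" "\<gamma> \<in> Phi J" shows "act g \<gamma> \<in> Phi J"
proof (rule PhiI)
  have r: "\<gamma> \<in> roots" using PhiD assms by blast
  show "act g \<gamma> \<in> roots" using r generate_carrier[OF assms(1,2)] by simp
  show "act g \<gamma> s = 0" if "s \<notin> J" for s
    using generate_act_coord[OF assms(1,2) root_V[OF r] that] PhiD(2)[OF assms(3) that] by simp
qed

lemma notin_Phi_coord:
  assumes "\<gamma> \<in> positive_roots" "\<gamma> \<notin> Phi J" obtains r where "r \<notin> J" "\<gamma> r > 0"
proof -
  obtain r where r: "r \<notin> J" "\<gamma> r \<noteq> 0" using assms PhiI[of \<gamma> J] by auto
  then have "\<gamma> r > 0" using pos_nonneg[OF assms(1), of r] by simp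
  then show ?thesis using that r by blast
qed

text \<open>Elements of the parabolic subgroup leave coordinates outside \<open>J\<close> unchanged,
  so a positive coordinate there keeps the root positive.\<close>

lemma inversions_generate: assumes "J \<subseteq> S" "g \<in> generate W J" shows "inversions g \<subseteq> Phi J"
proof
  fix \<gamma> assume g: "\<gamma> \<in> inversions g"
  show "\<gamma> \<in> Phi J"
  proof (rule ccontr)
    assume "\<gamma> \<notin> Phi J"
    then obtain r where r: "r \<notin> J" "\<gamma> r > 0" using notin_Phi_coord inversionsD(1)[OF g] by blast
    have rt: "\<gamma> \<in> roots" using inversionsD(1)[OF g] by simp
    have "act g \<gamma> r > 0" using generate_act_coord[OF assms root_V[OF rt] r(1)] r(2) by simp
    then have "act g \<gamma> \<in> positive_roots"
      by (rule pos_if_coord[rotated]) (use rt generate_carrier[OF assms] in simp)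
    then show False using inversionsD(2)[OF g] by simp
  qed
qed

section \<open>Descent on positive roots\<close>

text \<open>Multiplication by \<open>s\<close> on each side removes one inversion. The last
  hypothesis ensures that the first multiplication does not already destroy the descent on the other
  side.\<close>

lemma card_inversions_conj:
  assumes "s \<in> S" "d \<in> carrier W" "simple_root s \<in> inversions d" "simple_root s \<in> inversions (inv d)"
    "act d (simple_root s) \<noteq> neg (simple_root s)"
  shows "card (inversions (s \<otimes> d \<otimes> s)) < card (inversions d)"
proof -
  have 1: "card (inversions (d \<otimes> s)) + 1 = card (inversions d)"
    using card_inversions_quot[of d s] assms inversions_S S_inv by simp
  have si: "inv (d \<otimes> s) = s \<otimes> inv d" using assms by (simp add: inv_mult_group S_inv)
  have r: "act (inv d) (simple_root s) \<in> roots" using assms by simp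
  have "simple_root s \<in> inversions (s \<otimes> inv d)"
  proof (rule inversionsI)
    let ?b = "act (inv d) (simple_root s)"
    have nb: "neg ?b \<in> positive_roots" using neg_pos_iff[OF r] inversionsD(2)[OF assms(4)] by simp
    have "neg ?b \<noteq> simple_root s"
    proof
      assume "neg ?b = simple_root s"
      then have "act d (neg ?b) = act d (simple_root s)" by simp
      then have "neg (simple_root s) = act d (simple_root s)" using assms(1,2) by (simp add: act_neg)
      then show False using assms(5) by simp
    qed
    then have "act s (neg ?b) \<in> positive_roots" by (rule simple_permutes[OF assms(1) nb])
    then have "neg (act s ?b) \<in> positive_roots" using act_neg[of s ?b] r assms(1) by simp
    then have "act s ?b \<notin> positive_roots" using neg_pos_iff[of "act s ?b"] r assms(1) by simp
    then show "act (s \<otimes> inv d) (simple_root s) \<notin> positive_roots" using assms(1,2) by (simp add: act_mult)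
  qed (use assms in simp)
  then have 2: "card (inversions (s \<otimes> inv d \<otimes> s)) + 1 = card (inversions (s \<otimes> inv d))"
    using card_inversions_quot[of "s \<otimes> inv d" s] assms inversions_S S_inv by simp
  have "inv (s \<otimes> d \<otimes> s) = s \<otimes> inv d \<otimes> s" using assms by (simp add: inv_mult_group S_inv m_assoc)
  then have 3: "card (inversions (s \<otimes> d \<otimes> s)) = card (inversions (s \<otimes> inv d \<otimes> s))"
    using card_inversions_inv[of "s \<otimes> d \<otimes> s"] assms by simp
  have 4: "card (inversions (s \<otimes> inv d)) = card (inversions (d \<otimes> s))"
    using card_inversions_inv[of "d \<otimes> s"] si assms by simp
  show ?thesis using 1 2 3 4 by simp
qed

lemma form_expand_right:
  assumes "u \<in> V" "v \<in> V" shows "form u v = (\<Sum>s\<in>{s. v s \<noteq> 0}. v s * form u (simple_root s))"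
  using linear_functional_expand_V[OF linear_functional_form[OF assms(1)] assms(2)] .

text \<open>A root has norm 1, and this norm is the sum of its coordinates times its products with
  the simple roots; some summand must be positive.\<close>

lemma pos_root_lower:
  assumes "\<gamma> \<in> positive_roots" obtains s where "s \<in> S" "\<gamma> s > 0" "form \<gamma> (simple_root s) > 0"
proof -
  have V: "\<gamma> \<in> V" using assms by simp
  have "\<exists>s. \<gamma> s \<noteq> 0 \<and> \<gamma> s * form \<gamma> (simple_root s) > 0"
  proof (rule ccontr)
    assume "\<not> ?thesis"
    then have "(\<Sum>s\<in>{s. \<gamma> s \<noteq> 0}. \<gamma> s * form \<gamma> (simple_root s)) \<le> 0"
      by (intro sum_nonpos) (auto simp: not_less)
    then show False using form_expand_right[OF V V] root_norm[of \<gamma>] assms by simp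
  qed
  then obtain s where s: "\<gamma> s \<noteq> 0" "\<gamma> s * form \<gamma> (simple_root s) > 0" by blast
  then have "\<gamma> s > 0" using pos_nonneg[OF assms, of s] by simp
  then show ?thesis using that s root_supp[of \<gamma> s] assms by (simp add: zero_less_mult_iff)
qed

text \<open>Induction on the depth of a root. The measure is the number of inversions of its
  reflection, which falls when the reflection is conjugated by the simple reflection of
  \<open>pos_root_lower\<close>.\<close>

lemma pos_root_induct [consumes 3, case_names simple step]:
  assumes "\<gamma> \<in> positive_roots" "\<gamma> \<in> Phi J" "J \<subseteq> S"
    and simple: "\<And>s. s \<in> J \<Longrightarrow> P (simple_root s)"
    and step: "\<And>\<gamma> s. \<gamma> \<in> positive_roots \<Longrightarrow> \<gamma> \<in> Phi J \<Longrightarrow> s \<in> J \<Longrightarrow> form \<gamma> (simple_root s) > 0 \<Longrightarrow>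
      act s \<gamma> \<in> positive_roots \<Longrightarrow> act s \<gamma> \<in> Phi J \<Longrightarrow> P (act s \<gamma>) \<Longrightarrow> P \<gamma>"
  shows "P \<gamma>"
  using assms(1,2)
proof (induction "card (inversions (reflection \<gamma>))" arbitrary: \<gamma> rule: less_induct)
  case less
  note g = less.prems
  have gr: "\<gamma> \<in> roots" "\<gamma> \<in> V" using g(1) by auto
  obtain s where s: "s \<in> S" "\<gamma> s > 0" "form \<gamma> (simple_root s) > 0" using pos_root_lower[OF g(1)] .
  have sJ: "s \<in> J" using PhiD(2)[OF g(2), of s] s(2) by force
  show ?case
  proof (cases "\<gamma> = simple_root s")
    case True
    then show ?thesis using simple[OF sJ] by simp
  next
    case False
    have p: "act s \<gamma> \<in> positive_roots" by (rule simple_permutes[OF s(1) g(1) False])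
    have ph: "act s \<gamma> \<in> Phi J" by (rule generate_act_Phi[OF assms(3) generate.incl[OF sJ] g(2)])
    have cr: "reflection \<gamma> \<in> carrier W" using gr by simp
    \<comment> \<open>A nonzero coordinate away from \<open>s\<close> shows both that the reflection
      inverts the simple root of \<open>s\<close> and that it does not just negate it.\<close>
    obtain r where r: "r \<noteq> s" "\<gamma> r \<noteq> 0" using root_multiple_simple[OF g(1) s(1)] False by blast
    have rp: "\<gamma> r > 0" using r pos_nonneg[OF g(1), of r] by simp
    have e: "act (reflection \<gamma>) (simple_root s) r = - 2 * form \<gamma> (simple_root s) * \<gamma> r"
      using gr s(1) simple_root_other[OF r(1)[symmetric]] by (simp add: act_reflection)
    have neg: "act (reflection \<gamma>) (simple_root s) r < 0"
      unfolding e using s(3) rp by (simp add: mult_pos_pos)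
    have sN: "simple_root s \<in> inversions (reflection \<gamma>)"
      by (rule inversionsI[OF simple_root_pos[OF s(1)]], rule nonpos_if_coord, rule neg)
    have ne: "act (reflection \<gamma>) (simple_root s) \<noteq> neg (simple_root s)"
    proof
      assume "act (reflection \<gamma>) (simple_root s) = neg (simple_root s)"
      then show False using neg simple_root_other[OF r(1)[symmetric]] by simp
    qed
    have "reflection (act s \<gamma>) = s \<otimes> reflection \<gamma> \<otimes> s"
      using reflection_act[OF gr(1), of s] s(1) S_inv by simp
    then have "card (inversions (reflection (act s \<gamma>))) < card (inversions (reflection \<gamma>))"
      using card_inversions_conj[OF s(1) cr sN _ ne] sN reflection_inv[OF gr(1)] by simp
    then have "P (act s \<gamma>)" using less.hyps p ph by blast
    then show ?thesis using step[OF g sJ s(3) p ph] by blast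
  qed
qed

lemma reflection_generate:
  assumes "\<gamma> \<in> positive_roots" "\<gamma> \<in> Phi J" "J \<subseteq> S" shows "reflection \<gamma> \<in> generate W J"
  using assms
proof (induction rule: pos_root_induct)
  case (simple s)
  then show ?case using reflection_simple[of s] assms(3) generate.incl[of s J W] by auto
next
  case (step \<gamma> s)
  have s: "s \<in> S" "s \<in> generate W J" using step(3) assms(3) by (auto intro: generate.incl)
  have gr: "\<gamma> \<in> roots" using step(1) by simp
  have e: "reflection (act s \<gamma>) = s \<otimes> reflection \<gamma> \<otimes> s"
    using reflection_act[OF gr, of s] s(1) S_inv by simp
  have "s \<otimes> (s \<otimes> reflection \<gamma> \<otimes> s) \<otimes> s = reflection \<gamma>"
    using s(1) gr by (simp add: m_assoc involution_cancel S_square)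
  then have "reflection \<gamma> = s \<otimes> reflection (act s \<gamma>) \<otimes> s" using e by simp
  then show ?case using step(7) s(2) by (metis generate.eng)
qed

text \<open>In the induction, a simple reflection from the other part would be orthogonal to the
  lowered root and so have product 0 with it, whereas the induction step offers only reflections
  with nonzero product.\<close>

lemma Phi_orthogonal_split:
  assumes "\<gamma> \<in> positive_roots" "\<gamma> \<in> Phi (L \<union> M)" "L \<union> M \<subseteq> S"
    and orth: "\<And>l k. l \<in> L \<Longrightarrow> k \<in> M \<Longrightarrow> form_coeff l k = 0"
  shows "\<gamma> \<in> Phi L \<or> \<gamma> \<in> Phi M"
  using assms(1-3)
proof (induction rule: pos_root_induct)
  case (simple s)
  then show ?case using assms(3) simple_root_Phi[of s] by blast
next
  case (step \<gamma> s)
  have s: "s \<in> S" using step(3) assms(3) by blast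
  have gr: "\<gamma> \<in> roots" "\<gamma> \<in> V" using step(1) by auto
  have f: "form (act s \<gamma>) (simple_root s) = - form \<gamma> (simple_root s)"
  proof -
    have "form (act s \<gamma>) (act s (simple_root s)) = form \<gamma> (simple_root s)"
      using act_form[of s \<gamma> "simple_root s"] s gr by simp
    moreover have "act s (simple_root s) = neg (simple_root s)"
      using s by (simp add: act_S simple_reflection_self neg_lin)
    ultimately show ?thesis using form_neg_right[of "act s \<gamma>" "simple_root s"] s gr by simp
  qed
  have key: "\<gamma> \<in> Phi A" if A: "act s \<gamma> \<in> Phi A" "A \<subseteq> S" "B \<subseteq> S" "s \<in> A \<or> s \<in> B"
    "\<And>l k. l \<in> A \<Longrightarrow> k \<in> B \<Longrightarrow> form_coeff l k = 0" for A B
  proof (cases "s \<in> A")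
    case True
    have "act s (act s \<gamma>) \<in> Phi A" by (rule generate_act_Phi[OF A(2) generate.incl[OF True] A(1)])
    then show ?thesis using act_inv(1)[of s \<gamma>] s gr S_inv by simp
  next
    case False
    then have sB: "s \<in> B" using A(4) by blast
    have c: "form_coeff k s = 0" if "act s \<gamma> k \<noteq> 0" for k
      using PhiD(2)[OF A(1), of k] that A(5)[OF _ sB] by blast
    have "form (simple_root s) (act s \<gamma>) = (\<Sum>k\<in>{k. act s \<gamma> k \<noteq> 0}. act s \<gamma> k * form (simple_root s) (simple_root k))"
      by (rule form_expand_right) (use s gr in simp_all)
    also have "\<dots> = 0"
    proof (intro sum.neutral ballI)
      fix k assume k: "k \<in> {k. act s \<gamma> k \<noteq> 0}"
      have "k \<in> S" by (rule root_supp[of "act s \<gamma>"]) (use k s gr in simp_all)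
      then show "act s \<gamma> k * form (simple_root s) (simple_root k) = 0"
        using k c[of k] s form_coeff_sym[of k s] by (simp add: form_simple)
    qed
    finally have "form (act s \<gamma>) (simple_root s) = 0" using form_sym[of "act s \<gamma>" "simple_root s"] s gr by simp
    then show ?thesis using f step(4) by simp
  qed
  have orth': "form_coeff l k = 0" if "l \<in> M" "k \<in> L" for l k
  proof -
    have "l \<in> S" "k \<in> S" using that assms(3) by auto
    then show ?thesis using orth[OF that(2,1)] form_coeff_sym[of l k] by simp
  qed
  from step(7) show ?case
  proof
    assume "act s \<gamma> \<in> Phi L"
    then have "\<gamma> \<in> Phi L" by (rule key[where B = M]) (use assms(3) step(3) orth in auto)
    then show ?thesis by simp
  next
    assume "act s \<gamma> \<in> Phi M"
    then have "\<gamma> \<in> Phi M"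
      by (rule key[where B = L]) (use assms(3) step(3) orth' in auto)
    then show ?thesis by simp
  qed
qed

lemma act_pos_combination:
  assumes "\<gamma> \<in> positive_roots" "\<gamma> \<in> Phi K" "w \<in> carrier W"
    "\<And>k r. k \<in> K \<Longrightarrow> k \<in> S \<Longrightarrow> act w (simple_root k) r \<ge> 0"
  shows "act w \<gamma> \<in> positive_roots"
proof (rule posI)
  have gV: "\<gamma> \<in> V" using assms(1) by simp
  show "act w \<gamma> \<in> roots" using assms by simp
  fix r
  have "act w \<gamma> r = (\<Sum>s\<in>{s. \<gamma> s \<noteq> 0}. \<gamma> s * act w (simple_root s) r)"
    by (rule act_expand) (use V_supp[OF gV] assms(3) in auto)
  also have "\<dots> \<ge> 0"
  proof (intro sum_nonneg mult_nonneg_nonneg)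
    fix s assume s: "s \<in> {s. \<gamma> s \<noteq> 0}"
    then have "s \<in> K" "s \<in> S" using PhiD(2)[OF assms(2)] V_supp(2)[OF gV] by auto
    then show "act w (simple_root s) r \<ge> 0" by (rule assms(4))
  qed (rule pos_nonneg[OF assms(1)])
  finally show "act w \<gamma> r \<ge> 0" .
qed

lemma act_simple_notpos_combination:
  assumes "\<gamma> \<in> positive_roots" "\<gamma> \<in> Phi K" "w \<in> carrier W"
    "\<And>k r. k \<in> K \<Longrightarrow> k \<in> S \<Longrightarrow> act w (simple_root k) r \<le> 0"
  shows "act w \<gamma> \<notin> positive_roots"
proof
  assume p: "act w \<gamma> \<in> positive_roots"
  obtain r where r: "act w \<gamma> r > 0" using pos_coord_pos[OF p] .
  have gV: "\<gamma> \<in> V" using assms(1) by simp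
  have "act w \<gamma> r = (\<Sum>s\<in>{s. \<gamma> s \<noteq> 0}. \<gamma> s * act w (simple_root s) r)"
    by (rule act_expand) (use V_supp[OF gV] assms(3) in auto)
  also have "\<dots> \<le> 0"
  proof (intro sum_nonpos mult_nonneg_nonpos)
    fix s assume s: "s \<in> {s. \<gamma> s \<noteq> 0}"
    then have "s \<in> K" "s \<in> S" using PhiD(2)[OF assms(2)] V_supp(2)[OF gV] by auto
    then show "act w (simple_root s) r \<le> 0" by (rule assms(4))
  qed (rule pos_nonneg[OF assms(1)])
  finally show False using r by simp
qed

section \<open>Longest elements of finite parabolic subgroups\<close>

lemma finite_type_mono: "finite_type L \<Longrightarrow> M \<subseteq> L \<Longrightarrow> finite_type M"
  unfolding finite_type_def by (rule finite_subset[OF mono_generate])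

lemma finite_type_finite: "finite_type L \<Longrightarrow> finite L"
  unfolding finite_type_def using generate.incl[of _ L W] finite_subset[of L "generate W L"] by blast

text \<open>A longest element has every element of \<open>L\<close> as a descent, so it negates all
  positive roots supported on \<open>L\<close>. These are then exactly its inversions, and
  inversions determine the element.\<close>

lemma w0_unique_ex:
  assumes "L \<subseteq> S" "finite_type L"
  shows "\<exists>!w. w \<in> generate W L \<and> (\<forall>u \<in> generate W L. len u \<le> len w)"
    and "w \<in> generate W L \<Longrightarrow> \<forall>u \<in> generate W L. len u \<le> len w \<Longrightarrow>
      \<gamma> \<in> positive_roots \<Longrightarrow> \<gamma> \<in> Phi L \<Longrightarrow> act w \<gamma> \<notin> positive_roots"
proof -
  have neg: "act w \<gamma> \<notin> positive_roots"
    if w: "w \<in> generate W L" "\<forall>u \<in> generate W L. len u \<le> len w"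
      and g: "\<gamma> \<in> positive_roots" "\<gamma> \<in> Phi L" for w \<gamma>
  proof -
    have wc: "w \<in> carrier W" by (rule generate_carrier[OF assms(1) w(1)])
    have "act w (simple_root s) r \<le> 0" if s: "s \<in> L" for s r
    proof -
      have sS: "s \<in> S" using s assms(1) by blast
      have "w \<otimes> s \<in> generate W L" by (rule generate.eng[OF w(1) generate.incl[OF s]])
      then have "len (w \<otimes> s) \<le> len w" using w(2) by blast
      then show ?thesis by (rule len_nonpos[OF wc sS])
    qed
    then show ?thesis using act_simple_notpos_combination[OF g wc] by blast
  qed
  then show "w \<in> generate W L \<Longrightarrow> \<forall>u \<in> generate W L. len u \<le> len w \<Longrightarrow>
      \<gamma> \<in> positive_roots \<Longrightarrow> \<gamma> \<in> Phi L \<Longrightarrow> act w \<gamma> \<notin> positive_roots" .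
  have fin: "finite (generate W L)" "generate W L \<noteq> {}"
    using assms(2) generate.one[of W L] unfolding finite_type_def by auto
  have Mx: "Max (len ` generate W L) \<in> len ` generate W L" by (rule Max_in) (use fin in auto)
  then obtain w where w: "w \<in> generate W L" "len w = Max (len ` generate W L)" by auto
  have wmax: "\<forall>u \<in> generate W L. len u \<le> len w" unfolding w(2) using fin by auto
  have "inversions u = Phi L \<inter> positive_roots"
    if u: "u \<in> generate W L" "\<forall>v \<in> generate W L. len v \<le> len u" for u
    using inversions_generate[OF assms(1) u(1)] neg[OF u] by (auto simp: inversions_def)
  then have "u = w" if "u \<in> generate W L" "\<forall>v \<in> generate W L. len v \<le> len u" for u
    using inversions_eq_imp[of u w] that w(1) wmax generate_carrier[OF assms(1)] by blast
  then show "\<exists>!w. w \<in> generate W L \<and> (\<forall>u \<in> generate W L. len u \<le> len w)"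
    using w(1) wmax by blast
qed

lemma w0_generate: assumes "L \<subseteq> S" "finite_type L" shows "w0 L \<in> generate W L"
  using theI'[OF w0_unique_ex(1)[OF assms]] unfolding w0_def by blast

lemma w0_notpos:
  assumes "L \<subseteq> S" "finite_type L" "\<gamma> \<in> positive_roots" "\<gamma> \<in> Phi L" shows "act (w0 L) \<gamma> \<notin> positive_roots"
  using theI'[OF w0_unique_ex(1)[OF assms(1,2)]] w0_unique_ex(2)[OF assms(1,2) _ _ assms(3,4)]
  unfolding w0_def by blast

lemma w0_carrier: "L \<subseteq> S \<Longrightarrow> finite_type L \<Longrightarrow> w0 L \<in> carrier W"
  using generate_carrier w0_generate by blast

lemma w0_neg:
  assumes "L \<subseteq> S" "finite_type L" "\<gamma> \<in> positive_roots" "\<gamma> \<in> Phi L"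
  shows "neg (act (w0 L) \<gamma>) \<in> positive_roots" "neg (act (w0 L) \<gamma>) \<in> Phi L"
proof -
  have p: "act (w0 L) \<gamma> \<in> Phi L" by (rule generate_act_Phi[OF assms(1) w0_generate[OF assms(1,2)] assms(4)])
  show "neg (act (w0 L) \<gamma>) \<in> positive_roots"
    using w0_notpos[OF assms] neg_pos_iff[OF PhiD(1)[OF p]] by simp
  show "neg (act (w0 L) \<gamma>) \<in> Phi L" using p unfolding Phi_def by auto
qed

lemma w0_square: assumes "L \<subseteq> S" "finite_type L" shows "w0 L \<otimes> w0 L = \<one>"
proof (rule inversions_empty)
  have g: "w0 L \<otimes> w0 L \<in> generate W L" by (rule generate.eng) (rule w0_generate[OF assms])+
  show c: "w0 L \<otimes> w0 L \<in> carrier W" by (rule generate_carrier[OF assms(1) g])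
  show "inversions (w0 L \<otimes> w0 L) = {}"
  proof (rule ccontr)
    assume "inversions (w0 L \<otimes> w0 L) \<noteq> {}"
    then obtain \<gamma> where h: "\<gamma> \<in> inversions (w0 L \<otimes> w0 L)" by blast
    then have gp: "\<gamma> \<in> positive_roots" "\<gamma> \<in> Phi L" using inversionsD inversions_generate[OF assms(1) g] by auto
    note n = w0_neg[OF assms gp]
    have "act (w0 L) (neg (act (w0 L) \<gamma>)) \<notin> positive_roots" by (rule w0_notpos[OF assms n])
    then have "neg (act (w0 L \<otimes> w0 L) \<gamma>) \<notin> positive_roots"
      using gp w0_carrier[OF assms] by (simp add: act_neg act_mult)
    then show False using neg_pos_iff[of "act (w0 L \<otimes> w0 L) \<gamma>"] inversionsD(2)[OF h] gp c by simp
  qed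
qed

lemma w0_inv: "L \<subseteq> S \<Longrightarrow> finite_type L \<Longrightarrow> inv (w0 L) = w0 L"
  by (rule inv_equality) (simp_all add: w0_square w0_carrier)

text \<open>Let \<open>?b\<close> be the negative of the image. Its reflection is the conjugate of
  \<open>k\<close> by \<open>w0 L\<close>, and \<open>?b\<close> is the only root that it can
  invert. Every nontrivial element inverts a simple root, so \<open>?b\<close> is simple.\<close>

lemma w0_simple:
  assumes "L \<subseteq> S" "finite_type L" "k \<in> L" shows "\<exists>k'\<in>L. act (w0 L) (simple_root k) = neg (simple_root k')"
proof -
  have kS: "k \<in> S" using assms by blast
  have wc: "w0 L \<in> carrier W" by (rule w0_carrier[OF assms(1,2)])
  let ?b = "neg (act (w0 L) (simple_root k))"
  note b = w0_neg[OF assms(1,2) simple_root_pos[OF kS] simple_root_Phi[OF kS assms(3)]]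
  have br: "?b \<in> roots" using b(1) by simp
  have rb: "reflection ?b = w0 L \<otimes> k \<otimes> w0 L"
    using reflection_neg[of "act (w0 L) (simple_root k)"] reflection_act[of "simple_root k" "w0 L"]
      wc kS w0_inv[OF assms(1,2)] reflection_simple[OF kS] by simp
  have gen: "reflection ?b \<in> generate W L"
    unfolding rb using w0_generate[OF assms(1,2)] generate.incl[OF assms(3)] by (metis generate.eng)
  have "inversions (reflection ?b) \<subseteq> {?b}"
  proof
    fix \<gamma> assume g: "\<gamma> \<in> inversions (reflection ?b)"
    then have gp: "\<gamma> \<in> positive_roots" "\<gamma> \<in> Phi L" using inversionsD inversions_generate[OF assms(1) gen] by auto
    let ?d = "neg (act (w0 L) \<gamma>)"
    note d = w0_neg[OF assms(1,2) gp]
    have gd: "act (w0 L) ?d = neg \<gamma>"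
      using gp wc w0_inv[OF assms(1,2)] act_inv(1)[OF wc, of \<gamma>] by (simp add: act_neg)
    have "?d = simple_root k"
    proof (rule ccontr)
      assume "?d \<noteq> simple_root k"
      then have p: "act k ?d \<in> positive_roots" by (rule simple_permutes[OF kS d(1)])
      have "act k ?d \<in> Phi L" by (rule generate_act_Phi[OF assms(1) generate.incl[OF assms(3)] d(2)])
      then have "neg (act (w0 L) (act k ?d)) \<in> positive_roots" by (rule w0_neg(1)[OF assms(1,2) p])
      moreover have "neg (act (w0 L) (act k ?d)) = act (reflection ?b) \<gamma>"
        unfolding rb using wc kS gp by (simp add: act_mult act_neg)
      ultimately show False using inversionsD(2)[OF g] by simp
    qed
    then have "act (w0 L) (simple_root k) = neg \<gamma>" using gd by simp
    then show "\<gamma> \<in> {?b}" by simp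
  qed
  then have sub: "inversions (reflection ?b) \<subseteq> {?b}" .
  obtain s where s: "s \<in> S" "simple_root s \<in> inversions (reflection ?b)"
    using descent_exists[OF reflection_closed[OF br] reflection_ne_one[OF br]] by blast
  have "?b = simple_root s" by (rule singletonD[symmetric, OF subsetD[OF sub s(2)]])
  then have e: "act (w0 L) (simple_root k) = neg (simple_root s)" by (metis neg_neg)
  have "s \<in> L"
  proof (rule ccontr)
    assume "s \<notin> L"
    then have "?b s = 0" by (rule PhiD(2)[OF b(2)])
    then show False using \<open>?b = simple_root s\<close> by simp
  qed
  then show ?thesis using e by blast
qed

end

section \<open>Elementary moves between parabolic subsets\<close>

context coxeter_system
begin

abbreviation component :: "'a set \<Rightarrow> 'a \<Rightarrow> 'a set" where "component K t \<equiv> components_meeting K {t}"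

text \<open>The group element of an edge, but for an arbitrary set \<open>K\<close> instead of the
  image of a vertex: in rank two it is also needed for the image of a vertex enlarged by one
  generator.\<close>

definition elementary_move :: "'a set \<Rightarrow> 'a \<Rightarrow> 'a" where
  "elementary_move K t = w0 (component K t) \<otimes> w0 (component K t - {t})"

abbreviation step_rel :: "'a set \<Rightarrow> 'a \<Rightarrow> 'a \<Rightarrow> bool" where
  "step_rel A \<equiv> (\<lambda>a b. a \<in> A \<and> b \<in> A \<and> adjacent a b)"

lemma adjacent_sym: "adjacent a b \<Longrightarrow> adjacent b a"
  unfolding adjacent_def using m_sym by auto

lemma component_iff: "x \<in> component K t \<longleftrightarrow> x \<in> K \<union> {t} \<and> (step_rel (K \<union> {t}))\<^sup>*\<^sup>* t x"
  unfolding components_meeting_def by auto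

lemma component_subset: "component K t \<subseteq> K \<union> {t}"
  unfolding components_meeting_def by blast

lemma component_self: "t \<in> component K t"
  by (subst component_iff) simp

lemma component_adjacent:
  assumes "l \<in> component K t" "k \<in> K \<union> {t}" "adjacent l k" shows "k \<in> component K t"
proof -
  have l: "l \<in> K \<union> {t}" "(step_rel (K \<union> {t}))\<^sup>*\<^sup>* t l" using assms(1) component_iff by auto
  then have "(step_rel (K \<union> {t}))\<^sup>*\<^sup>* t k"
    using assms(2,3) by (intro rtranclp.rtrancl_into_rtrancl[OF l(2)]) simp
  then show ?thesis using assms(2) component_iff by simp
qed

lemma form_coeff_nonadjacent:
  assumes "s \<in> S" "t \<in> S" "s \<noteq> t" "\<not> adjacent s t" shows "form_coeff s t = 0"
proof -
  have "m s t = 2" using assms m_ge_2[of s t] unfolding adjacent_def by linarith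
  then show ?thesis by (simp add: form_coeff_def)
qed

lemma form_coeff_adjacent: assumes "adjacent s t" shows "form_coeff s t < 0"
proof (cases "m s t = 0")
  case False
  then have "m s t \<ge> 3" using assms unfolding adjacent_def by simp
  then have "pi / real (m s t) \<le> pi / 3" by (intro divide_left_mono) auto
  then have "pi / real (m s t) < pi / 2" using pi_gt_zero by linarith
  moreover have "0 < pi / real (m s t)" using False by simp
  ultimately have "cos (pi / real (m s t)) > 0" by (intro cos_gt_zero) auto
  then show ?thesis using False by (simp add: form_coeff_def)
qed (simp add: form_coeff_def)

lemma component_orth:
  assumes "K \<union> {t} \<subseteq> S" "l \<in> component K t" "k \<in> K \<union> {t}" "k \<notin> component K t" shows "form_coeff l k = 0"
proof (rule form_coeff_nonadjacent)
  show "l \<in> S" "k \<in> S" using assms component_subset by blast+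
  show "l \<noteq> k" using assms by blast
  show "\<not> adjacent l k" using component_adjacent assms by blast
qed

lemma component_cong:
  assumes "K' \<union> {t'} = K \<union> {t}" "t' \<in> component K t" shows "component K' t' = component K t"
proof -
  let ?R = "step_rel (K \<union> {t})"
  have sym: "?R\<^sup>*\<^sup>* b a" if "?R\<^sup>*\<^sup>* a b" for a b
    using that
  proof (induction rule: rtranclp_induct)
    case (step y z)
    then have "?R z y" using adjacent_sym by blast
    then show ?case using step.IH by (rule converse_rtranclp_into_rtranclp)
  qed simp
  have t: "?R\<^sup>*\<^sup>* t t'" using assms(2) component_iff by blast
  have eq: "?R\<^sup>*\<^sup>* t' x \<longleftrightarrow> ?R\<^sup>*\<^sup>* t x" for x
    using rtranclp_trans[OF t, of x] rtranclp_trans[OF sym[OF t], of x] by blast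
  show ?thesis
  proof (rule Set.set_eqI)
    fix x show "x \<in> component K' t' \<longleftrightarrow> x \<in> component K t" unfolding component_iff assms(1) eq ..
  qed
qed

lemma form_adjacent_neg:
  assumes "\<beta> \<in> positive_roots" "\<beta> k > 0" "\<beta> j = 0" "adjacent k j" shows "form (simple_root j) \<beta> < 0"
proof -
  have bV: "\<beta> \<in> V" and br: "\<beta> \<in> roots" using assms(1) by auto
  have jS: "j \<in> S" "k \<in> S" using assms(4) unfolding adjacent_def by auto
  let ?A = "{s. \<beta> s \<noteq> 0}"
  have "form (simple_root j) \<beta> = (\<Sum>s\<in>?A. \<beta> s * form (simple_root j) (simple_root s))"
    by (rule form_expand_right) (use jS bV in simp_all)
  also have "\<dots> = (\<Sum>s\<in>?A. \<beta> s * form_coeff s j)"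
    by (rule sum.cong) (use jS br root_supp form_coeff_sym[of j] in \<open>auto simp: form_simple\<close>)
  also have "\<dots> = \<beta> k * form_coeff k j + (\<Sum>s\<in>?A - {k}. \<beta> s * form_coeff s j)"
    by (rule sum.remove) (use V_supp(1)[OF bV] assms(2) in auto)
  also have "\<dots> \<le> \<beta> k * form_coeff k j + 0"
  proof (intro add_left_mono sum_nonpos mult_nonneg_nonpos)
    fix s assume s: "s \<in> ?A - {k}"
    have "s \<in> S" using s root_supp[OF br] by simp
    moreover have "s \<noteq> j" using s assms(3) by auto
    ultimately show "form_coeff s j \<le> 0" by (rule form_coeff_nonpos[OF _ jS(1)])
  qed (rule pos_nonneg[OF assms(1)])
  also have "\<dots> < 0" using assms(2) form_coeff_adjacent[OF assms(4)] by (simp add: mult_pos_neg)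
  finally show ?thesis .
qed

text \<open>The parabolic subgroup \<open>W\<^sub>L\<^sub>-\<^sub>t\<close> permutes the finite set \<open>B\<close> of positive roots of \<open>W\<^sub>L\<close> outside \<open>W\<^sub>L\<^sub>-\<^sub>t\<close>.
  The action is faithful since \<open>L\<close> is connected, so \<open>B\<close> spans.\<close>

lemma component_finite_type:
  assumes K: "K \<subseteq> S" "t \<in> S" and fin: "finite {\<gamma> \<in> positive_roots. \<gamma> \<in> Phi (K \<union> {t}) \<and> \<gamma> t > 0}"
  shows "finite_type (component K t)"
proof -
  define L where "L = component K t"
  define B where "B = {\<gamma> \<in> positive_roots. \<gamma> \<in> Phi L \<and> \<gamma> t > 0}"
  have LS: "L \<subseteq> S" using component_subset K unfolding L_def by blast
  have LtS: "L - {t} \<subseteq> S" using LS by blast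
  have finB: "finite B"
    by (rule finite_subset[OF _ fin]) (use Phi_mono component_subset in \<open>auto simp: B_def L_def\<close>)
  have B_act: "act g \<beta> \<in> B" if g: "g \<in> generate W (L - {t})" "\<beta> \<in> B" for g \<beta>
  proof -
    have b: "\<beta> \<in> positive_roots" "\<beta> \<in> Phi L" "\<beta> t > 0" "\<beta> \<in> roots" using g(2) by (auto simp: B_def)
    have gL: "g \<in> generate W L" using g(1) mono_generate[of "L - {t}" L] by blast
    have "act g \<beta> t = \<beta> t" by (rule generate_act_coord[OF LtS g(1) root_V[OF b(4)]]) simp
    then have "act g \<beta> t > 0" using b by simp
    moreover have "act g \<beta> \<in> Phi L" by (rule generate_act_Phi[OF LS gL b(2)])
    ultimately show ?thesis using pos_if_coord[OF PhiD(1)] by (simp add: B_def)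
  qed
  have tB: "simple_root t \<in> B" using K component_self simple_root_Phi[of t L] by (simp add: B_def L_def)
  have touch: "\<exists>\<beta>\<in>B. form (simple_root l) \<beta> \<noteq> 0" if l: "l \<in> L" "l \<noteq> t" for l
  proof -
    have "(step_rel (K \<union> {t}))\<^sup>*\<^sup>* t l" using l(1) unfolding L_def by (simp only: component_iff)
    \<comment> \<open>Invariant along a path from \<open>t\<close> towards \<open>l\<close>: either
      some root of \<open>B\<close> already pairs nontrivially with the simple root of
      \<open>l\<close>, or some root of \<open>B\<close> reaches the current vertex \<open>k\<close>
      while its coordinate at \<open>l\<close> is still 0. At \<open>k = l\<close> the second case
      is absurd.\<close>
    moreover have "k \<in> L \<and> ((\<exists>\<beta>\<in>B. form (simple_root l) \<beta> \<noteq> 0) \<or> (\<exists>\<beta>\<in>B. \<beta> l = 0 \<and> \<beta> k > 0))"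
      if "(step_rel (K \<union> {t}))\<^sup>*\<^sup>* t k" for k
      using that
    proof (induction rule: rtranclp_induct)
      case base
      have "simple_root t l = 0" "simple_root t t > 0" using l simple_root_other[of t l] by auto
      then show ?case using tB component_self unfolding L_def by blast
    next
      case (step k k')
      have k'L: "k' \<in> L" using step component_adjacent unfolding L_def by blast
      have adj: "adjacent k k'" using step by blast
      show ?case
      proof (cases "\<exists>\<beta>\<in>B. form (simple_root l) \<beta> \<noteq> 0")
        case False
        then obtain \<beta> where b: "\<beta> \<in> B" "\<beta> l = 0" "\<beta> k > 0" using step.IH by blast
        have bp: "\<beta> \<in> positive_roots" "\<beta> \<in> V" using b(1) by (auto simp: B_def)
        show ?thesis
        proof (cases "\<beta> k' > 0")
          case True
          then show ?thesis using b k'L by blast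
        next
          case F: False
          then have b0: "\<beta> k' = 0" using pos_nonneg[OF bp(1), of k'] by simp
          have neg: "form (simple_root k') \<beta> < 0" by (rule form_adjacent_neg[OF bp(1) b(3) b0 adj])
          have k'S: "k' \<in> S" using k'L LS by blast
          show ?thesis
          proof (cases "k' = l")
            case True
            then show ?thesis using neg b(1) False by auto
          next
            case ne: False
            have "k' \<noteq> t" using b0 b(1) by (auto simp: B_def)
            then have "k' \<in> generate W (L - {t})" using k'L by (intro generate.incl) simp
            then have "act k' \<beta> \<in> B" using b(1) by (rule B_act)
            moreover have "act k' \<beta> l = 0" using b(2) ne bp k'S by (simp add: act_S simple_reflection_other_coord)
            moreover have "act k' \<beta> k' > 0" using neg b0 bp k'S by (simp add: act_S simple_reflection_lin)
            ultimately show ?thesis using k'L by blast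
          qed
        qed
      qed (use k'L in blast)
    qed
    ultimately have "(\<exists>\<beta>\<in>B. form (simple_root l) \<beta> \<noteq> 0) \<or> (\<exists>\<beta>\<in>B. \<beta> l = 0 \<and> \<beta> l > 0)" by blast
    then show ?thesis by auto
  qed
  have faithful: "g = \<one>" if g: "g \<in> generate W (L - {t})" "\<And>\<beta>. \<beta> \<in> B \<Longrightarrow> act g \<beta> = \<beta>" for g
  proof -
    have gc: "g \<in> carrier W" by (rule generate_carrier[OF LtS g(1)])
    have fix_l: "act g (simple_root l) = simple_root l" if l: "l \<in> L" for l
    proof (cases "l = t")
      case True
      then show ?thesis using g(2)[OF tB] by simp
    next
      case False
      have lS: "l \<in> S" using l LS by blast
      obtain \<beta> where b: "\<beta> \<in> B" "form (simple_root l) \<beta> \<noteq> 0" using touch[OF l False] by blast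
      have bV: "\<beta> \<in> V" using b(1) by (simp add: B_def)
      have "l \<in> generate W (L - {t})" using l False by (intro generate.incl) simp
      then have b': "act l \<beta> \<in> B" using b(1) by (rule B_act)
      define f where "f = form (simple_root l) \<beta>"
      have e: "act l \<beta> = lin 1 \<beta> (- 2 * f) (simple_root l)" using lS bV by (simp add: act_S simple_reflection_lin f_def)
      \<comment> \<open>Both \<beta> and its image under \<open>l\<close> lie in \<open>B\<close>
        and are fixed. Their difference is a nonzero multiple of the simple root of
        \<open>l\<close>, which is therefore fixed as well.\<close>
      have "act g (act l \<beta>) = lin 1 (act g \<beta>) (- 2 * f) (act g (simple_root l))"
        unfolding e by (rule act_linear) (use gc bV lS in simp_all)
      then have "lin 1 \<beta> (- 2 * f) (simple_root l) = lin 1 \<beta> (- 2 * f) (act g (simple_root l))"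
        using g(2)[OF b'] g(2)[OF b(1)] e by simp
      then have "\<beta> r - 2 * f * simple_root l r = \<beta> r - 2 * f * act g (simple_root l) r" for r
        by (metis (no_types) fun_cong lin_apply mult_1 mult_minus_left uminus_add_conv_diff add.commute)
      then show ?thesis using b(2) by (intro ext) (simp add: f_def)
    qed
    have "inversions g = {}"
    proof (rule ccontr)
      assume "inversions g \<noteq> {}"
      then obtain \<gamma> where h: "\<gamma> \<in> inversions g" by blast
      have p: "\<gamma> \<in> positive_roots" "\<gamma> \<in> Phi (L - {t})" using inversionsD(1)[OF h] inversions_generate[OF LtS g(1)] h by auto
      have "act g \<gamma> \<in> positive_roots"
        by (rule act_pos_combination[OF p gc]) (use fix_l simple_root_nonneg in auto)
      then show False using inversionsD(2)[OF h] by simp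
    qed
    then show ?thesis by (rule inversions_empty[OF gc])
  qed
  have fin1: "finite (generate W (L - {t}))"
  proof (rule inj_on_finite)
    show "inj_on (\<lambda>g. restrict (act g) B) (generate W (L - {t}))"
    proof (rule inj_onI)
      fix g h assume g: "g \<in> generate W (L - {t})" and h: "h \<in> generate W (L - {t})"
        and e: "restrict (act g) B = restrict (act h) B"
      have gc: "g \<in> carrier W" "h \<in> carrier W" using generate_carrier[OF LtS] g h by auto
      have "inv h \<otimes> g = \<one>"
      proof (rule faithful)
        show "inv h \<otimes> g \<in> generate W (L - {t})"
          by (rule generate.eng[OF generate_inv[OF LtS h] g])
        fix \<beta> assume b: "\<beta> \<in> B"
        then have bV: "\<beta> \<in> V" by (simp add: B_def)
        have "act g \<beta> = act h \<beta>" using fun_cong[OF e, of \<beta>] b by simp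
        then show "act (inv h \<otimes> g) \<beta> = \<beta>" using gc bV by (simp add: act_mult)
      qed
      then show "g = h" using gc by (metis inv_cancel(2) r_one)
    qed
    show "(\<lambda>g. restrict (act g) B) ` generate W (L - {t}) \<subseteq> B \<rightarrow>\<^sub>E B"
      using B_act by auto
    show "finite (B \<rightarrow>\<^sub>E B)" by (rule finite_PiE[OF finB]) (rule finB)
  qed
  \<comment> \<open>Finiteness passes from a group to its roots because roots inject into
    reflections; further below it returns from roots to the group because elements inject into
    inversion sets.\<close>
  have fin2: "finite (positive_roots \<inter> Phi (L - {t}))"
  proof (rule inj_on_finite[OF _ _ fin1])
    show "inj_on reflection (positive_roots \<inter> Phi (L - {t}))"
      by (rule inj_onI) (use reflection_inj in blast)
    show "reflection ` (positive_roots \<inter> Phi (L - {t})) \<subseteq> generate W (L - {t})"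
      using reflection_generate[OF _ _ LtS] by blast
  qed
  have fin3: "finite (positive_roots \<inter> Phi L)"
  proof (rule finite_subset[OF _ finite_UnI[OF finB fin2]], rule subsetI)
    fix \<gamma> assume g: "\<gamma> \<in> positive_roots \<inter> Phi L"
    show "\<gamma> \<in> B \<union> (positive_roots \<inter> Phi (L - {t}))"
    proof (cases "\<gamma> t > 0")
      case True
      then show ?thesis using g by (simp add: B_def)
    next
      case False
      then have "\<gamma> t = 0" using pos_nonneg[of \<gamma> t] g by simp
      then have "\<gamma> \<in> Phi (L - {t})" using g by (auto simp: Phi_def)
      then show ?thesis using g by simp
    qed
  qed
  have "finite (generate W L)"
  proof (rule inj_on_finite)
    show "inj_on inversions (generate W L)"
      by (rule inj_onI) (use inversions_eq_imp generate_carrier[OF LS] in metis)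
    show "inversions ` generate W L \<subseteq> Pow (positive_roots \<inter> Phi L)"
      using inversions_generate[OF LS] inversionsD(1) by auto
    show "finite (Pow (positive_roots \<inter> Phi L))" unfolding finite_Pow_iff by (rule fin3)
  qed
  then show ?thesis by (simp add: finite_type_def L_def)
qed

lemma component_S: "K \<subseteq> S \<Longrightarrow> t \<in> S \<Longrightarrow> component K t \<subseteq> S"
  using component_subset by blast

section \<open>Inversions and images of elementary moves\<close>

lemma elementary_move_generate:
  assumes "K \<subseteq> S" "t \<in> S" "finite_type (component K t)" shows "elementary_move K t \<in> generate W (component K t)"
proof -
  note L = component_S[OF assms(1,2)]
  have "finite_type (component K t - {t})" by (rule finite_type_mono[OF assms(3)], blast)
  then have "w0 (component K t - {t}) \<in> generate W (component K t - {t})" using L by (intro w0_generate) auto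
  then have "w0 (component K t - {t}) \<in> generate W (component K t)"
    using mono_generate[of "component K t - {t}" "component K t"] by blast
  then show ?thesis unfolding elementary_move_def by (intro generate.eng w0_generate L assms(3))
qed

lemma elementary_move_carrier: "K \<subseteq> S \<Longrightarrow> t \<in> S \<Longrightarrow> finite_type (component K t) \<Longrightarrow> elementary_move K t \<in> carrier W"
  using elementary_move_generate generate_carrier component_S by blast

lemma component_finite_type_minus: "finite_type (component K t) \<Longrightarrow> finite_type (component K t - {t})"
  by (rule finite_type_mono, assumption, blast)

lemma act_elementary_move:
  assumes "K \<subseteq> S" "t \<in> S" "finite_type (component K t)" "v \<in> V"
  shows "act (elementary_move K t) v = act (w0 (component K t)) (act (w0 (component K t - {t})) v)"
proof -
  have "component K t - {t} \<subseteq> S" using component_S[OF assms(1,2)] by blast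
  then show ?thesis unfolding elementary_move_def
    by (intro act_mult w0_carrier component_S assms component_finite_type_minus)
qed

text \<open>The inner longest element keeps the coordinate at \<open>t\<close>, so it leaves roots
  involving \<open>t\<close> positive, and the outer one negates them; the other roots of the
  component are negated twice. Roots on \<open>K\<close> and \<open>t\<close> that involve
  \<open>t\<close> lie in the component by orthogonality.\<close>

lemma inversions_elementary_move:
  assumes K: "K \<subseteq> S" "t \<in> S" "t \<notin> K" and ft: "finite_type (component K t)"
  shows "inversions (elementary_move K t) = {\<gamma> \<in> positive_roots. \<gamma> \<in> Phi (K \<union> {t}) \<and> \<gamma> t > 0}"
proof (intro equalityI subsetI)
  let ?L = "component K t"
  have LS: "?L \<subseteq> S" by (rule component_S[OF K(1,2)])
  have LtS: "?L - {t} \<subseteq> S" using LS by blast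
  note ft' = component_finite_type_minus[OF ft]
  fix \<gamma>
  {
    assume g: "\<gamma> \<in> inversions (elementary_move K t)"
    then have p: "\<gamma> \<in> positive_roots" "\<gamma> \<in> Phi ?L" using inversionsD(1)[OF g] inversions_generate[OF LS elementary_move_generate[OF K(1,2) ft]] by auto
    have "\<gamma> t > 0"
    proof (rule ccontr)
      assume "\<not> \<gamma> t > 0"
      then have "\<gamma> t = 0" using pos_nonneg[OF p(1), of t] by simp
      then have ph: "\<gamma> \<in> Phi (?L - {t})" using p(2) by (auto simp: Phi_def)
      note n = w0_neg[OF LtS ft' p(1) ph]
      have "neg (act (w0 ?L) (neg (act (w0 (?L - {t})) \<gamma>))) \<in> positive_roots"
        by (rule w0_neg(1)[OF LS ft n(1) Phi_mono[OF n(2)]]) blast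
      moreover have "neg (act (w0 ?L) (neg (act (w0 (?L - {t})) \<gamma>))) = act (elementary_move K t) \<gamma>"
        using act_elementary_move[OF K(1,2) ft, of \<gamma>] w0_carrier[OF LS ft] w0_carrier[OF LtS ft'] p(1) by (simp add: act_neg)
      ultimately show False using inversionsD(2)[OF g] by simp
    qed
    then show "\<gamma> \<in> {\<gamma> \<in> positive_roots. \<gamma> \<in> Phi (K \<union> {t}) \<and> \<gamma> t > 0}"
      using p Phi_mono[OF p(2) component_subset] by simp
  next
    assume "\<gamma> \<in> {\<gamma> \<in> positive_roots. \<gamma> \<in> Phi (K \<union> {t}) \<and> \<gamma> t > 0}"
    then have g: "\<gamma> \<in> positive_roots" "\<gamma> \<in> Phi (K \<union> {t})" "\<gamma> t > 0" by auto
    have KL: "K \<union> {t} = ?L \<union> (K \<union> {t} - ?L)" using component_subset[of K t] by blast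
    have tKS: "K \<union> {t} \<subseteq> S" using K by blast
    have "\<gamma> \<in> Phi ?L \<or> \<gamma> \<in> Phi (K \<union> {t} - ?L)"
    proof (rule Phi_orthogonal_split[OF g(1)])
      show "\<gamma> \<in> Phi (?L \<union> (K \<union> {t} - ?L))" using g(2) KL by simp
      show "?L \<union> (K \<union> {t} - ?L) \<subseteq> S" using tKS component_subset[of K t] by blast
      show "form_coeff l k = 0" if "l \<in> ?L" "k \<in> K \<union> {t} - ?L" for l k
        using component_orth[OF tKS that(1)] that(2) by blast
    qed
    moreover have "\<gamma> \<notin> Phi (K \<union> {t} - ?L)" using PhiD(2)[of \<gamma> _ t] component_self[of t K] g(3) by force
    ultimately have ph: "\<gamma> \<in> Phi ?L" by blast
    let ?b = "act (w0 (?L - {t})) \<gamma>"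
    have w: "w0 (?L - {t}) \<in> generate W (?L - {t})" by (rule w0_generate[OF LtS ft'])
    have w': "w0 (?L - {t}) \<in> generate W ?L" using w mono_generate[of "?L - {t}" ?L] by blast
    have b: "?b \<in> Phi ?L" by (rule generate_act_Phi[OF LS w' ph])
    have "?b t = \<gamma> t" by (rule generate_act_coord[OF LtS w]) (use g(1) in simp_all)
    then have bp: "?b \<in> positive_roots" using g(3) by (intro pos_if_coord[OF PhiD(1)[OF b], of t]) simp
    have "act (elementary_move K t) \<gamma> \<notin> positive_roots"
      using w0_notpos[OF LS ft bp b] act_elementary_move[OF K(1,2) ft, of \<gamma>] g(1) by simp
    then show "\<gamma> \<in> inversions (elementary_move K t)" by (rule inversionsI[OF g(1)])
  }
qed

lemma generate_fixes:
  assumes "J \<subseteq> S" "g \<in> generate W J" "v \<in> V" "\<And>l. l \<in> J \<Longrightarrow> form (simple_root l) v = 0"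
  shows "act g v = v"
  using assms(2)
proof (induction rule: generate.induct)
  case (incl h)
  then show ?case using assms by (auto simp: act_S simple_reflection_fixed subset_iff)
next
  case (inv h)
  then have "h \<in> S" using assms(1) by blast
  then show ?case using inv assms by (simp add: S_inv act_S simple_reflection_fixed)
next
  case (eng h1 h2)
  then show ?case using generate_carrier[OF assms(1)] assms(3) by (simp add: act_mult)
qed (use assms(3) in simp)

text \<open>Inside the component the two longest elements each send simple roots to negatives of
  simple roots; outside, the simple root is orthogonal to the whole component.\<close>

lemma elementary_move_simple:
  assumes K: "K \<subseteq> S" "t \<in> S" "t \<notin> K" and ft: "finite_type (component K t)" and k: "k \<in> K"
  shows "k \<in> component K t \<Longrightarrow> \<exists>k'\<in>component K t. act (elementary_move K t) (simple_root k) = simple_root k'"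
    and "k \<notin> component K t \<Longrightarrow> act (elementary_move K t) (simple_root k) = simple_root k"
proof -
  let ?L = "component K t"
  have LS: "?L \<subseteq> S" by (rule component_S[OF K(1,2)])
  have LtS: "?L - {t} \<subseteq> S" using LS by blast
  note ft' = component_finite_type_minus[OF ft]
  have kS: "k \<in> S" using K k by blast
  {
    assume "k \<in> ?L"
    then have "k \<in> ?L - {t}" using k K(3) by blast
    then obtain k1 where k1: "k1 \<in> ?L - {t}" "act (w0 (?L - {t})) (simple_root k) = neg (simple_root k1)"
      using w0_simple[OF LtS ft'] by blast
    then have "k1 \<in> ?L" by blast
    then obtain k2 where k2: "k2 \<in> ?L" "act (w0 ?L) (simple_root k1) = neg (simple_root k2)"
      using w0_simple[OF LS ft] by blast
    have "act (elementary_move K t) (simple_root k) = simple_root k2"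
      using act_elementary_move[OF K(1,2) ft, of "simple_root k"] kS k1 k2 w0_carrier[OF LS ft] LS by (auto simp: act_neg)
    then show "\<exists>k'\<in>?L. act (elementary_move K t) (simple_root k) = simple_root k'" using k2(1) by blast
  next
    assume n: "k \<notin> ?L"
    show "act (elementary_move K t) (simple_root k) = simple_root k"
    proof (rule generate_fixes[OF LS elementary_move_generate[OF K(1,2) ft]])
      show "form (simple_root l) (simple_root k) = 0" if "l \<in> ?L" for l
      proof -
        have "form_coeff l k = 0" by (rule component_orth[OF _ that _ n]) (use K k in auto)
        then show ?thesis using that LS kS by (auto simp: form_simple)
      qed
    qed (use kS in simp)
  }
qed

lemma elementary_move_simple':
  assumes "K \<subseteq> S" "t \<in> S" "t \<notin> K" "finite_type (component K t)" "k \<in> K"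
  shows "\<exists>k'\<in>K \<union> {t}. act (elementary_move K t) (simple_root k) = simple_root k'"
  using elementary_move_simple[OF assms] component_subset[of K t] assms(5) by blast

text \<open>An element that keeps \<open>\<alpha>\<^sub>k\<close> simple for all \<open>k \<in> K\<close> and makes \<open>\<alpha>\<^sub>t\<close> negative makes every positive root
  of \<open>W\<^bsub>K \<union> {t}\<^esub>\<close> involving \<open>t\<close> negative, because some coordinate of \<open>w \<alpha>\<^sub>t\<close> outside \<open>w K\<close> is negative.\<close>

lemma deodhar_step:
  assumes K: "K \<subseteq> S" "t \<in> S" "t \<notin> K" and w: "w \<in> carrier W"
    and simple: "\<And>k. k \<in> K \<Longrightarrow> \<exists>k'\<in>S. act w (simple_root k) = simple_root k'"
    and t: "act w (simple_root t) \<notin> positive_roots"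
  shows "finite_type (component K t)" and "inversions (elementary_move K t) \<subseteq> inversions w"
proof -
  let ?A = "{\<gamma> \<in> positive_roots. \<gamma> \<in> Phi (K \<union> {t}) \<and> \<gamma> t > 0}"
  let ?b = "act w (simple_root t)"
  have br: "?b \<in> roots" using w K by simp
  \<comment> \<open>Otherwise the image of the simple root of \<open>t\<close> would be supported on
    images of simple roots from \<open>K\<close>. Applying \<open>inv w\<close> would then give the
    simple root of \<open>t\<close> a zero coordinate at \<open>t\<close>.\<close>
  have "\<exists>r. ?b r < 0 \<and> (\<forall>k\<in>K. act w (simple_root k) r = 0)"
  proof (rule ccontr)
    assume c: "\<not> ?thesis"
    have z: "act (inv w) (simple_root r) t = 0" if r: "?b r \<noteq> 0" for r
    proof -
      have "?b r < 0" using r notpos_coord[OF br t, of r] by simp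
      then obtain k where k: "k \<in> K" "act w (simple_root k) r \<noteq> 0" using c by blast
      obtain k' where k': "act w (simple_root k) = simple_root k'" using simple[OF k(1)] by blast
      have "k' = r" using k(2) simple_root_other[of k' r] k' by metis
      then have "act (inv w) (simple_root r) = simple_root k"
        using k' w k(1) K(1) act_inv(1)[OF w, of "simple_root k"] by auto
      then show ?thesis using k(1) K(3) simple_root_other[of k t] by force
    qed
    have "act (inv w) ?b t = (\<Sum>r\<in>{r. ?b r \<noteq> 0}. ?b r * act (inv w) (simple_root r) t)"
      by (rule act_expand) (use w V_supp[OF root_V[OF br]] in auto)
    also have "\<dots> = 0" by (rule sum.neutral) (use z in simp)
    finally show False using w K by simp
  qed
  then obtain r where r: "?b r < 0" "\<And>k. k \<in> K \<Longrightarrow> act w (simple_root k) r = 0" by blast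
  have sub: "?A \<subseteq> inversions w"
  proof
    fix \<gamma> assume "\<gamma> \<in> ?A"
    then have g: "\<gamma> \<in> positive_roots" "\<gamma> \<in> Phi (K \<union> {t})" "\<gamma> t > 0" by auto
    have gV: "\<gamma> \<in> V" using g(1) by simp
    let ?B = "{s. \<gamma> s \<noteq> 0}"
    have "act w \<gamma> r = (\<Sum>s\<in>?B. \<gamma> s * act w (simple_root s) r)"
      by (rule act_expand) (use w V_supp[OF gV] in auto)
    also have "\<dots> = \<gamma> t * ?b r + (\<Sum>s\<in>?B - {t}. \<gamma> s * act w (simple_root s) r)"
      by (rule sum.remove) (use V_supp(1)[OF gV] g(3) in auto)
    also have "(\<Sum>s\<in>?B - {t}. \<gamma> s * act w (simple_root s) r) = 0"
      by (rule sum.neutral) (use r(2) PhiD(2)[OF g(2)] in auto)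
    finally have "act w \<gamma> r < 0" using g(3) r(1) by (simp add: mult_pos_neg)
    then show "\<gamma> \<in> inversions w" by (intro inversionsI[OF g(1)] nonpos_if_coord)
  qed
  show ft: "finite_type (component K t)"
    by (rule component_finite_type[OF K(1,2) finite_subset[OF sub finite_inversions[OF w]]])
  show "inversions (elementary_move K t) \<subseteq> inversions w" using sub inversions_elementary_move[OF K ft] by simp
qed

section \<open>Loops and reflections\<close>

text \<open>With coordinate 0 at \<open>t\<close> the root would be a combination of simple roots
  from \<open>K\<close>, to all of which it is orthogonal, so its norm would vanish.\<close>

lemma root_perp_coord:
  assumes "t \<notin> K" "\<delta> \<in> positive_roots" "\<delta> \<in> Phi (K \<union> {t})" "\<And>k. k \<in> K \<Longrightarrow> form \<delta> (simple_root k) = 0"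
  shows "\<delta> t > 0"
proof (rule ccontr)
  assume "\<not> \<delta> t > 0"
  then have z: "\<delta> t = 0" using pos_nonneg[OF assms(2), of t] by simp
  have V: "\<delta> \<in> V" using assms(2) by simp
  have "form \<delta> \<delta> = (\<Sum>s\<in>{s. \<delta> s \<noteq> 0}. \<delta> s * form \<delta> (simple_root s))" by (rule form_expand_right[OF V V])
  also have "\<dots> = 0"
  proof (rule sum.neutral, rule ballI)
    fix s assume s: "s \<in> {s. \<delta> s \<noteq> 0}"
    then have "s \<in> K" using z PhiD(2)[OF assms(3), of s] by (cases "s = t") auto
    then show "\<delta> s * form \<delta> (simple_root s) = 0" using assms(4) by simp
  qed
  finally show False using root_norm assms(2) by simp
qed

text \<open>The reflection fixes the simple roots of \<open>K\<close> and makes that of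
  \<open>t\<close> negative, so \<open>deodhar_step\<close> gives one inclusion of inversion sets.
  Conversely, a root inverted by the reflection must be supported on \<open>K\<close> and
  \<open>t\<close>, and must involve \<open>t\<close>.\<close>

lemma loop_root:
  assumes K: "K \<subseteq> S" "t \<in> S" "t \<notin> K"
    and d: "\<delta> \<in> positive_roots" "\<delta> \<in> Phi (K \<union> {t})" "\<And>k. k \<in> K \<Longrightarrow> form \<delta> (simple_root k) = 0"
  shows "finite_type (component K t)" and "elementary_move K t = reflection \<delta>"
proof -
  let ?w = "reflection \<delta>"
  have dr: "\<delta> \<in> roots" "\<delta> \<in> V" using d(1) by auto
  have w: "?w \<in> carrier W" using dr by simp
  have fixK: "act ?w (simple_root k) = simple_root k" if "k \<in> K" for k
    using reflection_fixes[OF dr(1), of "simple_root k"] d(3)[OF that] K(1) that by auto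
  have dt: "\<delta> t > 0" by (rule root_perp_coord[OF K(3) d])
  \<comment> \<open>Coordinates at \<open>t\<close> are compared in the equation that the reflection
    negates \<delta>. Simple roots of \<open>K\<close> are fixed and contribute nothing
    there.\<close>
  have et: "act ?w (simple_root t) t = -1"
  proof -
    let ?B = "{s. \<delta> s \<noteq> 0}"
    have "act ?w \<delta> t = (\<Sum>s\<in>?B. \<delta> s * act ?w (simple_root s) t)"
      by (rule act_expand) (use w V_supp[OF dr(2)] in auto)
    also have "\<dots> = \<delta> t * act ?w (simple_root t) t + (\<Sum>s\<in>?B - {t}. \<delta> s * act ?w (simple_root s) t)"
      by (rule sum.remove) (use V_supp(1)[OF dr(2)] dt in auto)
    also have "(\<Sum>s\<in>?B - {t}. \<delta> s * act ?w (simple_root s) t) = 0"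
    proof (rule sum.neutral, rule ballI)
      fix s assume s: "s \<in> ?B - {t}"
      then have "s \<in> K" using PhiD(2)[OF d(2), of s] by auto
      then show "\<delta> s * act ?w (simple_root s) t = 0" using fixK simple_root_other[of s t] s by simp
    qed
    finally have "\<delta> t * (act ?w (simple_root t) t + 1) = 0"
      using act_reflection_self[OF dr(1)] by (simp add: distrib_left)
    then show ?thesis using dt by simp
  qed
  have simple: "\<exists>k'\<in>S. act ?w (simple_root k) = simple_root k'" if "k \<in> K" for k
    using fixK[OF that] K(1) that by blast
  have np: "act ?w (simple_root t) \<notin> positive_roots" by (rule nonpos_if_coord[of _ t]) (simp add: et)
  show ft: "finite_type (component K t)" by (rule deodhar_step(1)[OF K w simple np])
  have sub: "inversions (elementary_move K t) \<subseteq> inversions ?w" by (rule deodhar_step(2)[OF K w simple np])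
  have "inversions ?w \<subseteq> inversions (elementary_move K t)"
  proof
    fix \<gamma> assume g: "\<gamma> \<in> inversions ?w"
    have gp: "\<gamma> \<in> positive_roots" "\<gamma> \<in> V" "\<gamma> \<in> roots" using inversionsD(1)[OF g] by auto
    have ph: "\<gamma> \<in> Phi (K \<union> {t})"
    proof (rule ccontr)
      assume "\<gamma> \<notin> Phi (K \<union> {t})"
      then obtain r where r: "r \<notin> K \<union> {t}" "\<gamma> r > 0" using notin_Phi_coord[OF gp(1)] by blast
      have "act ?w \<gamma> r > 0" using r(2) PhiD(2)[OF d(2) r(1)] dr gp by (simp add: act_reflection)
      then have "act ?w \<gamma> \<in> positive_roots" by (rule pos_if_coord[rotated]) (use w gp in simp)
      then show False using inversionsD(2)[OF g] by simp
    qed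
    have "\<gamma> t > 0"
    proof (rule ccontr)
      assume "\<not> \<gamma> t > 0"
      then have "\<gamma> t = 0" using pos_nonneg[OF gp(1), of t] by simp
      then have phK: "\<gamma> \<in> Phi K" using ph by (auto simp: Phi_def)
      have "act ?w \<gamma> \<in> positive_roots"
        by (rule act_pos_combination[OF gp(1) phK w]) (use fixK simple_root_nonneg in simp)
      then show False using inversionsD(2)[OF g] by simp
    qed
    then show "\<gamma> \<in> inversions (elementary_move K t)" using inversions_elementary_move[OF K ft] gp ph by simp
  qed
  then show "elementary_move K t = ?w" using inversions_eq_imp[OF elementary_move_carrier[OF K(1,2) ft] w] sub by blast
qed

text \<open>Richardson's descent: conjugating an involution by one of its simple descents shortens it, unless
  that simple root is already mapped to its negative.\<close>

lemma rank_one_involution: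
  assumes "d \<in> carrier W" "d \<otimes> d = \<one>" "d \<noteq> \<one>" "\<eta> \<in> V"
    and "\<And>v. v \<in> V \<Longrightarrow> \<exists>c. act d v = lin 1 v c \<eta>"
  shows "\<exists>\<delta>\<in>roots. d = reflection \<delta>"
  using assms
proof (induction "card (inversions d)" arbitrary: d \<eta> rule: less_induct)
  case less
  note d = less.prems
  have di: "inv d = d" by (rule inv_equality[OF d(2,1,1)])
  obtain s where s: "s \<in> S" "simple_root s \<in> inversions d" using descent_exists[OF d(1,3)] by blast
  show ?case
  proof (cases "act d (simple_root s) = neg (simple_root s)")
    case True
    obtain c0 where c0: "act d (simple_root s) = lin 1 (simple_root s) c0 \<eta>" using d(5) s(1) by force
    have e0: "- simple_root s r = simple_root s r + c0 * \<eta> r" for r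
      using fun_cong[OF c0, of r] True by simp
    have c00: "c0 \<noteq> 0" using e0[of s] by auto
    have \<eta>0: "\<eta> r = 0" if "r \<noteq> s" for r
      using e0[of r] c00 simple_root_other[of s r] that by simp
    \<comment> \<open>The terminal case of the descent: \<eta> is now a multiple of the simple root
      of \<open>s\<close>, so \<open>d\<close> alters only the coordinate at \<open>s\<close>. Hence
      the image of each simple root under \<open>d \<otimes> s\<close> keeps its own positive
      coordinate, and there is no descent.\<close>
    have "d \<otimes> s = \<one>"
    proof (rule ccontr)
      assume "d \<otimes> s \<noteq> \<one>"
      then obtain r where r: "r \<in> S" "simple_root r \<in> inversions (d \<otimes> s)"
        using descent_exists[of "d \<otimes> s"] d(1) s(1) by auto
      have a: "act (d \<otimes> s) (simple_root r) = act d (act s (simple_root r))"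
        using d(1) s(1) r(1) by (simp add: act_mult)
      have root: "act (d \<otimes> s) (simple_root r) \<in> roots" using d(1) s(1) r(1) by simp
      have "act (d \<otimes> s) (simple_root r) r > 0"
      proof (cases "r = s")
        case True
        have "act d (act s (simple_root s)) = act d (neg (simple_root s))"
          using s(1) by (simp add: act_S simple_reflection_self neg_lin)
        also have "\<dots> = neg (act d (simple_root s))" using d(1) s(1) by (simp add: act_neg)
        also have "\<dots> = simple_root s" using \<open>act d (simple_root s) = neg (simple_root s)\<close> by simp
        finally show ?thesis using a True by simp
      next
        case ne: False
        obtain c where c: "act d (simple_root r) = lin 1 (simple_root r) c \<eta>" using d(5) r(1) by force
        define f where "f = - 2 * form (simple_root s) (simple_root r)"
        have "act s (simple_root r) = lin 1 (simple_root r) f (simple_root s)"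
          using s(1) r(1) by (simp add: act_S simple_reflection_lin f_def)
        then have "act d (act s (simple_root r)) = lin 1 (act d (simple_root r)) f (act d (simple_root s))"
          using act_linear[OF d(1), of "simple_root r" "simple_root s" 1 f] r(1) s(1) by simp
        then have "act (d \<otimes> s) (simple_root r) r = act d (simple_root r) r - f * simple_root s r"
          unfolding a by (simp add: True)
        also have "\<dots> = 1" using c \<eta>0[OF ne] simple_root_other[of s r] ne by simp
        finally show ?thesis by simp
      qed
      then show False using inversionsD(2)[OF r(2)] pos_if_coord[OF root] by blast
    qed
    then have "d = s" using d(1) s(1) S_inv inv_equality[of d s] by simp
    then show ?thesis using reflection_simple[OF s(1)] s(1) by (metis simple_root_root)
  next
    case False
    define d' where "d' = s \<otimes> d \<otimes> s"
    have d'c: "d' \<in> carrier W" using d(1) s(1) by (simp add: d'_def)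
    have sds: "s \<otimes> d' \<otimes> s = d" using d(1) s(1) by (simp add: d'_def m_assoc involution_cancel S_square)
    have lt: "card (inversions d') < card (inversions d)" unfolding d'_def
      by (rule card_inversions_conj[OF s(1) d(1) s(2) _ False]) (use di s in simp)
    have dds: "d \<otimes> (d \<otimes> s) = s" using d(1,2) s(1) by (simp add: m_assoc[symmetric])
    have sq: "d' \<otimes> d' = \<one>" using d(1) s(1) dds
      by (simp add: d'_def m_assoc involution_cancel S_square)
    have ne: "d' \<noteq> \<one>" using sds d(3) s(1) by (auto simp: S_square)
    have \<eta>': "act s \<eta> \<in> V" using d(4) s(1) by simp
    have "\<exists>c. act d' v = lin 1 v c (act s \<eta>)" if v: "v \<in> V" for v
    proof -
      obtain c where c: "act d (act s v) = lin 1 (act s v) c \<eta>" using d(5)[of "act s v"] v s(1) by auto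
      have ss: "act s (act s v) = v" using act_mult[of s s v] s(1) v by (simp add: S_square)
      have "act d' v = act s (act d (act s v))" using d(1) s(1) v by (simp add: d'_def act_mult)
      also have "\<dots> = lin 1 (act s (act s v)) c (act s \<eta>)"
        unfolding c by (rule act_linear) (use s(1) v d(4) in simp_all)
      finally show ?thesis using ss by auto
    qed
    from less.hyps[OF lt d'c sq ne \<eta>' this] obtain \<delta> where de: "\<delta> \<in> roots" "d' = reflection \<delta>" by blast
    have "d = reflection (act s \<delta>)" using reflection_act[OF de(1), of s] s(1) de(2) sds S_inv by simp
    then show ?thesis using de(1) s(1) by (metis S_closed root_act)
  qed
qed

text \<open>Since \<open>d\<close> fixes \<open>K\<close>, on vectors supported on \<open>K\<close>
  and \<open>t\<close> it differs from the identity by multiples of a single vector \<eta>. It is an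
  involution, which extends this description to all vectors, and \<open>rank_one_involution\<close>
  applies.\<close>

lemma loop_reflection:
  assumes K: "K \<subseteq> S" "t \<in> S" "t \<notin> K" and ft: "finite_type (component K t)"
    and fixK: "\<And>k. k \<in> K \<Longrightarrow> act (elementary_move K t) (simple_root k) = simple_root k"
  shows "\<exists>\<delta>. \<delta> \<in> positive_roots \<and> \<delta> \<in> Phi (K \<union> {t}) \<and> (\<forall>k\<in>K. form \<delta> (simple_root k) = 0) \<and>
    elementary_move K t = reflection \<delta>"
proof -
  define d where "d = elementary_move K t"
  have dc: "d \<in> carrier W" using elementary_move_carrier[OF K(1,2) ft] by (simp add: d_def)
  have KtS: "K \<union> {t} \<subseteq> S" using K by blast
  have dg: "d \<in> generate W (K \<union> {t})"
    using elementary_move_generate[OF K(1,2) ft] mono_generate[OF component_subset[of K t]] by (auto simp: d_def)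
  have Nd: "inversions d = {\<gamma> \<in> positive_roots. \<gamma> \<in> Phi (K \<union> {t}) \<and> \<gamma> t > 0}" using inversions_elementary_move[OF K ft] by (simp add: d_def)
  have tN: "simple_root t \<in> inversions d" using K(2) simple_root_Phi[of t] by (simp add: Nd)
  define \<tau> where "\<tau> = act d (simple_root t)"
  have \<tau>V: "\<tau> \<in> V" using dc K(2) by (simp add: \<tau>_def)
  have expand: "act d v = lin 1 v (v t) (lin 1 \<tau> (-1) (simple_root t))"
    if v: "v \<in> V" "\<And>s. s \<notin> K \<union> {t} \<Longrightarrow> v s = 0" for v
  proof
    fix r
    let ?A = "insert t {s. v s \<noteq> 0}"
    have fin: "finite ?A" "?A \<subseteq> S" using V_supp[OF v(1)] K(2) by auto
    have "act d v r = (\<Sum>s\<in>?A. v s * act d (simple_root s) r)"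
      by (rule act_expand[OF dc fin]) auto
    also have "\<dots> = v t * \<tau> r + (\<Sum>s\<in>?A - {t}. v s * act d (simple_root s) r)"
      using sum.remove[OF fin(1), of t] by (simp add: \<tau>_def)
    also have "(\<Sum>s\<in>?A - {t}. v s * act d (simple_root s) r) = (\<Sum>s\<in>?A - {t}. v s * simple_root s r)"
    proof (rule sum.cong[OF refl])
      fix s assume "s \<in> ?A - {t}"
      then have "s \<in> K" using v(2)[of s] by auto
      then show "v s * act d (simple_root s) r = v s * simple_root s r" using fixK by (simp add: d_def)
    qed
    finally have 1: "act d v r = v t * \<tau> r + (\<Sum>s\<in>?A - {t}. v s * simple_root s r)" .
    have "v r = (\<Sum>s\<in>?A. v s * simple_root s r)"
      by (rule linear_functional_expand[OF linear_functional_coord fin]) auto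
    also have "\<dots> = v t * simple_root t r + (\<Sum>s\<in>?A - {t}. v s * simple_root s r)"
      by (rule sum.remove[OF fin(1)]) simp
    finally show "act d v r = lin 1 v (v t) (lin 1 \<tau> (-1) (simple_root t)) r"
      using 1 by (simp add: algebra_simps)
  qed
  define \<eta> where "\<eta> = lin 1 \<tau> (-1) (simple_root t)"
  have \<eta>V: "\<eta> \<in> V" using \<tau>V K(2) by (simp add: \<eta>_def)
  have \<tau>supp: "\<tau> s = 0" if "s \<notin> K \<union> {t}" for s
  proof -
    have "t \<noteq> s" using that by blast
    then show ?thesis
      using generate_act_coord[OF KtS dg simple_root_V[OF K(2)] that] by (simp add: \<tau>_def simple_root_other)
  qed
  define x where "x = \<tau> t"
  have coordt: "act d v t = x * v t" if "v \<in> V" "\<And>s. s \<notin> K \<union> {t} \<Longrightarrow> v s = 0" for v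
    using fun_cong[OF expand[OF that], of t] by (simp add: x_def algebra_simps)
  have x0: "x \<noteq> 0"
  proof
    assume "x = 0"
    then have "act d \<tau> = \<tau>" using expand[OF \<tau>V \<tau>supp] by (auto simp: x_def)
    then have "act d \<tau> = act d (simple_root t)" by (simp add: \<tau>_def)
    then have "\<tau> = simple_root t" by (rule act_inj[OF dc \<tau>V simple_root_V[OF K(2)]])
    then show False using \<open>x = 0\<close> by (simp add: x_def)
  qed
  \<comment> \<open>On vectors supported on \<open>K\<close> and \<open>t\<close> the element
    \<open>d\<close> multiplies the coordinate at \<open>t\<close> by \<open>x\<close>, so its
    square multiplies it by a positive number. Roots with zero coordinate there are fixed, hence
    \<open>d \<otimes> d\<close> inverts nothing.\<close>
  have sq: "d \<otimes> d = \<one>"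
  proof (rule inversions_empty)
    show c: "d \<otimes> d \<in> carrier W" using dc by simp
    have g2: "d \<otimes> d \<in> generate W (K \<union> {t})" by (rule generate.eng[OF dg dg])
    show "inversions (d \<otimes> d) = {}"
    proof (rule ccontr)
      assume "inversions (d \<otimes> d) \<noteq> {}"
      then obtain \<gamma> where h: "\<gamma> \<in> inversions (d \<otimes> d)" by blast
      have gp: "\<gamma> \<in> positive_roots" "\<gamma> \<in> Phi (K \<union> {t})" "\<gamma> \<in> V" "\<gamma> \<in> roots"
        using inversionsD(1)[OF h] inversions_generate[OF KtS g2] h by auto
      have e: "act (d \<otimes> d) \<gamma> = act d (act d \<gamma>)" using dc gp by (simp add: act_mult)
      have dp: "act d \<gamma> \<in> Phi (K \<union> {t})" by (rule generate_act_Phi[OF KtS dg gp(2)])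
      show False
      proof (cases "\<gamma> t = 0")
        case True
        then have "act d \<gamma> = \<gamma>" using expand[OF gp(3) PhiD(2)[OF gp(2)]] by (auto simp: lin_def)
        then show False using e inversionsD(2)[OF h] gp(1) by simp
      next
        case False
        then have "\<gamma> t > 0" using pos_nonneg[OF gp(1), of t] by simp
        moreover have "act d (act d \<gamma>) t = x * (x * \<gamma> t)"
          using coordt[OF root_V[OF PhiD(1)[OF dp]] PhiD(2)[OF dp]] coordt[OF gp(3) PhiD(2)[OF gp(2)]] by simp
        ultimately have "act d (act d \<gamma>) t > 0" using x0 by (simp add: mult.assoc[symmetric])
          (metis mult_pos_pos not_real_square_gt_zero)
        then have "act d (act d \<gamma>) \<in> positive_roots" by (rule pos_if_coord[rotated]) (use dc gp in simp)
        then show False using e inversionsD(2)[OF h] by simp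
      qed
    qed
  qed
  have ne: "d \<noteq> \<one>" using tN by auto
  have ax: "\<exists>c. act d (simple_root r) = lin 1 (simple_root r) c \<eta>" if r: "r \<in> S" for r
  proof (cases "r \<in> K \<union> {t}")
    case True
    have "simple_root r s = 0" if "s \<notin> K \<union> {t}" for s
      using that True by (intro simple_root_other) blast
    then have "act d (simple_root r) = lin 1 (simple_root r) (simple_root r t) \<eta>" unfolding \<eta>_def
      by (rule expand[OF simple_root_V[OF r]])
    then show ?thesis by blast
  next
    case False
    \<comment> \<open>The displacement \<open>y\<close> of the simple root of \<open>r\<close> is
      supported on \<open>K\<close> and \<open>t\<close>, and the involution \<open>d\<close>
      negates it. Comparison with the formula for such vectors gives minus one half of
      \<open>y t\<close> as its coefficient along \<eta>.\<close>
    define y where "y = lin 1 (act d (simple_root r)) (-1) (simple_root r)"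
    have yV: "y \<in> V" using dc r by (simp add: y_def)
    have ys: "y s = 0" if "s \<notin> K \<union> {t}" for s
      using generate_act_coord[OF KtS dg simple_root_V[OF r] that] by (simp add: y_def)
    have "act d y = lin 1 (act d (act d (simple_root r))) (-1) (act d (simple_root r))"
      unfolding y_def by (rule act_linear) (use dc r in simp_all)
    also have "act d (act d (simple_root r)) = simple_root r"
      using act_mult[OF dc dc simple_root_V[OF r]] sq r by simp
    finally have dy: "act d y = lin 1 (simple_root r) (-1) (act d (simple_root r))" .
    have "act d (simple_root r) p = simple_root r p + (- (y t / 2)) * \<eta> p" for p
    proof -
      have "act d y p = y p + y t * \<eta> p" using fun_cong[OF expand[OF yV ys], of p] by (simp add: \<eta>_def)
      moreover have "act d y p = simple_root r p - act d (simple_root r) p" using fun_cong[OF dy, of p] by simp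
      moreover have "y p = act d (simple_root r) p - simple_root r p" by (simp add: y_def)
      ultimately show ?thesis by (simp add: algebra_simps)
    qed
    then have "act d (simple_root r) = lin 1 (simple_root r) (- (y t / 2)) \<eta>" by (intro ext) simp
    then show ?thesis by blast
  qed
  then obtain c where c: "\<And>r. r \<in> S \<Longrightarrow> act d (simple_root r) = lin 1 (simple_root r) (c r) \<eta>" by metis
  have "\<exists>c. act d v = lin 1 v c \<eta>" if v: "v \<in> V" for v
  proof -
    let ?A = "{s. v s \<noteq> 0}"
    have fin: "finite ?A" "?A \<subseteq> S" using V_supp[OF v] by auto
    have "act d v r = v r + (\<Sum>s\<in>?A. v s * c s) * \<eta> r" for r
    proof -
      have "act d v r = (\<Sum>s\<in>?A. v s * act d (simple_root s) r)" by (rule act_expand[OF dc fin]) auto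
      also have "\<dots> = (\<Sum>s\<in>?A. v s * simple_root s r + v s * c s * \<eta> r)"
        by (rule sum.cong) (use c fin(2) in \<open>auto simp: algebra_simps\<close>)
      also have "\<dots> = (\<Sum>s\<in>?A. v s * simple_root s r) + (\<Sum>s\<in>?A. v s * c s) * \<eta> r"
        by (simp add: sum.distrib sum_distrib_right)
      also have "(\<Sum>s\<in>?A. v s * simple_root s r) = v r"
        by (rule linear_functional_expand[OF linear_functional_coord fin, symmetric]) auto
      finally show ?thesis .
    qed
    then have "act d v = lin 1 v (\<Sum>s\<in>?A. v s * c s) \<eta>" by (intro ext) simp
    then show ?thesis by blast
  qed
  from rank_one_involution[OF dc sq ne \<eta>V this] obtain \<delta>0 where d0: "\<delta>0 \<in> roots" "d = reflection \<delta>0" by blast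
  obtain \<delta> where de: "\<delta> \<in> positive_roots" "d = reflection \<delta>"
  proof (cases "\<delta>0 \<in> positive_roots")
    case True
    then show ?thesis using that d0 by blast
  next
    case False
    then show ?thesis using that[of "neg \<delta>0"] d0 neg_pos_iff[OF d0(1)] reflection_neg[OF d0(1)] by simp
  qed
  have dr: "\<delta> \<in> roots" using de by simp
  have "act d \<delta> = neg \<delta>" using act_reflection_self[OF dr] de by simp
  then have "\<delta> \<in> inversions d" using de(1) neg_pos_iff[OF dr] by (intro inversionsI) simp_all
  then have ph: "\<delta> \<in> Phi (K \<union> {t})" by (simp add: Nd)
  have "form \<delta> (simple_root k) = 0" if k: "k \<in> K" for k
  proof -
    have kS: "k \<in> S" using k K by blast
    obtain r where r: "\<delta> r \<noteq> 0" using root_nonzero[OF dr] .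
    have "act d (simple_root k) r = simple_root k r" using fixK[OF k] by (simp add: d_def)
    then show ?thesis using de(2) act_reflection[OF dr, of "simple_root k"] kS r by simp
  qed
  then show ?thesis using de ph unfolding d_def by blast
qed

section \<open>Transport of walls\<close>

text \<open>No cancellation: applying \<open>inv u\<close> to the image writes the simple root of
  \<open>k\<close> as a nonnegative combination of positive roots. Each contributing root is then
  supported at \<open>k\<close> alone, hence equal to that simple root.\<close>

lemma positive_bijection_simple:
  assumes u: "u \<in> carrier W" and K: "K \<subseteq> S" "K' \<subseteq> S"
    and 1: "\<And>k. k \<in> K \<Longrightarrow> act u (simple_root k) \<in> positive_roots \<and> act u (simple_root k) \<in> Phi K'"
    and 2: "\<And>k. k \<in> K' \<Longrightarrow> act (inv u) (simple_root k) \<in> positive_roots"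
    and k: "k \<in> K"
  shows "\<exists>k'\<in>K'. act u (simple_root k) = simple_root k'"
proof -
  have kS: "k \<in> S" using k K by blast
  let ?b = "act u (simple_root k)"
  have bp: "?b \<in> positive_roots" and bph: "?b \<in> Phi K'" using 1[OF k] by auto
  have bV: "?b \<in> V" using bp by simp
  obtain k' where k': "?b k' > 0" "k' \<in> S" using pos_coord_pos[OF bp] .
  have k'K: "k' \<in> K'" using PhiD(2)[OF bph, of k'] k'(1) by force
  let ?c = "act (inv u) (simple_root k')"
  have cp: "?c \<in> positive_roots" by (rule 2[OF k'K])
  have "?c r = 0" if r: "r \<noteq> k" for r
  proof -
    let ?A = "{s. ?b s \<noteq> 0}"
    have fin: "finite ?A" using V_supp(1)[OF bV] .
    have "(\<Sum>s\<in>?A. ?b s * act (inv u) (simple_root s) r) = act (inv u) ?b r"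
      by (rule act_expand[symmetric]) (use u fin V_supp(2)[OF bV] in auto)
    also have "\<dots> = 0" using u kS simple_root_other[of k r] r by simp
    finally have z: "(\<Sum>s\<in>?A. ?b s * act (inv u) (simple_root s) r) = 0" .
    have nn: "?b s * act (inv u) (simple_root s) r \<ge> 0" if s: "s \<in> ?A" for s
    proof (rule mult_nonneg_nonneg)
      show "?b s \<ge> 0" by (rule pos_nonneg[OF bp])
      have "s \<in> K'" using s PhiD(2)[OF bph, of s] by auto
      then show "act (inv u) (simple_root s) r \<ge> 0" using pos_nonneg[OF 2] by blast
    qed
    have "k' \<in> ?A" using k'(1) by simp
    moreover have "\<forall>s\<in>?A. ?b s * act (inv u) (simple_root s) r = 0"
      using sum_nonneg_eq_0_iff[OF fin, of "\<lambda>s. ?b s * act (inv u) (simple_root s) r"] nn z by blast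
    ultimately have "?b k' * ?c r = 0" by blast
    then show ?thesis using k'(1) by simp
  qed
  then have "?c = simple_root k" by (rule root_multiple_simple[OF cp kS])
  then have "?b = simple_root k'" using u k'(2) by (metis act_inv(2) simple_root_V)
  then show ?thesis using k'K by blast
qed

text \<open>Were the image of the simple root of \<open>s\<close> negative,
  \<open>deodhar_step\<close> would make every positive root on \<open>K\<close> and
  \<open>s\<close> that involves \<open>s\<close> negative. But \<delta> is such a root, and its
  image is positive. The support of the image is read off from \<delta> in the same way.\<close>

lemma transport_positive:
  assumes K: "K \<subseteq> S" "s \<in> S" "s \<notin> K" and K': "K' \<subseteq> S" "s' \<in> S"
    and d: "\<delta> \<in> positive_roots" "\<delta> \<in> Phi (K \<union> {s})" "\<And>k. k \<in> K \<Longrightarrow> form \<delta> (simple_root k) = 0"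
    and d': "\<delta>' \<in> positive_roots" "\<delta>' \<in> Phi (K' \<union> {s'})"
    and u: "u \<in> carrier W" "\<And>k. k \<in> K \<Longrightarrow> \<exists>k'\<in>K'. act u (simple_root k) = simple_root k'"
    and ud: "act u \<delta> = \<delta>'" and k: "k \<in> K \<union> {s}"
  shows "act u (simple_root k) \<in> positive_roots \<and> act u (simple_root k) \<in> Phi (K' \<union> {s'})"
proof (cases "k = s")
  case False
  then have "k \<in> K" using k by blast
  then obtain k' where "k' \<in> K'" "act u (simple_root k) = simple_root k'" using u(2) by blast
  then show ?thesis using K' simple_root_Phi[of k' "K' \<union> {s'}"] by auto
next
  case True
  let ?b = "act u (simple_root s)"
  have ds: "\<delta> s > 0" by (rule root_perp_coord[OF K(3) d])
  have dV: "\<delta> \<in> V" using d(1) by simp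
  have "?b r = 0" if r: "r \<notin> K' \<union> {s'}" for r
  proof -
    let ?A = "{k. \<delta> k \<noteq> 0}"
    have "act u \<delta> r = (\<Sum>k\<in>?A. \<delta> k * act u (simple_root k) r)"
      by (rule act_expand) (use u V_supp[OF dV] in auto)
    also have "\<dots> = \<delta> s * ?b r + (\<Sum>k\<in>?A - {s}. \<delta> k * act u (simple_root k) r)"
      by (rule sum.remove) (use V_supp(1)[OF dV] ds in auto)
    also have "(\<Sum>k\<in>?A - {s}. \<delta> k * act u (simple_root k) r) = 0"
    proof (rule sum.neutral, rule ballI)
      fix k assume k: "k \<in> ?A - {s}"
      then have "k \<in> K" using PhiD(2)[OF d(2), of k] by auto
      then obtain k' where k': "k' \<in> K'" "act u (simple_root k) = simple_root k'" using u(2) by blast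
      have "k' \<noteq> r" using k'(1) r by blast
      then show "\<delta> k * act u (simple_root k) r = 0" using k'(2) by (simp add: simple_root_other)
    qed
    finally have "\<delta> s * ?b r = 0" using ud PhiD(2)[OF d'(2) r] by simp
    then show ?thesis using ds by simp
  qed
  then have ph: "?b \<in> Phi (K' \<union> {s'})" using u(1) K(2) by (intro PhiI) simp_all
  have "?b \<in> positive_roots"
  proof (rule ccontr)
    assume n: "?b \<notin> positive_roots"
    have "\<exists>k'\<in>S. act u (simple_root k) = simple_root k'" if "k \<in> K" for k using u(2)[OF that] K' by blast
    then have "inversions (elementary_move K s) \<subseteq> inversions u" by (rule deodhar_step(2)[OF K u(1) _ n])
    moreover have "\<delta> \<in> inversions (elementary_move K s)" using inversions_elementary_move[OF K loop_root(1)[OF K d]] d ds by simp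
    ultimately show False using inversionsD(2)[of \<delta> u] ud d'(1) by blast
  qed
  then show ?thesis using ph True by simp
qed

text \<open>Knowing \<open>u\<close> on \<open>K\<close> and on the perpendicular root suffices to
  control it on the extra generator: \<open>transport_positive\<close> holds for \<open>u\<close>
  and for its inverse, as the situation is symmetric.\<close>

lemma transport_simple:
  assumes K: "K \<subseteq> S" "s \<in> S" "s \<notin> K" and K': "K' \<subseteq> S" "s' \<in> S" "s' \<notin> K'"
    and d: "\<delta> \<in> positive_roots" "\<delta> \<in> Phi (K \<union> {s})" "\<And>k. k \<in> K \<Longrightarrow> form \<delta> (simple_root k) = 0"
    and d': "\<delta>' \<in> positive_roots" "\<delta>' \<in> Phi (K' \<union> {s'})" "\<And>k. k \<in> K' \<Longrightarrow> form \<delta>' (simple_root k) = 0"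
    and u: "u \<in> carrier W" "\<And>k. k \<in> K \<Longrightarrow> \<exists>k'\<in>K'. act u (simple_root k) = simple_root k'"
      "\<And>k'. k' \<in> K' \<Longrightarrow> \<exists>k\<in>K. act u (simple_root k) = simple_root k'"
    and ud: "act u \<delta> = \<delta>'" and k: "k \<in> K \<union> {s}"
  shows "\<exists>k'\<in>K' \<union> {s'}. act u (simple_root k) = simple_root k'"
proof (rule positive_bijection_simple[OF u(1) _ _ _ _ k])
  show "K \<union> {s} \<subseteq> S" "K' \<union> {s'} \<subseteq> S" using K K' by auto
  show "act u (simple_root k) \<in> positive_roots \<and> act u (simple_root k) \<in> Phi (K' \<union> {s'})"
    if "k \<in> K \<union> {s}" for k
    by (rule transport_positive[OF K K'(1,2) d d'(1,2) u(1,2) ud that])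
  have iu: "inv u \<in> carrier W" using u(1) by simp
  have "act (inv u) (simple_root k') \<in> positive_roots \<and> act (inv u) (simple_root k') \<in> Phi (K \<union> {s})"
    if "k' \<in> K' \<union> {s'}" for k'
  proof (rule transport_positive[OF K' K(1,2) d' d(1,2) iu _ _ that])
    show "\<exists>k\<in>K. act (inv u) (simple_root k') = simple_root k" if k': "k' \<in> K'" for k'
    proof -
      obtain k where k: "k \<in> K" "act u (simple_root k) = simple_root k'" using u(3)[OF k'] by blast
      have "act (inv u) (simple_root k') = simple_root k"
        using act_inv(1)[OF u(1), of "simple_root k"] k K by auto
      then show ?thesis using k(1) by blast
    qed
    show "act (inv u) \<delta>' = \<delta>" using ud act_inv(1)[OF u(1), of \<delta>] d(1) by auto
  qed
  then show "act (inv u) (simple_root k') \<in> positive_roots" if "k' \<in> K' \<union> {s'}" for k' using that by blast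
qed

text \<open>The move injects the component without \<open>t\<close> into the component, so by
  counting exactly one element is missed, and that is \<open>t'\<close>. The inverse keeps the
  simple roots of \<open>K1\<close> simple, hence \<open>deodhar_step\<close> compares it with the
  elementary move at \<open>t'\<close>.\<close>

lemma elementary_move_reverse:
  assumes K: "K \<subseteq> S" "t \<in> S" "t \<notin> K" and ft: "finite_type (component K t)"
    and K1: "K1 = {k'. \<exists>k\<in>K. act (elementary_move K t) (simple_root k) = simple_root k'}"
  shows "\<exists>t'. t' \<in> S \<and> t' \<notin> K1 \<and> K1 \<union> {t'} = K \<union> {t} \<and> component K1 t' = component K t \<and>
    elementary_move K1 t' = inv (elementary_move K t) \<and> act (inv (elementary_move K t)) (simple_root t') \<notin> positive_roots"
proof -
  define L where "L = component K t"
  define d where "d = elementary_move K t"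
  have LS: "L \<subseteq> S" using component_S[OF K(1,2)] by (simp add: L_def)
  have dc: "d \<in> carrier W" using elementary_move_carrier[OF K(1,2) ft] by (simp add: d_def)
  have idc: "inv d \<in> carrier W" using dc by simp
  have finL: "finite L" using finite_type_finite[OF ft] by (simp add: L_def)
  have tL: "t \<in> L" using component_self by (simp add: L_def)
  have LK: "L \<subseteq> K \<union> {t}" using component_subset by (simp add: L_def)
  have ex: "\<forall>k\<in>L - {t}. \<exists>k'. k' \<in> L \<and> act d (simple_root k) = simple_root k'"
  proof
    fix k assume k: "k \<in> L - {t}"
    then have "k \<in> K" using LK by blast
    then show "\<exists>k'. k' \<in> L \<and> act d (simple_root k) = simple_root k'"
      using elementary_move_simple(1)[OF K ft] k unfolding L_def d_def by blast
  qed
  obtain \<phi> where \<phi>: "\<And>k. k \<in> L - {t} \<Longrightarrow> \<phi> k \<in> L \<and> act d (simple_root k) = simple_root (\<phi> k)"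
    using bchoice[OF ex] by blast
  have inj: "inj_on \<phi> (L - {t})"
  proof (rule inj_onI)
    fix a b assume ab: "a \<in> L - {t}" "b \<in> L - {t}" "\<phi> a = \<phi> b"
    then have "act d (simple_root a) = act d (simple_root b)" using \<phi> by simp
    then have "simple_root a = simple_root b" by (rule act_inj[OF dc, rotated 2]) (use ab LS in auto)
    then show "a = b" by (simp add: simple_root_inj)
  qed
  have sub: "\<phi> ` (L - {t}) \<subseteq> L" using \<phi> by blast
  have "card (\<phi> ` (L - {t})) = card L - 1" using card_image[OF inj] tL finL by simp
  moreover have "card L \<ge> 1" using tL finL by (metis One_nat_def Suc_leI card_gt_0_iff empty_iff)
  ultimately have "card (L - \<phi> ` (L - {t})) = 1"
    using card_Diff_subset[OF finite_subset[OF sub finL] sub] by simp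
  then obtain t' where t': "L - \<phi> ` (L - {t}) = {t'}" using card_1_singletonE by blast
  have K1e: "K1 = \<phi> ` (L - {t}) \<union> (K - L)"
  proof (intro equalityI subsetI)
    fix x assume "x \<in> K1"
    then obtain k where k: "k \<in> K" "act d (simple_root k) = simple_root x" unfolding K1 d_def by blast
    show "x \<in> \<phi> ` (L - {t}) \<union> (K - L)"
    proof (cases "k \<in> L")
      case True
      then have kl: "k \<in> L - {t}" using k K by blast
      then have "x = \<phi> k" using \<phi>[OF kl] k(2) simple_root_inj by metis
      then show ?thesis using kl by blast
    next
      case False
      then have "act d (simple_root k) = simple_root k"
        using elementary_move_simple(2)[OF K ft k(1)] unfolding L_def d_def by blast
      then have "x = k" using k(2) simple_root_inj by metis
      then show ?thesis using k False by blast
    qed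
  next
    fix x assume "x \<in> \<phi> ` (L - {t}) \<union> (K - L)"
    then show "x \<in> K1"
    proof
      assume "x \<in> \<phi> ` (L - {t})"
      then obtain k where k: "k \<in> L - {t}" "x = \<phi> k" by blast
      moreover have "k \<in> K" using k LK by blast
      ultimately show ?thesis using \<phi>[OF k(1)] unfolding K1 d_def by blast
    next
      assume "x \<in> K - L"
      then show ?thesis using elementary_move_simple(2)[OF K ft] unfolding K1 L_def d_def by blast
    qed
  qed
  have t'L: "t' \<in> L" using t' by blast
  have t'K1: "t' \<notin> K1" using t' unfolding K1e by blast
  have t'S: "t' \<in> S" using t'L LS by blast
  have K1t: "K1 \<union> {t'} = K \<union> {t}" using t' LK tL sub K(3) unfolding K1e by blast
  have cc: "component K1 t' = L" using component_cong[OF K1t] t'L unfolding L_def by blast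
  have K1S: "K1 \<subseteq> S" using K1t K by blast
  have ft1: "finite_type (component K1 t')" using ft cc by (simp add: L_def)
  have inv_simple: "\<exists>k'\<in>S. act (inv d) (simple_root k) = simple_root k'" if k: "k \<in> K1" for k
  proof -
    obtain k0 where k0: "k0 \<in> K" "act d (simple_root k0) = simple_root k" using k unfolding K1 d_def by blast
    have "k0 \<in> S" using k0 K by blast
    then have "act (inv d) (simple_root k) = simple_root k0"
      using act_inv(1)[OF dc, of "simple_root k0"] k0 by simp
    then show ?thesis using \<open>k0 \<in> S\<close> by blast
  qed
  have idg: "inv d \<in> generate W L"
    using generate_inv[OF LS] elementary_move_generate[OF K(1,2) ft] by (simp add: L_def d_def)
  have tN: "simple_root t \<in> inversions d"
    using inversions_elementary_move[OF K ft] K(2) simple_root_Phi[of t "K \<union> {t}"] by (simp add: d_def)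
  have "inv d \<noteq> \<one>" using tN dc by (metis inversions_one empty_iff inv_inv inv_one)
  \<comment> \<open>Some simple root is inverted by the inverse. It belongs to the component by its
    support and not to \<open>K1\<close>, where images are simple; so \<open>t'\<close> is the only
    candidate.\<close>
  then obtain r where r: "r \<in> S" "simple_root r \<in> inversions (inv d)" using descent_exists[OF idc] by blast
  have rL: "r \<in> L"
  proof (rule ccontr)
    assume "r \<notin> L"
    then have "simple_root r r = 0" using inversions_generate[OF LS idg] r(2) PhiD(2) by blast
    then show False by simp
  qed
  have "r \<notin> K1" using inv_simple[of r] inversionsD(2)[OF r(2)] simple_root_pos by metis
  then have rt: "r = t'" using rL t' unfolding K1e by blast
  have np: "act (inv d) (simple_root t') \<notin> positive_roots" using inversionsD(2)[OF r(2)] rt by simp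
  have sub1: "inversions (elementary_move K1 t') \<subseteq> inversions (inv d)" by (rule deodhar_step(2)[OF K1S t'S t'K1 idc inv_simple np])
  have "inversions (inv d) \<subseteq> inversions (elementary_move K1 t')"
  proof
    fix \<gamma> assume g: "\<gamma> \<in> inversions (inv d)"
    have gp: "\<gamma> \<in> positive_roots" using inversionsD(1)[OF g] .
    have ph: "\<gamma> \<in> Phi (K1 \<union> {t'})" using inversions_generate[OF LS idg] g Phi_mono[of \<gamma> L "K1 \<union> {t'}"] LK K1t by blast
    have "\<gamma> t' > 0"
    proof (rule ccontr)
      assume "\<not> \<gamma> t' > 0"
      then have "\<gamma> t' = 0" using pos_nonneg[OF gp, of t'] by simp
      then have phK: "\<gamma> \<in> Phi K1" using ph by (auto simp: Phi_def)
      have "act (inv d) \<gamma> \<in> positive_roots"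
      proof (rule act_pos_combination[OF gp phK idc])
        fix k q assume "k \<in> K1"
        then obtain k' where "act (inv d) (simple_root k) = simple_root k'" using inv_simple by blast
        then show "act (inv d) (simple_root k) q \<ge> 0" by (simp add: simple_root_nonneg)
      qed
      then show False using inversionsD(2)[OF g] by simp
    qed
    then show "\<gamma> \<in> inversions (elementary_move K1 t')" using inversions_elementary_move[OF K1S t'S t'K1 ft1] gp ph by simp
  qed
  then have "elementary_move K1 t' = inv d"
    using inversions_eq_imp[OF elementary_move_carrier[OF K1S t'S ft1] idc] sub1 by blast
  then show ?thesis using t'S t'K1 K1t cc np unfolding L_def d_def by blast
qed

end

section \<open>The groupoid and its graph\<close>

context coxeter_groupoid
begin

lemma vertexD:
  assumes "x \<in> vertices"
  shows "x \<in> extensional \<Lambda>" "x ` \<Lambda> \<subseteq> S" "inj_on x \<Lambda>" "l \<in> \<Lambda> \<Longrightarrow> x l \<in> S"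
  using assms unfolding vertices_def injections_def by (auto simp: PiE_def)

lemma CD: "w \<in> C x y \<Longrightarrow> w \<in> carrier W"
  "w \<in> C x y \<Longrightarrow> l \<in> \<Lambda> \<Longrightarrow> act w (simple_root (y l)) = simple_root (x l)"
  unfolding C_def by auto

lemma CI: "w \<in> carrier W \<Longrightarrow> (\<And>l. l \<in> \<Lambda> \<Longrightarrow> act w (simple_root (y l)) = simple_root (x l)) \<Longrightarrow> w \<in> C x y"
  unfolding C_def by simp

lemma C_one: "x \<in> vertices \<Longrightarrow> \<one> \<in> C x x"
  by (rule CI) (simp_all add: vertexD)

lemma C_mult: assumes "w \<in> C x y" "v \<in> C y z" "z \<in> vertices" shows "w \<otimes> v \<in> C x z"
proof (rule CI)
  show "w \<otimes> v \<in> carrier W" using assms CD by simp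
  show "act (w \<otimes> v) (simple_root (z l)) = simple_root (x l)" if "l \<in> \<Lambda>" for l
    using act_mult[OF CD(1)[OF assms(1)] CD(1)[OF assms(2)], of "simple_root (z l)"]
      vertexD(4)[OF assms(3) that] CD(2)[OF assms(1) that] CD(2)[OF assms(2) that] by simp
qed

lemma C_inv: assumes "w \<in> C x y" "y \<in> vertices" shows "inv w \<in> C y x"
proof (rule CI)
  show "inv w \<in> carrier W" using assms CD by simp
  show "act (inv w) (simple_root (x l)) = simple_root (y l)" if "l \<in> \<Lambda>" for l
    using act_inv(1)[OF CD(1)[OF assms(1)], of "simple_root (y l)"]
      vertexD(4)[OF assms(2) that] CD(2)[OF assms(1) that] by simp
qed

lemma C_target_unique:
  assumes "w \<in> C x y" "w \<in> C x' y" "x \<in> vertices" "x' \<in> vertices" shows "x = x'"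
proof (rule extensionalityI[OF vertexD(1)[OF assms(3)] vertexD(1)[OF assms(4)]])
  fix l assume l: "l \<in> \<Lambda>"
  then show "x l = x' l" using CD(2)[OF assms(1) l] CD(2)[OF assms(2) l] simple_root_inj by metis
qed

abbreviation perp :: "('l \<Rightarrow> 'a) \<Rightarrow> ('a \<Rightarrow> real) set" where "perp x \<equiv> perp_roots (x ` \<Lambda>)"

lemma perpD: "\<gamma> \<in> perp x \<Longrightarrow> \<gamma> \<in> roots" "\<gamma> \<in> perp x \<Longrightarrow> k \<in> x ` \<Lambda> \<Longrightarrow> form \<gamma> (simple_root k) = 0"
  unfolding perp_roots_def by auto

lemma perpI: "\<gamma> \<in> roots \<Longrightarrow> (\<And>k. k \<in> x ` \<Lambda> \<Longrightarrow> form \<gamma> (simple_root k) = 0) \<Longrightarrow> \<gamma> \<in> perp x"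
  unfolding perp_roots_def by auto

lemma perp_neg: assumes "\<gamma> \<in> perp x" "x \<in> vertices" shows "neg \<gamma> \<in> perp x"
proof (rule perpI)
  show "neg \<gamma> \<in> roots" using perpD(1)[OF assms(1)] by simp
  fix k assume k: "k \<in> x ` \<Lambda>"
  then have "k \<in> S" using vertexD(2)[OF assms(2)] by blast
  then show "form (neg \<gamma>) (simple_root k) = 0"
    using perpD[OF assms(1)] k by (simp add: form_neg_left)
qed

lemma act_perp:
  assumes "w \<in> C x y" "y \<in> vertices" "\<gamma> \<in> perp y" shows "act w \<gamma> \<in> perp x"
proof (rule perpI)
  note w = CD(1)[OF assms(1)]
  have r: "\<gamma> \<in> roots" using perpD(1)[OF assms(3)] .
  show "act w \<gamma> \<in> roots" using w r by simp
  fix k assume "k \<in> x ` \<Lambda>"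
  then obtain l where l: "l \<in> \<Lambda>" "k = x l" by blast
  have "form (act w \<gamma>) (simple_root k) = form (act w \<gamma>) (act w (simple_root (y l)))"
    using CD(2)[OF assms(1) l(1)] l(2) by simp
  also have "\<dots> = form \<gamma> (simple_root (y l))"
    by (rule act_form) (use w r vertexD(4)[OF assms(2) l(1)] in simp_all)
  also have "\<dots> = 0" using perpD(2)[OF assms(3)] l(1) by simp
  finally show "form (act w \<gamma>) (simple_root k) = 0" .
qed

lemma YD: "w \<in> Y x y \<Longrightarrow> w \<in> C x y"
  "w \<in> Y x y \<Longrightarrow> \<gamma> \<in> perp y \<Longrightarrow> \<gamma> \<in> positive_roots \<Longrightarrow> act w \<gamma> \<in> positive_roots"
  unfolding Y_def by auto

lemma YI: "w \<in> C x y \<Longrightarrow> (\<And>\<gamma>. \<gamma> \<in> perp y \<Longrightarrow> \<gamma> \<in> positive_roots \<Longrightarrow> act w \<gamma> \<in> positive_roots) \<Longrightarrow> w \<in> Y x y"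
  unfolding Y_def by auto

lemma Y_carrier: "w \<in> Y x y \<Longrightarrow> w \<in> carrier W"
  using YD(1) CD(1) by blast

lemma Y_one: "x \<in> vertices \<Longrightarrow> \<one> \<in> Y x x"
  by (rule YI) (simp_all add: C_one)

lemma Y_mult: assumes "w \<in> Y x y" "v \<in> Y y z" "y \<in> vertices" "z \<in> vertices" shows "w \<otimes> v \<in> Y x z"
proof (rule YI)
  show "w \<otimes> v \<in> C x z" by (rule C_mult[OF YD(1)[OF assms(1)] YD(1)[OF assms(2)] assms(4)])
  fix \<gamma> assume g: "\<gamma> \<in> perp z" "\<gamma> \<in> positive_roots"
  have "act w (act v \<gamma>) \<in> positive_roots"
    by (rule YD(2)[OF assms(1) act_perp[OF YD(1)[OF assms(2)] assms(4) g(1)] YD(2)[OF assms(2) g]])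
  then show "act (w \<otimes> v) \<gamma> \<in> positive_roots"
    using act_mult[OF Y_carrier[OF assms(1)] Y_carrier[OF assms(2)]] g by simp
qed

lemma Y_pos_iff:
  assumes "w \<in> Y x y" "y \<in> vertices" "\<gamma> \<in> perp y"
  shows "act w \<gamma> \<in> positive_roots \<longleftrightarrow> \<gamma> \<in> positive_roots"
proof (cases "\<gamma> \<in> positive_roots")
  case True
  then show ?thesis using YD(2)[OF assms(1,3)] by simp
next
  case False
  have r: "\<gamma> \<in> roots" using perpD(1)[OF assms(3)] .
  note w = Y_carrier[OF assms(1)]
  have "neg \<gamma> \<in> positive_roots" using False neg_pos_iff[OF r] by simp
  then have "act w (neg \<gamma>) \<in> positive_roots" by (rule YD(2)[OF assms(1) perp_neg[OF assms(3,2)]])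
  then have "neg (act w \<gamma>) \<in> positive_roots" using act_neg[OF w] r by simp
  then show ?thesis using False neg_pos_iff[of "act w \<gamma>"] r w by simp
qed

lemma Y_inv: assumes "w \<in> Y x y" "x \<in> vertices" "y \<in> vertices" shows "inv w \<in> Y y x"
proof (rule YI)
  note w = Y_carrier[OF assms(1)]
  show c: "inv w \<in> C y x" by (rule C_inv[OF YD(1)[OF assms(1)] assms(3)])
  fix \<gamma> assume g: "\<gamma> \<in> perp x" "\<gamma> \<in> positive_roots"
  have p: "act (inv w) \<gamma> \<in> perp y" by (rule act_perp[OF c assms(2) g(1)])
  have "act w (act (inv w) \<gamma>) \<in> positive_roots" using w g by simp
  then show "act (inv w) \<gamma> \<in> positive_roots" using Y_pos_iff[OF assms(1,3) p] by simp
qed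

section \<open>Edges, their reversal, and loops\<close>

lemma edge_elt_elementary_move: "edge_elt (x, s) = elementary_move (x ` \<Lambda>) s"
  by (simp add: elementary_move_def)

declare edge_elt.simps [simp del]

lemma edgeD:
  assumes "(x, s) \<in> edges"
  shows "x \<in> vertices" "s \<in> S" "s \<notin> x ` \<Lambda>" "finite_type (component (x ` \<Lambda>) s)" "x ` \<Lambda> \<subseteq> S"
  using assms vertexD(2) unfolding edges_def by auto

lemma edge_elt_closed: "e \<in> edges \<Longrightarrow> edge_elt e \<in> carrier W"
  by (cases e) (use edgeD elementary_move_carrier in \<open>auto simp: edge_elt_elementary_move\<close>)

lemma vertex_of_simple:
  assumes x: "x \<in> vertices" and dc: "d \<in> carrier W"
    and simple: "\<And>k. k \<in> x ` \<Lambda> \<Longrightarrow> \<exists>k'\<in>S. act d (simple_root k) = simple_root k'"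
  shows "\<exists>y. y \<in> vertices \<and> d \<in> C y x"
proof -
  have "\<forall>l\<in>\<Lambda>. \<exists>k'. k' \<in> S \<and> act d (simple_root (x l)) = simple_root k'"
    using simple by blast
  from bchoice[OF this] obtain f where f: "\<forall>l\<in>\<Lambda>. f l \<in> S \<and> act d (simple_root (x l)) = simple_root (f l)" by blast
  define y where "y = restrict f \<Lambda>"
  have yl: "y l \<in> S" "act d (simple_root (x l)) = simple_root (y l)" if "l \<in> \<Lambda>" for l
    using f that by (auto simp: y_def)
  have dC: "d \<in> C y x" using yl dc by (intro CI) auto
  have "inj_on y \<Lambda>"
  proof (rule inj_onI)
    fix l m assume lm: "l \<in> \<Lambda>" "m \<in> \<Lambda>" "y l = y m"
    then have "act d (simple_root (x l)) = act d (simple_root (x m))" using yl by simp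
    then have "simple_root (x l) = simple_root (x m)"
      by (rule act_inj[OF dc, rotated 2]) (use lm vertexD(4)[OF x] in auto)
    then show "l = m" using lm vertexD(3)[OF x] by (simp add: simple_root_inj inj_on_eq_iff)
  qed
  then have "y \<in> injections" using yl(1) by (auto simp: injections_def y_def)
  moreover obtain w where w: "w \<in> C x xI" using x unfolding vertices_def by blast
  moreover have "d \<otimes> w \<in> C y xI"
  proof (rule CI)
    have "xI ` \<Lambda> \<subseteq> S" using xI_bij I_subset by (auto simp: bij_betw_def)
    then show "act (d \<otimes> w) (simple_root (xI l)) = simple_root (y l)" if l: "l \<in> \<Lambda>" for l
      using act_mult[OF dc CD(1)[OF w], of "simple_root (xI l)"] CD(2)[OF w l]
        yl(2)[OF l] l by auto
  qed (use dc CD w in simp)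
  ultimately have "y \<in> vertices" unfolding vertices_def by blast
  then show ?thesis using dC by blast
qed

lemma target_exists:
  assumes e: "(x, s) \<in> edges"
  shows "\<exists>y. y \<in> vertices \<and> edge_elt (x, s) \<in> C y x"
proof (rule vertex_of_simple[OF edgeD(1)[OF e] edge_elt_closed[OF e]])
  note E = edgeD[OF e]
  fix k assume "k \<in> x ` \<Lambda>"
  from elementary_move_simple'[OF E(5,2,3,4) this] show "\<exists>k'\<in>S. act (edge_elt (x, s)) (simple_root k) = simple_root k'"
    using E(5,2) unfolding edge_elt_elementary_move by blast
qed

lemma target_props:
  assumes "e \<in> edges" shows "target e \<in> vertices" "edge_elt e \<in> C (target e) (source e)"
proof -
  obtain x s where e: "e = (x, s)" by (cases e)
  obtain y where y: "y \<in> vertices" "edge_elt e \<in> C y (source e)"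
    using target_exists assms unfolding e source_def by auto
  have "\<exists>!y. y \<in> vertices \<and> edge_elt e \<in> C y (source e)"
    using y C_target_unique[OF y(2)] by blast
  from theI'[OF this] show "target e \<in> vertices" "edge_elt e \<in> C (target e) (source e)"
    unfolding target_def by auto
qed

lemma target_eqI: "e \<in> edges \<Longrightarrow> y \<in> vertices \<Longrightarrow> edge_elt e \<in> C y (source e) \<Longrightarrow> target e = y"
  using C_target_unique[OF target_props(2)] target_props(1) by blast

lemma source_vertex: "e \<in> edges \<Longrightarrow> source e \<in> vertices"
  by (cases e) (simp add: source_def edgeD)

lemma target_image:
  assumes "(x, s) \<in> edges"
  shows "target (x, s) ` \<Lambda> = {k'. \<exists>k\<in>x ` \<Lambda>. act (elementary_move (x ` \<Lambda>) s) (simple_root k) = simple_root k'}"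
proof -
  have c: "l \<in> \<Lambda> \<Longrightarrow> act (elementary_move (x ` \<Lambda>) s) (simple_root (x l)) = simple_root (target (x, s) l)" for l
    using CD(2)[OF target_props(2)[OF assms]] by (simp add: source_def edge_elt_elementary_move)
  show ?thesis
  proof (intro equalityI subsetI)
    fix k' assume "k' \<in> target (x, s) ` \<Lambda>"
    then show "k' \<in> {k'. \<exists>k\<in>x ` \<Lambda>. act (elementary_move (x ` \<Lambda>) s) (simple_root k) = simple_root k'}"
      using c by blast
  next
    fix k' assume "k' \<in> {k'. \<exists>k\<in>x ` \<Lambda>. act (elementary_move (x ` \<Lambda>) s) (simple_root k) = simple_root k'}"
    then obtain l where l: "l \<in> \<Lambda>" "act (elementary_move (x ` \<Lambda>) s) (simple_root (x l)) = simple_root k'" by blast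
    then have "k' = target (x, s) l" using c[OF l(1)] simple_root_inj by metis
    then show "k' \<in> target (x, s) ` \<Lambda>" using l(1) by blast
  qed
qed

text \<open>The clause about the negative image of a simple root is what later prevents a
  length-adding decomposition from undoing its previous edge.\<close>

lemma reverse_edge_props:
  assumes "e \<in> edges"
  shows "reverse_edge e \<in> edges" "edge_elt (reverse_edge e) = inv (edge_elt e)"
    "source (reverse_edge e) = target e" "target (reverse_edge e) = source e"
    "target e ` \<Lambda> \<union> {snd (reverse_edge e)} = source e ` \<Lambda> \<union> {snd e}"
    "component (target e ` \<Lambda>) (snd (reverse_edge e)) = component (source e ` \<Lambda>) (snd e)"
    "act (inv (edge_elt e)) (simple_root (snd (reverse_edge e))) \<notin> positive_roots"
    "reverse_edge (reverse_edge e) = e"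
proof -
  obtain x s where e: "e = (x, s)" by (cases e)
  have ex: "(x, s) \<in> edges" using assms e by simp
  note E = edgeD[OF ex]
  define y where "y = target e"
  have y: "y \<in> vertices" "edge_elt e \<in> C y x" using target_props[OF assms] by (simp_all add: y_def e source_def)
  have yi: "y ` \<Lambda> = {k'. \<exists>k\<in>x ` \<Lambda>. act (elementary_move (x ` \<Lambda>) s) (simple_root k) = simple_root k'}"
    unfolding y_def e by (rule target_image[OF ex])
  from elementary_move_reverse[OF E(5,2,3,4) yi] obtain t where t: "t \<in> S" "t \<notin> y ` \<Lambda>" "y ` \<Lambda> \<union> {t} = x ` \<Lambda> \<union> {s}"
    "component (y ` \<Lambda>) t = component (x ` \<Lambda>) s" "elementary_move (y ` \<Lambda>) t = inv (elementary_move (x ` \<Lambda>) s)"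
    "act (inv (elementary_move (x ` \<Lambda>) s)) (simple_root t) \<notin> positive_roots" by blast
  have "(THE t. t \<in> (source e ` \<Lambda> \<union> {snd e}) - target e ` \<Lambda>) = t"
    by (rule the_equality) (use t(2,3) in \<open>auto simp: e source_def y_def\<close>)
  then have re: "reverse_edge e = (y, t)" unfolding reverse_edge_def y_def by simp
  have edge: "(y, t) \<in> edges" using y t E(4) unfolding edges_def by simp
  have ye: "edge_elt (y, t) = inv (edge_elt e)" using t(5) by (simp add: e edge_elt_elementary_move)
  have ty: "target (y, t) = x"
    by (rule target_eqI[OF edge E(1)]) (use C_inv[OF y(2) E(1)] ye in \<open>simp add: source_def\<close>)
  have "(THE t'. t' \<in> (y ` \<Lambda> \<union> {t}) - x ` \<Lambda>) = s"
    by (rule the_equality) (use t(3) E(3) in auto)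
  then have "reverse_edge (y, t) = e" unfolding reverse_edge_def by (simp add: ty source_def e)
  then show "reverse_edge (reverse_edge e) = e" by (simp add: re)
  show "reverse_edge e \<in> edges" "edge_elt (reverse_edge e) = inv (edge_elt e)"
    "source (reverse_edge e) = target e" "target (reverse_edge e) = source e"
    "target e ` \<Lambda> \<union> {snd (reverse_edge e)} = source e ` \<Lambda> \<union> {snd e}"
    "component (target e ` \<Lambda>) (snd (reverse_edge e)) = component (source e ` \<Lambda>) (snd e)"
    "act (inv (edge_elt e)) (simple_root (snd (reverse_edge e))) \<notin> positive_roots"
    using edge ye ty t by (simp_all add: re y_def[symmetric]) (simp_all add: source_def e edge_elt_elementary_move)
qed

lemma loopD: assumes "e \<in> loops" shows "e \<in> edges" "target e = source e"
  using assms unfolding loops_def by auto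

lemma reverse_nonloop: assumes "e \<in> edges - loops" shows "reverse_edge e \<in> edges - loops"
  using assms reverse_edge_props(1,3,4,8)[of e] unfolding loops_def by auto

lemma loop_root_exists:
  assumes "(x, s) \<in> loops"
  shows "\<exists>\<delta>. \<delta> \<in> positive_roots \<and> \<delta> \<in> Phi (x ` \<Lambda> \<union> {s}) \<and> \<delta> \<in> perp x \<and> edge_elt (x, s) = reflection \<delta>"
proof -
  note E = edgeD[OF loopD(1)[OF assms]]
  have "edge_elt (x, s) \<in> C x x"
    using target_props(2)[OF loopD(1)[OF assms]] loopD(2)[OF assms] by (simp add: source_def)
  then have "act (elementary_move (x ` \<Lambda>) s) (simple_root k) = simple_root k" if "k \<in> x ` \<Lambda>" for k
    using that CD(2) by (auto simp: edge_elt_elementary_move)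
  from loop_reflection[OF E(5,2,3,4) this] show ?thesis
    by (auto simp: edge_elt_elementary_move intro!: perpI)
qed

text \<open>The positive root of the reflection that a loop represents. It is unique by
  \<open>reflection_inj\<close>; support and perpendicularity are built into the choice because they
  describe the wall.\<close>

definition lroot :: "('l \<Rightarrow> 'a) \<times> 'a \<Rightarrow> ('a \<Rightarrow> real)" where
  "lroot e = (SOME \<delta>. \<delta> \<in> positive_roots \<and> \<delta> \<in> Phi (fst e ` \<Lambda> \<union> {snd e}) \<and> \<delta> \<in> perp (fst e) \<and>
     edge_elt e = reflection \<delta>)"

lemma lroot_props:
  assumes "(x, s) \<in> loops"
  shows "lroot (x, s) \<in> positive_roots" "lroot (x, s) \<in> Phi (x ` \<Lambda> \<union> {s})" "lroot (x, s) \<in> perp x"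
    "edge_elt (x, s) = reflection (lroot (x, s))"
  using someI_ex[OF loop_root_exists[OF assms]] unfolding lroot_def by auto

lemma lroot_coord: assumes "(x, s) \<in> loops" shows "lroot (x, s) s > 0"
  using root_perp_coord[OF edgeD(3)[OF loopD(1)[OF assms]] lroot_props(1,2)[OF assms]]
    perpD(2)[OF lroot_props(3)[OF assms]] by blast

text \<open>Converse of \<open>loop_root_exists\<close>, and the way in which loops are recognised:
  a perpendicular root of the right support already forces finite type and turns the edge into a
  loop.\<close>

lemma loopI:
  assumes "x \<in> vertices" "s \<in> S" "s \<notin> x ` \<Lambda>" "\<delta> \<in> positive_roots" "\<delta> \<in> Phi (x ` \<Lambda> \<union> {s})" "\<delta> \<in> perp x"
  shows "(x, s) \<in> loops" "lroot (x, s) = \<delta>"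
proof -
  note lr = loop_root[OF vertexD(2)[OF assms(1)] assms(2,3,4,5) perpD(2)[OF assms(6)]]
  have e: "(x, s) \<in> edges" using assms lr(1) unfolding edges_def by simp
  have ee: "edge_elt (x, s) = reflection \<delta>" using lr(2) by (simp add: edge_elt_elementary_move)
  have dr: "\<delta> \<in> roots" using assms(4) by simp
  have "reflection \<delta> \<in> C x x"
  proof (rule CI)
    fix l assume l: "l \<in> \<Lambda>"
    show "act (reflection \<delta>) (simple_root (x l)) = simple_root (x l)"
      by (rule reflection_fixes[OF dr]) (use perpD(2)[OF assms(6)] vertexD(4)[OF assms(1) l] l in auto)
  qed (use dr in simp)
  then have "target (x, s) = x" by (intro target_eqI[OF e assms(1)]) (simp add: ee source_def)
  then show l: "(x, s) \<in> loops" using e unfolding loops_def by (simp add: source_def)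
  show "lroot (x, s) = \<delta>"
    using reflection_inj[OF lroot_props(1)[OF l] assms(4)] lroot_props(4)[OF l] ee by simp
qed

lemma inversions_edge:
  assumes "(x, s) \<in> edges"
  shows "inversions (edge_elt (x, s)) = {\<gamma> \<in> positive_roots. \<gamma> \<in> Phi (x ` \<Lambda> \<union> {s}) \<and> \<gamma> s > 0}"
  using inversions_elementary_move[OF edgeD(5,2,3,4)[OF assms]] by (simp add: edge_elt_elementary_move)

text \<open>A perpendicular root inverted by the edge would be supported on the vertex and
  \<open>s\<close>, which by \<open>loopI\<close> would make the edge a loop.\<close>

lemma nonloop_Y: assumes "e \<in> edges - loops" shows "edge_elt e \<in> Y (target e) (source e)"
proof (rule YI)
  have e: "e \<in> edges" using assms by blast
  obtain x s where xs: "e = (x, s)" by (cases e)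
  show "edge_elt e \<in> C (target e) (source e)" by (rule target_props(2)[OF e])
  fix \<gamma> assume g: "\<gamma> \<in> perp (source e)" "\<gamma> \<in> positive_roots"
  show "act (edge_elt e) \<gamma> \<in> positive_roots"
  proof (rule ccontr)
    assume "act (edge_elt e) \<gamma> \<notin> positive_roots"
    then have "\<gamma> \<in> inversions (edge_elt (x, s))" using g(2) xs by (simp add: inversions_def)
    then have "\<gamma> \<in> Phi (x ` \<Lambda> \<union> {s})" using inversions_edge e xs by blast
    then have "(x, s) \<in> loops" using loopI(1)[OF edgeD(1,2,3)] e xs g by (simp add: source_def)
    then show False using assms xs by simp
  qed
qed

section \<open>Paths, their reversal, and backtracking\<close>

lemma path_append: "path E y (p @ q) z \<longleftrightarrow> (\<exists>x. path E y q x \<and> path E x p z)"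
  if "E \<subseteq> edges"
proof (induction p arbitrary: z)
  case Nil
  have "path E y q z \<Longrightarrow> z \<in> vertices"
    by (cases q) (use that target_props(1) in auto)
  then show ?case by auto
qed auto

lemma path_vertices:
  assumes "E \<subseteq> edges" "path E y q z" shows "y \<in> vertices" "z \<in> vertices"
proof -
  show "y \<in> vertices" using assms(2) by (induction q arbitrary: z) auto
  show "z \<in> vertices" using assms by (cases q) (use target_props(1) in auto)
qed

lemma path_mono: "path E y q z \<Longrightarrow> E \<subseteq> F \<Longrightarrow> path F y q z"
  by (induction q arbitrary: z) auto

lemma path_set: "path E y q z \<Longrightarrow> set q \<subseteq> E"
  by (induction q arbitrary: z) auto

lemma path_subset: "path E y q z \<Longrightarrow> set q \<subseteq> F \<Longrightarrow> path F y q z"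
  by (induction q arbitrary: z) auto

lemma path_elt_Nil [simp]: "path_elt [] = \<one>"
  by (simp add: path_elt_def)

lemma path_elt_Cons [simp]: "path_elt (e # q) = edge_elt e \<otimes> path_elt q"
  by (simp add: path_elt_def)

lemma path_elt_closed: "set q \<subseteq> edges \<Longrightarrow> path_elt q \<in> carrier W"
  by (induction q) (auto simp: edge_elt_closed)

lemma path_elt_append: "set p \<subseteq> edges \<Longrightarrow> set q \<subseteq> edges \<Longrightarrow> path_elt (p @ q) = path_elt p \<otimes> path_elt q"
  by (induction p) (auto simp: edge_elt_closed path_elt_closed m_assoc)

lemma path_Y: assumes "path (edges - loops) y q z" shows "path_elt q \<in> Y z y"
  using assms
proof (induction q arbitrary: z)
  case Nil
  then show ?case by (auto intro: Y_one)
next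
  case (Cons e q)
  then have e: "e \<in> edges - loops" "target e = z" "path (edges - loops) y q (source e)" by auto
  have v: "y \<in> vertices" "source e \<in> vertices" using path_vertices[OF _ e(3)] by auto
  show ?case using Y_mult[OF nonloop_Y[OF e(1)] Cons.IH[OF e(3)] v(2,1)] e(2) by simp
qed

lemma reverse_path_Cons: "reverse_path (e # q) = reverse_path q @ [reverse_edge e]"
  by (simp add: reverse_path_def)

lemma reverse_path_Nil [simp]: "reverse_path [] = []"
  by (simp add: reverse_path_def)

lemma path_reverse:
  assumes "path E y q z" "E \<subseteq> edges" "F \<subseteq> edges" "\<And>e. e \<in> E \<Longrightarrow> reverse_edge e \<in> F"
  shows "path F z (reverse_path q) y"
  using assms(1)
proof (induction q arbitrary: z)
  case (Cons e q)
  then have e: "e \<in> E" "target e = z" "path E y q (source e)" by auto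
  note r = reverse_edge_props[of e]
  have ee: "e \<in> edges" using e(1) assms(2) by blast
  have zv: "z \<in> vertices" using target_props(1)[OF ee] e(2) by simp
  have "path F z [reverse_edge e] (source e)" using r(3,4)[OF ee] e zv assms(4)[OF e(1)] by simp
  then show ?case unfolding reverse_path_Cons path_append[OF assms(3)] using Cons.IH[OF e(3)] by blast
qed simp

lemma path_elt_reverse: assumes "set q \<subseteq> edges" shows "path_elt (reverse_path q) = inv (path_elt q)"
  using assms
proof (induction q)
  case (Cons e q)
  have c: "path_elt q \<in> carrier W" "edge_elt e \<in> carrier W"
    using Cons.prems path_elt_closed edge_elt_closed by auto
  have s: "set (reverse_path q) \<subseteq> edges"
    unfolding reverse_path_def using Cons.prems reverse_edge_props(1) by auto
  have s1: "set [reverse_edge e] \<subseteq> edges" using Cons.prems reverse_edge_props(1) by simp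
  have "path_elt (reverse_path (e # q)) = inv (path_elt q) \<otimes> inv (edge_elt e)"
    unfolding reverse_path_Cons path_elt_append[OF s s1]
    using Cons c reverse_edge_props(2)[of e] by simp
  then show ?case using c by (simp add: inv_mult_group)
qed simp

lemma nonbacktracking_Nil [simp]: "nonbacktracking []"
  by (simp add: nonbacktracking_def)

lemma nonbacktracking_single [simp]: "nonbacktracking [e]"
  by (simp add: nonbacktracking_def)

lemma nonbacktracking_Cons:
  "nonbacktracking (a # b # q) \<longleftrightarrow> a \<noteq> reverse_edge b \<and> nonbacktracking (b # q)"
  unfolding nonbacktracking_def
proof (intro iffI conjI allI impI)
  assume h: "\<forall>i. Suc i < length (a # b # q) \<longrightarrow> (a # b # q) ! i \<noteq> reverse_edge ((a # b # q) ! Suc i)"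
  show "a \<noteq> reverse_edge b" using h[rule_format, of 0] by simp
  fix i assume "Suc i < length (b # q)"
  then show "(b # q) ! i \<noteq> reverse_edge ((b # q) ! Suc i)" using h[rule_format, of "Suc i"] by simp
next
  fix i
  assume h: "a \<noteq> reverse_edge b \<and> (\<forall>i. Suc i < length (b # q) \<longrightarrow> (b # q) ! i \<noteq> reverse_edge ((b # q) ! Suc i))"
    and i: "Suc i < length (a # b # q)"
  show "(a # b # q) ! i \<noteq> reverse_edge ((a # b # q) ! Suc i)"
    using h i by (cases i) auto
qed

lemma nonbacktracking_append:
  "nonbacktracking (p @ q) \<longleftrightarrow> nonbacktracking p \<and> nonbacktracking q \<and>
     (p \<noteq> [] \<and> q \<noteq> [] \<longrightarrow> last p \<noteq> reverse_edge (hd q))"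
proof (induction p)
  case (Cons a p)
  show ?case
  proof (cases p)
    case Nil
    then show ?thesis by (cases q) (auto simp: nonbacktracking_Cons)
  next
    case (Cons b p')
    then show ?thesis using Cons.IH by (auto simp: nonbacktracking_Cons)
  qed
qed simp

lemma nonbacktracking_reverse:
  assumes "set q \<subseteq> edges" "nonbacktracking q" shows "nonbacktracking (reverse_path q)"
  using assms
proof (induction q)
  case (Cons a q)
  show ?case
  proof (cases q)
    case Nil
    then show ?thesis by (simp add: reverse_path_Cons)
  next
    case (Cons b q')
    have "last (reverse_path q) = reverse_edge b" using Cons by (simp add: reverse_path_Cons)
    moreover have "nonbacktracking (reverse_path q)"
      using Cons.IH Cons.prems Cons nonbacktracking_Cons by auto
    moreover have "reverse_edge b \<noteq> reverse_edge (reverse_edge a)"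
      using Cons.prems Cons nonbacktracking_Cons reverse_edge_props(8) by auto
    ultimately show ?thesis by (simp add: reverse_path_Cons nonbacktracking_append)
  qed
qed simp

text \<open>The basic step of the decomposition of groupoid elements: any simple descent \<open>\<alpha>\<^sub>t\<close> of \<open>w\<close> splits off the
  edge \<open>w\<^sub>x\<^sup>t\<close>.\<close>

lemma groupoid_step:
  assumes w: "w \<in> C z x" and v: "x \<in> vertices" "z \<in> vertices" and t: "t \<in> S" "simple_root t \<in> inversions w"
  shows "(x, t) \<in> edges" "inversions (edge_elt (x, t)) \<subseteq> inversions w"
    "w \<otimes> inv (edge_elt (x, t)) \<in> C z (target (x, t))"
    "card (inversions (w \<otimes> inv (edge_elt (x, t)))) < card (inversions w)"
proof -
  note wc = CD(1)[OF w]
  have tx: "t \<notin> x ` \<Lambda>"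
  proof
    assume "t \<in> x ` \<Lambda>"
    then obtain l where l: "l \<in> \<Lambda>" "t = x l" by blast
    then have "act w (simple_root t) = simple_root (z l)" using CD(2)[OF w] by simp
    then show False using inversionsD(2)[OF t(2)] vertexD(4)[OF v(2) l(1)] by simp
  qed
  have simple: "\<exists>k'\<in>S. act w (simple_root k) = simple_root k'" if "k \<in> x ` \<Lambda>" for k
    using that CD(2)[OF w] vertexD(4)[OF v(2)] by blast
  note ds = deodhar_step[OF vertexD(2)[OF v(1)] t(1) tx wc simple inversionsD(2)[OF t(2)]]
  show e: "(x, t) \<in> edges" using v t tx ds(1) unfolding edges_def by simp
  show sub: "inversions (edge_elt (x, t)) \<subseteq> inversions w" using ds(2) by (simp add: edge_elt_elementary_move)
  have dC: "edge_elt (x, t) \<in> C (target (x, t)) x" using target_props(2)[OF e] by (simp add: source_def)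
  show "w \<otimes> inv (edge_elt (x, t)) \<in> C z (target (x, t))"
    by (rule C_mult[OF w C_inv[OF dC v(1)] target_props(1)[OF e]])
  have "simple_root t \<in> inversions (edge_elt (x, t))"
    unfolding inversions_edge[OF e] using t(1) simple_root_Phi[OF t(1), of "x ` \<Lambda> \<union> {t}"] by simp
  then have "card (inversions (edge_elt (x, t))) > 0" using finite_inversions[OF edge_elt_closed[OF e]] card_gt_0_iff by blast
  then show "card (inversions (w \<otimes> inv (edge_elt (x, t)))) < card (inversions w)"
    using card_inversions_quot[OF wc edge_elt_closed[OF e] sub] by simp
qed

lemma C_one_imp_eq: "\<one> \<in> C z x \<Longrightarrow> x \<in> vertices \<Longrightarrow> z \<in> vertices \<Longrightarrow> z = x"
  using C_target_unique[OF _ C_one] by blast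

lemma connected_nonloop:
  assumes "w \<in> C z x" "x \<in> vertices" "z \<in> vertices"
  shows "\<exists>p. path (edges - loops) x p z"
  using assms
proof (induction "card (inversions w)" arbitrary: w x rule: less_induct)
  case less
  show ?case
  proof (cases "w = \<one>")
    case True
    then have "z = x" using C_one_imp_eq less.prems by simp
    then show ?thesis using less.prems by (intro exI[of _ "[]"]) simp
  next
    case False
    then obtain t where t: "t \<in> S" "simple_root t \<in> inversions w"
      using descent_exists[OF CD(1)[OF less.prems(1)]] by blast
    note st = groupoid_step[OF less.prems t]
    obtain p where p: "path (edges - loops) (target (x, t)) p z"
      using less.hyps[OF st(4,3) target_props(1)[OF st(1)] less.prems(3)] by blast
    show ?thesis
    proof (cases "(x, t) \<in> loops")
      case True
      then show ?thesis using p loopD(2)[OF True] by (auto simp: source_def)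
    next
      case False
      then have "path (edges - loops) x [(x, t)] (target (x, t))" using st(1) less.prems by (simp add: source_def)
      then have "path (edges - loops) x (p @ [(x, t)]) z" using p path_append[of "edges - loops"] by blast
      then show ?thesis by blast
    qed
  qed
qed

lemma vertices_C_nonempty: assumes "x \<in> vertices" "z \<in> vertices" shows "\<exists>w. w \<in> C z x"
proof -
  obtain a b where ab: "a \<in> C x xI" "b \<in> C z xI" using assms unfolding vertices_def by blast
  have xIS: "l \<in> \<Lambda> \<Longrightarrow> xI l \<in> S" for l using xI_bij I_subset by (auto simp: bij_betw_def)
  have "b \<otimes> inv a \<in> C z x"
  proof (rule CI)
    fix l assume l: "l \<in> \<Lambda>"
    have "act (inv a) (simple_root (x l)) = simple_root (xI l)"
      using act_inv(1)[OF CD(1)[OF ab(1)], of "simple_root (xI l)"] CD(2)[OF ab(1) l] xIS[OF l] by simp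
    then show "act (b \<otimes> inv a) (simple_root (x l)) = simple_root (z l)"
      using act_mult[OF CD(1)[OF ab(2)], of "inv a" "simple_root (x l)"] CD[OF ab(1)] CD(2)[OF ab(2) l]
        vertexD(4)[OF assms(1) l] by simp
  qed (use CD ab in simp)
  then show ?thesis by blast
qed

lemma edge_image: "(x, t) \<in> edges \<Longrightarrow> target (x, t) ` \<Lambda> \<subseteq> x ` \<Lambda> \<union> {t}"
  using reverse_edge_props(5)[of "(x, t)"] by (auto simp: source_def)

text \<open>Splitting off descents until a loop occurs. The lengths add up, so no step is undone by the next one.\<close>

lemma decompose:
  assumes "w \<in> C z x" "x \<in> vertices" "z \<in> vertices" "x ` \<Lambda> \<subseteq> J" "J \<subseteq> S" "inversions w \<subseteq> Phi J"
  shows "\<exists>p y. path (sub_edges J - loops) x p y \<and> nonbacktracking p \<and> inversions (path_elt p) \<subseteq> inversions w \<and>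
    (p \<noteq> [] \<longrightarrow> simple_root (snd (last p)) \<in> inversions w) \<and>
    (y = z \<and> path_elt p = w \<or>
     (\<exists>s. (y, s) \<in> loops \<inter> sub_edges J \<and> act (inv (path_elt p)) (lroot (y, s)) \<in> inversions w))"
  using assms(1,2,4,6)
proof (induction "card (inversions w)" arbitrary: w x rule: less_induct)
  case less
  note wc = CD(1)[OF less.prems(1)]
  show ?case
  proof (cases "w = \<one>")
    case True
    then have "z = x" using C_one_imp_eq less.prems assms(3) by simp
    then show ?thesis using less.prems True by (intro exI[of _ "[]"] exI[of _ x]) simp
  next
    case False
    then obtain t where t: "t \<in> S" "simple_root t \<in> inversions w" using descent_exists[OF wc] by blast
    note st = groupoid_step[OF less.prems(1,2) assms(3) t]
    define d where "d = edge_elt (x, t)"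
    have dc: "d \<in> carrier W" using edge_elt_closed[OF st(1)] by (simp add: d_def)
    have tJ: "t \<in> J"
    proof (rule ccontr)
      assume "t \<notin> J"
      then have "simple_root t t = 0" using less.prems(4) t(2) PhiD(2) by blast
      then show False by simp
    qed
    have se: "(x, t) \<in> sub_edges J" using st(1) less.prems(3) tJ by (simp add: sub_edges_def source_def)
    show ?thesis
    proof (cases "(x, t) \<in> loops")
      case True
      have "lroot (x, t) \<in> inversions d" unfolding d_def inversions_edge[OF st(1)]
        using lroot_props[OF True] lroot_coord[OF True] by simp
      then have "lroot (x, t) \<in> inversions w" using st(2) by (auto simp: d_def)
      moreover have "lroot (x, t) \<in> V" using lroot_props(1)[OF True] by simp
      ultimately show ?thesis using True se less.prems(2)
        by (intro exI[of _ "[]"] exI[of _ x]) (auto intro!: exI[of _ t])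
    next
      case nl: False
      define x1 where "x1 = target (x, t)"
      define w' where "w' = w \<otimes> inv d"
      have x1: "x1 \<in> vertices" using target_props(1)[OF st(1)] by (simp add: x1_def)
      have w': "w' \<in> C z x1" "card (inversions w') < card (inversions w)" using st(3,4) by (simp_all add: w'_def d_def x1_def)
      have x1J: "x1 ` \<Lambda> \<subseteq> J" 
      proof -
        have "x ` \<Lambda> \<union> {t} \<subseteq> J" using less.prems(3) tJ by simp
        then show ?thesis unfolding x1_def by (rule order_trans[OF edge_image[OF st(1)]])
      qed
      have Nq: "inversions w' = act d ` (inversions w - inversions d)" unfolding w'_def
        by (rule inversions_quot[OF wc dc]) (use st(2) in \<open>simp add: d_def\<close>)
      have dJ: "d \<in> generate W J"
      proof -
        note E = edgeD[OF st(1)]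
        have "component (x ` \<Lambda>) t \<subseteq> J" using component_subset[of "x ` \<Lambda>" t] less.prems(3) tJ by blast
        then show ?thesis using elementary_move_generate[OF E(5,2,4)] mono_generate[of "component (x ` \<Lambda>) t" J]
          by (auto simp: d_def edge_elt_elementary_move)
      qed
      have inversions'J: "inversions w' \<subseteq> Phi J" unfolding Nq using generate_act_Phi[OF assms(5) dJ] less.prems(4) by blast
      from less.hyps[OF w'(2,1) x1 x1J inversions'J] obtain p y where p: "path (sub_edges J - loops) x1 p y"
        "nonbacktracking p" "inversions (path_elt p) \<subseteq> inversions w'" "p \<noteq> [] \<longrightarrow> simple_root (snd (last p)) \<in> inversions w'"
        and py: "y = z \<and> path_elt p = w' \<or>
         (\<exists>s. (y, s) \<in> loops \<inter> sub_edges J \<and> act (inv (path_elt p)) (lroot (y, s)) \<in> inversions w')" by blast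
      have sub: "sub_edges J - loops \<subseteq> edges" by (auto simp: sub_edges_def)
      have pe: "set p \<subseteq> edges" using path_set[OF p(1)] sub by blast
      have pc: "path_elt p \<in> carrier W" by (rule path_elt_closed[OF pe])
      have back_pos: "act (inv d) \<gamma> \<in> inversions w" if "\<gamma> \<in> inversions w'" for \<gamma>
      proof -
        have "\<gamma> \<in> act d ` (inversions w - inversions d)" using that unfolding Nq .
        then obtain b where b: "b \<in> inversions w" "\<gamma> = act d b" by blast
        then show ?thesis using act_inv(1)[OF dc, of b] inversionsD(1)[OF b(1)] by simp
      qed
      let ?q = "p @ [(x, t)]"
      have elt: "path_elt ?q = path_elt p \<otimes> d"
        using path_elt_append[OF pe, of "[(x, t)]"] st(1) dc by (simp add: d_def)
      have "path (sub_edges J - loops) x [(x, t)] x1" using se nl less.prems(2) by (simp add: x1_def source_def)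
      then have 1: "path (sub_edges J - loops) x ?q y" using p(1) path_append[OF sub] by blast
      \<comment> \<open>Paths run from right to left, so \<open>last p\<close> is the edge passed
        next. If it undid the edge, its simple root would be inverted by \<open>w'\<close> and hence
        pulled back by \<open>inv d\<close> to a positive root, whereas the reversed edge sends it
        to a negative one.\<close>
      have 2: "nonbacktracking ?q"
      proof -
        have "last p \<noteq> reverse_edge (x, t)" if "p \<noteq> []"
        proof
          assume h: "last p = reverse_edge (x, t)"
          have "simple_root (snd (reverse_edge (x, t))) \<in> inversions w'" using p(4) that h by simp
          then have "act (inv d) (simple_root (snd (reverse_edge (x, t)))) \<in> positive_roots"
            using back_pos inversionsD(1) by blast
          then show False using reverse_edge_props(7)[OF st(1)] by (simp add: d_def)
        qed
        then show ?thesis using p(2) by (simp add: nonbacktracking_append)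
      qed
      \<comment> \<open>An inversion of the longer path is either inverted by the edge already or
        carried by it to an inversion of \<open>p\<close>; lengths add up, so both kinds are
        inversions of \<open>w\<close>.\<close>
      have 3: "inversions (path_elt ?q) \<subseteq> inversions w"
      proof
        fix \<gamma> assume g: "\<gamma> \<in> inversions (path_elt ?q)"
        have gp: "\<gamma> \<in> positive_roots" "\<gamma> \<in> V" using inversionsD(1)[OF g] by auto
        show "\<gamma> \<in> inversions w"
        proof (cases "act d \<gamma> \<in> positive_roots")
          case True
          have "act (path_elt p) (act d \<gamma>) \<notin> positive_roots"
            using inversionsD(2)[OF g] act_mult[OF pc dc gp(2)] elt by simp
          then have "act d \<gamma> \<in> inversions w'" using p(3) True by (auto simp: inversions_def)
          then show ?thesis using back_pos[of "act d \<gamma>"] act_inv(1)[OF dc gp(2)] by simp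
        next
          case False
          then show ?thesis using gp st(2) by (auto simp: inversions_def d_def)
        qed
      qed
      have iq: "act (inv (path_elt ?q)) v = act (inv d) (act (inv (path_elt p)) v)" if "v \<in> V" for v
        unfolding elt using pc dc that by (simp add: inv_mult_group act_mult)
      have 4: "y = z \<and> path_elt ?q = w \<or>
        (\<exists>s. (y, s) \<in> loops \<inter> sub_edges J \<and> act (inv (path_elt ?q)) (lroot (y, s)) \<in> inversions w)"
        using py
      proof
        assume "y = z \<and> path_elt p = w'"
        then show ?thesis using wc dc by (simp add: elt w'_def m_assoc)
      next
        assume "\<exists>s. (y, s) \<in> loops \<inter> sub_edges J \<and> act (inv (path_elt p)) (lroot (y, s)) \<in> inversions w'"
        then obtain s where s: "(y, s) \<in> loops \<inter> sub_edges J" "act (inv (path_elt p)) (lroot (y, s)) \<in> inversions w'" by blast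
        have "lroot (y, s) \<in> V" using lroot_props(1) s(1) by simp
        then show ?thesis using s back_pos iq by auto
      qed
      have 5: "simple_root (snd (last ?q)) \<in> inversions w" using t(2) by simp
      show ?thesis using 1 2 3 4 5 by blast
    qed
  qed
qed

end

section \<open>Spanning trees and shuttling tours\<close>

context coxeter_groupoid
begin

lemma treeD:
  assumes "tree U E"
  shows "U \<noteq> {}" "U \<subseteq> vertices" "E \<subseteq> edges - loops"
    "e \<in> E \<Longrightarrow> source e \<in> U" "e \<in> E \<Longrightarrow> target e \<in> U" "e \<in> E \<Longrightarrow> reverse_edge e \<in> E"
    "y \<in> U \<Longrightarrow> z \<in> U \<Longrightarrow> \<exists>q. path E y q z"
    "path E y q y \<Longrightarrow> nonbacktracking q \<Longrightarrow> q = []"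
  using assms unfolding tree_def by blast+

lemma exit_edge:
  assumes "path E y p z" "y \<in> U" "z \<notin> U" shows "\<exists>e\<in>E. source e \<in> U \<and> target e \<notin> U"
  using assms(1,3)
proof (induction p arbitrary: z)
  case Nil
  then show ?case using assms(2) by simp
next
  case (Cons e p)
  then show ?case by (cases "source e \<in> U") auto
qed

lemma nonbacktracking_tl: "nonbacktracking (a # q) \<Longrightarrow> nonbacktracking q"
  using nonbacktracking_append[of "[a]" q] by simp

text \<open>A pendant edge creates no closed path, because its new end can be left only by turning
  back.\<close>

lemma tree_extend:
  assumes T: "tree U E" and e: "e \<in> edges - loops" "source e \<in> U" "target e \<notin> U"
  shows "tree (insert (target e) U) (insert e (insert (reverse_edge e) E))"
proof -
  let ?U = "insert (target e) U" and ?E = "insert e (insert (reverse_edge e) E)"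
  have ee: "e \<in> edges" using e by blast
  note t = treeD[OF T] and r = reverse_edge_props[OF ee]
  have Ee: "E \<subseteq> edges" using t(3) by blast
  have E'e: "?E \<subseteq> edges - loops" using t(3) e reverse_nonloop[OF e(1)] by blast
  then have E'e': "?E \<subseteq> edges" by blast
  have EE': "E \<subseteq> ?E" by blast
  have sv: "source e \<in> vertices" "target e \<in> vertices" using t(2) e target_props(1)[OF ee] by auto
  \<comment> \<open>A path without backtracking that starts in \<open>U\<close> can use the new edge
    only as its final step.\<close>
  have step: "z \<in> U \<and> path E y q z \<or> (\<exists>q'. q = e # q' \<and> path E y q' (source e) \<and> z = target e)"
    if "path ?E y q z" "nonbacktracking q" "y \<in> U" for y q z
    using that(1,2)
  proof (induction q arbitrary: z)
    case Nil
    then show ?case using that(3) by auto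
  next
    case (Cons a q)
    then have a: "a \<in> ?E" "target a = z" "path ?E y q (source a)" by auto
    from Cons.IH[OF a(3) nonbacktracking_tl[OF Cons.prems(2)]] show ?case
    proof
      assume h: "source a \<in> U \<and> path E y q (source a)"
      show ?case
      proof (cases "a \<in> E")
        case True
        then show ?thesis using h a(2) t(5)[OF True] by simp
      next
        case False
        moreover have "a \<noteq> reverse_edge e" using h r(3) e(3) by auto
        ultimately have "a = e" using a(1) by blast
        then show ?thesis using h a(2) by auto
      qed
    next
      assume "\<exists>q'. q = e # q' \<and> path E y q' (source e) \<and> source a = target e"
      then obtain q' where h: "q = e # q'" "source a = target e" by blast
      have "a \<notin> E" using h(2) e(3) t(4)[of a] by auto
      moreover have "a \<noteq> e" using h(2) e(2,3) by auto
      moreover have "a \<noteq> reverse_edge e" using Cons.prems(2) h(1) nonbacktracking_Cons by simp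
      ultimately show ?case using a(1) by blast
    qed
  qed
  have closed: "q = []" if q: "path ?E y q y" "nonbacktracking q" for y q
  proof -
    have yU: "y \<in> ?U" if qne: "q \<noteq> []"
    proof -
      obtain a q' where "q = a # q'" using qne by (cases q) auto
      then have "a \<in> ?E" "target a = y" using q by auto
      then show ?thesis using t(5)[of a] r(4) e(2) by auto
    qed
    show ?thesis
    proof (cases "y \<in> U")
      case True
      from step[OF q True] True e(3) have "path E y q y" by auto
      then show ?thesis using t(8) q(2) by blast
    next
      \<comment> \<open>A closed path at the new vertex leaves by the reversed edge and returns by
        \<open>e\<close>. What lies between is a closed path of the old tree, hence empty, and the
        whole path backtracks.\<close>
      case False
      show ?thesis
      proof (cases q rule: rev_cases)
        case (snoc q0 b)
        have y: "y = target e" using yU False snoc by blast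
        obtain x where x: "path ?E y [b] x" "path ?E x q0 y" using q(1) snoc path_append[OF E'e'] by blast
        have b: "b \<in> ?E" "source b = y" "target b = x" using x(1) by auto
        have "b \<notin> E" using b(2) False t(4)[of b] by auto
        moreover have "b \<noteq> e" using b(2) y e(2,3) by auto
        ultimately have br: "b = reverse_edge e" using b(1) by blast
        then have xs: "x = source e" using b(3) r(4) by simp
        have nb0: "nonbacktracking q0" using q(2) snoc nonbacktracking_append by blast
        from step[OF x(2) nb0] xs e(2,3) y obtain q' where q': "q0 = e # q'" "path E x q' (source e)" by auto
        have "nonbacktracking q'" using nb0 q'(1) nonbacktracking_tl by blast
        then have "q' = []" using t(8)[of x q'] q'(2) xs by simp
        then have "q = [e, reverse_edge e]" using snoc q'(1) br by simp
        then show ?thesis using q(2) r(8) nonbacktracking_Cons[of e "reverse_edge e" "[]"] by simp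
      qed
    qed
  qed
  have conn: "\<exists>q. path ?E y q z" if yz: "y \<in> ?U" "z \<in> ?U" for y z
  proof -
    have to: "\<exists>q. path ?E y q (source e)"
    proof (cases "y \<in> U")
      case True
      then show ?thesis using t(7)[OF True e(2)] path_mono[OF _ EE'] by blast
    next
      case False
      then have "path ?E y [reverse_edge e] (source e)" using yz r(3,4) sv by simp
      then show ?thesis by blast
    qed
    have from': "\<exists>q. path ?E (source e) q z"
    proof (cases "z \<in> U")
      case True
      then show ?thesis using t(7)[OF e(2) True] path_mono[OF _ EE'] by blast
    next
      case False
      then have "path ?E (source e) [e] z" using yz sv by simp
      then show ?thesis by blast
    qed
    show ?thesis using to from' path_append[OF E'e'] by blast
  qed
  show ?thesis unfolding tree_def
  proof (intro conjI ballI allI impI)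
    show "?U \<noteq> {}" by blast
    show "?U \<subseteq> vertices" using t(2) sv by blast
    show "?E \<subseteq> edges - loops" by (rule E'e)
  next
    fix a assume "a \<in> ?E"
    then show "source a \<in> ?U" "target a \<in> ?U" "reverse_edge a \<in> ?E"
      using t(4,5,6)[of a] r(3,4,8) e(2) by auto
  next
    fix y z assume "y \<in> ?U" "z \<in> ?U"
    then show "\<exists>q. path ?E y q z" by (rule conn)
  next
    fix y q assume "path ?E y q y \<and> nonbacktracking q"
    then show "q = []" using closed by blast
  qed
qed

text \<open>Maximality is with respect to inclusion. The graph without loops is connected, so a path
  to a missing vertex has an edge leaving \<open>U\<close>, which could be attached.\<close>

lemma maximal_tree_spanning: assumes "maximal_tree U T" shows "U = vertices"
proof (rule ccontr)
  assume n: "U \<noteq> vertices"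
  have T: "tree U T" using assms unfolding maximal_tree_def by blast
  note t = treeD[OF T]
  obtain z where z: "z \<in> vertices" "z \<notin> U" using n t(2) by blast
  obtain u where u: "u \<in> U" using t(1) by blast
  have uv: "u \<in> vertices" using u t(2) by blast
  obtain w where "w \<in> C z u" using vertices_C_nonempty[OF uv z(1)] by blast
  from connected_nonloop[OF this uv z(1)] obtain p where "path (edges - loops) u p z" by blast
  from exit_edge[OF this u z(2)] obtain e where e: "e \<in> edges - loops" "source e \<in> U" "target e \<notin> U" by blast
  from tree_extend[OF T e] have "insert (target e) U = U"
    using assms unfolding maximal_tree_def by blast
  then show False using e(3) by blast
qed

end

section \<open>Paths in the maximal tree\<close>

locale groupoid_tree = coxeter_groupoid W S I \<Lambda> xI
  for W (structure) and S :: "'a set" and I and \<Lambda> :: "'l set" and xI +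
  fixes U :: "('l \<Rightarrow> 'a) set" and T
  assumes max_tree: "maximal_tree U T"
begin

lemma T_tree: "tree vertices T"
  using max_tree maximal_tree_spanning[OF max_tree] unfolding maximal_tree_def by blast

lemmas T_props = treeD[OF T_tree]

lemma T_edges: "T \<subseteq> edges"
  using T_props(3) by blast

lemma nonbacktracking_path_exists:
  assumes "path T y q z" shows "\<exists>q. path T y q z \<and> nonbacktracking q"
  using assms
proof (induction q arbitrary: z)
  case Nil
  then show ?case by (intro exI[of _ "[]"]) auto
next
  case (Cons a q)
  then have a: "a \<in> T" "target a = z" "path T y q (source a)" by auto
  obtain q0 where q0: "path T y q0 (source a)" "nonbacktracking q0" using Cons.IH[OF a(3)] by blast
  show ?case
  proof (cases q0)
    case Nil
    then have "path T y [a] z" using q0(1) a by auto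
    then show ?thesis using nonbacktracking_single by blast
  next
    case (Cons b q1)
    have b: "b \<in> T" "target b = source a" "path T y q1 (source b)" using q0(1) Cons by auto
    show ?thesis
    proof (cases "a = reverse_edge b")
      case True
      have "b \<in> edges" using b(1) T_edges by blast
      then have "source b = z" using True a(2) reverse_edge_props(4) by simp
      then show ?thesis using b(3) nonbacktracking_tl q0(2) Cons by blast
    next
      case False
      then have "nonbacktracking (a # q0)" using q0(2) Cons nonbacktracking_Cons by simp
      moreover have "path T y (a # q0) z" using a q0(1) by simp
      ultimately show ?thesis by blast
    qed
  qed
qed

text \<open>The heads of the lists are the edges passed last. If they differ, following one path and
  returning along the other is a nonempty closed path without backtracking.\<close>

lemma nonbacktracking_path_unique:
  assumes "path T y q z" "nonbacktracking q" "path T y q' z" "nonbacktracking q'" shows "q = q'"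
  using assms
proof (induction q arbitrary: z q')
  case Nil
  then have "path T y q' y" by auto
  then show ?case using T_props(8) Nil by blast
next
  case (Cons a q)
  have a: "a \<in> T" "target a = z" "path T y q (source a)" using Cons.prems(1) by auto
  show ?case
  proof (cases q')
    case Nil
    then have "y = z" using Cons.prems(3) by simp
    then show ?thesis using T_props(8) Cons.prems by blast
  next
    case q': (Cons b q0)
    have b: "b \<in> T" "target b = z" "path T y q0 (source b)" using Cons.prems(3) q' by auto
    show ?thesis
    proof (cases "a = b")
      case True
      have "q = q0"
        by (rule Cons.IH[OF a(3) nonbacktracking_tl[OF Cons.prems(2)]])
          (use b True Cons.prems(4) q' nonbacktracking_tl in auto)
      then show ?thesis using q' True by simp
    next
      case False
      have sq: "set q' \<subseteq> edges" using path_set[OF Cons.prems(3)] T_edges by blast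
      have ab: "a \<in> edges" "b \<in> edges" using a(1) b(1) T_edges by auto
      have "path T z (reverse_path q') y"
        by (rule path_reverse[OF Cons.prems(3) T_edges T_edges]) (rule T_props(6))
      then have p: "path T y (reverse_path q' @ (a # q)) y"
        using Cons.prems(1) path_append[OF T_edges] by blast
      have "reverse_edge b \<noteq> reverse_edge a" using False reverse_edge_props(8) ab by metis
      then have "nonbacktracking (reverse_path q' @ (a # q))"
        using nonbacktracking_reverse[OF sq Cons.prems(4)] Cons.prems(2) q'
        by (simp add: nonbacktracking_append nonbacktracking_Cons reverse_path_Cons)
      then show ?thesis using T_props(8)[OF p] by simp
    qed
  qed
qed

lemma tree_path_props:
  assumes "y \<in> vertices" "z \<in> vertices"
  shows "path T y (tree_path T z y) z" "nonbacktracking (tree_path T z y)"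
proof -
  have "\<exists>!q. path T y q z \<and> nonbacktracking q"
    using T_props(7)[OF assms] nonbacktracking_path_exists nonbacktracking_path_unique by blast
  from theI'[OF this] show "path T y (tree_path T z y) z" "nonbacktracking (tree_path T z y)"
    unfolding tree_path_def by auto
qed

definition tree_elt :: "('l \<Rightarrow> 'a) \<Rightarrow> ('l \<Rightarrow> 'a) \<Rightarrow> 'a" where "tree_elt z y = path_elt (tree_path T z y)"

lemma tree_path_edges: "y \<in> vertices \<Longrightarrow> z \<in> vertices \<Longrightarrow> set (tree_path T z y) \<subseteq> edges"
  using path_set[OF tree_path_props(1)] T_edges by blast

lemma tree_elt_Y: assumes "y \<in> vertices" "z \<in> vertices" shows "tree_elt z y \<in> Y z y"
  unfolding tree_elt_def by (rule path_Y[OF path_mono[OF tree_path_props(1)[OF assms] T_props(3)]])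

lemma tree_elt_inv: assumes "y \<in> vertices" "z \<in> vertices" shows "tree_elt y z = inv (tree_elt z y)"
proof -
  note p = tree_path_props[OF assms]
  note sq = tree_path_edges[OF assms]
  have "path T z (reverse_path (tree_path T z y)) y"
    by (rule path_reverse[OF p(1) T_edges T_edges]) (rule T_props(6))
  moreover have "nonbacktracking (reverse_path (tree_path T z y))"
    by (rule nonbacktracking_reverse[OF sq p(2)])
  ultimately have "tree_path T y z = reverse_path (tree_path T z y)"
    using nonbacktracking_path_unique tree_path_props[OF assms(2,1)] by blast
  then show ?thesis unfolding tree_elt_def using path_elt_reverse[OF sq] by simp
qed

lemma based_eq:
  assumes "x \<in> vertices" "y \<in> vertices" "z \<in> vertices" "set q \<subseteq> edges"
  shows "based T x z q y = tree_elt x z \<otimes> (path_elt q \<otimes> tree_elt y x)"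
  unfolding based_def tree_elt_def
  using path_elt_append[OF tree_path_edges[OF assms(3,1)], of "q @ tree_path T y x"]
    path_elt_append[OF assms(4) tree_path_edges[OF assms(1,2)]] tree_path_edges[OF assms(1,2)] assms(4)
  by simp

end

section \<open>Components of rank two as paths with two end loops\<close>

context coxeter_groupoid
begin

lemma sub_edges_edges: "sub_edges J \<subseteq> edges"
  by (auto simp: sub_edges_def)

lemma sub_edgesD: assumes "e \<in> sub_edges J" shows "e \<in> edges" "source e ` \<Lambda> \<subseteq> J" "snd e \<in> J" "target e ` \<Lambda> \<subseteq> J"
proof -
  show e: "e \<in> edges" "source e ` \<Lambda> \<subseteq> J" "snd e \<in> J" using assms by (auto simp: sub_edges_def)
  have "target e ` \<Lambda> \<subseteq> source e ` \<Lambda> \<union> {snd e}" using reverse_edge_props(5)[OF e(1)] by blast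
  also have "\<dots> \<subseteq> J" using e by simp
  finally show "target e ` \<Lambda> \<subseteq> J" .
qed

lemma reverse_sub_edges: assumes "e \<in> sub_edges J" shows "reverse_edge e \<in> sub_edges J"
proof -
  have e: "e \<in> edges" "source e ` \<Lambda> \<union> {snd e} \<subseteq> J" using assms by (simp_all add: sub_edges_def)
  note r = reverse_edge_props[OF e(1)]
  show ?thesis unfolding sub_edges_def mem_Collect_eq r(3) r(5) using r(1) e(2) by (rule conjI)
qed

text \<open>\<open>J\<close> may be infinite, so vertices are measured by their complement in
  \<open>J\<close>. An edge exchanges one element of the complement for another, hence its size 2
  persists along paths.\<close>

lemma card_complement_step:
  assumes "e \<in> sub_edges J" shows "card (J - target e ` \<Lambda>) = card (J - source e ` \<Lambda>)"
proof -
  note d = sub_edgesD[OF assms] and r = reverse_edge_props[OF sub_edgesD(1)[OF assms]]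
  note d' = sub_edgesD[OF reverse_sub_edges[OF assms]]
  have n: "snd e \<notin> source e ` \<Lambda>" using edgeD(3)[of "source e" "snd e"] d(1) by (simp add: source_def)
  have n': "snd (reverse_edge e) \<notin> target e ` \<Lambda>"
    using edgeD(3)[of "source (reverse_edge e)" "snd (reverse_edge e)"] d'(1) r(3) by (simp add: source_def)
  define D where "D = J - (source e ` \<Lambda> \<union> {snd e})"
  have 1: "J - source e ` \<Lambda> = insert (snd e) D" "snd e \<notin> D" using n d(3) by (auto simp: D_def)
  have 2: "J - target e ` \<Lambda> = insert (snd (reverse_edge e)) D" "snd (reverse_edge e) \<notin> D"
    using n' d'(3) r(5) by (auto simp: D_def)
  \<comment> \<open>If the common part \<open>D\<close> is infinite, both cardinalities are 0 by
    convention.\<close>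
  show ?thesis by (cases "finite D") (simp_all add: 1 2)
qed

lemma card_complement_path:
  "path (sub_edges J) y p z \<Longrightarrow> card (J - z ` \<Lambda>) = card (J - y ` \<Lambda>)"
  by (induction p arbitrary: z) (auto simp: card_complement_step)

lemma path_image_subset: "path (sub_edges J) y p z \<Longrightarrow> y ` \<Lambda> \<subseteq> J \<Longrightarrow> z ` \<Lambda> \<subseteq> J"
proof (cases p)
  case (Cons a p')
  moreover assume "path (sub_edges J) y p z"
  ultimately have "a \<in> sub_edges J" "target a = z" by auto
  then show ?thesis using sub_edgesD(4) by blast
qed simp

text \<open>An edge is determined by its source and the added generator, and only two generators are
  available. This valency bound is the reason why a component is a cycle or a path.\<close>

lemma two_out_edges:
  assumes "card (J - v ` \<Lambda>) = 2" "a \<in> sub_edges J" "b \<in> sub_edges J" "c \<in> sub_edges J"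
    "source a = v" "source b = v" "source c = v" "a \<noteq> b"
  shows "c = a \<or> c = b"
proof -
  have m: "snd e \<in> J - v ` \<Lambda>" if "e \<in> sub_edges J" "source e = v" for e
    using sub_edgesD[OF that(1)] edgeD(3)[of v "snd e"] that(2) by (cases e) (auto simp: source_def)
  have eq: "e = e'" if "source e = v" "source e' = v" "snd e = snd e'" for e e' :: "('l \<Rightarrow> 'a) \<times> 'a"
    using that by (simp add: source_def prod_eq_iff)
  have ab: "snd a \<noteq> snd b" using eq assms by blast
  have fin: "finite (J - v ` \<Lambda>)" by (rule card_ge_0_finite) (simp add: assms(1))
  have "{snd a, snd b} = J - v ` \<Lambda>"
  proof (rule card_subset_eq[OF fin])
    show "{snd a, snd b} \<subseteq> J - v ` \<Lambda>" using m[OF assms(2,5)] m[OF assms(3,6)] by simp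
    show "card {snd a, snd b} = card (J - v ` \<Lambda>)" by (simp add: ab assms(1))
  qed
  then have "snd c = snd a \<or> snd c = snd b" using m[OF assms(4,7)] by blast
  then show ?thesis using eq[OF assms(7,5)] eq[OF assms(7,6)] by blast
qed

lemma visited_split:
  assumes "v \<in> set (visited z q)" shows "\<exists>A B. q = A @ B \<and> hd (visited z B) = v"
  using assms
proof (induction q)
  case Nil
  then show ?case by (simp add: visited_def)
next
  case (Cons a q)
  show ?case
  proof (cases "v = target a")
    case True
    then show ?thesis by (intro exI[of _ "[]"] exI[of _ "a # q"]) (simp add: visited_def)
  next
    case False
    then have "v \<in> set (visited z q)" using Cons.prems by (simp add: visited_def)
    from Cons.IH[OF this] obtain A B where "q = A @ B" "hd (visited z B) = v" by blast
    then show ?thesis by (intro exI[of _ "a # A"] exI[of _ B]) simp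
  qed
qed

lemma path_hd_visited: "path E z q y \<Longrightarrow> hd (visited z q) = y"
  by (cases q) (auto simp: visited_def)

lemma path_split_visited:
  assumes "path E z q y" "E \<subseteq> edges" "v \<in> set (visited z q)"
  obtains A B where "q = A @ B" "path E z B v" "path E v A y"
proof -
  obtain A B where ab: "q = A @ B" "hd (visited z B) = v" using visited_split[OF assms(3)] by blast
  obtain x where x: "path E z B x" "path E x A y" using assms(1) ab(1) path_append[OF assms(2)] by blast
  have "x = v" using path_hd_visited[OF x(1)] ab(2) by simp
  then show ?thesis using that ab(1) x by blast
qed

lemma path_last_source: "path E v A y \<Longrightarrow> A \<noteq> [] \<Longrightarrow> source (last A) = v"
  by (induction A arbitrary: y) auto

text \<open>The loop \<open>f\<close> at the starting vertex uses up one of the two edges there, so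
  the walk cannot close up to a cycle.\<close>

lemma visited_distinct:
  assumes "path (sub_edges J - loops) z q y" "nonbacktracking q"
    and f: "f \<in> loops \<inter> sub_edges J" "source f = z" and card: "card (J - z ` \<Lambda>) = 2"
  shows "distinct (visited z q)"
  using assms(1,2)
proof (induction q arbitrary: y)
  case Nil
  then show ?case by (simp add: visited_def)
next
  case (Cons a q)
  have sub: "sub_edges J - loops \<subseteq> edges" using sub_edges_edges by blast
  have sub': "sub_edges J - loops \<subseteq> sub_edges J" by blast
  have a: "a \<in> sub_edges J - loops" "target a = y" "path (sub_edges J - loops) z q (source a)" using Cons.prems by auto
  have ae: "a \<in> edges" using a(1) sub by blast
  note r = reverse_edge_props[OF ae]
  have IH: "distinct (visited z q)" by (rule Cons.IH[OF a(3) nonbacktracking_tl[OF Cons.prems(2)]])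
  have "y \<notin> set (visited z q)"
  proof
    assume y: "y \<in> set (visited z q)"
    obtain A B where AB: "q = A @ B" "path (sub_edges J - loops) z B y" "path (sub_edges J - loops) y A (source a)"
      using path_split_visited[OF a(3) sub y] .
    have cy: "card (J - y ` \<Lambda>) = 2" using card_complement_path[OF path_mono[OF AB(2) sub']] card by simp
    have An: "A \<noteq> []"
    proof
      assume "A = []"
      then have "target a = source a" using AB(3) a(2) by simp
      then show False using a(1) ae unfolding loops_def by blast
    qed
    define c where "c = last A"
    have c: "c \<in> sub_edges J" "c \<notin> loops" "source c = y"
      using path_set[OF AB(3)] last_in_set[OF An] path_last_source[OF AB(3) An] by (auto simp: c_def)
    have rr: "reverse_edge a \<in> sub_edges J" "source (reverse_edge a) = y" "reverse_edge a \<notin> loops"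
      using reverse_sub_edges a(1,2) r(3) reverse_nonloop[of a] ae by auto
    have hdq: "hd (visited z q) = source a" by (rule path_hd_visited[OF a(3)])
    have vq: "visited z q = map target A @ visited z B" using AB(1) by (simp add: visited_def)
    have hA: "source a = target (hd A)" using hdq vq An by (cases A) auto
    \<comment> \<open>Here \<open>c\<close> is the edge by which the walk left \<open>y\<close>. If
      the last edge retraced it, then either the walk just backtracks, or the far end of
      \<open>c\<close> was visited twice before.\<close>
    have not_c: "reverse_edge a \<noteq> c"
    proof
      assume rc: "reverse_edge a = c"
      show False
      proof (cases "butlast A")
        case Nil
        then have "A = [c]" using An c_def by (metis append_butlast_last_id append_Nil)
        then have "q = c # B" using AB(1) by simp
        then have "a \<noteq> reverse_edge c" using Cons.prems(2) nonbacktracking_Cons by simp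
        then show False using rc r(8) by simp
      next
        case (Cons b A')
        have Ae: "A = (b # A') @ [c]" using An c_def Cons by (metis append_butlast_last_id)
        have "target c = source a" using rc r(4) by simp
        then have "target c = target b" using hA Ae by simp
        then show False using IH unfolding vq Ae by simp
      qed
    qed
    \<comment> \<open>At the start the two outgoing edges are the loop \<open>f\<close> and
      \<open>c\<close>, and the reversed edge is neither. Elsewhere they are \<open>c\<close> and
      the reverse of the edge \<open>b\<close> by which \<open>y\<close> was first reached; then
      \<open>a = b\<close>, whose source would have been visited both before and after
      \<open>y\<close>.\<close>
    show False
    proof (cases B)
      case Nil
      then have zy: "z = y" using AB(2) by simp
      have "f \<noteq> c" using f c by blast
      then have "reverse_edge a = f \<or> reverse_edge a = c"
        using two_out_edges[OF cy, of f c "reverse_edge a"] f c rr zy by blast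
      then show False using not_c rr(3) f(1) by blast
    next
      case (Cons b B')
      have b: "b \<in> sub_edges J - loops" "target b = y" using AB(2) Cons by auto
      have be: "b \<in> edges" using b(1) sub by blast
      note rb = reverse_edge_props[OF be]
      have "nonbacktracking (A @ B)" using nonbacktracking_tl[OF Cons.prems(2)] AB(1) by simp
      then have "reverse_edge b \<noteq> c" using An Cons unfolding nonbacktracking_append c_def by auto
      moreover have "reverse_edge b \<in> sub_edges J" "source (reverse_edge b) = y"
        using b rb(3) reverse_sub_edges[of b] by simp_all
      ultimately have "reverse_edge a = reverse_edge b \<or> reverse_edge a = c"
        using two_out_edges[OF cy _ c(1) rr(1) _ c(3) rr(2), of "reverse_edge b"] by blast
      then have "reverse_edge a = reverse_edge b" using not_c by blast
      then have "reverse_edge (reverse_edge a) = reverse_edge (reverse_edge b)" by simp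
      then have "a = b" unfolding r(8) rb(8) .
      then have sa: "source a = source b" by simp
      have "path (sub_edges J - loops) z B' (source b)" using AB(2) Cons by simp
      then have "source b = hd (visited z B')" by (simp add: path_hd_visited)
      then have "source b \<in> set (visited z B')" by (cases B') (simp_all add: visited_def)
      moreover have "source a \<in> set (map target A)" using hA An by simp
      moreover have "visited z B = target b # visited z B'" using Cons by (simp add: visited_def)
      ultimately show False using IH sa unfolding vq by auto
    qed
  qed
  then show ?case using IH a(2) by (simp add: visited_def)
qed

text \<open>At each visited vertex two different outgoing edges are known: the next edge, or the
  loop \<open>e\<close> at the end, and the reverse of the previous edge, or the loop
  \<open>f\<close> at the start. There is no room for a third.\<close>

lemma out_edges_visited:
  assumes q: "path (sub_edges J - loops) z q y" "nonbacktracking q"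
    and f: "f \<in> loops \<inter> sub_edges J" "source f = z" and e: "e \<in> loops \<inter> sub_edges J" "source e = y"
    and ef: "q = [] \<Longrightarrow> e \<noteq> f" and card: "card (J - z ` \<Lambda>) = 2"
    and a: "a \<in> sub_edges J" "source a \<in> set (visited z q)"
  shows "a \<in> set q \<union> set (reverse_path q) \<union> {f, e}"
proof -
  have sub: "sub_edges J - loops \<subseteq> edges" using sub_edges_edges by blast
  have sub': "sub_edges J - loops \<subseteq> sub_edges J" by blast
  define v where "v = source a"
  obtain A B where AB: "q = A @ B" "path (sub_edges J - loops) z B v" "path (sub_edges J - loops) v A y"
    using path_split_visited[OF q(1) sub a(2)] unfolding v_def .
  have cv: "card (J - v ` \<Lambda>) = 2" using card_complement_path[OF path_mono[OF AB(2) sub']] card by simp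
  define c where "c = (if A = [] then e else last A)"
  define b where "b = (if B = [] then f else reverse_edge (hd B))"
  have c: "c \<in> sub_edges J" "source c = v" "c \<in> set q \<union> {e}"
  proof -
    show "c \<in> sub_edges J"
    proof (cases "A = []")
      case False
      then have "last A \<in> sub_edges J" using path_set[OF AB(3)] last_in_set[OF False] by blast
      then show ?thesis using False by (simp add: c_def)
    qed (use e in \<open>simp add: c_def\<close>)
    show "source c = v" using e AB(3) path_last_source[OF AB(3)] by (auto simp: c_def)
    show "c \<in> set q \<union> {e}" using AB(1) by (simp add: c_def)
  qed
  have hB: "hd B \<in> sub_edges J - loops \<and> target (hd B) = v" if "B \<noteq> []"
    using that AB(2) by (cases B) auto
  have b: "b \<in> sub_edges J" "source b = v" "b \<in> set (reverse_path q) \<union> {f}"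
  proof -
    show "b \<in> sub_edges J" using f hB reverse_sub_edges by (auto simp: b_def)
    show "source b = v"
    proof (cases "B = []")
      case True
      then show ?thesis using f AB(2) by (simp add: b_def)
    next
      case False
      then have "hd B \<in> edges" using hB sub by blast
      then show ?thesis using False hB reverse_edge_props(3)[of "hd B"] by (simp add: b_def)
    qed
    show "b \<in> set (reverse_path q) \<union> {f}" using AB(1) by (simp add: b_def reverse_path_def)
  qed
  have "c \<noteq> b"
  proof (cases "A = []"; cases "B = []")
    assume "A = []" "B = []"
    then show ?thesis using ef AB(1) by (simp add: c_def b_def)
  next
    assume h: "A = []" "B \<noteq> []"
    then have "hd B \<in> edges - loops" using hB sub by blast
    then have "b \<notin> loops" using h reverse_nonloop by (simp add: b_def)
    then show ?thesis using h e by (auto simp: c_def)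
  next
    assume h: "A \<noteq> []" "B = []"
    then have "last A \<notin> loops" using path_set[OF AB(3)] last_in_set by blast
    then show ?thesis using h f by (auto simp: c_def b_def)
  next
    assume h: "A \<noteq> []" "B \<noteq> []"
    then show ?thesis using q(2) unfolding AB(1) nonbacktracking_append by (simp add: c_def b_def)
  qed
  then have "a = c \<or> a = b" using two_out_edges[OF cv c(1) b(1) a(1) c(2) b(2)] v_def by blast
  then show ?thesis using c(3) b(3) by blast
qed

lemma map_target_reverse_path:
  assumes "path E z q y" "E \<subseteq> edges" shows "map target (reverse_path q) @ [y] = rev (visited z q)"
  using assms(1)
proof (induction q arbitrary: y)
  case Nil
  then show ?case by (simp add: visited_def)
next
  case (Cons a q)
  then have a: "a \<in> edges" "target a = y" "path E z q (source a)" using assms(2) by auto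
  show ?case using Cons.IH[OF a(3)] a(2) reverse_edge_props(4)[OF a(1)]
    by (simp add: reverse_path_Cons visited_def)
qed

lemma count_list_distinct: "distinct xs \<Longrightarrow> count_list xs v = (if v \<in> set xs then 1 else 0)"
  by (induction xs) auto

lemma source_visited: "path E z q y \<Longrightarrow> a \<in> set q \<Longrightarrow> source a \<in> set (visited z q)"
proof (induction q arbitrary: y)
  case (Cons b q)
  then have p: "path E z q (source b)" by simp
  have "source b \<in> set (visited z q)"
  proof -
    have "visited z q \<noteq> []" by (simp add: visited_def)
    then show ?thesis using path_hd_visited[OF p] hd_in_set by metis
  qed
  then show ?case using Cons.IH[OF p] Cons.prems by (auto simp: visited_def)
qed simp

text \<open>By \<open>out_edges_visited\<close> the vertices of \<open>q\<close> are closed under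
  the edges of the graph on \<open>J\<close>. So they make up the whole component, and its shape can
  be read off from \<open>q\<close> and the two loops.\<close>

lemma shuttling_tourI:
  assumes J: "J = y ` \<Lambda> \<union> {s, t}" "s \<noteq> t" "s \<in> S - y ` \<Lambda>" "t \<in> S - y ` \<Lambda>"
    and ft: "finite_type (components_meeting (y ` \<Lambda>) {s, t})"
    and q: "path (sub_edges J - loops) z q y" "nonbacktracking q"
    and f: "f \<in> loops \<inter> sub_edges J" "source f = z" and e: "e \<in> loops \<inter> sub_edges J" "source e = y"
    and ef: "q = [] \<Longrightarrow> e \<noteq> f"
  shows "shuttling_tour y ([e] @ q @ [f] @ reverse_path q)"
proof -
  let ?c = "[e] @ q @ [f] @ reverse_path q"
  have sub: "sub_edges J - loops \<subseteq> edges" using sub_edges_edges by blast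
  have sub': "sub_edges J - loops \<subseteq> sub_edges J" by blast
  have yv: "y \<in> vertices" "z \<in> vertices" using path_vertices[OF sub q(1)] by auto
  have zJ: "z ` \<Lambda> \<subseteq> J" using sub_edgesD(2)[of f J] f by blast
  have "J - y ` \<Lambda> = {s, t}" using J by blast
  then have "card (J - y ` \<Lambda>) = 2" using J(2) by simp
  then have card: "card (J - z ` \<Lambda>) = 2" using card_complement_path[OF path_mono[OF q(1) sub']] by simp
  note dist = visited_distinct[OF q f card]
  have out: "a \<in> set q \<union> set (reverse_path q) \<union> {f, e}"
    if "a \<in> sub_edges J" "source a \<in> set (visited z q)" for a
    by (rule out_edges_visited[OF q f e _ card that]) (rule ef)
  let ?U = "component_vertices J y" and ?E = "component_edges J y"
  let ?V = "set (visited z q)"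
  have tgt: "target a \<in> ?V" if a: "a \<in> set q \<union> set (reverse_path q) \<union> {f, e}" for a
  proof -
    consider "a \<in> set q" | b where "b \<in> set q" "a = reverse_edge b" | "a = f" | "a = e"
      using a by (auto simp: reverse_path_def)
    then show ?thesis
    proof cases
      case 1
      then show ?thesis by (simp add: visited_def)
    next
      case (2 b)
      then have "b \<in> edges" using path_set[OF q(1)] sub by blast
      then show ?thesis using reverse_edge_props(4) 2 source_visited[OF q(1) 2(1)] by simp
    next
      case 3
      then show ?thesis using loopD(2) f by (simp add: visited_def)
    next
      case 4
      have "visited z q \<noteq> []" by (simp add: visited_def)
      then have "y \<in> ?V" using path_hd_visited[OF q(1)] hd_in_set by metis
      then show ?thesis using 4 loopD(2) e by simp
    qed
  qed
  have yV: "y \<in> ?V" using tgt[of e] loopD(2)[of e] e by simp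
  have rq: "path (sub_edges J - loops) y (reverse_path q) z"
    by (rule path_reverse[OF q(1) sub sub]) (use reverse_sub_edges reverse_nonloop sub in blast)
  have U1: "v \<in> ?V" if "path (sub_edges J) y p v" for p v
    using that
  proof (induction p arbitrary: v)
    case Nil
    then show ?case using yV by simp
  next
    case (Cons a p)
    then have a: "a \<in> sub_edges J" "target a = v" "source a \<in> ?V" by auto
    then show ?case using tgt[OF out[OF a(1,3)]] by simp
  qed
  have U2: "v \<in> ?U" if v: "v \<in> ?V" for v
  proof -
    obtain A B where AB: "path (sub_edges J - loops) z B v"
      using path_split_visited[OF q(1) sub v] by blast
    have "path (sub_edges J - loops) y (B @ reverse_path q) v" using rq AB path_append[OF sub] by blast
    then have p: "path (sub_edges J) y (B @ reverse_path q) v" by (rule path_mono[OF _ sub'])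
    have "v \<in> vertices" using path_vertices(2)[OF sub AB] .
    moreover have "v ` \<Lambda> \<subseteq> J" using path_image_subset[OF p] J(1) by blast
    ultimately show ?thesis using p unfolding component_vertices_def by blast
  qed
  have U: "?U = ?V" using U1 U2 unfolding component_vertices_def by blast
  have E: "?E = set q \<union> set (reverse_path q) \<union> {f, e}"
  proof (intro equalityI subsetI)
    fix a assume "a \<in> ?E"
    then show "a \<in> set q \<union> set (reverse_path q) \<union> {f, e}" using out U unfolding component_edges_def by blast
  next
    fix a assume a: "a \<in> set q \<union> set (reverse_path q) \<union> {f, e}"
    have qs: "b \<in> sub_edges J" if "b \<in> set q" for b using path_set[OF q(1)] that by blast
    consider "a \<in> set q" | b where "b \<in> set q" "a = reverse_edge b" | "a = f" | "a = e"
      using a by (auto simp: reverse_path_def)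
    then show "a \<in> ?E"
    proof cases
      case 1
      then show ?thesis using qs U source_visited[OF q(1)] unfolding component_edges_def by blast
    next
      case (2 b)
      have "source a = target b" using 2 reverse_edge_props(3) qs[OF 2(1)] sub_edges_edges by blast
      moreover have "target b \<in> ?V" using 2 by (simp add: visited_def)
      ultimately show ?thesis using 2 qs[OF 2(1)] reverse_sub_edges U unfolding component_edges_def by auto
    next
      case 3
      then show ?thesis using f U unfolding component_edges_def by (auto simp: visited_def)
    next
      case 4
      then show ?thesis using e U yV unfolding component_edges_def by auto
    qed
  qed
  have Eed: "?E \<subseteq> edges" unfolding component_edges_def using sub_edges_edges by blast
  have efne: "e \<noteq> f"
  proof (cases "q = []")
    case False
    have "hd (visited z q) \<noteq> last (visited z q)"
      using dist False by (cases q) (auto simp: visited_def)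
    then have "y \<noteq> z" using path_hd_visited[OF q(1)] by (simp add: visited_def)
    then show ?thesis using e f by blast
  qed (rule ef)
  have qE: "path ?E z q y" by (rule path_subset[OF q(1)]) (use E in blast)
  have rqE: "path ?E y (reverse_path q) z" by (rule path_subset[OF rq]) (use E in blast)
  have "looped_path_graph ?U ?E" unfolding looped_path_graph_def
    by (rule exI[of _ z], rule exI[of _ q], rule exI[of _ y], rule exI[of _ f], rule exI[of _ e])
      (use qE dist U e f efne E in auto)
  moreover have "path ?E y ?c y"
  proof -
    have "path ?E z [f] z" using f E yv loopD(2)[of f] by simp
    moreover have "path ?E y [e] y" using e E yv loopD(2)[of e] by simp
    ultimately show ?thesis using qE rqE unfolding path_append[OF Eed] by blast
  qed
  moreover have "count_list (visited y ?c) v = 2" if v: "v \<in> ?U - {y}" for v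
  proof -
    have "visited y ?c = target e # map target q @ [target f] @ map target (reverse_path q) @ [y]"
      by (simp add: visited_def)
    \<comment> \<open>The loops repeat the end vertices, and the way back runs through the vertices
      of \<open>q\<close> in reverse order; so every vertex except the starting point occurs exactly
      twice.\<close>
    also have "\<dots> = y # visited z q @ rev (visited z q)"
      using map_target_reverse_path[OF q(1) sub] loopD(2)[of e] loopD(2)[of f] e f by (simp add: visited_def)
    finally show ?thesis using v U count_list_distinct[OF dist] by auto
  qed
  moreover have "count_list ?c a = 1" if a: "a \<in> ?E \<inter> loops" for a
  proof -
    have nq: "a \<notin> set q" using a path_set[OF q(1)] by blast
    have nr: "a \<notin> set (reverse_path q)" using a path_set[OF rq] by blast
    have "a = e \<or> a = f" using a E nq nr by blast
    then show ?thesis using efne nq nr by (auto simp: count_list_0_iff)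
  qed
  ultimately show ?thesis unfolding shuttling_tour_def Let_def
    using J ft yv(1) U yV by (intro exI[of _ y] exI[of _ s] exI[of _ t]) auto
qed

end

section \<open>Finite type of unions of components\<close>

context coxeter_system
begin

text \<open>Roots inject into the group as reflections, and the group injects into sets of roots by
  inversions.\<close>

lemma finite_type_iff_roots:
  assumes "A \<subseteq> S" shows "finite_type A \<longleftrightarrow> finite (positive_roots \<inter> Phi A)"
proof
  assume "finite_type A"
  then have fin: "finite (generate W A)" by (simp add: finite_type_def)
  show "finite (positive_roots \<inter> Phi A)"
  proof (rule inj_on_finite[OF _ _ fin])
    show "inj_on reflection (positive_roots \<inter> Phi A)"
      by (rule inj_onI) (use reflection_inj in blast)
    show "reflection ` (positive_roots \<inter> Phi A) \<subseteq> generate W A"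
      using reflection_generate[OF _ _ assms] by blast
  qed
next
  assume fin: "finite (positive_roots \<inter> Phi A)"
  have "finite (generate W A)"
  proof (rule inj_on_finite)
    show "inj_on inversions (generate W A)"
    proof (rule inj_onI)
      fix g h assume "g \<in> generate W A" "h \<in> generate W A" "inversions g = inversions h"
      then show "g = h" using inversions_eq_imp[of g h] generate_carrier[OF assms] by simp
    qed
    show "inversions ` generate W A \<subseteq> Pow (positive_roots \<inter> Phi A)"
      using inversions_generate[OF assms] inversionsD(1) by auto
    show "finite (Pow (positive_roots \<inter> Phi A))" unfolding finite_Pow_iff by (rule fin)
  qed
  then show "finite_type A" by (simp add: finite_type_def)
qed

lemma finite_type_orthogonal_union:
  assumes "A \<subseteq> S" "B \<subseteq> S" "finite_type A" "finite_type B" "\<And>l k. l \<in> A \<Longrightarrow> k \<in> B \<Longrightarrow> form_coeff l k = 0"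
  shows "finite_type (A \<union> B)"
proof -
  have AB: "A \<union> B \<subseteq> S" using assms(1,2) by blast
  have "positive_roots \<inter> Phi (A \<union> B) \<subseteq> (positive_roots \<inter> Phi A) \<union> (positive_roots \<inter> Phi B)"
    using Phi_orthogonal_split[OF _ _ AB assms(5)] by blast
  then have "finite (positive_roots \<inter> Phi (A \<union> B))"
    using assms finite_type_iff_roots finite_subset finite_UnI by metis
  then show ?thesis using finite_type_iff_roots[OF AB] by blast
qed

text \<open>Tours require finite type for \<open>s\<close> and \<open>t\<close> together, while a
  decomposition delivers it for one generator at a time. If \<open>s\<close> lies in the component
  of \<open>t\<close>, that component contains everything; otherwise the two components are
  orthogonal.\<close>

lemma finite_type_two:
  assumes K: "K \<subseteq> S" and s: "s \<in> S" "s \<notin> K" and t: "t \<in> S" "t \<notin> K \<union> {s}"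
    and fs: "finite_type (component K s)" and ft: "finite_type (component (K \<union> {s}) t)"
  shows "finite_type (components_meeting K {s, t})"
proof -
  let ?A = "component (K \<union> {s}) t" and ?B = "component K s"
  have e: "K \<union> {s} \<union> {t} = K \<union> {s, t}" by blast
  let ?J = "K \<union> {s, t}"
  have JS: "K \<union> {s} \<union> {t} \<subseteq> S" using K s t by blast
  have A_closed: "x \<in> ?A" if "(step_rel ?J)\<^sup>*\<^sup>* a x" "a \<in> ?A" for a x
    using that
  proof (induction rule: rtranclp_induct)
    case (step y z)
    then show ?case using component_adjacent[of y "K \<union> {s}" t z] by (metis e)
  qed
  have fromt: "x \<in> ?A" if "(step_rel ?J)\<^sup>*\<^sup>* t x" for x
    by (rule A_closed[OF that component_self])
  show ?thesis
  proof (cases "s \<in> ?A")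
    case True
    have "components_meeting K {s, t} \<subseteq> ?A"
      unfolding components_meeting_def[of K "{s, t}"] using fromt A_closed[OF _ True] by blast
    then show ?thesis by (rule finite_type_mono[OF ft])
  next
    case False
    have disj: "x \<notin> ?A" if x: "x \<in> ?B" for x
    proof
      assume xA: "x \<in> ?A"
      have "(step_rel (K \<union> {s}))\<^sup>*\<^sup>* s x" using x component_iff by blast
      then have "s \<in> ?A" using xA
      proof (induction rule: rtranclp_induct)
        case (step y z)
        have "adjacent z y" using step(2) adjacent_sym by blast
        then have "y \<in> ?A" using component_adjacent[OF step(4), of y] step(2) by blast
        then show ?case by (rule step(3))
      qed
      then show False using False by simp
    qed
    have froms: "x \<in> ?B" if "(step_rel ?J)\<^sup>*\<^sup>* s x" for x
      using that
    proof (induction rule: rtranclp_induct)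
      case base
      show ?case by (rule component_self)
    next
      case (step y z)
      have zt: "z \<noteq> t"
      proof
        assume "z = t"
        then have "adjacent t y" using step(2) adjacent_sym by blast
        then have "y \<in> ?A" using component_adjacent[OF component_self, of y "K \<union> {s}" t] step(2) by blast
        then show False using disj[OF step(3)] by simp
      qed
      then have "z \<in> K \<union> {s}" using step(2) by blast
      then show ?case using component_adjacent[OF step(3)] step(2) by blast
    qed
    have sub: "components_meeting K {s, t} \<subseteq> ?A \<union> ?B"
      unfolding components_meeting_def[of K "{s, t}"] using fromt froms by blast
    have "finite_type (?A \<union> ?B)"
    proof (rule finite_type_orthogonal_union[OF _ _ ft fs])
      show "?A \<subseteq> S" "?B \<subseteq> S" using component_S[OF _ t(1), of "K \<union> {s}"] component_S[OF K s(1)] K s by auto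
      show "form_coeff l k = 0" if "l \<in> ?A" "k \<in> ?B" for l k
        using component_orth[OF JS that(1) _ disj[OF that(2)]] that(2) component_subset[of K s] by blast
    qed
    then show ?thesis using sub finite_type_mono by blast
  qed
qed

end

context coxeter_groupoid
begin

text \<open>The groupoid element \<open>d\<close> carries the wall of the loop \<open>(y, s)\<close> to another wall of \<open>\<C>\<close>. Walking
  along \<open>d\<close> inside \<open>\<C>(J)\<close> one meets the second loop of the component: either at the very end, where it is the
  transported wall, or earlier, at a wall separating the two chambers.\<close>

lemma tour_exists:
  assumes e: "(y, s) \<in> loops" and t: "t \<in> S" "t \<notin> y ` \<Lambda> \<union> {s}"
    and ft: "finite_type (component (y ` \<Lambda> \<union> {s}) t)"
  shows "\<exists>q f. f \<in> loops \<and> path (edges - loops) (source f) q y \<and>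
    shuttling_tour y ([(y, s)] @ q @ [f] @ reverse_path q) \<and>
    (path_elt q = inv (elementary_move (y ` \<Lambda> \<union> {s}) t) \<and> act (path_elt q) (lroot f) = lroot (y, s) \<or>
     act (path_elt q) (lroot f) \<in> inversions (elementary_move (y ` \<Lambda> \<union> {s}) t))"
proof -
  note E = edgeD[OF loopD(1)[OF e]]
  note lr = lroot_props[OF e]
  define K where "K = y ` \<Lambda> \<union> {s}"
  define J where "J = y ` \<Lambda> \<union> {s, t}"
  define d where "d = elementary_move K t"
  have KS: "K \<subseteq> S" using E by (simp add: K_def)
  have tK: "t \<notin> K" using t by (simp add: K_def)
  have JK: "J = K \<union> {t}" by (auto simp: J_def K_def)
  have JS: "J \<subseteq> S" using KS t by (simp add: JK)
  have ftK: "finite_type (component K t)" using ft by (simp add: K_def)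
  have dc: "d \<in> carrier W" using elementary_move_carrier[OF KS t(1) ftK] by (simp add: d_def)
  have Nd: "inversions d = {\<gamma> \<in> positive_roots. \<gamma> \<in> Phi J \<and> \<gamma> t > 0}" using inversions_elementary_move[OF KS t(1) tK ftK] by (simp add: d_def JK)
  have simple: "\<exists>k'\<in>J. act d (simple_root k) = simple_root k'" if "k \<in> K" for k
    using elementary_move_simple'[OF KS t(1) tK ftK that] by (simp add: d_def JK)
  have "\<exists>k'\<in>S. act d (simple_root k) = simple_root k'" if "k \<in> y ` \<Lambda>" for k
    using simple[of k] that JS by (auto simp: K_def)
  from vertex_of_simple[OF E(1) dc this] obtain z where z: "z \<in> vertices" "d \<in> C z y" by blast
  obtain s1 where s1: "s1 \<in> J" "act d (simple_root s) = simple_root s1" using simple[of s] by (auto simp: K_def)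
  have s1S: "s1 \<in> S" using s1 JS by blast
  have s1z: "s1 \<notin> z ` \<Lambda>"
  proof
    assume "s1 \<in> z ` \<Lambda>"
    then obtain l where l: "l \<in> \<Lambda>" "s1 = z l" by blast
    then have "act d (simple_root s) = act d (simple_root (y l))" using s1(2) CD(2)[OF z(2)] by simp
    then have "simple_root s = simple_root (y l)"
      by (rule act_inj[OF dc, rotated 2]) (use E(2) vertexD(4)[OF E(1) l(1)] in auto)
    then show False using E(3) l(1) by (simp add: simple_root_inj)
  qed
  define \<delta> where "\<delta> = act d (lroot (y, s))"
  have dp: "\<delta> \<in> positive_roots" unfolding \<delta>_def
  proof (rule act_pos_combination[OF lr(1) _ dc])
    show "lroot (y, s) \<in> Phi K" using lr(2) by (simp add: K_def)
    show "act d (simple_root k) r \<ge> 0" if k: "k \<in> K" for k r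
    proof -
      obtain k' where "act d (simple_root k) = simple_root k'" using simple[OF k] by blast
      then show ?thesis by (simp add: simple_root_nonneg)
    qed
  qed
  have dperp: "\<delta> \<in> perp z" unfolding \<delta>_def by (rule act_perp[OF z(2) E(1) lr(3)])
  have dph: "\<delta> \<in> Phi (z ` \<Lambda> \<union> {s1})"
  proof (rule PhiI)
    show "\<delta> \<in> roots" using dp by simp
    fix r assume r: "r \<notin> z ` \<Lambda> \<union> {s1}"
    have V: "lroot (y, s) \<in> V" using lr(1) by simp
    have "\<delta> r = (\<Sum>k\<in>{k. lroot (y, s) k \<noteq> 0}. lroot (y, s) k * act d (simple_root k) r)"
      unfolding \<delta>_def by (rule act_expand) (use dc V_supp[OF V] in auto)
    also have "\<dots> = 0"
    proof (rule sum.neutral, rule ballI)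
      fix k assume "k \<in> {k. lroot (y, s) k \<noteq> 0}"
      then have "k \<in> y ` \<Lambda> \<union> {s}" using PhiD(2)[OF lr(2), of k] by auto
      then have "\<exists>k'\<in>z ` \<Lambda> \<union> {s1}. act d (simple_root k) = simple_root k'"
        using CD(2)[OF z(2)] s1(2) by auto
      then obtain k' where k': "k' \<in> z ` \<Lambda> \<union> {s1}" "act d (simple_root k) = simple_root k'" by blast
      have "k' \<noteq> r" using k'(1) r by blast
      then show "lroot (y, s) k * act d (simple_root k) r = 0" using k'(2) by (simp add: simple_root_other)
    qed
    finally show "\<delta> r = 0" .
  qed
  note l1 = loopI[OF z(1) s1S s1z dp dph dperp]
  have NJ: "inversions d \<subseteq> Phi J" using Nd by blast
  have yJ: "y ` \<Lambda> \<subseteq> J" by (auto simp: J_def)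
  obtain p y' where p: "path (sub_edges J - loops) y p y'" "nonbacktracking p"
    and py: "y' = z \<and> path_elt p = d \<or>
     (\<exists>s. (y', s) \<in> loops \<inter> sub_edges J \<and> act (inv (path_elt p)) (lroot (y', s)) \<in> inversions d)"
    using decompose[OF z(2) E(1) z(1) yJ JS NJ] by blast
  have sub: "sub_edges J - loops \<subseteq> edges" using sub_edges_edges by blast
  have sube: "sub_edges J - loops \<subseteq> edges - loops" using sub_edges_edges by blast
  have se: "set p \<subseteq> edges" using path_set[OF p(1)] sub by blast
  define q where "q = reverse_path p"
  have q: "path (sub_edges J - loops) y' q y" unfolding q_def
    by (rule path_reverse[OF p(1) sub sub]) (use reverse_sub_edges reverse_nonloop sub in blast)
  have nbq: "nonbacktracking q" unfolding q_def by (rule nonbacktracking_reverse[OF se p(2)])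
  have qe: "path_elt q = inv (path_elt p)" unfolding q_def by (rule path_elt_reverse[OF se])
  have pq: "q = [] \<longleftrightarrow> p = []" by (simp add: q_def reverse_path_def)
  have eJ: "(y, s) \<in> loops \<inter> sub_edges J" using e E loopD(1)[OF e] by (auto simp: sub_edges_def source_def J_def)
  have zJ: "z ` \<Lambda> \<subseteq> J"
  proof
    fix k assume "k \<in> z ` \<Lambda>"
    then obtain l where l: "l \<in> \<Lambda>" "k = z l" by blast
    then have "y l \<in> K" by (simp add: K_def)
    then obtain k' where "k' \<in> J" "act d (simple_root (y l)) = simple_root k'" using simple by blast
    then show "k \<in> J" using CD(2)[OF z(2) l(1)] l(2) simple_root_inj by metis
  qed
  have f1J: "(z, s1) \<in> loops \<inter> sub_edges J" using l1(1) loopD(1)[OF l1(1)] zJ s1(1)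
    by (auto simp: sub_edges_def source_def)
  have dinvV: "act (inv d) \<delta> = lroot (y, s)" unfolding \<delta>_def using act_inv(1)[OF dc] lr(1) by simp
  \<comment> \<open>The wall of the starting loop is not crossed by \<open>d\<close>. This excludes
    that the loop met after an empty path is the starting loop again.\<close>
  have eN: "lroot (y, s) \<notin> inversions d" using dp by (auto simp: \<delta>_def inversions_def)
  obtain f where f: "f \<in> loops \<inter> sub_edges J" "source f = y'" "q = [] \<Longrightarrow> (y, s) \<noteq> f"
    "path_elt q = inv d \<and> act (path_elt q) (lroot f) = lroot (y, s) \<or> act (path_elt q) (lroot f) \<in> inversions d"
    using py
  proof
    assume h: "y' = z \<and> path_elt p = d"
    have tN: "simple_root t \<in> inversions d" unfolding Nd using t(1) simple_root_Phi[OF t(1), of J] by (simp add: J_def)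
    show ?thesis
    proof (rule that[of "(z, s1)"])
      show "(y, s) \<noteq> (z, s1)" if "q = []"
      proof -
        have "d = \<one>" using that h pq by auto
        then show ?thesis using tN by simp
      qed
      show "path_elt q = inv d \<and> act (path_elt q) (lroot (z, s1)) = lroot (y, s) \<or>
          act (path_elt q) (lroot (z, s1)) \<in> inversions d"
        using h qe l1(2) dinvV by simp
    qed (use f1J h in \<open>simp_all add: source_def\<close>)
  next
    assume "\<exists>s. (y', s) \<in> loops \<inter> sub_edges J \<and> act (inv (path_elt p)) (lroot (y', s)) \<in> inversions d"
    then obtain s' where s': "(y', s') \<in> loops \<inter> sub_edges J" "act (inv (path_elt p)) (lroot (y', s')) \<in> inversions d" by blast
    show ?thesis
    proof (rule that[of "(y', s')"])
      show "(y, s) \<noteq> (y', s')" if "q = []"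
      proof
        assume h: "(y, s) = (y', s')"
        have "lroot (y', s') \<in> inversions d" using s' that pq lroot_props(1)[of y' s'] by simp
        then show False using eN h by simp
      qed
    qed (use s' qe in \<open>simp_all add: source_def\<close>)
  qed
  have "shuttling_tour y ([(y, s)] @ q @ [f] @ reverse_path q)"
  proof (rule shuttling_tourI[OF J_def])
    show "s \<noteq> t" "s \<in> S - y ` \<Lambda>" "t \<in> S - y ` \<Lambda>" using t E by auto
    show "finite_type (components_meeting (y ` \<Lambda>) {s, t})"
      by (rule finite_type_two[OF E(5,2,3) t E(4) ft])
    show "path (sub_edges J - loops) y' q y" by (rule q)
    show "nonbacktracking q" by (rule nbq)
    show "f \<in> loops \<inter> sub_edges J" "source f = y'" by (rule f)+
    show "(y, s) \<in> loops \<inter> sub_edges J" by (rule eJ)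
    show "source (y, s) = y" by (simp add: source_def)
    show "(y, s) \<noteq> f" if "q = []" by (rule f(3)[OF that])
  qed
  moreover have "path (edges - loops) (source f) q y" unfolding f(2) by (rule path_mono[OF q sube])
  ultimately show ?thesis using f(1,4) unfolding d_def K_def by blast
qed

end

section \<open>The reflection subgroup as a Coxeter group\<close>

context coxeter_system
begin

lemma pow_conj:
  assumes "g \<in> carrier W" "c \<in> carrier W" shows "(g \<otimes> c \<otimes> inv g) [^] (n::nat) = g \<otimes> c [^] n \<otimes> inv g"
proof (induction n)
  case 0
  then show ?case using assms by simp
next
  case (Suc n)
  have "(g \<otimes> c \<otimes> inv g) [^] Suc n = (g \<otimes> c [^] n \<otimes> inv g) \<otimes> (g \<otimes> c \<otimes> inv g)" using Suc by simp
  also have "\<dots> = g \<otimes> c [^] Suc n \<otimes> inv g" using assms by (simp add: m_assoc inv_cancel)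
  finally show ?case .
qed

lemma conj_eq_one_iff:
  assumes "g \<in> carrier W" "c \<in> carrier W" shows "g \<otimes> c \<otimes> inv g = \<one> \<longleftrightarrow> c = \<one>"
proof
  assume h: "g \<otimes> c \<otimes> inv g = \<one>"
  have "c = inv g \<otimes> (g \<otimes> c \<otimes> inv g) \<otimes> g" using assms by (simp add: m_assoc inv_cancel)
  then show "c = \<one>" using h assms by simp
qed (use assms in simp)

lemma ord_conj:
  assumes "g \<in> carrier W" "c \<in> carrier W" shows "ord (g \<otimes> c \<otimes> inv g) = ord c"
proof -
  have "ord (g \<otimes> c \<otimes> inv g) dvd n \<longleftrightarrow> ord c dvd n" for n
    using assms pow_eq_id[of "g \<otimes> c \<otimes> inv g" n] pow_eq_id[of c n] pow_conj[OF assms, of n]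
      conj_eq_one_iff[OF assms(1), of "c [^] n"] by simp
  then show ?thesis by (meson dvd_antisym dvd_refl)
qed

end

section \<open>Generators as reflections in walls\<close>

locale perp_system = groupoid_tree W S I \<Lambda> xI U T
  for W (structure) and S :: "'a set" and I and \<Lambda> :: "'l set" and xI U T +
  fixes x :: "'l \<Rightarrow> 'a"
  assumes x: "x \<in> vertices"
begin

abbreviation ppos :: "('a \<Rightarrow> real) set" where "ppos \<equiv> perp x \<inter> positive_roots"

abbreviation R where "R \<equiv> gens x"

abbreviation r where "r \<equiv> gen_elt T x"

text \<open>The tree path only normalises base points: an index amounts to a loop at some vertex
  \<open>y\<close> together with an element of \<open>Y x y\<close>, and by
  \<open>gen_of_walk\<close> every such pair occurs.\<close>

definition walk :: "'a \<times> (('l \<Rightarrow> 'a) \<times> 'a) \<Rightarrow> 'a" where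
  "walk i = fst i \<otimes> tree_elt x (source (snd i))"

text \<open>The positive root of the reflection \<open>r i\<close>. These roots play the part of the
  simple roots for the reflection subgroup.\<close>

definition \<rho> :: "'a \<times> (('l \<Rightarrow> 'a) \<times> 'a) \<Rightarrow> ('a \<Rightarrow> real)" where
  "\<rho> i = act (walk i) (lroot (snd i))"

lemma genD: assumes "i \<in> R" shows "fst i \<in> Y x x" "snd i \<in> loops" "snd i \<in> edges" "source (snd i) \<in> vertices"
  using assms loopD(1) source_vertex unfolding gens_def by auto

lemma lroot_props_at: assumes "e \<in> loops"
  shows "lroot e \<in> positive_roots" "lroot e \<in> perp (source e)" "edge_elt e = reflection (lroot e)" "lroot e \<in> roots"
    "lroot e \<in> Phi (source e ` \<Lambda> \<union> {snd e})"
proof -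
  obtain y s where e: "e = (y, s)" by (cases e)
  show "lroot e \<in> positive_roots" "lroot e \<in> perp (source e)" "edge_elt e = reflection (lroot e)"
    "lroot e \<in> Phi (source e ` \<Lambda> \<union> {snd e})"
    using lroot_props[of y s] assms by (simp_all add: e source_def)
  then show "lroot e \<in> roots" by simp
qed

lemma walk_Y: assumes "i \<in> R" shows "walk i \<in> Y x (source (snd i))"
  unfolding walk_def by (rule Y_mult[OF genD(1)[OF assms] tree_elt_Y x genD(4)[OF assms]]) (use genD(4)[OF assms] x in auto)

lemma walk_carrier: "i \<in> R \<Longrightarrow> walk i \<in> carrier W"
  using Y_carrier[OF walk_Y] .

lemma rho_props: assumes "i \<in> R" shows "\<rho> i \<in> perp x" "\<rho> i \<in> positive_roots" "\<rho> i \<in> roots"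
proof -
  note l = lroot_props_at[OF genD(2)[OF assms]]
  show "\<rho> i \<in> perp x" unfolding \<rho>_def by (rule act_perp[OF YD(1)[OF walk_Y[OF assms]] genD(4)[OF assms] l(2)])
  show "\<rho> i \<in> positive_roots" unfolding \<rho>_def by (rule YD(2)[OF walk_Y[OF assms] l(2,1)])
  then show "\<rho> i \<in> roots" by simp
qed

lemma gen_elt_conj: assumes "i \<in> R" shows "r i = walk i \<otimes> edge_elt (snd i) \<otimes> inv (walk i)"
proof -
  obtain w e where i: "i = (w, e)" by (cases i)
  note g = genD[OF assms, unfolded i fst_conv snd_conv]
  have c: "w \<in> carrier W" "tree_elt x (source e) \<in> carrier W" "edge_elt e \<in> carrier W"
    using Y_carrier[OF g(1)] Y_carrier[OF tree_elt_Y[OF g(4) x]] edge_elt_closed[OF g(3)] by auto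
  have "based T x (source e) [e] (source e) = tree_elt x (source e) \<otimes> (edge_elt e \<otimes> inv (tree_elt x (source e)))"
    using based_eq[OF x g(4,4), of "[e]"] g(3) c tree_elt_inv[OF g(4) x] by simp
  then show ?thesis unfolding i walk_def gen_elt_def using c by (simp add: m_assoc inv_mult_group)
qed

lemma gen_elt_reflection: assumes "i \<in> R" shows "r i = reflection (\<rho> i)"
  unfolding gen_elt_conj[OF assms] \<rho>_def using lroot_props_at(3,4)[OF genD(2)[OF assms]]
  by (simp add: reflection_act[OF _ walk_carrier[OF assms]])

lemma gen_of_walk:
  assumes "v \<in> Y x y" "y \<in> vertices" "e \<in> loops" "source e = y"
  shows "(v \<otimes> tree_elt y x, e) \<in> R" "walk (v \<otimes> tree_elt y x, e) = v"
proof -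
  note p = tree_elt_Y[OF x assms(2)]
  show "(v \<otimes> tree_elt y x, e) \<in> R" unfolding gens_def using Y_mult[OF assms(1) p assms(2) x] assms(3) by simp
  have "tree_elt x y = inv (tree_elt y x)" by (rule tree_elt_inv[OF x assms(2)])
  then show "walk (v \<otimes> tree_elt y x, e) = v"
    using Y_carrier[OF assms(1)] Y_carrier[OF p] by (simp add: walk_def assms(4) m_assoc)
qed

lemma reflection_C: assumes "\<gamma> \<in> perp x" shows "reflection \<gamma> \<in> C x x"
proof (rule CI)
  have g: "\<gamma> \<in> roots" using perpD(1)[OF assms] .
  then show "reflection \<gamma> \<in> carrier W" by simp
  show "act (reflection \<gamma>) (simple_root (x l)) = simple_root (x l)" if "l \<in> \<Lambda>" for l
    by (rule reflection_fixes[OF g]) (use that vertexD(4)[OF x] perpD(2)[OF assms] in auto)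
qed

lemma gen_elt_C: "i \<in> R \<Longrightarrow> r i \<in> C x x"
  unfolding gen_elt_reflection by (rule reflection_C[OF rho_props(1)])

lemma gen_elt_carrier: "i \<in> R \<Longrightarrow> r i \<in> carrier W"
  using CD(1)[OF gen_elt_C] .

lemma act_gen_perp: "i \<in> R \<Longrightarrow> \<delta> \<in> perp x \<Longrightarrow> act (r i) \<delta> \<in> perp x"
  by (rule act_perp[OF gen_elt_C x])

lemma act_gen_self: "i \<in> R \<Longrightarrow> act (r i) (\<rho> i) = neg (\<rho> i)"
  using act_reflection_self[OF rho_props(3)] gen_elt_reflection by simp

lemma gen_square: "i \<in> R \<Longrightarrow> r i \<otimes> r i = \<one>"
  using reflection_square[OF rho_props(3)] gen_elt_reflection by simp

lemma gen_inv: "i \<in> R \<Longrightarrow> inv (r i) = r i"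
  using reflection_inv[OF rho_props(3)] gen_elt_reflection by simp

lemma act_gen_gen: "i \<in> R \<Longrightarrow> v \<in> V \<Longrightarrow> act (r i) (act (r i) v) = v"
  using act_inv(1)[OF gen_elt_carrier, of i v] gen_inv[of i] by simp

lemma rho_eqI: "i \<in> R \<Longrightarrow> j \<in> R \<Longrightarrow> r i = r j \<Longrightarrow> \<rho> i = \<rho> j"
  using reflection_inj[OF rho_props(2) rho_props(2)] gen_elt_reflection by metis

text \<open>The analogue of \<open>simple_permutes\<close>. The walk preserves signs of
  perpendicular roots, so the claim can be tested at the loop, where \<open>lroot\<close> is the
  only perpendicular root that is inverted.\<close>

lemma gen_permutes:
  assumes i: "i \<in> R" and d: "\<delta> \<in> ppos" "\<delta> \<noteq> \<rho> i" shows "act (r i) \<delta> \<in> ppos"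
proof -
  obtain w y s where iw: "i = (w, (y, s))" by (cases i, cases "snd i") auto
  note g = genD[OF i, unfolded iw fst_conv snd_conv]
  have sy: "source (y, s) = y" by (simp add: source_def)
  note v = walk_Y[OF i, unfolded iw snd_conv sy]
  define v where "v = walk i"
  have vY: "v \<in> Y x y" using walk_Y[OF i] by (simp add: v_def iw source_def)
  have yv: "y \<in> vertices" using g(4) by (simp add: source_def)
  have vc: "v \<in> carrier W" using Y_carrier[OF vY] .
  have ivY: "inv v \<in> Y y x" by (rule Y_inv[OF vY x yv])
  define \<beta> where "\<beta> = act (inv v) \<delta>"
  have dr: "\<delta> \<in> roots" "\<delta> \<in> perp x" "\<delta> \<in> positive_roots" using d(1) by auto
  have bp: "\<beta> \<in> perp y" "\<beta> \<in> positive_roots"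
    unfolding \<beta>_def using act_perp[OF YD(1)[OF ivY] x dr(2)] YD(2)[OF ivY dr(2,3)] by auto
  have vb: "act v \<beta> = \<delta>" unfolding \<beta>_def using act_inv(2)[OF vc] dr by simp
  have l: "(y, s) \<in> loops" using g(2) .
  have e: "(y, s) \<in> edges" using g(3) .
  let ?e = "edge_elt (y, s)"
  have "act ?e \<beta> \<in> positive_roots"
  proof (rule ccontr)
    assume "act ?e \<beta> \<notin> positive_roots"
    then have "\<beta> \<in> inversions ?e" by (rule inversionsI[OF bp(2)])
    then have "\<beta> \<in> Phi (y ` \<Lambda> \<union> {s})" using inversions_edge[OF e] by simp
    then have "lroot (y, s) = \<beta>" using loopI(2)[OF edgeD(1,2,3)[OF e] bp(2) _ bp(1)] by blast
    then have "\<rho> i = \<delta>" using vb by (simp add: \<rho>_def v_def iw)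
    then show False using d(2) by simp
  qed
  moreover have "act ?e \<beta> \<in> perp y"
    using act_perp[OF _ yv bp(1), of ?e y] target_props(2)[OF e] loopD(2)[OF l] by (simp add: source_def)
  ultimately have "act v (act ?e \<beta>) \<in> positive_roots" by (intro YD(2)[OF vY])
  moreover have "act (r i) \<delta> = act v (act ?e \<beta>)"
    unfolding gen_elt_conj[OF i] \<beta>_def using vc dr edge_elt_closed[OF e] by (simp add: iw v_def[symmetric, unfolded iw] act_mult)
  ultimately show ?thesis using act_gen_perp[OF i dr(2)] by simp
qed

text \<open>The decomposition of \<open>w\<close> must meet a loop, since a path without loops
  represents an element of \<open>Y\<close>. The stretch before that loop, reversed, is the walk of
  the wanted index.\<close>

lemma exists_gen_inverted:
  assumes w: "w \<in> C z x" "z \<in> vertices" "w \<notin> Y z x" shows "\<exists>i\<in>R. \<rho> i \<in> inversions w"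
proof -
  have wS: "inversions w \<subseteq> Phi S"
  proof
    fix \<gamma> assume "\<gamma> \<in> inversions w"
    then have g: "\<gamma> \<in> roots" using inversionsD(1) pos_root by blast
    show "\<gamma> \<in> Phi S" by (rule PhiI[OF g]) (use root_supp[OF g] in blast)
  qed
  obtain p y where p: "path (sub_edges S - loops) x p y"
    and py: "y = z \<and> path_elt p = w \<or>
     (\<exists>s. (y, s) \<in> loops \<inter> sub_edges S \<and> act (inv (path_elt p)) (lroot (y, s)) \<in> inversions w)"
    using decompose[OF w(1) x w(2) vertexD(2)[OF x] order_refl wS] by blast
  have sub: "sub_edges S - loops \<subseteq> edges - loops" using sub_edges_edges by blast
  have pY: "path_elt p \<in> Y y x" by (rule path_Y[OF path_mono[OF p sub]])
  have yv: "y \<in> vertices" using path_vertices(2)[OF _ p] sub by blast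
  obtain s where s: "(y, s) \<in> loops" "act (inv (path_elt p)) (lroot (y, s)) \<in> inversions w" using py pY w(3) by blast
  note g = gen_of_walk[OF Y_inv[OF pY yv x] yv s(1)]
  have "source (y, s) = y" by (simp add: source_def)
  note g' = g[OF this]
  have "\<rho> (inv (path_elt p) \<otimes> tree_elt y x, (y, s)) = act (inv (path_elt p)) (lroot (y, s))"
    unfolding \<rho>_def g'(2) by simp
  then show ?thesis using g'(1) s(2) by (intro bexI[OF _ g'(1)]) simp
qed

text \<open>The reflection inverts its own root, so it inverts some \<rho> of an index as well.
  Conjugation by the corresponding generator lowers the number of perpendicular inversions.\<close>

lemma reflection_in_generate:
  assumes "\<gamma> \<in> ppos" shows "reflection \<gamma> \<in> generate W (r ` R)"
  using assms
proof (induction "card (inversions (reflection \<gamma>) \<inter> perp x)" arbitrary: \<gamma> rule: less_induct)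
  case less
  have g: "\<gamma> \<in> perp x" "\<gamma> \<in> positive_roots" "\<gamma> \<in> roots" using less.prems by auto
  let ?w = "reflection \<gamma>"
  have wc: "?w \<in> carrier W" using g by simp
  have wC: "?w \<in> C x x" by (rule reflection_C[OF g(1)])
  have "?w \<notin> Y x x"
  proof
    assume "?w \<in> Y x x"
    then have "act ?w \<gamma> \<in> positive_roots" using YD(2) g by blast
    then show False using act_reflection_self[OF g(3)] neg_pos_iff[OF g(3)] g(2) by simp
  qed
  then obtain i where i: "i \<in> R" "\<rho> i \<in> inversions ?w" using exists_gen_inverted[OF wC x] by blast
  note ri = rho_props[OF i(1)]
  have rG: "r i \<in> generate W (r ` R)" using i(1) by (intro generate.incl) blast
  show ?case
  proof (cases "\<rho> i = \<gamma>")
    case True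
    then show ?thesis using rG gen_elt_reflection[OF i(1)] by simp
  next
    case False
    define \<gamma>' where "\<gamma>' = act (r i) \<gamma>"
    have g': "\<gamma>' \<in> ppos" unfolding \<gamma>'_def by (rule gen_permutes[OF i(1) less.prems]) (use False in simp)
    have rc: "r i \<in> carrier W" by (rule gen_elt_carrier[OF i(1)])
    have conj: "reflection \<gamma>' = r i \<otimes> ?w \<otimes> r i"
      unfolding \<gamma>'_def using reflection_act[OF g(3) rc] gen_inv[OF i(1)] by simp
    have act_conj: "act (reflection \<gamma>') v = act (r i) (act ?w (act (r i) v))" if "v \<in> V" for v
      unfolding conj using rc wc that by (simp add: act_mult)
    let ?NP = "inversions ?w \<inter> perp x"
    have np: "act ?w (\<rho> i) \<notin> positive_roots" using inversionsD(2)[OF i(2)] .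
    have nb: "neg (act ?w (\<rho> i)) \<in> ppos"
      using np neg_pos_iff[of "act ?w (\<rho> i)"] ri wc perp_neg[OF act_perp[OF wC x ri(1)] x] by simp
    \<comment> \<open>A root negated by the reflection is proportional to \<gamma>; being positive
      of norm 1 it would equal \<gamma>, the case already treated.\<close>
    have nbne: "neg (act ?w (\<rho> i)) \<noteq> \<rho> i"
    proof
      assume h: "neg (act ?w (\<rho> i)) = \<rho> i"
      define c where "c = form \<gamma> (\<rho> i)"
      have e: "\<rho> i q = c * \<gamma> q" for q
        using fun_cong[OF h, of q] act_reflection[OF g(3), of "\<rho> i"] ri(3) by (simp add: c_def)
      then have gl: "\<rho> i = lin c \<gamma> 0 \<gamma>" by auto
      have "reflection (\<rho> i) = ?w"
      proof -
        have c1: "c * c = 1"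
        proof -
          have "form (\<rho> i) (\<rho> i) = c * c" by (subst (1 2) gl) (use g(3) in \<open>simp add: form_lin_left form_lin_right root_norm\<close>)
          then show ?thesis using root_norm[OF ri(3)] by simp
        qed
        then have "c = 1 \<or> c = -1" by (metis square_eq_1_iff)
        then show ?thesis
        proof
          assume "c = 1" then have "\<rho> i = \<gamma>" using e by auto
          then show ?thesis by simp
        next
          assume "c = -1" then have "\<rho> i = neg \<gamma>" using e by auto
          then show ?thesis using reflection_neg[OF g(3)] by simp
        qed
      qed
      then have "\<rho> i = \<gamma>" by (rule reflection_inj[OF ri(2) g(2)])
      then show False using False by simp
    qed
    have rnot: "\<rho> i \<notin> inversions (reflection \<gamma>')"
    proof -
      have "act (r i) (neg (act ?w (\<rho> i))) \<in> positive_roots" using gen_permutes[OF i(1) nb nbne] by simp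
      moreover have "act (reflection \<gamma>') (\<rho> i) = act (r i) (neg (act ?w (\<rho> i)))"
        using act_conj[of "\<rho> i"] act_gen_self[OF i(1)] act_neg[OF wc, of "\<rho> i"] ri(3) by simp
      ultimately show ?thesis by (simp add: inversions_def)
    qed
    \<comment> \<open>The generator carries the perpendicular inversions of the conjugate
      injectively into those of the reflection and misses \<rho> of \<open>i\<close>, so their
      number drops.\<close>
    have img: "act (r i) ` (inversions (reflection \<gamma>') \<inter> perp x) \<subseteq> ?NP - {\<rho> i}"
    proof
      fix \<epsilon> assume "\<epsilon> \<in> act (r i) ` (inversions (reflection \<gamma>') \<inter> perp x)"
      then obtain \<delta> where d: "\<delta> \<in> inversions (reflection \<gamma>')" "\<delta> \<in> perp x" "\<epsilon> = act (r i) \<delta>" by blast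
      have dp: "\<delta> \<in> ppos" "\<delta> \<in> roots" using d inversionsD(1) by auto
      have "\<delta> \<noteq> \<rho> i" using d(1) rnot by blast
      then have ep: "\<epsilon> \<in> ppos" unfolding d(3) by (rule gen_permutes[OF i(1) dp(1)])
      have "act ?w \<epsilon> \<notin> positive_roots"
      proof
        assume p: "act ?w \<epsilon> \<in> positive_roots"
        have pp: "act ?w \<epsilon> \<in> ppos" using p act_perp[OF wC x] ep by blast
        have n: "act (r i) (act ?w \<epsilon>) \<notin> positive_roots" using inversionsD(2)[OF d(1)] act_conj[of \<delta>] dp(2) d(3) by simp
        have "act ?w \<epsilon> = \<rho> i" using gen_permutes[OF i(1) pp] n by blast
        moreover have "act ?w (act ?w \<epsilon>) = \<epsilon>"
          using act_inv(1)[OF wc, of \<epsilon>] reflection_inv[OF g(3)] ep by simp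
        ultimately have "act ?w (\<rho> i) = \<epsilon>" by simp
        then show False using np ep by simp
      qed
      then have "\<epsilon> \<in> ?NP" using ep by (simp add: inversions_def)
      moreover have "\<epsilon> \<noteq> \<rho> i"
      proof
        assume h: "\<epsilon> = \<rho> i"
        have "act (r i) \<epsilon> = \<delta>" unfolding d(3) using act_gen_gen[OF i(1)] dp(2) by simp
        then have "\<delta> = neg (\<rho> i)" using h act_gen_self[OF i(1)] by simp
        then show False using dp(1) neg_pos_iff[OF ri(3)] ri(2) by simp
      qed
      ultimately show "\<epsilon> \<in> ?NP - {\<rho> i}" by blast
    qed
    have fin: "finite ?NP" using finite_inversions[OF wc] by blast
    have inj: "inj_on (act (r i)) (inversions (reflection \<gamma>') \<inter> perp x)"
    proof (rule inj_onI)
      fix a b assume "a \<in> inversions (reflection \<gamma>') \<inter> perp x" "b \<in> inversions (reflection \<gamma>') \<inter> perp x" "act (r i) a = act (r i) b"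
      then show "a = b" using act_inj[OF rc, of a b] perpD(1) root_V by blast
    qed
    have "card (inversions (reflection \<gamma>') \<inter> perp x) \<le> card (?NP - {\<rho> i})"
      by (rule card_inj_on_le[OF inj img]) (use fin in simp)
    also have "\<dots> < card ?NP" by (rule card_Diff1_less[OF fin]) (use i(2) ri(1) in simp)
    finally have "reflection \<gamma>' \<in> generate W (r ` R)" using less.hyps g' by blast
    then have "r i \<otimes> reflection \<gamma>' \<otimes> r i \<in> generate W (r ` R)" using rG by (metis generate.eng)
    moreover have "r i \<otimes> reflection \<gamma>' \<otimes> r i = ?w"
      unfolding conj using rc wc gen_square[OF i(1)] by (simp add: m_assoc involution_cancel)
    ultimately show ?thesis by simp
  qed
qed

lemma perp_group_generate: "perp_group (x ` \<Lambda>) = generate W (r ` R)"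
proof
  have rc: "r ` R \<subseteq> carrier W" using gen_elt_carrier by blast
  have "reflection ` perp x \<subseteq> generate W (r ` R)"
  proof
    fix g assume "g \<in> reflection ` perp x"
    then obtain \<gamma> where g: "\<gamma> \<in> perp x" "g = reflection \<gamma>" by blast
    have gr: "\<gamma> \<in> roots" using perpD(1)[OF g(1)] .
    show "g \<in> generate W (r ` R)"
    proof (cases "\<gamma> \<in> positive_roots")
      case True
      then show ?thesis using reflection_in_generate g by blast
    next
      case False
      then have "neg \<gamma> \<in> ppos" using neg_pos_iff[OF gr] perp_neg[OF g(1) x] by simp
      then show ?thesis using reflection_in_generate reflection_neg[OF gr] g(2) by metis
    qed
  qed
  then show "perp_group (x ` \<Lambda>) \<subseteq> generate W (r ` R)"
    unfolding perp_group_def by (rule generate_subgroup_incl) (rule generate_is_subgroup[OF rc])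
  have "r ` R \<subseteq> reflection ` perp x" using gen_elt_reflection rho_props(1) by blast
  then show "generate W (r ` R) \<subseteq> perp_group (x ` \<Lambda>)"
    unfolding perp_group_def by (rule mono_generate)
qed

section \<open>The exchange condition for the generators\<close>

abbreviation rval where "rval \<equiv> word_val W r"

lemma r_image: "r ` R \<subseteq> carrier W"
  using gen_elt_carrier by blast

lemma rval_closed: "a \<in> lists R \<Longrightarrow> rval a \<in> carrier W"
  by (rule word_val_closed[OF r_image])

lemma rval_C: "a \<in> lists R \<Longrightarrow> rval a \<in> C x x"
proof (induction a rule: list.induct)
  case Nil
  then show ?case using C_one[OF x] by simp
next
  case (Cons i a)
  then have "i \<in> R" "rval a \<in> C x x" by auto
  then show ?case using C_mult[OF gen_elt_C] x by simp
qed

text \<open>Strong exchange: the root is pushed through the word letter by letter. By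
  \<open>gen_permutes\<close> it can change sign only where it equals the root of the letter, and
  this is the letter to delete.\<close>

lemma deletion:
  assumes "a \<in> lists R" "\<tau> \<in> ppos" "act (inv (rval a)) \<tau> \<notin> positive_roots"
  shows "\<exists>u j v. a = u @ j # v \<and> reflection \<tau> \<otimes> rval a = rval (u @ v)"
  using assms
proof (induction a arbitrary: \<tau> rule: list.induct)
  case Nil
  then show ?case by simp
next
  case (Cons j a)
  have j: "j \<in> R" "a \<in> lists R" using Cons.prems(1) by auto
  have t: "\<tau> \<in> roots" "\<tau> \<in> V" using Cons.prems(2) by auto
  have c: "r j \<in> carrier W" "rval a \<in> carrier W" using gen_elt_carrier[OF j(1)] rval_closed[OF j(2)] by auto
  show ?case
  proof (cases "\<tau> = \<rho> j")
    case True
    then have "reflection \<tau> \<otimes> rval (j # a) = rval a"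
      using gen_elt_reflection[OF j(1)] c gen_square[OF j(1)] by (simp add: involution_cancel)
    then show ?thesis by (intro exI[of _ "[]"] exI[of _ j] exI[of _ a]) simp
  next
    case False
    let ?t = "act (r j) \<tau>"
    have tp: "?t \<in> ppos" by (rule gen_permutes[OF j(1) Cons.prems(2) False])
    have "act (inv (rval (j # a))) \<tau> = act (inv (rval a)) ?t"
      using c t gen_inv[OF j(1)] by (simp add: inv_mult_group act_mult)
    then have "act (inv (rval a)) ?t \<notin> positive_roots" using Cons.prems(3) by simp
    from Cons.IH[OF j(2) tp this] obtain u k v where u: "a = u @ k # v" "reflection ?t \<otimes> rval a = rval (u @ v)" by blast
    have rt: "reflection ?t = r j \<otimes> reflection \<tau> \<otimes> r j"
      using reflection_act[OF t(1) c(1)] gen_inv[OF j(1)] by simp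
    have rr: "reflection \<tau> \<in> carrier W" using t by simp
    have "rval (j # u @ v) = r j \<otimes> (reflection ?t \<otimes> rval a)" using u(2) by simp
    also have "\<dots> = reflection \<tau> \<otimes> rval (j # a)"
      unfolding rt using c rr gen_square[OF j(1)] by (simp add: m_assoc involution_cancel)
    finally show ?thesis using u(1) by (intro exI[of _ "j # u"] exI[of _ k] exI[of _ v]) simp
  qed
qed

text \<open>The root of \<open>i\<close> is made negative by the inverse of \<open>rval a\<close> or
  by that of \<open>rval b\<close>. In the first case deletion gives the claim; in the second it
  would shorten \<open>b\<close> to a word for \<open>rval a\<close> with fewer letters than
  \<open>a\<close>.\<close>

sublocale exchange: exchange_system W R r
proof
  fix i assume i: "i \<in> R"
  show "r i \<in> carrier W" by (rule gen_elt_carrier[OF i])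
  show "r i \<noteq> \<one>" using reflection_ne_one[OF rho_props(3)[OF i]] gen_elt_reflection[OF i] by simp
  show "r i \<otimes> r i = \<one>" by (rule gen_square[OF i])
next
  fix i a b
  assume i: "i \<in> R" and a: "a \<in> lists R"
    and amin: "\<And>b. b \<in> lists R \<Longrightarrow> rval b = rval a \<Longrightarrow> length a \<le> length b"
    and b: "b \<in> lists R" "rval b = r i \<otimes> rval a" "length b \<le> length a"
  note ri = rho_props[OF i]
  have rp: "\<rho> i \<in> ppos" using ri by simp
  have c: "r i \<in> carrier W" "rval a \<in> carrier W" using gen_elt_carrier[OF i] rval_closed[OF a] by auto
  have refl: "reflection (\<rho> i) = r i" using gen_elt_reflection[OF i] by simp
  show "\<exists>u j v. a = u @ j # v \<and> r i \<otimes> rval a = rval (u @ v)"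
  proof (cases "act (inv (rval a)) (\<rho> i) \<in> positive_roots")
    case False
    from deletion[OF a rp False] show ?thesis unfolding refl .
  next
    case True
    have "act (inv (rval b)) (\<rho> i) = act (inv (rval a)) (act (r i) (\<rho> i))"
      unfolding b(2) using c ri(3) gen_inv[OF i] by (simp add: inv_mult_group act_mult)
    also have "\<dots> = neg (act (inv (rval a)) (\<rho> i))"
      using act_gen_self[OF i] act_neg[of "inv (rval a)" "\<rho> i"] c ri(3) by simp
    finally have "act (inv (rval b)) (\<rho> i) \<notin> positive_roots"
      using True neg_pos_iff[of "act (inv (rval a)) (\<rho> i)"] c ri(3) by simp
    from deletion[OF b(1) rp this] obtain u j v where u: "b = u @ j # v" "r i \<otimes> rval b = rval (u @ v)"
      unfolding refl by blast
    have "r i \<otimes> rval b = rval a" unfolding b(2) using c gen_square[OF i] by (simp add: involution_cancel)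
    then have "rval (u @ v) = rval a" using u(2) by simp
    moreover have "u @ v \<in> lists R" using b(1) u(1) by simp
    ultimately have "length a \<le> length (u @ v)" by (intro amin)
    then show ?thesis using b(3) u(1) by simp
  qed
qed

section \<open>Related pairs of generators\<close>

text \<open>The partner index is reached by prolonging the walk of \<open>i\<close> along
  \<open>q\<close>. Conjugation by this walk carries the tour to \<open>r i \<otimes> r j\<close>,
  so the order of the tour is that of the product.\<close>

lemma sim_of_tour:
  assumes i: "i \<in> R" and f: "f \<in> loops" and q: "path (edges - loops) (source f) q (source (snd i))"
    and tour: "shuttling_tour (source (snd i)) ([snd i] @ q @ [f] @ reverse_path q)"
  obtains j where "j \<in> R" "snd j = f" "walk j = walk i \<otimes> path_elt q"
    "ord (r i \<otimes> r j) \<noteq> 0 \<Longrightarrow> gen_sim T x (ord (r i \<otimes> r j)) i j"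
proof -
  obtain w e where iw: "i = (w, e)" by (cases i)
  note g = genD[OF i, unfolded iw fst_conv snd_conv]
  have fe: "f \<in> edges" "source f \<in> vertices" using f loopD(1) source_vertex by auto
  have se: "set q \<subseteq> edges" using path_set[OF q] by blast
  have qY: "path_elt q \<in> Y (source e) (source f)" using path_Y[OF q] by (simp add: iw)
  define w' where "w' = w \<otimes> based T x (source e) q (source f)"
  have p1: "tree_elt x (source e) \<in> Y x (source e)" by (rule tree_elt_Y[OF g(4) x])
  have p2: "tree_elt (source f) x \<in> Y (source f) x" by (rule tree_elt_Y[OF x fe(2)])
  have c: "w \<in> carrier W" "tree_elt x (source e) \<in> carrier W" "path_elt q \<in> carrier W" "tree_elt (source f) x \<in> carrier W"
    using g(1) p1 p2 qY Y_carrier by auto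
  have w': "w' = (walk i \<otimes> path_elt q) \<otimes> tree_elt (source f) x"
    unfolding w'_def based_eq[OF x fe(2) g(4) se] walk_def iw using c by (simp add: m_assoc)
  have wq: "walk i \<otimes> path_elt q \<in> Y x (source f)"
    using Y_mult[OF walk_Y[OF i] _ _ fe(2)] qY g(4) by (simp add: iw)
  note gw = gen_of_walk[OF wq fe(2) f refl, folded w']
  let ?j = "(w', f)"
  let ?c = "path_elt ([e] @ q @ [f] @ reverse_path q)"
  have srq: "set (reverse_path q) \<subseteq> edges" unfolding reverse_path_def using se reverse_edge_props(1) by auto
  have ec: "edge_elt e \<in> carrier W" "edge_elt f \<in> carrier W" using edge_elt_closed g(3) fe(1) by auto
  have ce: "?c = edge_elt e \<otimes> (path_elt q \<otimes> (edge_elt f \<otimes> inv (path_elt q)))"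
    using path_elt_append[OF se, of "[f] @ reverse_path q"] fe(1) srq path_elt_reverse[OF se] by simp
  have cc: "?c \<in> carrier W" unfolding ce using ec c by simp
  have wc: "walk i \<in> carrier W" by (rule walk_carrier[OF i])
  have "r i \<otimes> r ?j = walk i \<otimes> ?c \<otimes> inv (walk i)"
    unfolding gen_elt_conj[OF i] gen_elt_conj[OF gw(1)] gw(2) ce snd_conv
    using wc c ec by (simp add: iw m_assoc inv_mult_group inv_cancel)
  then have o: "ord (r i \<otimes> r ?j) = ord ?c" using ord_conj[OF wc cc] by simp
  show ?thesis
  proof (rule that[of ?j])
    show "?j \<in> R" by (rule gw(1))
    show "walk ?j = walk i \<otimes> path_elt q" by (rule gw(2))
    assume o0: "ord (r i \<otimes> r ?j) \<noteq> 0"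
    show "gen_sim T x (ord (r i \<otimes> r ?j)) i ?j"
      unfolding o unfolding gen_sim_def iw prod.case
    proof (intro conjI exI[of _ q])
      show "1 \<le> ord ?c" using o0 unfolding o by simp
      show "(w, e) \<in> R" using i by (simp add: iw)
      show "(w', f) \<in> R" by (rule gw(1))
      show "path edges (source f) q (source e)" using path_mono[OF q, of edges] by (simp add: iw)
      show "w' = w \<otimes> based T x (source e) q (source f)" by (rule w'_def)
      show "shuttling_tour (source e) ([e] @ q @ [f] @ reverse_path q)" using tour by (simp add: iw)
    qed (rule refl)
  qed simp
qed

lemma sim_sound:
  assumes "1 \<le> k" "gen_sim T x k i j" shows "i \<in> R \<and> j \<in> R \<and> (r i \<otimes> r j) [^] k = \<one>"
proof -
  obtain w e w' f where ij: "i = (w, e)" "j = (w', f)" by (cases i, cases j)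
  from assms(2) obtain q where i: "i \<in> R" and j: "j \<in> R" and q: "path edges (source f) q (source e)"
    and w': "w' = w \<otimes> based T x (source e) q (source f)"
    and o: "ord (path_elt ([e] @ q @ [f] @ reverse_path q)) = k"
    unfolding gen_sim_def ij by auto
  note g = genD[OF i, unfolded ij fst_conv snd_conv] and h = genD[OF j, unfolded ij fst_conv snd_conv]
  have se: "set q \<subseteq> edges" using path_set[OF q] .
  have c: "w \<in> carrier W" "tree_elt x (source e) \<in> carrier W" "path_elt q \<in> carrier W" "tree_elt (source f) x \<in> carrier W"
    using g(1) tree_elt_Y[OF g(4) x] tree_elt_Y[OF x h(4)] Y_carrier path_elt_closed[OF se] by auto
  let ?c = "path_elt ([e] @ q @ [f] @ reverse_path q)"
  have srq: "set (reverse_path q) \<subseteq> edges" unfolding reverse_path_def using se reverse_edge_props(1) by auto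
  have ec: "edge_elt e \<in> carrier W" "edge_elt f \<in> carrier W" using edge_elt_closed g(3) h(3) by auto
  have ce: "?c = edge_elt e \<otimes> (path_elt q \<otimes> (edge_elt f \<otimes> inv (path_elt q)))"
    using path_elt_append[OF se, of "[f] @ reverse_path q"] h(3) srq path_elt_reverse[OF se] by simp
  have cc: "?c \<in> carrier W" unfolding ce using ec c by simp
  have wc: "walk i \<in> carrier W" by (rule walk_carrier[OF i])
  have wj: "walk j = walk i \<otimes> path_elt q"
    unfolding walk_def ij fst_conv snd_conv w' based_eq[OF x h(4) g(4) se] tree_elt_inv[OF x h(4)]
    using c by (simp add: m_assoc)
  have "r i \<otimes> r j = walk i \<otimes> ?c \<otimes> inv (walk i)"
    unfolding gen_elt_conj[OF i] gen_elt_conj[OF j] wj ce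
    using wc c ec by (simp add: ij m_assoc inv_mult_group inv_cancel)
  then have "(r i \<otimes> r j) [^] k = walk i \<otimes> ?c [^] k \<otimes> inv (walk i)" using pow_conj[OF wc cc] by simp
  moreover have "?c [^] k = \<one>" using pow_ord_eq_1[OF cc] o by simp
  ultimately show ?thesis using i j wc by simp
qed

text \<open>One step of the comparison of two walks: \<open>u\<close> carries the wall of \<open>i\<close> to the wall of \<open>c\<close>. Any descent
  of \<open>u\<close> yields a tour, which either shortens \<open>u\<close> while staying at the same wall, or turns around a corner.\<close>

lemma walk_step:
  assumes i: "i \<in> R" and c: "c \<in> R" and g: "g \<in> C x x" and gr: "act g (\<rho> i) = \<rho> c"
    and ne: "inv (walk c) \<otimes> g \<otimes> walk i \<noteq> \<one>"
  obtains j where "j \<in> R" "ord (r i \<otimes> r j) \<noteq> 0 \<Longrightarrow> gen_sim T x (ord (r i \<otimes> r j)) i j"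
    "\<rho> j = \<rho> i \<and> card (inversions (inv (walk c) \<otimes> g \<otimes> walk j)) < card (inversions (inv (walk c) \<otimes> g \<otimes> walk i)) \<or>
     act g (\<rho> j) \<notin> positive_roots"
proof -
  obtain w y s where iw: "i = (w, (y, s))" by (cases i, cases "snd i") auto
  obtain w' y' s' where cw: "c = (w', (y', s'))" by (cases c, cases "snd c") auto
  have l: "(y, s) \<in> loops" and l': "(y', s') \<in> loops" using genD(2)[OF i] genD(2)[OF c] by (simp_all add: iw cw)
  note E = edgeD[OF loopD(1)[OF l]] and E' = edgeD[OF loopD(1)[OF l']]
  note lr = lroot_props[OF l] and lr' = lroot_props[OF l']
  define v where "v = walk i"
  define v' where "v' = walk c"
  have vY: "v \<in> Y x y" and v'Y: "v' \<in> Y x y'"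
    using walk_Y[OF i] walk_Y[OF c] by (simp_all add: v_def v'_def iw cw source_def)
  have iv'Y: "inv v' \<in> Y y' x" by (rule Y_inv[OF v'Y x E'(1)])
  have cr: "v \<in> carrier W" "v' \<in> carrier W" "g \<in> carrier W" using Y_carrier vY v'Y CD(1)[OF g] by auto
  define u where "u = inv v' \<otimes> g \<otimes> v"
  have uC: "u \<in> C y' y" unfolding u_def
    by (rule C_mult[OF C_mult[OF YD(1)[OF iv'Y] g x] YD(1)[OF vY] E(1)])
  have uc: "u \<in> carrier W" using CD(1)[OF uC] .
  have ri: "\<rho> i = act v (lroot (y, s))" "\<rho> c = act v' (lroot (y', s'))" by (simp_all add: \<rho>_def v_def v'_def iw cw)
  have ud: "act u (lroot (y, s)) = lroot (y', s')"
  proof -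
    have "act u (lroot (y, s)) = act (inv v') (act g (act v (lroot (y, s))))"
      unfolding u_def using cr lr(1) by (simp add: act_mult)
    also have "\<dots> = act (inv v') (act v' (lroot (y', s')))" using gr ri by simp
    also have "\<dots> = lroot (y', s')" using act_inv(1)[OF cr(2)] lr'(1) by simp
    finally show ?thesis .
  qed
  define K where "K = y ` \<Lambda> \<union> {s}"
  have KS: "K \<subseteq> S" using E by (simp add: K_def)
  have simple: "\<exists>k'\<in>S. act u (simple_root k) = simple_root k'" if k: "k \<in> K" for k
  proof -
    have "\<exists>k'\<in>y' ` \<Lambda> \<union> {s'}. act u (simple_root k) = simple_root k'"
    proof (rule transport_simple[OF E(5,2,3) E'(5,2,3) lr(1,2) perpD(2)[OF lr(3)] lr'(1,2) perpD(2)[OF lr'(3)] uc _ _ ud])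
      show "\<exists>k'\<in>y' ` \<Lambda>. act u (simple_root k) = simple_root k'" if "k \<in> y ` \<Lambda>" for k
        using that CD(2)[OF uC] by blast
      show "\<exists>k\<in>y ` \<Lambda>. act u (simple_root k) = simple_root k'" if "k' \<in> y' ` \<Lambda>" for k'
        using that CD(2)[OF uC] by blast
      show "k \<in> y ` \<Lambda> \<union> {s}" using k by (simp add: K_def)
    qed
    then show ?thesis using E' by auto
  qed
  have une: "u \<noteq> \<one>" using ne by (simp add: u_def v_def v'_def)
  obtain t where t: "t \<in> S" "simple_root t \<in> inversions u" using descent_exists[OF uc une] by blast
  have tK: "t \<notin> K"
  proof
    assume "t \<in> K"
    then obtain k' where "k' \<in> S" "act u (simple_root t) = simple_root k'" using simple by blast
    then show False using inversionsD(2)[OF t(2)] by simp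
  qed
  note ds = deodhar_step[OF KS t(1) tK uc simple inversionsD(2)[OF t(2)]]
  define d where "d = elementary_move K t"
  have dc: "d \<in> carrier W" using elementary_move_carrier[OF KS t(1) ds(1)] by (simp add: d_def)
  have dsub: "inversions d \<subseteq> inversions u" using ds(2) by (simp add: d_def)
  have tN: "simple_root t \<in> inversions d"
    using inversions_elementary_move[OF KS t(1) tK ds(1)] t(1) simple_root_Phi[OF t(1), of "K \<union> {t}"] by (simp add: d_def)
  have tys: "t \<notin> y ` \<Lambda> \<union> {s}" and ftys: "finite_type (component (y ` \<Lambda> \<union> {s}) t)" using tK ds(1) by (simp_all add: K_def)
  obtain q f where f: "f \<in> loops" and q: "path (edges - loops) (source f) q y"
    and tour: "shuttling_tour y ([(y, s)] @ q @ [f] @ reverse_path q)"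
    and alt: "path_elt q = inv d \<and> act (path_elt q) (lroot f) = lroot (y, s) \<or> act (path_elt q) (lroot f) \<in> inversions d"
    using tour_exists[OF l t(1) tys ftys] unfolding d_def K_def by blast
  have q': "path (edges - loops) (source f) q (source (snd i))" using q by (simp add: iw source_def)
  have tour': "shuttling_tour (source (snd i)) ([snd i] @ q @ [f] @ reverse_path q)"
    using tour by (simp add: iw source_def)
  obtain j where j: "j \<in> R" "snd j = f" "walk j = walk i \<otimes> path_elt q"
    and js: "ord (r i \<otimes> r j) \<noteq> 0 \<Longrightarrow> gen_sim T x (ord (r i \<otimes> r j)) i j"
    using sim_of_tour[OF i f q' tour'] by blast
  have qY: "path_elt q \<in> Y y (source f)" by (rule path_Y[OF q])
  have qc: "path_elt q \<in> carrier W" by (rule Y_carrier[OF qY])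
  note fl = lroot_props_at[OF f]
  have rj: "\<rho> j = act v (act (path_elt q) (lroot f))"
    unfolding \<rho>_def j(2,3) v_def[symmetric] using cr qc fl(4) by (simp add: act_mult)
  from alt have "\<rho> j = \<rho> i \<and> card (inversions (inv v' \<otimes> g \<otimes> walk j)) < card (inversions u) \<or> act g (\<rho> j) \<notin> positive_roots"
  proof
    assume h: "path_elt q = inv d \<and> act (path_elt q) (lroot f) = lroot (y, s)"
    \<comment> \<open>The path covers the whole move \<open>d\<close>: the walk is changed by
      \<open>inv d\<close>, the wall stays the same, and \<open>u\<close> loses the inversions of
      \<open>d\<close>.\<close>
    have "\<rho> j = \<rho> i" unfolding rj ri(1) h[THEN conjunct2] ..
    moreover have "inv v' \<otimes> g \<otimes> walk j = u \<otimes> inv d"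
      unfolding j(3) u_def v_def[symmetric] using h cr dc by (simp add: m_assoc)
    moreover have "card (inversions d) > 0" using tN finite_inversions[OF dc] card_gt_0_iff by blast
    ultimately show ?thesis using card_inversions_quot[OF uc dc dsub] by simp
  next
    assume h: "act (path_elt q) (lroot f) \<in> inversions d"
    let ?b = "act (path_elt q) (lroot f)"
    have sf: "source f \<in> vertices" using source_vertex loopD(1)[OF f] by blast
    have bp: "?b \<in> perp y" by (rule act_perp[OF YD(1)[OF qY] sf fl(2)])
    have br: "?b \<in> roots" using qc fl(4) by simp
    \<comment> \<open>The root of the loop met on the way is inverted by \<open>d\<close>, hence by
      \<open>u\<close>. Since \<open>inv v'\<close> keeps signs of perpendicular roots, it is
      \<open>g\<close> that makes \<rho> of \<open>j\<close> negative.\<close>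
    have "act u ?b \<notin> positive_roots" using h dsub inversionsD(2) by blast
    moreover have "act u ?b = act (inv v') (act g (\<rho> j))"
      unfolding u_def rj using cr br by (simp add: act_mult)
    moreover have "act g (\<rho> j) \<in> perp x" by (rule act_perp[OF g x rho_props(1)[OF j(1)]])
    ultimately have "act g (\<rho> j) \<notin> positive_roots" using YD(2)[OF iv'Y] by metis
    then show ?thesis by blast
  qed
  then show ?thesis using that[OF j(1) js] by (simp add: u_def v_def v'_def)
qed

text \<open>Equal walks have the same vertex and hence the same loop root there. This root
  determines the generator \<open>s\<close>, because it involves exactly one generator outside the
  vertex.\<close>

lemma walk_eq_imp:
  assumes i: "i \<in> R" and j: "j \<in> R" and rr: "\<rho> i = \<rho> j" and u: "inv (walk j) \<otimes> walk i = \<one>" shows "i = j"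
proof -
  obtain w y s where iw: "i = (w, (y, s))" by (cases i, cases "snd i") auto
  obtain w' y' s' where jw: "j = (w', (y', s'))" by (cases j, cases "snd j") auto
  have l: "(y, s) \<in> loops" and l': "(y', s') \<in> loops" using genD(2)[OF i] genD(2)[OF j] by (simp_all add: iw jw)
  note E = edgeD[OF loopD(1)[OF l]] and E' = edgeD[OF loopD(1)[OF l']]
  have vY: "walk i \<in> Y x y" and v'Y: "walk j \<in> Y x y'"
    using walk_Y[OF i] walk_Y[OF j] by (simp_all add: iw jw source_def)
  have cr: "walk i \<in> carrier W" "walk j \<in> carrier W" using Y_carrier vY v'Y by auto
  have "\<one> \<in> C y' y"
    using C_mult[OF YD(1)[OF Y_inv[OF v'Y x E'(1)]] YD(1)[OF vY] E(1)] u by simp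
  then have yy: "y' = y" by (rule C_one_imp_eq[OF _ E(1) E'(1)])
  have ww: "walk i = walk j" using u cr inv_cancel(2)[of "walk j" "walk i"] by simp
  have lrr: "lroot (y, s) = lroot (y, s')"
  proof (rule act_inj[OF cr(1)])
    show "act (walk i) (lroot (y, s)) = act (walk i) (lroot (y, s'))"
      using rr ww by (simp add: \<rho>_def iw jw yy)
    show "lroot (y, s) \<in> V" "lroot (y, s') \<in> V" using lroot_props(1) l l' yy by auto
  qed
  have ss: "s = s'"
  proof (rule ccontr)
    assume n: "s \<noteq> s'"
    have "s' \<notin> y ` \<Lambda> \<union> {s}" using E'(3) yy n by blast
    then have "lroot (y, s) s' = 0" by (rule PhiD(2)[OF lroot_props(2)[OF l]])
    then show False using lrr lroot_coord[OF l'] yy by simp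
  qed
  have p: "tree_elt x y \<in> carrier W" using Y_carrier[OF tree_elt_Y[OF E(1) x]] .
  have "w \<in> carrier W" "w' \<in> carrier W"
    using Y_carrier[OF genD(1)[OF i]] Y_carrier[OF genD(1)[OF j]] by (simp_all add: iw jw)
  moreover have "w \<otimes> tree_elt x y = w' \<otimes> tree_elt x y" using ww by (simp add: walk_def iw jw yy source_def)
  ultimately have "w = w'" using p by simp
  then show ?thesis using yy ss by (simp add: iw jw)
qed

lemma ord_gen_self: "i \<in> R \<Longrightarrow> ord (r i \<otimes> r i) = 1"
  by (simp add: gen_square)

abbreviation moves where "moves \<equiv> (word_move R (gen_sim T x))\<^sup>*\<^sup>*"

text \<open>\<open>walk_step\<close> for the identity: it inverts no root, so every step stays at
  the same wall and shortens the comparison element. Equal reflections have a product of order 1,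
  and a braid of length 1 replaces one letter by another.\<close>

lemma moves_same:
  assumes "i \<in> R" "j \<in> R" "r i = r j" shows "moves [i] [j]"
  using assms(1,3)
proof (induction "card (inversions (inv (walk j) \<otimes> \<one> \<otimes> walk i))" arbitrary: i rule: less_induct)
  case less
  have rr: "\<rho> i = \<rho> j" by (rule rho_eqI[OF less.prems(1) assms(2) less.prems(2)])
  have cr: "walk i \<in> carrier W" "walk j \<in> carrier W" using walk_carrier less.prems(1) assms(2) by auto
  show ?case
  proof (cases "inv (walk j) \<otimes> \<one> \<otimes> walk i = \<one>")
    case True
    then have "i = j" using walk_eq_imp[OF less.prems(1) assms(2) rr] cr by simp
    then show ?thesis by simp
  next
    case False
    have "act \<one> (\<rho> i) = \<rho> j" using rr rho_props(3)[OF less.prems(1)] by simp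
    from walk_step[OF less.prems(1) assms(2) C_one[OF x] this False] obtain k where k: "k \<in> R"
      "ord (r i \<otimes> r k) \<noteq> 0 \<Longrightarrow> gen_sim T x (ord (r i \<otimes> r k)) i k"
      "\<rho> k = \<rho> i \<and> card (inversions (inv (walk j) \<otimes> \<one> \<otimes> walk k)) < card (inversions (inv (walk j) \<otimes> \<one> \<otimes> walk i)) \<or>
       act \<one> (\<rho> k) \<notin> positive_roots" by blast
    have "act \<one> (\<rho> k) \<in> positive_roots" using rho_props[OF k(1)] by simp
    then have k3: "\<rho> k = \<rho> i" "card (inversions (inv (walk j) \<otimes> \<one> \<otimes> walk k)) < card (inversions (inv (walk j) \<otimes> \<one> \<otimes> walk i))"
      using k(3) by blast+
    have rk: "r k = r i" using gen_elt_reflection k(1) less.prems(1) k3(1) by simp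
    have "gen_sim T x 1 i k" using k(2) ord_gen_self[OF less.prems(1)] rk by simp
    then have "word_move R (gen_sim T x) ([] @ alternating 1 i k @ []) ([] @ alternating 1 k i @ [])"
      by (intro word_move.braid) simp
    then have "word_move R (gen_sim T x) [i] [k]" by simp
    moreover have "moves [k] [j]" by (rule less.hyps[OF k3(2) k(1)]) (use rk less.prems(2) in simp)
    ultimately show ?thesis by (rule converse_rtranclp_into_rtranclp)
  qed
qed

text \<open>Pushing the root through the word as in \<open>deletion\<close>, it eventually equals
  the root of a letter. Before that it was only changed by reflections in the plane of the two
  roots.\<close>

lemma inverted_in_span:
  assumes "a \<in> lists {i, j}" "i \<in> R" "j \<in> R" "\<delta> \<in> ppos" "act (inv (rval a)) \<delta> \<notin> positive_roots"
  shows "\<exists>c1 c2. \<delta> = lin c1 (\<rho> i) c2 (\<rho> j)"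
  using assms(1,4,5)
proof (induction a arbitrary: \<delta> rule: list.induct)
  case Nil
  then show ?case by simp
next
  case (Cons b a)
  have b: "b \<in> {i, j}" "a \<in> lists {i, j}" using Cons.prems(1) by auto
  have bR: "b \<in> R" using b(1) assms by blast
  have aR: "a \<in> lists R" using b(2) assms lists_mono[of "{i, j}" R] by blast
  have dV: "\<delta> \<in> V" using Cons.prems(2) by simp
  note rb = rho_props[OF bR]
  have ins: "\<exists>c1 c2. \<rho> b = lin c1 (\<rho> i) c2 (\<rho> j)"
  proof (cases "b = i")
    case True
    then show ?thesis by (intro exI[of _ 1] exI[of _ 0]) (auto simp: lin_def)
  next
    case False
    then have "b = j" using b(1) by blast
    then show ?thesis by (intro exI[of _ 0] exI[of _ 1]) (auto simp: lin_def)
  qed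
  show ?case
  proof (cases "\<delta> = \<rho> b")
    case True
    show ?thesis unfolding True by (rule ins)
  next
    case False
    let ?d = "act (r b) \<delta>"
    have dp: "?d \<in> ppos" by (rule gen_permutes[OF bR Cons.prems(2) False])
    have c: "r b \<in> carrier W" "rval a \<in> carrier W" using gen_elt_carrier[OF bR] rval_closed[OF aR] by auto
    have "act (inv (rval (b # a))) \<delta> = act (inv (rval a)) ?d"
      using c dV gen_inv[OF bR] by (simp add: inv_mult_group act_mult)
    then have "act (inv (rval a)) ?d \<notin> positive_roots" using Cons.prems(3) by simp
    from Cons.IH[OF b(2) dp this] obtain c1 c2 where e: "?d = lin c1 (\<rho> i) c2 (\<rho> j)" by blast
    obtain b1 b2 where eb: "\<rho> b = lin b1 (\<rho> i) b2 (\<rho> j)" using ins by blast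
    have dV': "?d \<in> V" using dp by simp
    define k where "k = - 2 * form (\<rho> b) ?d"
    have "\<delta> = act (r b) ?d" using act_gen_gen[OF bR dV] by simp
    also have "\<dots> = lin 1 ?d k (\<rho> b)"
      unfolding gen_elt_reflection[OF bR] k_def
      using act_reflection[OF rb(3) dV', unfolded gen_elt_reflection[OF bR]] .
    also have "\<dots> = lin (c1 + k * b1) (\<rho> i) (c2 + k * b2) (\<rho> j)"
      by (subst e, subst eb) (auto simp: lin_def algebra_simps)
    finally show ?thesis by blast
  qed
qed

text \<open>A plane contains no third simple root. With nonnegative coefficients, its own generator
  would keep the two given roots positive and yet make their combination negative; the other signs
  are refuted by \<open>mixed\<close>.\<close>

lemma simple_in_span:
  assumes l: "l \<in> R" and i: "i \<in> R" and j: "j \<in> R" and ne: "\<rho> i \<noteq> \<rho> j"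
    and e: "\<rho> l = lin c1 (\<rho> i) c2 (\<rho> j)"
  shows "\<rho> l = \<rho> i \<or> \<rho> l = \<rho> j"
proof (rule ccontr)
  assume n: "\<not> ?thesis"
  have pp: "\<rho> k \<in> ppos" if "k \<in> R" for k using rho_props[OF that] by simp
  have nn: "\<rho> k q \<ge> 0" if "k \<in> R" for k q by (rule pos_nonneg[OF rho_props(2)[OF that]])
  \<comment> \<open>With \<open>d1\<close> nonpositive, applying \<open>r b\<close> leaves the
    combination positive only if \<open>d2\<close> is negative. But then all coordinates of \<rho>
    of \<open>l\<close> would be nonpositive.\<close>
  have mixed: False if a: "a \<in> R" "b \<in> R" "\<rho> l = lin d1 (\<rho> a) d2 (\<rho> b)" "d1 \<le> 0" "\<rho> l \<noteq> \<rho> b"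
    "\<rho> a \<noteq> \<rho> b" for a b d1 d2
  proof -
    have 1: "act (r b) (\<rho> l) \<in> positive_roots" using gen_permutes[OF a(2) pp[OF l]] a(5) by simp
    have 2: "act (r b) (\<rho> a) \<in> positive_roots" using gen_permutes[OF a(2) pp[OF a(1)]] a(6) by simp
    obtain q where q: "act (r b) (\<rho> l) q > 0" using pos_coord_pos[OF 1] by blast
    have "act (r b) (\<rho> l) = lin d1 (act (r b) (\<rho> a)) d2 (neg (\<rho> b))"
      unfolding a(3) using act_linear[OF gen_elt_carrier[OF a(2)], of "\<rho> a" "\<rho> b"]
        rho_props(3)[OF a(1)] rho_props(3)[OF a(2)] act_gen_self[OF a(2)] by simp
    then have "act (r b) (\<rho> l) q = d1 * act (r b) (\<rho> a) q - d2 * \<rho> b q" by simp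
    moreover have "d1 * act (r b) (\<rho> a) q \<le> 0" using a(4) pos_nonneg[OF 2] by (simp add: mult_nonpos_nonneg)
    ultimately have "d2 * \<rho> b q < 0" using q by simp
    then have d2: "d2 < 0" using nn[OF a(2), of q] by (simp add: mult_less_0_iff)
    obtain q' where q': "\<rho> l q' > 0" using pos_coord_pos[OF rho_props(2)[OF l]] by blast
    have "\<rho> l q' = d1 * \<rho> a q' + d2 * \<rho> b q'" using fun_cong[OF a(3), of q'] by simp
    moreover have "d1 * \<rho> a q' \<le> 0" using a(4) nn[OF a(1)] by (simp add: mult_nonpos_nonneg)
    moreover have "d2 * \<rho> b q' \<le> 0" using d2 nn[OF a(2)] by (simp add: mult_nonpos_nonneg)
    ultimately show False using q' by simp
  qed
  have nl: "\<rho> i \<noteq> \<rho> l" "\<rho> j \<noteq> \<rho> l" "\<rho> l \<noteq> \<rho> j" "\<rho> l \<noteq> \<rho> i" using n by auto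
  consider "c1 \<ge> 0" "c2 \<ge> 0" | "c1 \<le> 0" | "c2 \<le> 0" by linarith
  then show False
  proof cases
    case 1
    have pi: "act (r l) (\<rho> i) \<in> positive_roots" using gen_permutes[OF l pp[OF i] nl(1)] by blast
    have pj: "act (r l) (\<rho> j) \<in> positive_roots" using gen_permutes[OF l pp[OF j] nl(2)] by blast
    obtain q where q: "\<rho> l q > 0" using pos_coord_pos[OF rho_props(2)[OF l]] by blast
    have "neg (\<rho> l) = act (r l) (\<rho> l)" using act_gen_self[OF l] by simp
    also have "\<dots> = act (r l) (lin c1 (\<rho> i) c2 (\<rho> j))" by (rule arg_cong[OF e])
    also have "\<dots> = lin c1 (act (r l) (\<rho> i)) c2 (act (r l) (\<rho> j))"
      by (rule act_linear[OF gen_elt_carrier[OF l] root_V[OF rho_props(3)[OF i]] root_V[OF rho_props(3)[OF j]]])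
    finally have "neg (\<rho> l) q = lin c1 (act (r l) (\<rho> i)) c2 (act (r l) (\<rho> j)) q" by (rule fun_cong)
    then have "- \<rho> l q = c1 * act (r l) (\<rho> i) q + c2 * act (r l) (\<rho> j) q" by simp
    moreover have "c1 * act (r l) (\<rho> i) q \<ge> 0" using 1 pos_nonneg[OF pi] by simp
    moreover have "c2 * act (r l) (\<rho> j) q \<ge> 0" using 1 pos_nonneg[OF pj] by simp
    ultimately show False using q by linarith
  next
    case 2
    show False by (rule mixed[OF i j e 2 nl(3) ne])
  next
    case 3
    have "\<rho> l = lin c2 (\<rho> j) c1 (\<rho> i)" unfolding e by (rule lin_swap)
    then show False by (rule mixed[OF j i _ 3 nl(4) ne[symmetric]])
  qed
qed

text \<open>The index of \<open>r i\<close> cannot be prescribed, only found: the walk may pass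
  through several indices of this reflection before a tour turns to the wall of \<open>j\<close>,
  and the pair at that corner is returned.\<close>

lemma sim_representatives:
  assumes i: "i \<in> R" and j: "j \<in> R" and ne: "r i \<noteq> r j" and o: "ord (r i \<otimes> r j) \<noteq> 0"
  shows "\<exists>i' j'. i' \<in> R \<and> j' \<in> R \<and> r i' = r i \<and> r j' = r j \<and> gen_sim T x (ord (r i \<otimes> r j)) i' j'"
proof -
  define k where "k = ord (r i \<otimes> r j)"
  have k1: "k \<noteq> 1"
  proof
    assume "k = 1"
    then have "r i \<otimes> r j = \<one>"
      using ord_eq_1[of "r i \<otimes> r j"] gen_elt_carrier[OF i] gen_elt_carrier[OF j] by (simp add: k_def)
    then have "r i = r j"
      using inv_equality[of "r i" "r j"] gen_elt_carrier[OF i] gen_elt_carrier[OF j] gen_inv[OF j] by simp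
    then show False using ne by simp
  qed
  then obtain n where n: "k = Suc (Suc n)" using o unfolding k_def[symmetric] by (metis One_nat_def not0_implies_Suc)
  have o': "ord (r j \<otimes> r i) = k"
  proof -
    have "inv (r i \<otimes> r j) = r j \<otimes> r i"
      using gen_inv i j gen_elt_carrier by (simp add: inv_mult_group)
    then show ?thesis using ord_inv[of "r i \<otimes> r j"] gen_elt_carrier i j by (simp add: k_def)
  qed
  have al: "alternating m i j \<in> lists R" "alternating m j i \<in> lists R" for m
    using i j by (auto intro: alternating_in_lists)
  have al2: "alternating m j i \<in> lists {i, j}" for m by (simp add: alternating_in_lists)
  \<comment> \<open>The word starts with \<open>j\<close> and is one letter short of the longest
    element of the dihedral group. Its inverse \<open>g\<close> thus makes \<rho> of
    \<open>j\<close> negative and still keeps \<rho> of \<open>i\<close> positive.\<close>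
  define h where "h = rval (alternating (Suc n) j i)"
  define g where "g = inv h"
  have hC: "h \<in> C x x" unfolding h_def by (rule rval_C[OF al(2)])
  have gC: "g \<in> C x x" unfolding g_def by (rule C_inv[OF hC x])
  have hc: "h \<in> carrier W" "g \<in> carrier W" using CD(1) hC gC by auto
  have ri: "\<rho> i \<in> ppos" "\<rho> j \<in> ppos" using rho_props i j by auto
  have rne: "\<rho> i \<noteq> \<rho> j" using ne gen_elt_reflection i j by auto
  have redk: "exchange.reduced (alternating k i j)"
    by (rule exchange.reduced_alternating[OF i j ne]) (simp add: k_def)
  have redk1: "exchange.reduced (alternating (Suc n) j i)"
    by (rule exchange.reduced_alternating[OF j i ne[symmetric]]) (use o' n in simp)
  \<comment> \<open>Otherwise deletion would shorten the alternating word of length \<open>k\<close>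
    beginning with \<open>i\<close>, which is reduced.\<close>
  have gi: "act g (\<rho> i) \<in> positive_roots"
  proof (rule ccontr)
    assume "act g (\<rho> i) \<notin> positive_roots"
    from deletion[OF al(2) ri(1) this[unfolded g_def h_def]] obtain u a v where
      u: "alternating (Suc n) j i = u @ a # v" "reflection (\<rho> i) \<otimes> rval (alternating (Suc n) j i) = rval (u @ v)" by blast
    have "rval (u @ v) = rval (alternating k i j)"
      using u(2) gen_elt_reflection[OF i] n by simp
    moreover have "u @ v \<in> lists R" using al(2)[of "Suc n"] unfolding u(1) by simp
    ultimately have "length (alternating k i j) \<le> length (u @ v)" using exchange.reducedD(2)[OF redk] by blast
    moreover have "length (u @ v) < Suc n" using arg_cong[OF u(1), of length] by simp
    ultimately show False using n by simp
  qed
  obtain c where c: "c \<in> {i, j}" "alternating k j i = alternating (Suc n) j i @ [c]"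
    using alternating_add[of "Suc n" 1 j i] n by (cases "even (Suc n)") auto
  have cR: "c \<in> R" using c(1) i j by blast
  \<comment> \<open>The braid equality of length \<open>k\<close>, with the common factor
    \<open>h\<close> on different sides, says that \<open>h\<close> conjugates \<open>r c\<close> to
    \<open>r i\<close>. The sign of the root comes from the preceding fact about \<rho> of
    \<open>i\<close>.\<close>
  have gc: "act g (\<rho> i) = \<rho> c"
  proof -
    have "rval (alternating k i j) = rval (alternating k j i)"
      using exchange.val_alternating_eq_iff[OF i j, of k] by (simp add: k_def)
    moreover have "rval (alternating k i j) = r i \<otimes> h" by (simp add: n h_def)
    moreover have "rval (alternating k j i) = h \<otimes> r c"
      unfolding c(2) h_def using word_val_append[OF r_image al(2), of "[c]" "Suc n"] cR gen_elt_carrier[OF cR] by simp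
    ultimately have "r i \<otimes> h = h \<otimes> r c" by simp
    then have "g \<otimes> (r i \<otimes> h) = r c" unfolding g_def using hc(1) gen_elt_carrier[OF cR] inv_cancel(1) by simp
    then have "g \<otimes> r i \<otimes> inv g = r c" using hc gen_elt_carrier[OF i] by (simp add: g_def m_assoc)
    then have "reflection (act g (\<rho> i)) = reflection (\<rho> c)"
      using reflection_act[OF rho_props(3)[OF i] hc(2)] gen_elt_reflection i cR by simp
    then show ?thesis by (rule reflection_inj[OF gi rho_props(2)[OF cR]])
  qed
  \<comment> \<open>Otherwise, after removing the first letter \<open>j\<close> of \<open>h\<close>,
    deletion would shorten the reduced alternating word of length \<open>k - 1\<close>.\<close>
  have gj: "act g (\<rho> j) \<notin> positive_roots"
  proof
    assume p: "act g (\<rho> j) \<in> positive_roots"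
    define h' where "h' = rval (alternating n i j)"
    have h'c: "h' \<in> carrier W" unfolding h'_def by (rule rval_closed[OF al(1)])
    have hh: "h = r j \<otimes> h'" by (simp add: h_def h'_def)
    have gh: "act g (\<rho> j) = act (inv h') (act (r j) (\<rho> j))"
      unfolding g_def hh using h'c gen_elt_carrier[OF j] gen_inv[OF j] rho_props(3)[OF j]
      by (simp add: inv_mult_group act_mult)
    also have "\<dots> = neg (act (inv h') (\<rho> j))"
      using act_gen_self[OF j] act_neg[of "inv h'" "\<rho> j"] h'c rho_props(3)[OF j] by simp
    finally have "act (inv h') (\<rho> j) \<notin> positive_roots"
      using p neg_pos_iff[of "act (inv h') (\<rho> j)"] h'c rho_props(3)[OF j] by simp
    from deletion[OF al(1) ri(2) this[unfolded h'_def]] obtain u a v where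
      u: "alternating n i j = u @ a # v" "reflection (\<rho> j) \<otimes> rval (alternating n i j) = rval (u @ v)" by blast
    have "rval (u @ v) = rval (alternating (Suc n) j i)" using u(2) gen_elt_reflection[OF j] by simp
    moreover have "u @ v \<in> lists R" using al(1)[of n] unfolding u(1) by simp
    ultimately have "length (alternating (Suc n) j i) \<le> length (u @ v)" using exchange.reducedD(2)[OF redk1] by blast
    moreover have "length (u @ v) < n" using arg_cong[OF u(1), of length] by simp
    ultimately show False by simp
  qed
  have "\<exists>i' j'. i' \<in> R \<and> j' \<in> R \<and> r i' = r i \<and> r j' = r j \<and> gen_sim T x k i' j'"
    if "i1 \<in> R" "\<rho> i1 = \<rho> i" for i1
    using that
  proof (induction "card (inversions (inv (walk c) \<otimes> g \<otimes> walk i1))" arbitrary: i1 rule: less_induct)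
    case less
    have r1: "r i1 = r i" using gen_elt_reflection less.prems i by simp
    have g1: "act g (\<rho> i1) = \<rho> c" using gc less.prems(2) by simp
    have wc: "walk c \<in> carrier W" "walk i1 \<in> carrier W" using walk_carrier cR less.prems(1) by auto
    \<comment> \<open>If the comparison element were trivial, \<open>g\<close> would be a product of
      a walk and an inverse walk. Walks keep signs of perpendicular roots, but \<open>g\<close>
      makes \<rho> of \<open>j\<close> negative.\<close>
    have une: "inv (walk c) \<otimes> g \<otimes> walk i1 \<noteq> \<one>"
    proof
      assume u1: "inv (walk c) \<otimes> g \<otimes> walk i1 = \<one>"
      have cY: "walk c \<in> Y x (source (snd c))" and iY: "walk i1 \<in> Y x (source (snd i1))"
        using walk_Y cR less.prems(1) by auto
      have sv: "source (snd c) \<in> vertices" "source (snd i1) \<in> vertices" using genD(4) cR less.prems(1) by auto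
      have jr: "\<rho> j \<in> roots" "\<rho> j \<in> perp x" "\<rho> j \<in> positive_roots" using rho_props[OF j] by auto
      have g_perp: "act g (\<rho> j) \<in> perp x" by (rule act_perp[OF gC x jr(2)])
      have "act (inv (walk c)) (act g (\<rho> j)) \<notin> positive_roots"
        using Y_pos_iff[OF Y_inv[OF cY x sv(1)] x g_perp] gj by simp
      moreover have "act (inv (walk c)) (act g (\<rho> j)) = act (inv (walk i1)) (\<rho> j)"
      proof -
        have "inv (walk i1) = (inv (walk c) \<otimes> g \<otimes> walk i1) \<otimes> inv (walk i1)" using u1 wc by simp
        also have "\<dots> = inv (walk c) \<otimes> g" using wc hc by (simp add: m_assoc)
        finally show ?thesis using wc hc jr(1) by (simp add: act_mult)
      qed
      moreover have "act (inv (walk i1)) (\<rho> j) \<in> positive_roots"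
        by (rule YD(2)[OF Y_inv[OF iY x sv(2)] jr(2,3)])
      ultimately show False by simp
    qed
    from walk_step[OF less.prems(1) cR gC g1 une] obtain j1 where j1: "j1 \<in> R"
      "ord (r i1 \<otimes> r j1) \<noteq> 0 \<Longrightarrow> gen_sim T x (ord (r i1 \<otimes> r j1)) i1 j1"
      "\<rho> j1 = \<rho> i1 \<and> card (inversions (inv (walk c) \<otimes> g \<otimes> walk j1)) < card (inversions (inv (walk c) \<otimes> g \<otimes> walk i1)) \<or>
       act g (\<rho> j1) \<notin> positive_roots" by blast
    show ?case
    proof (cases "act g (\<rho> j1) \<in> positive_roots")
      case True
      then have "\<rho> j1 = \<rho> i1" "card (inversions (inv (walk c) \<otimes> g \<otimes> walk j1)) < card (inversions (inv (walk c) \<otimes> g \<otimes> walk i1))"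
        using j1(3) by blast+
      then show ?thesis using less.hyps[OF _ j1(1)] less.prems(2) by simp
    next
      case False
      have j1p: "\<rho> j1 \<in> ppos" using rho_props[OF j1(1)] by simp
      obtain c1 c2 where "\<rho> j1 = lin c1 (\<rho> i) c2 (\<rho> j)"
        using inverted_in_span[OF al2 i j j1p False[unfolded g_def h_def]] by blast
      then have "\<rho> j1 = \<rho> i \<or> \<rho> j1 = \<rho> j" by (rule simple_in_span[OF j1(1) i j rne])
      moreover have "\<rho> j1 \<noteq> \<rho> i" using False gi by auto
      ultimately have "\<rho> j1 = \<rho> j" by blast
      \<comment> \<open>The root inverted by \<open>g\<close> lies in the plane of the two roots, so
        it is one of them, and \<rho> of \<open>i\<close> is not inverted.\<close>
      then have rj: "r j1 = r j" using gen_elt_reflection j1(1) j by simp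
      then have "gen_sim T x k i1 j1" using j1(2) o r1 by (simp add: k_def)
      then show ?thesis using less.prems(1) j1(1) r1 rj by blast
    qed
  qed
  from this[OF i refl] show ?thesis by (simp add: k_def)
qed

lemma moves_alternating:
  "moves [i] [i'] \<Longrightarrow> moves [j] [j'] \<Longrightarrow> moves (alternating n i j) (alternating n i' j')"
proof (induction n arbitrary: i j i' j')
  case (Suc n)
  have "moves (i # alternating n j i) (i # alternating n j' i')" by (rule word_moves_Cons[OF Suc.IH[OF Suc.prems(2,1)]])
  moreover have "moves (i # alternating n j' i') (i' # alternating n j' i')" by (rule word_moves_head[OF Suc.prems(1)])
  ultimately show ?case unfolding alternating.simps by (rule rtranclp_trans)
qed simp

sublocale braid: braid_system W R r "gen_sim T x"
proof
  fix k i j assume "1 \<le> k" "gen_sim T x k i j"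
  then show "i \<in> R \<and> j \<in> R \<and> (r i \<otimes> r j) [^] k = \<one>" by (rule sim_sound)
next
  fix i j assume "i \<in> R" "j \<in> R" "r i = r j"
  then show "moves [i] [j]" by (rule moves_same)
next
  fix i j assume i: "i \<in> R" and j: "j \<in> R" and ne: "r i \<noteq> r j" and o: "ord (r i \<otimes> r j) \<noteq> 0"
  let ?k = "ord (r i \<otimes> r j)"
  obtain i' j' where ij: "i' \<in> R" "j' \<in> R" "r i' = r i" "r j' = r j" "gen_sim T x ?k i' j'"
    using sim_representatives[OF i j ne o] by blast
  \<comment> \<open>Only the representatives are related, so the letters are exchanged before the
    braid and back after it.\<close>
  have "moves (alternating ?k i j) (alternating ?k i' j')"
    by (rule moves_alternating) (use ij i j in \<open>auto intro: moves_same\<close>)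
  moreover have "word_move R (gen_sim T x) ([] @ alternating ?k i' j' @ []) ([] @ alternating ?k j' i' @ [])"
  proof (rule word_move.braid)
    show "1 \<le> ?k" using o by simp
  qed (rule ij(5))
  then have "word_move R (gen_sim T x) (alternating ?k i' j') (alternating ?k j' i')" by simp
  moreover have "moves (alternating ?k j' i') (alternating ?k j i)"
    by (rule moves_alternating) (use ij i j in \<open>auto intro: moves_same\<close>)
  ultimately show "moves (alternating ?k i j) (alternating ?k j i)"
    by (meson rtranclp.rtrancl_into_rtrancl rtranclp_trans)
qed

end

theorem theorem4p13:
  fixes W :: "('a, 'm) monoid_scheme" and S I :: "'a set"
    and \<Lambda> :: "'l set" and xI x :: "'l \<Rightarrow> 'a"
    and U :: "('l \<Rightarrow> 'a) set" and T :: "(('l \<Rightarrow> 'a) \<times> 'a) set"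
  assumes "coxeter_groupoid W S I \<Lambda> xI"
    and "coxeter_groupoid.maximal_tree W S \<Lambda> xI U T"
    and "x \<in> coxeter_groupoid.vertices W S \<Lambda> xI"
  defines "R \<equiv> coxeter_groupoid.gens W S \<Lambda> xI x"
    and "r \<equiv> coxeter_groupoid.gen_elt W S \<Lambda> xI T x"
    and "sim \<equiv> coxeter_groupoid.gen_sim W S \<Lambda> xI T x"
  shows "presents (W\<lparr>carrier := coxeter_system.perp_group W S (x ` \<Lambda>)\<rparr>) R r
           ({[(i, True), (i, True)] | i. i \<in> R} \<union>
            {pair_power k i j | k i j. 1 \<le> k \<and> sim k i j})
       \<and> (\<forall>a \<in> lists R. \<forall>b \<in> lists R.
            word_val W r a = word_val W r b \<and>
            (\<forall>c \<in> lists R. word_val W r c = word_val W r b \<longrightarrow> length b \<le> length c) \<longrightarrow>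
            (word_move R sim)\<^sup>*\<^sup>* a b)"
proof -
  interpret coxeter_groupoid W S I \<Lambda> xI by (rule assms(1))
  interpret perp_system W S I \<Lambda> xI U T x
    by unfold_locales (use assms(2,3) in auto)
  show ?thesis unfolding R_def r_def sim_def
  proof (intro conjI ballI impI)
    show "presents (W\<lparr>carrier := perp_group (x ` \<Lambda>)\<rparr>) (gens x) (gen_elt T x)
      ({[(i, True), (i, True)] |i. i \<in> gens x} \<union> {pair_power k i j |k i j. 1 \<le> k \<and> gen_sim T x k i j})"
      using braid.presents_generate unfolding braid.relators_def perp_group_generate .
  next
    fix a b
    assume ab: "a \<in> lists (gens x)" "b \<in> lists (gens x)"
      and h: "word_val W (gen_elt T x) a = word_val W (gen_elt T x) b \<and>
        (\<forall>c\<in>lists (gens x). word_val W (gen_elt T x) c = word_val W (gen_elt T x) b \<longrightarrow> length b \<le> length c)"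
    show "(word_move (gens x) (gen_sim T x))\<^sup>*\<^sup>* a b"
      by (rule braid.moves_to_shortest[OF ab]) (use h in blast)+
  qed
qed

end
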